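(* Let $j\in\mathbb N$, $\gamma\in\mathbb R$, $T>0$, and let $u_0$, $\boldsymbol\varphi=(\varphi_1,\dots,\varphi_j)$, and $f$ be sufficiently smooth and decaying. Define $u$ for $x>0$, $0\le t\le T$ by $$\begin{aligned}u(t,x)=&\frac1{2\pi}\int_{\mathbb R}e^{ikx+ik^{2j+1}t}\left(\widehat{u_0}(k)+F(t,k)\right)dk\\&-\frac1{2\pi}\sum_{p=1}^j\sum_{n=1}^{j+1}\int_{\partial D_{2p}^+}e^{ikx+ik^{2j+1}t}\left(\widehat{u_0}(\alpha_{p,n}k)+F(T,\alpha_{p,n}k)\right)\mathcal P_{p,n}(k)\,dk\\&+\frac1{2\pi}\sum_{p=1}^j\sum_{\ell=1}^jc_{p,\ell}\int_{\partial D_{2p}^+}e^{ikx+ik^{2j+1}t}\frac{k^{2j+1-\ell}}{k-i\gamma}\widetilde\varphi_\ell(T,k^{2j+1})\,dk\\&+\mathcal R_{j,\gamma}[u_0,\boldsymbol\varphi,f](t,x).\end{aligned}$$ Then $u$ satisfies the linear initial boundary value problem $$\partial_tu+(-1)^{j+1}\partial_x^{2j+1}u=f(t,x)\ (0<t<T,\ x>0),\quad u(0,x)=u_0(x)\ (x>0),\quad (\partial_x+\gamma)\partial_x^{\ell-1}u(t,0)=\varphi_\ell(t)\ (0<t<T,\ 1\le\ell\le j).$$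
   Context: Let $\omega=e^{2\pi i/(2j+1)}$, $\alpha_{p,n}=\omega^{j-p+n}$ ($1\le p\le j$, $1\le n\le j+1$), $Q_p(z)=\prod_{m=1}^{j+1}(z-\alpha_{p,m})$, $L_{p,n}(z)=\prod_{1\le m\le j+1,\,m\ne n}\frac{z-\alpha_{p,m}}{\alpha_{p,n}-\alpha_{p,m}}$, and $$\mathcal P_{p,n}(k)=L_{p,n}(1)-\frac{Q_p(1)}{Q_p'(\alpha_{p,n})}\frac{k}{k-i\gamma}.$$ For $1\le\ell\le j$ let $S_{p,\ell}$ be the quotient in the Euclidean division $z^{2j+1-\ell}=Q_p(z)S_{p,\ell}(z)+E_{p,\ell}(z)$, $\deg E_{p,\ell}\le j$, and set $c_{p,\ell}=(-1)^{j+1}i^{2j-\ell}Q_p(1)S_{p,\ell}(1)$. $D_{2p}^+=\{re^{i\theta}:r>0,\ \frac{(2p-1)\pi}{2j+1}<\theta<\frac{2p\pi}{2j+1}\}$, and $\partial D_{2p}^+$ is its positively oriented boundary (incoming from infinity along the ray of larger argument, outgoing along the ray of smaller argument). $\widehat{u_0}(k)=\int_0^\infty e^{-ikx}u_0(x)\,dx$ and $\widehat f(t,k)=\int_0^\infty e^{-ikx}f(t,x)\,dx$ for $\operatorname{Im}k\le0$; $F(t,k)=\int_0^te^{-ik^{2j+1}\tau}\widehat f(\tau,k)\,d\tau$; $\widetilde\varphi_\ell(t,\zeta)=\int_0^te^{-i\zeta\tau}\varphi_\ell(\tau)\,d\tau$. The residue term is $\mathcal R_{j,\gamma}[u_0,\boldsymbol\varphi,f]=0$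 unless $j$ is odd and $\gamma>0$; if $j$ is odd and $\gamma>0$, with $p_*=\frac{j+1}{2}$, $$\mathcal R_{j,\gamma}[u_0,\boldsymbol\varphi,f](t,x)=\gamma Q_{p_*}(1)e^{-\gamma x+\gamma^{2j+1}t}\sum_{n=1}^{j+1}\frac{\widehat{u_0}(i\gamma\alpha_{p_*,n})+F(T,i\gamma\alpha_{p_*,n})}{Q_{p_*}'(\alpha_{p_*,n})}-ie^{-\gamma x+\gamma^{2j+1}t}\sum_{\ell=1}^jc_{p_*,\ell}(i\gamma)^{2j+1-\ell}\widetilde\varphi_\ell(T,-i\gamma^{2j+1}).$$ When $\gamma=0$, the factor $k/(k-i\gamma)$ is read as $1$ and $k^{2j+1-\ell}/(k-i\gamma)$ as $k^{2j-\ell}$ (removable singularity at $k=0$). *)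

theory Defs
  imports "HOL-Analysis.Analysis" "HOL-Computational_Algebra.Polynomial"
begin

text \<open>
  All integrals are Henstock--Kurzweil integrals.  On an unbounded interval this is the improper
  integral; it agrees with the Lebesgue integral wherever the latter exists, and it also covers the
  integral over the real line in the solution formula, which in general converges only
  conditionally (the transform of \<open>u0\<close> decays like \<open>u0 0 / (\<i> * k)\<close>).
\<close>

section \<open>Algebraic ingredients\<close>

definition root_omega :: "nat \<Rightarrow> complex" where
  "root_omega j = exp (2 * of_real pi * \<i> / of_nat (2 * j + 1))"

text \<open>The truncated subtraction below is harmless, since only \<open>1 \<le> p \<le> j\<close> is used.\<close>

definition alpha :: "nat \<Rightarrow> nat \<Rightarrow> nat \<Rightarrow> complex" where
  "alpha j p n = root_omega j ^ (j - p + n)"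

definition Qpoly :: "nat \<Rightarrow> nat \<Rightarrow> complex poly" where
  "Qpoly j p = (\<Prod>m=1..j+1. [:- alpha j p m, 1:])"

definition lagrange :: "nat \<Rightarrow> nat \<Rightarrow> nat \<Rightarrow> complex \<Rightarrow> complex" where
  "lagrange j p n z = (\<Prod>m\<in>{1..j+1} - {n}. (z - alpha j p m) / (alpha j p n - alpha j p m))"

text \<open>\<open>pole_factor \<gamma> m k\<close> is \<open>k ^ (m + 1) / (k - \<i> * \<gamma>)\<close>, read as \<open>k ^ m\<close> when \<open>\<gamma> = 0\<close>.\<close>

definition pole_factor :: "real \<Rightarrow> nat \<Rightarrow> complex \<Rightarrow> complex" where
  "pole_factor \<gamma> m k = (if \<gamma> = 0 then k ^ m else k ^ (m + 1) / (k - \<i> * of_real \<gamma>))"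

definition Pcoef :: "nat \<Rightarrow> real \<Rightarrow> nat \<Rightarrow> nat \<Rightarrow> complex \<Rightarrow> complex" where
  "Pcoef j \<gamma> p n k =
     lagrange j p n 1
     - poly (Qpoly j p) 1 / poly (pderiv (Qpoly j p)) (alpha j p n) * pole_factor \<gamma> 0 k"

definition Squot :: "nat \<Rightarrow> nat \<Rightarrow> nat \<Rightarrow> complex poly" where
  "Squot j p l = monom 1 (2 * j + 1 - l) div Qpoly j p"

definition ccoef :: "nat \<Rightarrow> nat \<Rightarrow> nat \<Rightarrow> complex" where
  "ccoef j p l = (-1) ^ (j + 1) * \<i> ^ (2 * j - l) * poly (Qpoly j p) 1 * poly (Squot j p l) 1"


section \<open>Contours\<close>

text \<open>
  \<open>sector_integral j p g\<close> is the integral of \<open>g\<close> along the positively oriented boundary of the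
  sector \<open>{r * cis \<theta> | r > 0, (2 * p - 1) * pi / (2 * j + 1) < \<theta> < 2 * p * pi / (2 * j + 1)}\<close>:
  outgoing along the ray of smaller argument, incoming along the ray of larger argument.
\<close>

definition ray_integrand :: "(complex \<Rightarrow> complex) \<Rightarrow> real \<Rightarrow> real \<Rightarrow> complex" where
  "ray_integrand g \<theta> r = g (of_real r * cis \<theta>) * cis \<theta>"

definition lower_angle :: "nat \<Rightarrow> nat \<Rightarrow> real" where
  "lower_angle j p = (2 * real p - 1) * pi / (2 * real j + 1)"

definition upper_angle :: "nat \<Rightarrow> nat \<Rightarrow> real" where
  "upper_angle j p = 2 * real p * pi / (2 * real j + 1)"

definition sector_integral :: "nat \<Rightarrow> nat \<Rightarrow> (complex \<Rightarrow> complex) \<Rightarrow> complex" where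
  "sector_integral j p g =
     integral {0..} (ray_integrand g (lower_angle j p))
     - integral {0..} (ray_integrand g (upper_angle j p))"

definition sector_integrable :: "nat \<Rightarrow> nat \<Rightarrow> (complex \<Rightarrow> complex) \<Rightarrow> bool" where
  "sector_integrable j p g \<longleftrightarrow>
     ray_integrand g (lower_angle j p) integrable_on {0..} \<and>
     ray_integrand g (upper_angle j p) integrable_on {0..}"


section \<open>Transforms of the data\<close>

definition half_line_ft :: "(real \<Rightarrow> complex) \<Rightarrow> complex \<Rightarrow> complex" where
  "half_line_ft g k = integral {0..} (\<lambda>x. exp (- \<i> * k * of_real x) * g x)"

definition Fterm :: "nat \<Rightarrow> (real \<Rightarrow> real \<Rightarrow> complex) \<Rightarrow> real \<Rightarrow> complex \<Rightarrow> complex" where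
  "Fterm j f t k =
     integral {0..t} (\<lambda>\<tau>. exp (- \<i> * k ^ (2 * j + 1) * of_real \<tau>) * half_line_ft (f \<tau>) k)"

definition time_transform :: "(real \<Rightarrow> complex) \<Rightarrow> real \<Rightarrow> complex \<Rightarrow> complex" where
  "time_transform g t \<zeta> = integral {0..t} (\<lambda>\<tau>. exp (- \<i> * \<zeta> * of_real \<tau>) * g \<tau>)"


section \<open>The solution formula\<close>

definition phase :: "nat \<Rightarrow> real \<Rightarrow> real \<Rightarrow> complex \<Rightarrow> complex" where
  "phase j t x k = exp (\<i> * k * of_real x + \<i> * k ^ (2 * j + 1) * of_real t)"

definition residue_term ::
  "nat \<Rightarrow> real \<Rightarrow> real \<Rightarrow> (real \<Rightarrow> complex) \<Rightarrow> (nat \<Rightarrow> real \<Rightarrow> complex) \<Rightarrow> (real \<Rightarrow> real \<Rightarrow> complex)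
    \<Rightarrow> real \<Rightarrow> real \<Rightarrow> complex" where
  "residue_term j \<gamma> T u0 \<phi> f t x =
     (if odd j \<and> \<gamma> > 0 then
        let p = (j + 1) div 2; e = of_real (exp (- \<gamma> * x + \<gamma> ^ (2 * j + 1) * t)) in
          of_real \<gamma> * poly (Qpoly j p) 1 * e *
            (\<Sum>n=1..j+1.
               (half_line_ft u0 (\<i> * of_real \<gamma> * alpha j p n)
                 + Fterm j f T (\<i> * of_real \<gamma> * alpha j p n))
               / poly (pderiv (Qpoly j p)) (alpha j p n))
          - \<i> * e *
            (\<Sum>l=1..j. ccoef j p l * (\<i> * of_real \<gamma>) ^ (2 * j + 1 - l)
               * time_transform (\<phi> l) T (- \<i> * of_real \<gamma> ^ (2 * j + 1)))
      else 0)"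

definition line_integrand ::
  "nat \<Rightarrow> (real \<Rightarrow> complex) \<Rightarrow> (real \<Rightarrow> real \<Rightarrow> complex) \<Rightarrow> real \<Rightarrow> real \<Rightarrow> real \<Rightarrow> complex" where
  "line_integrand j u0 f t x k =
     phase j t x (of_real k) * (half_line_ft u0 (of_real k) + Fterm j f t (of_real k))"

definition data_integrand ::
  "nat \<Rightarrow> real \<Rightarrow> real \<Rightarrow> (real \<Rightarrow> complex) \<Rightarrow> (real \<Rightarrow> real \<Rightarrow> complex) \<Rightarrow> real \<Rightarrow> real
    \<Rightarrow> nat \<Rightarrow> nat \<Rightarrow> complex \<Rightarrow> complex" where
  "data_integrand j \<gamma> T u0 f t x p n k =
     phase j t x k
     * (half_line_ft u0 (alpha j p n * k) + Fterm j f T (alpha j p n * k))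
     * Pcoef j \<gamma> p n k"

definition boundary_integrand ::
  "nat \<Rightarrow> real \<Rightarrow> real \<Rightarrow> (nat \<Rightarrow> real \<Rightarrow> complex) \<Rightarrow> real \<Rightarrow> real \<Rightarrow> nat \<Rightarrow> complex \<Rightarrow> complex" where
  "boundary_integrand j \<gamma> T \<phi> t x l k =
     phase j t x k * pole_factor \<gamma> (2 * j - l) k * time_transform (\<phi> l) T (k ^ (2 * j + 1))"

definition u_formula ::
  "nat \<Rightarrow> real \<Rightarrow> real \<Rightarrow> (real \<Rightarrow> complex) \<Rightarrow> (nat \<Rightarrow> real \<Rightarrow> complex) \<Rightarrow> (real \<Rightarrow> real \<Rightarrow> complex)
    \<Rightarrow> real \<Rightarrow> real \<Rightarrow> complex" where
  "u_formula j \<gamma> T u0 \<phi> f t x =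
     1 / (2 * of_real pi) * integral UNIV (line_integrand j u0 f t x)
     - 1 / (2 * of_real pi) *
         (\<Sum>p=1..j. \<Sum>n=1..j+1. sector_integral j p (data_integrand j \<gamma> T u0 f t x p n))
     + 1 / (2 * of_real pi) *
         (\<Sum>p=1..j. \<Sum>l=1..j. ccoef j p l * sector_integral j p (boundary_integrand j \<gamma> T \<phi> t x l))
     + residue_term j \<gamma> T u0 \<phi> f t x"

text \<open>
  \<open>integral\<close> is a total function, with value \<open>0\<close> for non-integrable arguments; the next predicate
  says that all integrals in the formula genuinely converge.
\<close>

definition formula_converges ::
  "nat \<Rightarrow> real \<Rightarrow> real \<Rightarrow> (real \<Rightarrow> complex) \<Rightarrow> (nat \<Rightarrow> real \<Rightarrow> complex) \<Rightarrow> (real \<Rightarrow> real \<Rightarrow> complex)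
    \<Rightarrow> real \<Rightarrow> real \<Rightarrow> bool" where
  "formula_converges j \<gamma> T u0 \<phi> f t x \<longleftrightarrow>
     line_integrand j u0 f t x integrable_on UNIV \<and>
     (\<forall>p\<in>{1..j}. \<forall>n\<in>{1..j+1}. sector_integrable j p (data_integrand j \<gamma> T u0 f t x p n)) \<and>
     (\<forall>p\<in>{1..j}. \<forall>l\<in>{1..j}. sector_integrable j p (boundary_integrand j \<gamma> T \<phi> t x l))"


section \<open>Smooth and decaying data\<close>

text \<open>
  Classes of order \<open>N\<close>: all derivatives up to order \<open>N\<close> exist and are continuous up to the
  boundary of the domain, and, where the domain is unbounded, they decay like \<open>x powr - N\<close>.  The
  functions \<open>D m\<close> and \<open>D a b\<close> are the successive (one-sided at end points) derivatives.
\<close>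

definition initial_class :: "nat \<Rightarrow> (real \<Rightarrow> complex) \<Rightarrow> bool" where
  "initial_class N g \<longleftrightarrow>
     (\<exists>D :: nat \<Rightarrow> real \<Rightarrow> complex.
        (\<forall>x\<ge>0. D 0 x = g x) \<and>
        (\<forall>m<N. \<forall>x\<ge>0. (D m has_vector_derivative D (Suc m) x) (at x within {0..})) \<and>
        (\<forall>m\<le>N. continuous_on {0..} (D m)) \<and>
        (\<exists>C. \<forall>m\<le>N. \<forall>x\<ge>0. (1 + x) ^ N * norm (D m x) \<le> C))"

definition boundary_class :: "nat \<Rightarrow> real \<Rightarrow> (real \<Rightarrow> complex) \<Rightarrow> bool" where
  "boundary_class N T g \<longleftrightarrow>
     (\<exists>D :: nat \<Rightarrow> real \<Rightarrow> complex.
        (\<forall>t\<in>{0..T}. D 0 t = g t) \<and>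
        (\<forall>m<N. \<forall>t\<in>{0..T}. (D m has_vector_derivative D (Suc m) t) (at t within {0..T})) \<and>
        (\<forall>m\<le>N. continuous_on {0..T} (D m)))"

definition source_class :: "nat \<Rightarrow> real \<Rightarrow> (real \<Rightarrow> real \<Rightarrow> complex) \<Rightarrow> bool" where
  "source_class N T f \<longleftrightarrow>
     (\<exists>D :: nat \<Rightarrow> nat \<Rightarrow> real \<Rightarrow> real \<Rightarrow> complex.
        (\<forall>t\<in>{0..T}. \<forall>x\<ge>0. D 0 0 t x = f t x) \<and>
        (\<forall>a b. a + b < N \<longrightarrow> (\<forall>t\<in>{0..T}. \<forall>x\<ge>0.
           ((\<lambda>s. D a b s x) has_vector_derivative D (Suc a) b t x) (at t within {0..T}) \<and>
           ((\<lambda>y. D a b t y) has_vector_derivative D a (Suc b) t x) (at x within {0..}))) \<and>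
        (\<forall>a b. a + b \<le> N \<longrightarrow> continuous_on ({0..T} \<times> {0..}) (\<lambda>(t, x). D a b t x)) \<and>
        (\<exists>C. \<forall>a b. a + b \<le> N \<longrightarrow>
           (\<forall>t\<in>{0..T}. \<forall>x\<ge>0. (1 + x) ^ N * norm (D a b t x) \<le> C)))"


section \<open>The initial boundary value problem\<close>

definition iter_deriv :: "nat \<Rightarrow> (real \<Rightarrow> complex) \<Rightarrow> real \<Rightarrow> complex" where
  "iter_deriv m g = ((\<lambda>h x. vector_derivative h (at x)) ^^ m) g"

text \<open>
  Classical solutions.  As \<open>u\<close> lives on \<open>x > 0\<close>, the boundary values are limits for \<open>x\<close> tending to
  \<open>0\<close> from the right.  The initial condition is the equality at \<open>t = 0\<close> together with continuity
  of \<open>u\<close> there, without which it would not be tied to the equation.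
\<close>

definition solves_ibvp ::
  "nat \<Rightarrow> real \<Rightarrow> real \<Rightarrow> (real \<Rightarrow> complex) \<Rightarrow> (nat \<Rightarrow> real \<Rightarrow> complex) \<Rightarrow> (real \<Rightarrow> real \<Rightarrow> complex)
    \<Rightarrow> (real \<Rightarrow> real \<Rightarrow> complex) \<Rightarrow> bool" where
  "solves_ibvp j \<gamma> T u0 \<phi> f u \<longleftrightarrow>
     (\<forall>t x. 0 < t \<and> t < T \<and> 0 < x \<longrightarrow>
        (\<lambda>s. u s x) differentiable (at t) \<and>
        (\<forall>m < 2 * j + 1. iter_deriv m (u t) differentiable (at x)) \<and>
        vector_derivative (\<lambda>s. u s x) (at t) + (-1) ^ (j + 1) * iter_deriv (2 * j + 1) (u t) x
          = f t x) \<and>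
     (\<forall>x>0. u 0 x = u0 x \<and> ((\<lambda>t. u t x) \<longlongrightarrow> u0 x) (at_right 0)) \<and>
     (\<forall>t l. 0 < t \<and> t < T \<and> 1 \<le> l \<and> l \<le> j \<longrightarrow>
        ((\<lambda>x. iter_deriv l (u t) x + of_real \<gamma> * iter_deriv (l - 1) (u t) x) \<longlongrightarrow> \<phi> l t)
          (at_right 0))"

end

theory Submission
  imports Defs "HOL-Complex_Analysis.Complex_Analysis" "HOL-Real_Asymp.Real_Asymp"
begin

text \<open>
 Write \<open>d = 2 * j + 1\<close>.  For a fixed amplitude \<open>a\<close>, the function \<open>exp (\<i> * k * x + \<i> * k ^ d * t) * a k\<close>
 of \<open>(t, x)\<close> solves the homogeneous equation, and Duhamel's integral accounts for the source.  So
 the formula solves the equation with the right source as soon as its integrals may be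
 differentiated under the integral sign.  On a boundary ray of a sector this is clear for
 \<open>x > 0\<close>: there \<open>exp (\<i> * k * x)\<close> decays exponentially, while \<open>k ^ d\<close> is real.  On the real line it
 is not, since the transform of the data decays only like \<open>1 / k\<close>.  Repeated integration by parts
 therefore splits it (locale \<open>space_family\<close>) into a part \<open>rest\<close> of high decay and a rational function
 \<open>slow\<close> of \<open>1 + \<i> * k\<close>, whose rays of integration are rotated slightly into the upper half-plane;
 \<open>exp (\<i> * k ^ d * t)\<close> does not grow there (\<open>line_family_solution\<close>).

 At \<open>t = 0\<close> the line integral is Fourier inversion (\<open>inversion_split\<close>).  The other contours can be
 closed at infinity inside their sectors, where \<open>exp (\<i> * k * x)\<close> decays.  They contribute
 nothing but the residue at \<open>\<i> * \<gamma>\<close>, if this point lies in a sector, and the last term of the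
 formula cancels it (\<open>sector_closes_pole\<close>, \<open>initial_value\<close>).

 For the boundary values, the operator \<open>(\<partial>\<^sub>x + \<gamma>) \<partial>\<^sub>x\<^sup>l\<^sup>-\<^sup>1\<close> is applied and \<open>x\<close> tends to zero.  It removes
 the pole and turns the integrand of the data in the sector \<open>p\<close> with index \<open>n\<close> into a constant times a
 function of \<open>alpha j p n * k\<close>.  In this variable the sector of \<open>(p, n)\<close> is mapped to a sector of
 the lower half-plane that depends on \<open>n\<close> only, and the constants sum over \<open>p\<close> to \<open>- 1\<close>
 (\<open>sum_lagrange_alpha\<close>).  The gaps between these sectors close, because \<open>exp (\<i> * k ^ d * t)\<close> decays
 in them; so the sectors sum to minus the boundary of the lower half-plane, and this is the integral
 over the line, from which it is subtracted (\<open>data_boundary_values\<close>).  The boundary terms depend on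
 \<open>k ^ d\<close> up to a power of \<open>k\<close>, so that their limits in different sectors differ by roots of unity.
 The coefficients \<open>ccoef\<close> are orthogonal to all but one of these (\<open>sum_ccoef\<close>), and for the remaining
 one the substitution \<open>z = k ^ d\<close> gives Fourier inversion in time (\<open>boundary_value_inversion\<close>).

 On the contours themselves \<open>exp (\<i> * k ^ d * t)\<close> merely oscillates, so the limit cannot be taken under
 the integral.  As on the line, the slowly decaying parts are therefore first rotated out of the
 sectors, where this factor decays.
\<close>

text \<open>Shorthands for expressions that occur throughout: a point of a ray, two exponentials, the angles of
 the boundary rays of a sector, and the order of the equation.\<close>

abbreviation pol :: "real => real => complex" where
 "pol r th \<equiv> of_real r * cis th"

abbreviation exi :: "real => complex => complex" where
 "exi x k \<equiv> exp (\<i> * k * of_real x)"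

abbreviation exn :: "real => complex => complex" where
 "exn x k \<equiv> exp (- \<i> * k * of_real x)"

abbreviation edges :: "nat => nat => real set" where
 "edges j p \<equiv> {lower_angle j p, upper_angle j p}"

abbreviation od :: "nat => nat" where
 "od j \<equiv> 2 * j + 1"

section \<open>Absolutely convergent and improper integrals on the half-line\<close>

text \<open>An integral over the half-line is an improper integral: for Henstock--Kurzweil integrals
 no absolute convergence is needed.\<close>

lemma has_integral_half_line_iff:
 fixes f :: "real => complex"
 assumes int: "\<And>R. R \<ge> 0 ==> (f has_integral F R) {0..R}"
 shows "(f has_integral I) {0..} \<longleftrightarrow> (F \<longlongrightarrow> I) at_top"
proof -
 have cut: "((%x. if x \<in> {0..} then f x else 0) has_integral F b) (cbox a b)" if "a \<le> 0" "0 \<le> b" for a b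
 proof -
  have "(f has_integral F b) {0..b}" by (rule int[OF that(2)])
  hence "((%x. if x \<in> {0..b} then f x else 0) has_integral F b) (cbox a b)"
   using that by (subst has_integral_restrict) auto
  thus ?thesis by (rule has_integral_eq[rotated]) auto
 qed
 have ball: "a \<le> 0 \<and> B \<le> b" if "ball 0 B \<subseteq> cbox a b" "B > 0" for a b B :: real
 proof -
  have "cball 0 B \<subseteq> cbox a b"
   using closure_mono[OF that(1)] that(2) by simp
  hence "-B \<in> cbox a b" "B \<in> cbox a b" using that(2) by (auto simp: subset_iff dist_real_def)
  thus ?thesis using that(2) by auto
 qed
 show ?thesis
 proof
  assume L: "(f has_integral I) {0..}"
  show "(F \<longlongrightarrow> I) at_top"
  proof (rule tendstoI)
   fix e :: real assume "e > 0"
   with L obtain B where B: "B > 0" "\<And>a b. ball 0 B \<subseteq> cbox a b ==>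
     (\<exists>z. ((%x. if x \<in> {0..} then f x else 0) has_integral z) (cbox a b) \<and> norm (z - I) < e)"
    unfolding has_integral'[of f I "{0..}"] by meson
   have "dist (F R) I < e" if "R \<ge> B" for R
   proof -
    have "ball 0 B \<subseteq> cbox (-B) R" using that by (auto simp: dist_real_def)
    then obtain z where z: "((%x. if x \<in> {0..} then f x else 0) has_integral z) (cbox (-B) R)"
      "norm (z - I) < e" using B(2) by blast
    have "z = F R" using has_integral_unique[OF z(1) cut] that B(1) by auto
    thus ?thesis using z(2) by (simp add: dist_norm)
   qed
   thus "\<forall>\<^sub>F x in at_top. dist (F x) I < e" unfolding eventually_at_top_linorder by blast
  qed
 next
  assume R: "(F \<longlongrightarrow> I) at_top"
  show "(f has_integral I) {0..}"
   unfolding has_integral'[of f I "{0..}"]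
  proof (intro allI impI)
   fix e :: real assume "e > 0"
   with R obtain N where N: "\<And>x. x \<ge> N ==> dist (F x) I < e"
    unfolding tendsto_iff eventually_at_top_linorder by meson
   show "\<exists>B>0. \<forall>a b. ball 0 B \<subseteq> cbox a b \<longrightarrow>
     (\<exists>z. ((%x. if x \<in> {0..} then f x else 0) has_integral z) (cbox a b) \<and> norm (z - I) < e)"
   proof (intro exI[of _ "max N 1"] conjI allI impI)
    fix a b :: real assume s: "ball 0 (max N 1) \<subseteq> cbox a b"
    have "a \<le> 0" "max N 1 \<le> b" using ball[OF s] by auto
    thus "\<exists>z. ((%x. if x \<in> {0..} then f x else 0) has_integral z) (cbox a b) \<and> norm (z - I) < e"
     using cut[of a b] N[of b] by (auto simp: dist_norm)
   qed auto
  qed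
 qed
qed

lemma has_integral_half_line_FTC:
 fixes G :: "real => complex"
 assumes der: "\<And>r. r \<ge> 0 ==> (G has_vector_derivative g r) (at r within {0..})"
  and lim: "(G \<longlongrightarrow> L) at_top"
 shows "(g has_integral (L - G 0)) {0..}"
proof -
 have "(g has_integral (G R - G 0)) {0..R}" if "R \<ge> 0" for R
  by (rule fundamental_theorem_of_calculus[OF that], rule has_vector_derivative_within_subset[OF der]) auto
 moreover have "((%R. G R - G 0) \<longlongrightarrow> L - G 0) at_top" by (intro tendsto_intros lim)
 ultimately show ?thesis using has_integral_half_line_iff[of g "%R. G R - G 0"] by blast
qed

lemma has_integral_inverse_square: "((%r::real. 1 / (1 + r)\<^sup>2) has_integral 1) {0..}"
proof -
 have "((%r::real. complex_of_real (1 / (1 + r)\<^sup>2)) has_integral (0 - (- complex_of_real (1 / (1 + 0))))) {0..}"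
 proof (rule has_integral_half_line_FTC[where G="%r. - complex_of_real (1 / (1 + r))"])
  fix r :: real assume "r \<ge> 0"
  have "((%r. - (1 / (1 + r))) has_field_derivative (1 / (1 + r)\<^sup>2)) (at r within {0..})"
   using \<open>r \<ge> 0\<close> by (auto intro!: derivative_eq_intros simp: power2_eq_square)
  hence "((%r. complex_of_real (- (1 / (1 + r)))) has_vector_derivative of_real (1 / (1 + r)\<^sup>2)) (at r within {0..})"
   by (rule has_vector_derivative_of_real)
  thus "((%r. - complex_of_real (1 / (1 + r))) has_vector_derivative of_real (1 / (1 + r)\<^sup>2)) (at r within {0..})"
   by simp
 next
  have "((%r::real. 1 / (1 + r)) \<longlongrightarrow> 0) at_top" by real_asymp
  hence "((%r. - complex_of_real (1 / (1 + r))) \<longlongrightarrow> - complex_of_real 0) at_top" by (intro tendsto_intros)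
  thus "((%r. - complex_of_real (1 / (1 + r))) \<longlongrightarrow> 0) at_top" by simp
 qed
 hence "((%r::real. complex_of_real (1 / (1 + r)\<^sup>2)) has_integral complex_of_real 1) {0..}" by simp
 hence "((Re \<circ> (%r::real. complex_of_real (1 / (1 + r)\<^sup>2))) has_integral Re (complex_of_real 1)) {0..}"
  by (rule has_integral_linear[OF _ bounded_linear_Re])
 thus ?thesis by (simp add: o_def)
qed

lemma inverse_square_integrable: "(%r::real. C / (1 + r)\<^sup>2) integrable_on {0..}"
 using has_integral_integrable[OF has_integral_mult_right[OF has_integral_inverse_square, of C]] by simp

lemma integrable_on_quadratic_decay:
 fixes f :: "real => complex"
 assumes "continuous_on {0..} f" "\<And>r. r \<ge> 0 ==> norm (f r) \<le> C / (1 + r)\<^sup>2"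
 shows "f integrable_on {0..}"
 by (rule measurable_bounded_by_integrable_imp_integrable[OF _ inverse_square_integrable[of C]])
   (use assms in \<open>auto intro: continuous_imp_measurable_on_sets_lebesgue\<close>)

lemma norm_integral_quadratic_decay:
 fixes f :: "real => complex"
 assumes "continuous_on {0..} f" "\<And>r. r \<ge> 0 ==> norm (f r) \<le> C / (1 + r)\<^sup>2"
 shows "norm (integral {0..} f) \<le> C"
proof -
 have "norm (integral {0..} f) \<le> integral {0..} (%r::real. C / (1 + r)\<^sup>2)"
  by (rule integral_norm_bound_integral[OF integrable_on_quadratic_decay inverse_square_integrable])
    (use assms in auto)
 also have "\<dots> = C" using has_integral_mult_right[OF has_integral_inverse_square, of C] 
  by (simp add: integral_unique)
 finally show ?thesis .
qed

text \<open>Dominated convergence along a punctured neighbourhood instead of a sequence.\<close>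

lemma tendsto_integral_dominated:
 fixes f :: "'a::first_countable_topology => real => complex"
 assumes f: "\<And>y. y \<in> U ==> f y integrable_on S" and h: "h integrable_on S"
  and le: "\<And>y r. y \<in> U ==> r \<in> S ==> norm (f y r) \<le> h r"
  and conv: "\<And>r. r \<in> S ==> ((%y. f y r) \<longlongrightarrow> g r) (at y0 within U)"
  and nontriv: "at y0 within U \<noteq> bot"
 shows "g integrable_on S" "((%y. integral S (f y)) \<longlongrightarrow> integral S g) (at y0 within U)"
proof -
 have seq: "g integrable_on S \<and> (%n. integral S (f (X n))) \<longlonglongrightarrow> integral S g"
  if X: "\<forall>n. X n \<in> U - {y0}" "X \<longlonglongrightarrow> y0" for X
 proof -
  have "(%n. f (X n) r) \<longlonglongrightarrow> g r" if "r \<in> S" for r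
  proof -
   have "filterlim X (at y0 within U) sequentially"
    using X by (auto simp: filterlim_at eventually_sequentially)
   from filterlim_compose[OF conv[OF that] this] show ?thesis .
  qed
  thus ?thesis
   using dominated_convergence[of "%n. f (X n)" S h g] f h le X(1) by auto
 qed
 show "((%y. integral S (f y)) \<longlongrightarrow> integral S g) (at y0 within U)"
  unfolding tendsto_def
 proof (intro allI impI, rule sequentially_imp_eventually_within, intro allI impI)
  fix V and X assume "open V" "integral S g \<in> V" "(\<forall>n. X n \<in> U \<and> X n \<noteq> y0) \<and> X \<longlonglongrightarrow> y0"
  thus "\<forall>\<^sub>F n in sequentially. integral S (f (X n)) \<in> V"
   using seq[of X] by (auto simp: tendsto_def)
 qed
 have "y0 islimpt U" using nontriv trivial_limit_within by blast
 then obtain X where "\<forall>n. X n \<in> U - {y0}" "X \<longlonglongrightarrow> y0"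
  unfolding islimpt_sequential by blast
 thus "g integrable_on S" using seq by blast
qed

lemma has_vector_derivative_iff_quotient:
 fixes f :: "real => complex"
 shows "(f has_vector_derivative D) (at x within S) \<longleftrightarrow>
     ((%y. (f y - f x) / of_real (y - x)) \<longlongrightarrow> D) (at x within S)"
proof -
 have eq: "norm (f y - f x - (y - x) *\<^sub>R D) / norm (y - x) = norm ((f y - f x) / of_real (y - x) - D)"
  if "y \<noteq> x" for y
 proof -
  have "f y - f x - (y - x) *\<^sub>R D = ((f y - f x) / of_real (y - x) - D) * of_real (y - x)"
   using that by (simp add: field_simps scaleR_conv_of_real)
  hence "norm (f y - f x - (y - x) *\<^sub>R D) = norm ((f y - f x) / of_real (y - x) - D) * norm (y - x)"
   by (metis norm_mult norm_of_real real_norm_def)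
  thus ?thesis using that by simp
 qed
 have "(f has_vector_derivative D) (at x within S) \<longleftrightarrow>
   ((%y. norm (f y - f x - (y - x) *\<^sub>R D) / norm (y - x)) \<longlongrightarrow> 0) (at x within S)"
  unfolding has_vector_derivative_def has_derivative_iff_norm by (auto intro: bounded_linear_intros)
 also have "\<dots> \<longleftrightarrow> ((%y. norm ((f y - f x) / of_real (y - x) - D)) \<longlongrightarrow> 0) (at x within S)"
  by (rule Lim_cong_within) (use eq in auto)
 also have "\<dots> \<longleftrightarrow> ((%y. (f y - f x) / of_real (y - x)) \<longlongrightarrow> D) (at x within S)"
  by (simp only: tendsto_norm_zero_iff LIM_zero_iff)
 finally show ?thesis .
qed

lemma has_field_derivative_integral_dominated:
 fixes f :: "complex => real => complex"
 assumes f: "\<And>y. y \<in> U ==> f y integrable_on S" and h: "h integrable_on S" and y0: "y0 \<in> U"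
  and lip: "\<And>y r. y \<in> U ==> r \<in> S ==> norm (f y r - f y0 r) \<le> h r * norm (y - y0)"
  and der: "\<And>r. r \<in> S ==> ((%y. f y r) has_field_derivative f' r) (at y0 within U)"
  and nontriv: "at y0 within U \<noteq> bot"
 shows "((%y. integral S (f y)) has_field_derivative integral S f') (at y0 within U)"
proof -
 have "((%y. integral S (%r. (f y r - f y0 r) / (y - y0))) \<longlongrightarrow> integral S f') (at y0 within U - {y0})"
 proof (rule tendsto_integral_dominated(2)[OF _ h])
  show "(%r. (f y r - f y0 r) / (y - y0)) integrable_on S" if "y \<in> U - {y0}" for y
   by (intro integrable_on_divide integrable_diff f) (use that y0 in auto)
  show "norm ((f y r - f y0 r) / (y - y0)) \<le> h r" if "y \<in> U - {y0}" "r \<in> S" for y r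
   using lip[of y r] that by (simp add: norm_divide divide_le_eq)
  show "((%y. (f y r - f y0 r) / (y - y0)) \<longlongrightarrow> f' r) (at y0 within U - {y0})" if "r \<in> S" for r
   using der[OF that] unfolding has_field_derivative_iff by (simp add: at_within_def)
  show "at y0 within U - {y0} \<noteq> bot" using nontriv by (simp add: at_within_def)
 qed
 hence "((%y. integral S (%r. (f y r - f y0 r) / (y - y0))) \<longlongrightarrow> integral S f') (at y0 within U)"
  by (simp add: at_within_def)
 moreover have eq: "integral S (%r. (f y r - f y0 r) / (y - y0)) =
   (integral S (f y) - integral S (f y0)) / (y - y0)" if "y \<in> U" for y
  using integral_diff[OF f[OF that] f[OF y0]] by simp
 ultimately show ?thesis
  unfolding has_field_derivative_iff
  by (subst Lim_cong_within[OF refl refl refl, OF eq[symmetric]]) auto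
qed

text \<open>The Lipschitz constants of the integrand dominate its difference quotients.\<close>

lemma has_vector_derivative_integral_dominated:
 fixes f :: "real => real => complex"
 assumes f: "\<And>y. y \<in> U ==> f y integrable_on S" and h: "h integrable_on S" and y0: "y0 \<in> U"
  and lip: "\<And>y r. y \<in> U ==> r \<in> S ==> norm (f y r - f y0 r) \<le> h r * norm (y - y0)"
  and der: "\<And>r. r \<in> S ==> ((%y. f y r) has_vector_derivative f' r) (at y0 within U)"
  and nontriv: "at y0 within U \<noteq> bot"
 shows "((%y. integral S (f y)) has_vector_derivative integral S f') (at y0 within U)"
proof -
 have "((%y. integral S (%r. (f y r - f y0 r) / of_real (y - y0))) \<longlongrightarrow> integral S f') (at y0 within U - {y0})"
 proof (rule tendsto_integral_dominated(2)[OF _ h])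
  show "(%r. (f y r - f y0 r) / of_real (y - y0)) integrable_on S" if "y \<in> U - {y0}" for y
   by (intro integrable_on_divide integrable_diff f) (use that y0 in auto)
  show "norm ((f y r - f y0 r) / of_real (y - y0)) \<le> h r" if "y \<in> U - {y0}" "r \<in> S" for y r
   using lip[of y r] that by (simp add: norm_divide divide_le_eq del: of_real_diff)
  show "((%y. (f y r - f y0 r) / of_real (y - y0)) \<longlongrightarrow> f' r) (at y0 within U - {y0})" if "r \<in> S" for r
   using der[OF that] unfolding has_vector_derivative_iff_quotient by (simp add: at_within_def)
  show "at y0 within U - {y0} \<noteq> bot" using nontriv by (simp add: at_within_def)
 qed
 hence "((%y. integral S (%r. (f y r - f y0 r) / of_real (y - y0))) \<longlongrightarrow> integral S f') (at y0 within U)"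
  by (simp add: at_within_def)
 moreover have eq: "integral S (%r. (f y r - f y0 r) / of_real (y - y0)) =
   (integral S (f y) - integral S (f y0)) / of_real (y - y0)" if "y \<in> U" for y
  using integral_diff[OF f[OF that] f[OF y0]] by simp
 ultimately show ?thesis
  unfolding has_vector_derivative_iff_quotient
  by (subst Lim_cong_within[OF refl refl refl, OF eq[symmetric]]) auto
qed

lemma exp_beats_power:
 fixes c r :: real
 assumes "c > 0" "r \<ge> 0"
 shows "(1 + r) ^ n * exp (- (c * r)) \<le> exp c * fact n / c ^ n"
proof -
 have "(c * (1 + r)) ^ n / fact n \<le> exp (c * (1 + r))"
 proof -
  have "(\<Sum>i\<in>{n}. (c * (1 + r)) ^ i /\<^sub>R fact i) \<le> (\<Sum>i. (c * (1 + r)) ^ i /\<^sub>R fact i)"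
   using assms by (intro sum_le_suminf summable_exp_generic) auto
  thus ?thesis by (simp add: exp_def divide_inverse mult.commute)
 qed
 also have "exp (c * (1 + r)) = exp c * exp (c * r)" by (simp add: exp_add[symmetric] algebra_simps)
 finally have "(1 + r) ^ n \<le> exp c * exp (c * r) * fact n / c ^ n"
  unfolding power_mult_distrib using assms by (simp add: divide_simps mult_ac)
 hence "(1 + r) ^ n * exp (- (c * r)) \<le> (exp c * exp (c * r) * fact n / c ^ n) * exp (- (c * r))"
  by (rule mult_right_mono) simp
 also have "\<dots> = exp c * fact n / c ^ n" by (simp add: exp_minus field_simps)
 finally show ?thesis .
qed

section \<open>Rotating rays of integration\<close>

definition wedge :: "real => real => complex set" where
 "wedge a b = {pol r th | r th. 0 \<le> r \<and> a \<le> th \<and> th \<le> b}"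

lemma inner_i_cis: "inner (\<i> * cis a) (pol r th) = r * sin (th - a)"
 by (simp add: inner_complex_def sin_diff algebra_simps)

lemma polar_coordinates_between:
 assumes "z \<noteq> 0" "a < b" "b \<le> a + pi" "inner (\<i> * cis a) z \<ge> 0" "inner (\<i> * cis b) z \<le> 0"
 obtains th where "z = pol (norm z) th" "a \<le> th" "th \<le> b"
proof -
 define t where "t = Arg2pi (z * cis (-a))"
 have t: "0 \<le> t" "t < 2 * pi" by (auto simp: t_def Arg2pi)
 have "z * cis (-a) = of_real (norm (z * cis (-a))) * exp (\<i> * of_real t)"
  unfolding t_def by (rule Arg2pi_eq)
 hence "z * cis (-a) * cis a = pol (norm z) t * cis a"
  by (simp add: norm_mult cis_conv_exp)
 hence z: "z = pol (norm z) (a + t)"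
  by (simp add: mult.assoc cis_mult add.commute)
 have nz: "norm z > 0" using assms(1) by simp
 have s1: "sin t \<ge> 0"
  using assms(4) nz by (subst (asm) z) (auto simp: inner_i_cis zero_le_mult_iff)
 have s2: "sin (a + t - b) \<le> 0"
  using assms(5) nz by (subst (asm) z) (auto simp: inner_i_cis mult_le_0_iff)
 have "t \<le> pi"
 proof (rule ccontr)
  assume "\<not> t \<le> pi"
  hence "sin t < 0" using t by (intro sin_lt_zero) auto
  thus False using s1 by simp
 qed
 have "a + t \<le> b"
 proof (rule ccontr)
  assume "\<not> a + t \<le> b"
  hence "sin (a + t - b) > 0" using \<open>t \<le> pi\<close> assms(2) by (intro sin_gt_zero) auto
  thus False using s2 by simp
 qed
 thus ?thesis using that[OF z] t by auto
qed

text \<open>Up to opening \<open>pi\<close> a wedge is an intersection of two half-planes; this makes it convex, as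
 Cauchy's theorem requires.\<close>

lemma wedge_eq_halfplanes:
 assumes "a < b" "b \<le> a + pi"
 shows "wedge a b = {z. inner (\<i> * cis a) z \<ge> 0} \<inter> {z. inner (\<i> * cis b) z \<le> 0}"
proof (intro equalityI subsetI)
 fix z assume "z \<in> wedge a b"
 then obtain r th where z: "z = pol r th" and r: "0 \<le> r" "a \<le> th" "th \<le> b"
  by (auto simp: wedge_def)
 have "sin (th - a) \<ge> 0" using r assms by (intro sin_ge_zero) auto
 moreover have "sin (th - b) \<le> 0" using r assms sin_ge_zero[of "b - th"] sin_minus[of "b - th"] by auto
 ultimately show "z \<in> {z. inner (\<i> * cis a) z \<ge> 0} \<inter> {z. inner (\<i> * cis b) z \<le> 0}"
  using r by (auto simp: z inner_i_cis mult_nonneg_nonpos)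
next
 fix z assume z: "z \<in> {z. inner (\<i> * cis a) z \<ge> 0} \<inter> {z. inner (\<i> * cis b) z \<le> 0}"
 show "z \<in> wedge a b"
 proof (cases "z = 0")
  case True
  thus ?thesis using assms unfolding wedge_def by (auto intro!: exI[of _ "0::real"] exI[of _ a])
 next
  case False
  thus ?thesis using polar_coordinates_between[OF False assms] z unfolding wedge_def
   by (smt (verit) IntD1 IntD2 mem_Collect_eq norm_ge_zero)
 qed
qed

lemma convex_wedge: "a < b ==> b \<le> a + pi ==> convex (wedge a b)"
 by (simp add: wedge_eq_halfplanes convex_Int convex_halfspace_ge convex_halfspace_le)

lemma interior_wedge_subset:
 assumes "a < b" "b \<le> a + pi" "z \<in> interior (wedge a b)"
 obtains r th where "z = pol r th" "r > 0" "a < th" "th < b"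
proof -
 have nz: "\<i> * cis a \<noteq> 0" "\<i> * cis b \<noteq> 0" by auto
 have z: "inner (\<i> * cis a) z > 0" "inner (\<i> * cis b) z < 0"
  using assms(3) nz by (auto simp: wedge_eq_halfplanes[OF assms(1,2)])
 hence "z \<noteq> 0" by auto
 with polar_coordinates_between[OF this assms(1,2)] z obtain th where
  th: "z = pol (norm z) th" "a \<le> th" "th \<le> b" by auto
 have "norm z * sin (th - a) > 0" "norm z * sin (th - b) < 0"
  using z inner_i_cis[of a "norm z" th] inner_i_cis[of b "norm z" th] th(1) by auto
 hence "th \<noteq> a" "th \<noteq> b" by auto
 thus ?thesis using that[of "norm z" th] th \<open>z \<noteq> 0\<close> by auto
qed

lemma ray_in_wedge: "r \<ge> 0 ==> a \<le> th ==> th \<le> b ==> pol r th \<in> wedge a b"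
 by (auto simp: wedge_def)

lemma continuous_on_ray_integrand:
 assumes "continuous_on S h" "\<And>r. r \<ge> 0 ==> pol r th \<in> S"
 shows "continuous_on {0..} (ray_integrand h th)"
 unfolding ray_integrand_def
 by (intro continuous_intros continuous_on_compose2[OF assms(1)]) (use assms(2) in auto)

lemma norm_ray_integrand: "norm (ray_integrand h th r) = norm (h (pol r th))"
 by (simp add: ray_integrand_def norm_mult)

lemma contour_integral_ray:
 assumes "continuous_on {0..} (ray_integrand h th)" "R > 0"
 shows "(h has_contour_integral integral {0..R} (ray_integrand h th)) (linepath 0 (pol R th))"
proof -
 have "(ray_integrand h th has_integral integral {0..R} (ray_integrand h th)) {0..R}"
  by (intro integrable_integral integrable_continuous_real continuous_on_subset[OF assms(1)]) auto
 hence "((%s. ray_integrand h th (R * s)) has_integral (1 / \<bar>R\<bar>) *\<^sub>R integral {0..R} (ray_integrand h th))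
   ((%s. s / R) ` {0..R})"
  by (rule has_integral_stretch_real) (use assms(2) in auto)
 moreover have "(%s. s / R) ` {0..R} = {0..1}"
  using assms(2) by (simp add: image_divide_atLeastAtMost)
 ultimately have "((%s. ray_integrand h th (R * s) * of_real R) has_integral
   ((1 / R) *\<^sub>R integral {0..R} (ray_integrand h th)) * of_real R) {0..1}"
  using assms(2) by (intro has_integral_mult_left) auto
 moreover have "((1 / R) *\<^sub>R integral {0..R} (ray_integrand h th)) * of_real R = integral {0..R} (ray_integrand h th)"
  using assms(2) by (simp add: scaleR_conv_of_real)
 ultimately show ?thesis
  unfolding has_contour_integral_linepath
  by (simp add: ray_integrand_def linepath_def scaleR_conv_of_real mult_ac)
qed

text \<open>
 Cauchy's theorem on a truncated wedge.  The hypotheses are those of Jordan's lemma in a form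
 suited to dominated convergence: on the arc of radius \<open>r\<close> the quantity \<open>r * h\<close> only has to stay
 bounded, and to vanish in the limit along each interior ray.
\<close>

theorem has_integral_rotate_ray:
 assumes ab: "a < b" "b \<le> a + pi"
  and cont: "continuous_on (wedge a b) h"
  and holo: "\<And>r th. r > 0 ==> a < th ==> th < b ==> h field_differentiable at (pol r th)"
  and bound: "\<And>r th. r \<ge> L ==> a \<le> th ==> th \<le> b ==> r * norm (h (pol r th)) \<le> C"
  and lim: "\<And>th. a < th ==> th < b ==> ((%r. r * norm (h (pol r th))) \<longlongrightarrow> 0) at_top"
 shows "(ray_integrand h a has_integral I) {0..} \<longleftrightarrow> (ray_integrand h b has_integral I) {0..}"
proof -
 define arc where "arc R = integral {a..b} (%t. h (pol R t) * of_real R * \<i> * cis t)" for R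
 have ca: "continuous_on {0..} (ray_integrand h a)" and cb: "continuous_on {0..} (ray_integrand h b)"
  by (rule continuous_on_ray_integrand[OF cont]; use ab in \<open>auto intro: ray_in_wedge\<close>)+
 have cauchy: "integral {0..R} (ray_integrand h a) + arc R - integral {0..R} (ray_integrand h b) = 0"
  if "R > 0" for R
 proof -
  define A B where "A = pol R a" and "B = pol R b"
  define g where "g = linepath 0 A +++ part_circlepath 0 R a b +++ linepath B 0"
  have sub: "path_image g \<subseteq> wedge a b"
  proof -
   have "0 \<in> wedge a b" "A \<in> wedge a b" "B \<in> wedge a b"
    using ray_in_wedge[of 0 a a b] ray_in_wedge[of R a a b] ray_in_wedge[of R a b b] ab that
    by (auto simp: A_def B_def)
   hence "closed_segment 0 A \<subseteq> wedge a b" "closed_segment B 0 \<subseteq> wedge a b"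
    using convex_wedge[OF ab] by (auto intro: closed_segment_subset[THEN subsetD])
   moreover have "path_image (part_circlepath 0 R a b) \<subseteq> wedge a b"
   proof -
    show ?thesis
    proof
     fix w assume "w \<in> path_image (part_circlepath 0 R a b)"
     then obtain th where "th \<in> closed_segment a b" "w = pol R th"
      by (auto simp: path_image_part_circlepath')
     thus "w \<in> wedge a b"
      using ray_in_wedge[of R a th b] that ab by (simp add: closed_segment_eq_real_ivl)
    qed
   qed
   ultimately show ?thesis unfolding g_def by (intro subset_path_image_join) simp_all
  qed
  have ends: "pathstart (part_circlepath 0 R a b) = A" "pathfinish (part_circlepath 0 R a b) = B"
   by (auto simp: A_def B_def cis_conv_exp)
  have zero: "(h has_contour_integral 0) g"
  proof (rule Cauchy_theorem_convex[OF cont convex_wedge[OF ab], of "{}"])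
   fix z assume "z \<in> interior (wedge a b) - {}"
   thus "h field_differentiable at z"
    using interior_wedge_subset[OF ab] holo by (metis Diff_empty)
  qed (use sub ends in \<open>auto simp: g_def\<close>)
  have "(h has_contour_integral integral {0..R} (ray_integrand h a)) (linepath 0 A)"
   unfolding A_def by (rule contour_integral_ray[OF ca that])
  moreover have "(h has_contour_integral - integral {0..R} (ray_integrand h b)) (linepath B 0)"
   using has_contour_integral_reversepath[OF _ contour_integral_ray[OF cb that]]
   unfolding B_def by simp
  moreover have "(h has_contour_integral arc R) (part_circlepath 0 R a b)"
  proof -
   have "(%t. h (pol R t) * of_real R * \<i> * cis t) integrable_on {a..b}"
    by (intro integrable_continuous_real continuous_intros continuous_on_compose2[OF cont])
      (use that in \<open>auto intro: ray_in_wedge\<close>)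
   thus ?thesis
    unfolding has_contour_integral_part_circlepath_iff[OF ab(1)] arc_def
    by (auto dest: integrable_integral)
  qed
  ultimately have "(h has_contour_integral
    (integral {0..R} (ray_integrand h a) + (arc R + - integral {0..R} (ray_integrand h b)))) g"
   unfolding g_def using ends by (intro has_contour_integral_join valid_path_join) simp_all
  hence "integral {0..R} (ray_integrand h a) + (arc R + - integral {0..R} (ray_integrand h b)) = 0"
   using zero has_contour_integral_unique by blast
  thus ?thesis by (simp add: algebra_simps)
 qed
 have "(arc \<longlongrightarrow> 0) at_top"
 proof -
  have "arc = (%R. integral {a<..<b} (%t. h (pol R t) * of_real R * \<i> * cis t))"
   unfolding arc_def integral_open_interval_real ..
  moreover have "((%R. integral {a<..<b} (%t. h (pol R t) * of_real R * \<i> * cis t)) \<longlongrightarrow>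
    integral {a<..<b} (%t. 0)) at_top"
  proof (rule tendsto_at_topI_sequentially)
   fix X :: "nat => real" assume X: "filterlim X at_top sequentially"
   hence "\<forall>\<^sub>F n in sequentially. X n \<ge> max L 1"
    unfolding filterlim_at_top by blast
   then obtain N where N: "\<And>n. n \<ge> N ==> X n \<ge> max L 1" unfolding eventually_sequentially by blast
   have "(%n. integral {a<..<b} (%t. h (pol (X (n + N)) t) * of_real (X (n + N)) * \<i> * cis t))
     \<longlonglongrightarrow> integral {a<..<b} (%t. 0)"
   proof (rule dominated_convergence(2)[where h="%_. C"])
    fix n
    have Xn: "X (n + N) \<ge> L" "X (n + N) \<ge> 1" using N[of "n + N"] by auto
    have "(%t. h (pol (X (n + N)) t) * of_real (X (n + N)) * \<i> * cis t) integrable_on {a..b}"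
     by (intro integrable_continuous_real continuous_intros continuous_on_compose2[OF cont])
       (use Xn in \<open>auto intro: ray_in_wedge\<close>)
    thus "(%t. h (pol (X (n + N)) t) * of_real (X (n + N)) * \<i> * cis t) integrable_on {a<..<b}"
     by (simp add: integrable_on_Icc_iff_Ioo)
    show "norm (h (pol (X (n + N)) t) * of_real (X (n + N)) * \<i> * cis t) \<le> C"
     if "t \<in> {a<..<b}" for t
     using bound[of "X (n + N)" t] Xn that by (simp add: norm_mult mult_ac)
   next
    have "(%t::real. C) integrable_on {a..b}" by (rule integrable_const_ivl)
    thus "(%t::real. C) integrable_on {a<..<b}" by (simp add: integrable_on_Icc_iff_Ioo)
   next
    fix t assume t: "t \<in> {a<..<b}"
    have Xinf: "filterlim (%n. X (n + N)) at_top sequentially"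
     by (rule filterlim_compose[OF X filterlim_add_const_nat_at_top])
    have "(%n. X (n + N) * norm (h (pol (X (n + N)) t))) \<longlonglongrightarrow> 0"
     using filterlim_compose[OF lim Xinf] t by auto
    thus "(%n. h (pol (X (n + N)) t) * of_real (X (n + N)) * \<i> * cis t) \<longlonglongrightarrow> 0"
    proof (rule Lim_null_comparison[rotated], intro always_eventually allI)
     fix n
     have "X (n + N) \<ge> 1" using N[of "n + N"] by simp
     thus "norm (h (pol (X (n + N)) t) * of_real (X (n + N)) * \<i> * cis t)
       \<le> X (n + N) * norm (h (pol (X (n + N)) t))"
      by (simp add: norm_mult)
    qed
   qed
   thus "(%n. integral {a<..<b} (%t. h (pol (X n) t) * of_real (X n) * \<i> * cis t))
     \<longlonglongrightarrow> integral {a<..<b} (%t. 0)"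
    by (rule LIMSEQ_offset)
  qed
  ultimately show ?thesis by simp
 qed
 moreover have "\<forall>\<^sub>F R in at_top. integral {0..R} (ray_integrand h b) = integral {0..R} (ray_integrand h a) + arc R"
  using eventually_gt_at_top[of 0] by eventually_elim (use cauchy in \<open>auto simp: algebra_simps\<close>)
 ultimately have "((%R. integral {0..R} (ray_integrand h a)) \<longlongrightarrow> I) at_top \<longleftrightarrow>
   ((%R. integral {0..R} (ray_integrand h b)) \<longlongrightarrow> I) at_top"
 proof -
  assume arc: "(arc \<longlongrightarrow> 0) at_top" and
   ev: "\<forall>\<^sub>F R in at_top. integral {0..R} (ray_integrand h b) = integral {0..R} (ray_integrand h a) + arc R"
  have "((%R. integral {0..R} (ray_integrand h b)) \<longlongrightarrow> I) at_top \<longleftrightarrow>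
    ((%R. integral {0..R} (ray_integrand h a) + arc R) \<longlongrightarrow> I) at_top"
   by (rule tendsto_cong[OF ev])
  also have "\<dots> \<longleftrightarrow> ((%R. integral {0..R} (ray_integrand h a)) \<longlongrightarrow> I) at_top"
   using tendsto_add[OF _ arc, of "%R. integral {0..R} (ray_integrand h a)" I]
    tendsto_diff[OF _ arc, of "%R. integral {0..R} (ray_integrand h a) + arc R" I] by auto
  finally show ?thesis by simp
 qed
 moreover have "(ray_integrand h th has_integral integral {0..R} (ray_integrand h th)) {0..R}"
  if "continuous_on {0..} (ray_integrand h th)" for th R
  by (intro integrable_integral integrable_continuous_real continuous_on_subset[OF that]) auto
 ultimately show ?thesis using ca cb
  by (simp add: has_integral_half_line_iff[where F="%R. integral {0..R} (ray_integrand h a)"]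
    has_integral_half_line_iff[where F="%R. integral {0..R} (ray_integrand h b)"])
qed

section \<open>The half-line Fourier transform in the closed lower half-plane\<close>

lemma norm_exp_lower_le_1:
 assumes "Im k \<le> 0" "x \<ge> 0"
 shows "norm (exn x k) \<le> 1"
 using assms by (simp add: mult_nonpos_nonneg)

lemma decay_power_le:
 fixes x :: real
 assumes "x \<ge> 0" "n \<le> N" "(1 + x) ^ N * y \<le> C" "y \<ge> 0"
 shows "y \<le> C / (1 + x) ^ n"
proof -
 have "(1 + x) ^ n * y \<le> (1 + x) ^ N * y"
  using assms by (intro mult_right_mono power_increasing) auto
 hence "(1 + x) ^ n * y \<le> C" using assms(3) by linarith
 thus ?thesis using assms(1) by (simp add: field_simps)
qed

lemma continuous_on_half_line_ft_param:
 fixes G :: "'p::first_countable_topology => real => complex"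
 assumes cont: "continuous_on (P \<times> {0..}) (%(p, x). G p x)"
  and bound: "\<And>p x. p \<in> P ==> x \<ge> 0 ==> norm (G p x) \<le> C / (1 + x)\<^sup>2"
 shows "continuous_on (P \<times> {k. Im k \<le> 0}) (%(p, k). half_line_ft (G p) k)"
proof -
 define f where "f = (%y x. exp (- \<i> * snd y * of_real x) * G (fst y) x)"
 have contG: "continuous_on {0..} (G p)" if "p \<in> P" for p
 proof -
  have "continuous_on {0..} (%x. (%(p, x). G p x) (p, x))"
   by (rule continuous_on_compose2[OF cont]) (use that in \<open>auto intro!: continuous_intros\<close>)
  thus ?thesis by simp
 qed
 have fb: "norm (f y x) \<le> C / (1 + x)\<^sup>2" if "y \<in> P \<times> {k. Im k \<le> 0}" "x \<ge> 0" for y x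
 proof -
  have "norm (f y x) \<le> 1 * norm (G (fst y) x)"
   unfolding f_def norm_mult using that norm_exp_lower_le_1[of "snd y" x]
   by (intro mult_right_mono) auto
  thus ?thesis using bound[of "fst y" x] that by auto
 qed
 have fi: "f y integrable_on {0..}" if "y \<in> P \<times> {k. Im k \<le> 0}" for y
 proof (rule integrable_on_quadratic_decay)
  show "continuous_on {0..} (f y)" unfolding f_def
   using that by (intro continuous_intros contG) auto
  show "norm (f y x) \<le> C / (1 + x)\<^sup>2" if "x \<ge> 0" for x
   by (rule fb) fact+
 qed
 have "((%y. integral {0..} (f y)) \<longlongrightarrow> integral {0..} (f y0)) (at y0 within P \<times> {k. Im k \<le> 0})"
  if y0: "y0 \<in> P \<times> {k. Im k \<le> 0}" for y0
 proof (cases "at y0 within P \<times> {k. Im k \<le> 0} = bot")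
  case False
  show ?thesis
  proof (rule tendsto_integral_dominated(2)[OF fi inverse_square_integrable[of C] _ _ False])
   fix x :: real assume x: "x \<in> {0..}"
   have "continuous_on (P \<times> {k. Im k \<le> 0}) (%y. (%(p, x). G p x) (fst y, x))"
    by (rule continuous_on_compose2[OF cont]) (use x in \<open>auto intro!: continuous_intros\<close>)
   hence "continuous_on (P \<times> {k. Im k \<le> 0}) (%y. f y x)"
    unfolding f_def by (intro continuous_intros) simp
   thus "((%y. f y x) \<longlongrightarrow> f y0 x) (at y0 within P \<times> {k. Im k \<le> 0})"
    using y0 unfolding continuous_on_def by blast
  qed (use fb in auto)
 qed simp
 hence "continuous_on (P \<times> {k. Im k \<le> 0}) (%y. integral {0..} (f y))"
  by (simp add: continuous_on_def)
 thus ?thesis by (simp add: f_def half_line_ft_def case_prod_unfold)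
qed

lemma half_line_ft_integrable:
 assumes "continuous_on {0..} g" "\<And>x. x \<ge> 0 ==> norm (g x) \<le> C / (1 + x)\<^sup>2" "Im k \<le> 0"
 shows "(%x. exn x k * g x) integrable_on {0..}"
  and "norm (half_line_ft g k) \<le> C"
proof -
 have b: "norm (exn x k * g x) \<le> C / (1 + x)\<^sup>2" if "x \<ge> 0" for x
 proof -
  have "norm (exn x k * g x) \<le> 1 * norm (g x)"
   unfolding norm_mult using that assms(3) norm_exp_lower_le_1[of k x] by (intro mult_right_mono) auto
  thus ?thesis using assms(2)[OF that] by simp
 qed
 have c: "continuous_on {0..} (%x. exn x k * g x)"
  by (intro continuous_intros assms)
 show "(%x. exn x k * g x) integrable_on {0..}"
  by (rule integrable_on_quadratic_decay[OF c b])
 show "norm (half_line_ft g k) \<le> C"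
  unfolding half_line_ft_def by (rule norm_integral_quadratic_decay[OF c b])
qed

lemma has_field_derivative_half_line_ft:
 assumes g: "continuous_on {0..} g" "\<And>x. x \<ge> 0 ==> norm (g x) \<le> C / (1 + x) ^ 3" and k: "Im k \<le> 0"
 shows "(half_line_ft g has_field_derivative half_line_ft (%x. - \<i> * of_real x * g x) k)
      (at k within {k. Im k \<le> 0})"
proof -
 have C: "C \<ge> 0" using order_trans[OF norm_ge_zero g(2)[of 0]] by simp
 have b2: "norm (g x) \<le> C / (1 + x)\<^sup>2" if "x \<ge> 0" for x
 proof -
  have "(1 + x)\<^sup>2 \<le> (1 + x) ^ 3" using that by (intro power_increasing) auto
  hence "C / (1 + x) ^ 3 \<le> C / (1 + x)\<^sup>2" using that C by (intro divide_left_mono) auto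
  thus ?thesis using g(2)[OF that] by linarith
 qed
 have b3: "x * norm (g x) \<le> C / (1 + x)\<^sup>2" if "x \<ge> 0" for x
 proof -
  have "x * norm (g x) \<le> (1 + x) * (C / (1 + x) ^ 3)" using that g(2)[OF that] by (intro mult_mono) auto
  also have "\<dots> = C / (1 + x)\<^sup>2" using that by (simp add: power2_eq_square power3_eq_cube divide_simps)
  finally show ?thesis .
 qed
 have convex: "convex {k. Im k \<le> 0}" by (rule convex_halfspace_Im_le)
 have "((%k. integral {0..} (%x. exn x k * g x)) has_field_derivative
   integral {0..} (%x. exn x k * (- \<i> * of_real x * g x))) (at k within {k. Im k \<le> 0})"
 proof (rule has_field_derivative_integral_dominated[OF _ inverse_square_integrable[of C]])
  show "(%x. exn x k * g x) integrable_on {0..}" if "k \<in> {k. Im k \<le> 0}" for k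
   using half_line_ft_integrable(1)[OF g(1) b2] that by auto
  show "k \<in> {k. Im k \<le> 0}" using k by simp
  show "((%y. exn x y * g x) has_field_derivative
    exn x k * (- \<i> * of_real x * g x)) (at k within {k. Im k \<le> 0})" for x
   by (auto intro!: derivative_eq_intros)
  show "norm (exn x y * g x - exn x k * g x)
    \<le> C / (1 + x)\<^sup>2 * norm (y - k)" if "y \<in> {k. Im k \<le> 0}" "x \<in> {0..}" for y x
  proof -
   have "norm (exn x y - exn x k) \<le> x * norm (y - k)"
   proof (rule field_differentiable_bound[OF convex, where f'="%z. - \<i> * of_real x * exn x z"])
    show "((%y. exn x y) has_field_derivative - \<i> * of_real x * exn x z)
      (at z within {k. Im k \<le> 0})" for z
     by (auto intro!: derivative_eq_intros)
    show "norm (- \<i> * of_real x * exn x z) \<le> x" if "z \<in> {k. Im k \<le> 0}" for z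
    proof -
     have "norm (- \<i> * of_real x * exn x z) = x * norm (exn x z)"
      using \<open>x \<in> {0..}\<close> by (simp add: norm_mult)
     also have "\<dots> \<le> x * 1"
      using \<open>x \<in> {0..}\<close> that norm_exp_lower_le_1[of z x] by (intro mult_left_mono) auto
     finally show ?thesis by simp
    qed
   qed (use that k in auto)
   hence "norm (exn x y - exn x k) * norm (g x)
     \<le> x * norm (y - k) * norm (g x)" by (rule mult_right_mono) simp
   also have "\<dots> = (x * norm (g x)) * norm (y - k)" by simp
   also have "\<dots> \<le> C / (1 + x)\<^sup>2 * norm (y - k)"
    using b3 that by (intro mult_right_mono) auto
   finally show ?thesis by (simp only: left_diff_distrib[symmetric] norm_mult)
  qed
  show "at k within {k. Im k \<le> 0} \<noteq> bot"
  proof -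
   have "{k. Im k \<le> 0} \<noteq> {a}" for a
   proof
    assume eq: "{k. Im k \<le> 0} = {a}"
    have "0 \<in> {k. Im k \<le> 0}" "1 \<in> {k. Im k \<le> 0}" by auto
    hence "0 = a" "1 = a" unfolding eq by auto
    thus False by auto
   qed
   hence "k islimpt {k. Im k \<le> 0}"
    using connected_imp_perfect[OF convex_connected[OF convex], of k] k by blast
   thus ?thesis by (simp add: trivial_limit_within)
  qed
 qed
 thus ?thesis by (simp add: half_line_ft_def[abs_def])
qed

text \<open>Integration by parts.  The function is added to its derivative because \<open>1 + \<i> * k\<close>, unlike \<open>\<i> * k\<close>,
 has no zero in the closed lower half-plane.\<close>

lemma half_line_ft_plus_derivative:
 assumes g: "continuous_on {0..} g" "\<And>x. x \<ge> 0 ==> norm (g x) \<le> C / (1 + x)\<^sup>2"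
  and g': "continuous_on {0..} g'" "\<And>x. x \<ge> 0 ==> norm (g' x) \<le> C / (1 + x)\<^sup>2"
  and der: "\<And>x. x \<ge> 0 ==> (g has_vector_derivative g' x) (at x within {0..})"
  and k: "Im k \<le> 0"
 shows "(1 + \<i> * k) * half_line_ft g k = g 0 + half_line_ft (%x. g' x + g x) k"
proof -
 define G where "G = (%x. exn x k * g x)"
 have "((%x. exn x k * g' x - \<i> * k * (exn x k * g x)) has_integral (0 - G 0)) {0..}"
 proof (rule has_integral_half_line_FTC)
  fix r :: real assume r: "r \<ge> 0"
  have "((%z. exp (- \<i> * k * z)) has_field_derivative - \<i> * k * exn r k) (at (of_real r))"
   by (auto intro!: derivative_eq_intros)
  hence "((%x. exn x k) has_vector_derivative - \<i> * k * exn r k) (at r within {0..})"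
   by (rule has_vector_derivative_real_field)
  from has_vector_derivative_mult[OF this der[OF r]]
  show "(G has_vector_derivative (exn r k * g' r - \<i> * k * (exn r k * g r))) (at r within {0..})"
   unfolding G_def by (simp add: algebra_simps)
 next
  show "(G \<longlongrightarrow> 0) at_top"
  proof (rule Lim_null_comparison)
   show "\<forall>\<^sub>F x in at_top. norm (G x) \<le> C / (1 + x)\<^sup>2"
    using eventually_ge_at_top[of 0]
   proof eventually_elim
    case (elim x)
    have "norm (G x) \<le> 1 * norm (g x)" unfolding G_def norm_mult
     using elim k norm_exp_lower_le_1[of k x] by (intro mult_right_mono) auto
    thus ?case using g(2)[OF elim] by simp
   qed
   have "((%x::real. 1 / (1 + x)\<^sup>2) \<longlongrightarrow> 0) at_top" by real_asymp
   from tendsto_mult_right_zero[OF this, of C]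
   show "((%x. C / (1 + x)\<^sup>2) \<longlongrightarrow> 0) at_top" by simp
  qed
 qed
 moreover have "((%x. exn x k * g' x - \<i> * k * (exn x k * g x)) has_integral
   (half_line_ft g' k - \<i> * k * half_line_ft g k)) {0..}"
  unfolding half_line_ft_def
  using half_line_ft_integrable(1)[OF g k] half_line_ft_integrable(1)[OF g' k]
  by (intro has_integral_diff has_integral_mult_right integrable_integral) auto
 ultimately have "half_line_ft g' k - \<i> * k * half_line_ft g k = 0 - G 0"
  by (rule has_integral_unique[rotated])
 hence "half_line_ft g' k - \<i> * k * half_line_ft g k = - g 0" by (simp add: G_def)
 moreover have "half_line_ft (%x. g' x + g x) k = half_line_ft g' k + half_line_ft g k"
  unfolding half_line_ft_def using half_line_ft_integrable(1)[OF g k] half_line_ft_integrable(1)[OF g' k]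
  by (simp add: distrib_left integral_add)
 ultimately show ?thesis by (simp add: algebra_simps)
qed

lemma norm_one_plus_i_ge:
 assumes "Im k \<le> 0"
 shows "norm (1 + \<i> * k) \<ge> (1 + norm k) / 3" "norm (1 + \<i> * k) \<ge> 1"
proof -
 have "1 \<le> Re (1 + \<i> * k)" using assms by simp
 also have "\<dots> \<le> norm (1 + \<i> * k)" by (rule complex_Re_le_cmod)
 finally show 1: "norm (1 + \<i> * k) \<ge> 1" .
 have "norm k = norm ((1 + \<i> * k) - 1)" by (simp add: norm_mult)
 also have "\<dots> \<le> norm (1 + \<i> * k) + 1" using norm_triangle_ineq4[of "1 + \<i> * k" 1] by simp
 finally show "norm (1 + \<i> * k) \<ge> (1 + norm k) / 3" using 1 by simp
qed

lemma one_plus_i_nonzero: "Im k \<le> 0 ==> 1 + \<i> * k \<noteq> 0"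
 using norm_one_plus_i_ge(2)[of k] by auto

section \<open>Expansion of transforms in powers of \<open>1 / (1 + \<i> * k)\<close>\<close>

fun boost :: "nat => (nat => real => complex) => nat => real => complex" where
 "boost 0 D = D"
| "boost (Suc m) D = (%i x. boost m D (Suc i) x + boost m D i x)"

lemma boost_has_vector_derivative:
 assumes "\<And>i. i < N ==> (D i has_vector_derivative D (Suc i) x) (at x within S)" "i + m < N"
 shows "(boost m D i has_vector_derivative boost m D (Suc i) x) (at x within S)"
 using assms(2)
proof (induction m arbitrary: i)
 case (Suc m)
 have "(boost m D (Suc i) has_vector_derivative boost m D (Suc (Suc i)) x) (at x within S)"
  "(boost m D i has_vector_derivative boost m D (Suc i) x) (at x within S)"
  using Suc by auto
 from has_vector_derivative_add[OF this] show ?case by simp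
qed (use assms(1) in simp)

lemma norm_boost_le:
 assumes "\<And>i. i \<le> N ==> norm (D i x) \<le> B" "i + m \<le> N"
 shows "norm (boost m D i x) \<le> 2 ^ m * B"
 using assms(2)
proof (induction m arbitrary: i)
 case (Suc m)
 have "norm (boost m D (Suc i) x + boost m D i x) \<le> 2 ^ m * B + 2 ^ m * B"
  by (rule norm_triangle_mono) (use Suc in auto)
 thus ?case by (simp add: algebra_simps)
qed (use assms(1) in simp)

lemma continuous_on_boost:
 assumes "\<And>i. i \<le> N ==> continuous_on S (%p. D p i (X p))" "i + m \<le> N"
 shows "continuous_on S (%p. boost m (D p) i (X p))"
 using assms(2)
proof (induction m arbitrary: i)
 case (Suc m)
 thus ?case by (auto intro!: continuous_intros)
qed (use assms(1) in simp)

lemma half_line_ft_expansion: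
 assumes der: "\<And>m x. m < N ==> x \<ge> 0 ==> (D m has_vector_derivative D (Suc m) x) (at x within {0..})"
  and cont: "\<And>m. m \<le> N ==> continuous_on {0..} (D m)"
  and bound: "\<And>m x. m \<le> N ==> x \<ge> 0 ==> norm (D m x) \<le> C / (1 + x)\<^sup>2"
  and k: "Im k \<le> 0" and m: "m \<le> N"
 shows "half_line_ft (D 0) k =
  (\<Sum>i<m. boost i D 0 0 / (1 + \<i> * k) ^ Suc i) + half_line_ft (boost m D 0) k / (1 + \<i> * k) ^ m"
 using m
proof (induction m)
 case (Suc m)
 have bc: "continuous_on {0..} (boost m D i)" if "i + m \<le> N" for i
  using continuous_on_boost[of N "{0..}" "%_. D" "%x. x" i m] cont that by auto
 have bb: "norm (boost m D i x) \<le> (2 ^ m * C) / (1 + x)\<^sup>2" if "i + m \<le> N" "x \<ge> 0" for i x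
  using norm_boost_le[of N D x "C / (1 + x)\<^sup>2" i m] bound that by auto
 have "(1 + \<i> * k) * half_line_ft (boost m D 0) k = boost m D 0 0 +
   half_line_ft (%x. boost m D (Suc 0) x + boost m D 0 x) k"
  by (rule half_line_ft_plus_derivative[where C="2 ^ m * C"])
    (use Suc.prems k in \<open>auto intro!: bc bb boost_has_vector_derivative[where N=N] der\<close>)
 hence "half_line_ft (boost m D 0) k = boost m D 0 0 / (1 + \<i> * k) +
   half_line_ft (boost (Suc m) D 0) k / (1 + \<i> * k)"
  using one_plus_i_nonzero[OF k]
  by (simp add: nonzero_eq_divide_eq mult.commute add_divide_distrib[symmetric])
 thus ?case using Suc by (simp add: add_divide_distrib)
qed simp

section \<open>Transforms in time\<close>

lemma norm_time_integral_le:
 fixes b :: "real => complex"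
 assumes le: "s1 \<le> s2" and cont: "continuous_on {s1..s2} b"
  and K: "\<And>ta. ta \<in> {s1..s2} ==> norm (b ta) \<le> K"
  and sgn: "\<And>ta. ta \<in> {s1..s2} ==> Im z * (t - ta) \<ge> 0"
 shows "norm (integral {s1..s2} (%ta. exi (t - ta) z * b ta)) \<le> K * (s2 - s1)"
proof (rule integral_bound[OF le])
 show "continuous_on {s1..s2} (%ta. exi (t - ta) z * b ta)"
  by (intro continuous_intros cont)
 show "norm (exi (t - ta) z * b ta) \<le> K" if "ta \<in> {s1..s2}" for ta
 proof -
  have "norm (exi (t - ta) z * b ta) \<le> 1 * K"
   unfolding norm_mult using sgn[OF that] K[OF that] by (intro mult_mono) auto
  thus ?thesis by simp
 qed
qed

text \<open>The integral in Duhamel's formula without its outer factor \<open>exp (\<i> * k ^ d * t)\<close>.  Both \<open>Fterm\<close>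
 and \<open>time_transform\<close> are instances.\<close>

definition duhamel :: "nat => (real => complex => complex) => real => complex => complex" where
 "duhamel d b t k = integral {0..t} (%ta. exn ta (k ^ d) * b ta k)"

lemma Fterm_eq_duhamel: "Fterm j f t k = duhamel (od j) (%ta. half_line_ft (f ta)) t k"
 by (simp add: Fterm_def duhamel_def)

lemma time_transform_eq_duhamel: "time_transform g t (k ^ d) = duhamel d (%ta _. g ta) t k"
 by (simp add: time_transform_def duhamel_def)

lemma exp_mult_duhamel:
 "exi t (k ^ d) * duhamel d b s k =
   integral {0..s} (%ta. exi (t - ta) (k ^ d) * b ta k)"
proof -
 have e: "exi (t - ta) (k ^ d) = exi t (k ^ d) * exn ta (k ^ d)" for ta
  by (subst exp_add[symmetric]) (simp add: algebra_simps)
 have "exi t (k ^ d) * duhamel d b s k =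
   integral {0..s} (%ta. exi t (k ^ d) * (exn ta (k ^ d) * b ta k))"
  unfolding duhamel_def by (rule integral_mult_right[symmetric])
 also have "\<dots> = integral {0..s} (%ta. exi (t - ta) (k ^ d) * b ta k)"
  unfolding e by (simp only: mult.assoc)
 finally show ?thesis .
qed

lemma continuous_on_section:
 assumes "continuous_on (A \<times> S) (%(ta, k). b ta k)" "k \<in> S"
 shows "continuous_on A (%ta. b ta k)"
proof -
 have "continuous_on A (%ta. (%(ta, k). b ta k) (ta, k))"
  by (rule continuous_on_compose2[OF assms(1)]) (use assms(2) in \<open>auto intro!: continuous_intros\<close>)
 thus ?thesis by simp
qed

lemma continuous_on_section':
 assumes "continuous_on (A \<times> S) (%(ta, k). b ta k)" "ta \<in> A"
 shows "continuous_on S (b ta)"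
proof -
 have "continuous_on S (%k. (%(ta, k). b ta k) (ta, k))"
  by (rule continuous_on_compose2[OF assms(1)]) (use assms(2) in \<open>auto intro!: continuous_intros\<close>)
 thus ?thesis by simp
qed

lemma continuous_on_duhamel:
 assumes "continuous_on ({0..T} \<times> S) (%(ta, k). b ta k)" "t \<le> T"
 shows "continuous_on S (duhamel d b t)"
proof -
 have "continuous_on (S \<times> cbox 0 t) (%x. exp (- \<i> * fst x ^ d * of_real (snd x)) * (%(ta, k). b ta k) (snd x, fst x))"
  by (intro continuous_intros continuous_on_compose2[OF assms(1)]) (use assms(2) in auto)
 hence "continuous_on (S \<times> cbox 0 t) (%(k, ta). exn ta (k ^ d) * b ta k)"
  by (simp add: case_prod_unfold)
 from integral_continuous_on_param[OF this] show ?thesis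
  by (simp add: duhamel_def[abs_def])
qed

lemma duhamel_has_vector_derivative:
 assumes "continuous_on {0..T} (%ta. b ta k)" "t \<in> {0..T}"
 shows "((%t. duhamel d b t k) has_vector_derivative exn t (k ^ d) * b t k) (at t within {0..T})"
 unfolding duhamel_def
 by (rule integral_has_vector_derivative) (use assms in \<open>auto intro!: continuous_intros\<close>)

lemma duhamel_holomorphic:
 assumes cont: "continuous_on ({0..T} \<times> S) (%(ta, k). b ta k)"
  and cont': "continuous_on ({0..T} \<times> S) (%(ta, k). b' ta k)"
  and der: "\<And>ta k. ta \<in> {0..T} ==> k \<in> S ==> (b ta has_field_derivative b' ta k) (at k within S)"
  and S: "convex S" and t: "t \<le> T"
 shows "duhamel d b t holomorphic_on S"
proof -
 have "(%k. integral (cbox 0 t) (%ta. exn ta (k ^ d) * b ta k)) holomorphic_on S"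
 proof (rule leibniz_rule_holomorphic[OF _ _ _ S, where fx="%k ta. exn ta (k ^ d) * b' ta k +
    (- \<i> * (of_nat d * k ^ (d - 1)) * of_real ta * exn ta (k ^ d)) * b ta k"])
  show "((%k. exn ta (k ^ d) * b ta k) has_field_derivative
    exn ta (k ^ d) * b' ta k +
    (- \<i> * (of_nat d * k ^ (d - 1)) * of_real ta * exn ta (k ^ d)) * b ta k) (at k within S)"
   if "k \<in> S" "ta \<in> cbox 0 t" for k ta
  proof -
   have 1: "(b ta has_field_derivative b' ta k) (at k within S)" by (rule der) (use that t in auto)
   have 2: "((%k. exn ta (k ^ d)) has_field_derivative
     - \<i> * (of_nat d * k ^ (d - 1)) * of_real ta * exn ta (k ^ d)) (at k within S)"
    by (auto intro!: derivative_eq_intros)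
   from DERIV_mult[OF 2 1] show ?thesis by (simp add: algebra_simps)
  qed
  show "(%ta. exn ta (k ^ d) * b ta k) integrable_on cbox 0 t" if "k \<in> S" for k
  proof -
   have "continuous_on {0..t} (%ta. b ta k)"
    by (rule continuous_on_subset[OF continuous_on_section[OF cont that]]) (use t in auto)
   thus ?thesis by (auto intro!: integrable_continuous_real continuous_intros)
  qed
  have "continuous_on (S \<times> cbox 0 t) (%x. exp (- \<i> * fst x ^ d * of_real (snd x)) * (%(ta, k). b' ta k) (snd x, fst x) +
    (- \<i> * (of_nat d * fst x ^ (d - 1)) * of_real (snd x) * exp (- \<i> * fst x ^ d * of_real (snd x))) * (%(ta, k). b ta k) (snd x, fst x))"
   by (intro continuous_intros continuous_on_compose2[OF cont] continuous_on_compose2[OF cont']) (use t in auto)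
  thus "continuous_on (S \<times> cbox 0 t) (%(k, ta). exn ta (k ^ d) * b' ta k +
    (- \<i> * (of_nat d * k ^ (d - 1)) * of_real ta * exn ta (k ^ d)) * b ta k)"
   by (simp add: case_prod_unfold)
 qed
 thus ?thesis by (simp add: duhamel_def[abs_def])
qed

lemma duhamel_time_holomorphic:
 assumes "continuous_on {0..T} g" "t \<le> T"
 shows "duhamel d (%ta _. g ta) t holomorphic_on UNIV"
proof (rule duhamel_holomorphic[where T=T and b'="%_ _. 0"])
 show "continuous_on ({0..T} \<times> UNIV) (%(ta, k). g ta)"
  unfolding case_prod_unfold by (intro continuous_on_compose2[OF assms(1)] continuous_intros) auto
qed (use assms(2) in auto)

lemma time_transform_plus_derivative:
 fixes g :: "real => complex"
 assumes T: "0 \<le> T"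
  and der: "\<And>ta. ta \<in> {0..T} ==> (g has_vector_derivative g' ta) (at ta within {0..T})"
  and cont: "continuous_on {0..T} g'"
 shows "(1 + \<i> * z) * time_transform g T z =
   g 0 - exn T z * g T + time_transform (%ta. g' ta + g ta) T z"
proof -
 define e where "e = (%ta. exn ta z)"
 have ce: "continuous_on {0..T} e" unfolding e_def by (intro continuous_intros)
 have cg: "continuous_on {0..T} g"
  by (rule continuous_on_vector_derivative[OF der])
 have "((%ta. e ta * g' ta - \<i> * z * (e ta * g ta)) has_integral (e T * g T - e 0 * g 0)) {0..T}"
 proof (rule fundamental_theorem_of_calculus[OF T])
  fix ta assume ta: "ta \<in> {0..T}"
  have "((%w. exp (- \<i> * z * w)) has_field_derivative - \<i> * z * exn ta z) (at (of_real ta))"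
   by (auto intro!: derivative_eq_intros)
  hence "(e has_vector_derivative - \<i> * z * e ta) (at ta within {0..T})"
   unfolding e_def by (rule has_vector_derivative_real_field)
  from has_vector_derivative_mult[OF this der[OF ta]]
  show "((%ta. e ta * g ta) has_vector_derivative e ta * g' ta - \<i> * z * (e ta * g ta)) (at ta within {0..T})"
   by (simp add: algebra_simps)
 qed
 moreover have "((%ta. e ta * g' ta - \<i> * z * (e ta * g ta)) has_integral
   (integral {0..T} (%ta. e ta * g' ta) - \<i> * z * integral {0..T} (%ta. e ta * g ta))) {0..T}"
  by (intro has_integral_diff has_integral_mult_right integrable_integral integrable_continuous_real
    continuous_intros ce cg cont)
 ultimately have "integral {0..T} (%ta. e ta * g' ta) - \<i> * z * integral {0..T} (%ta. e ta * g ta) =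
   e T * g T - e 0 * g 0" by (rule has_integral_unique[rotated])
 moreover have "integral {0..T} (%ta. e ta * (g' ta + g ta)) =
   integral {0..T} (%ta. e ta * g' ta) + integral {0..T} (%ta. e ta * g ta)"
  unfolding distrib_left
  by (intro integral_add integrable_continuous_real continuous_intros ce cg cont)
 ultimately show ?thesis
  unfolding time_transform_def e_def[symmetric] by (simp add: e_def algebra_simps)
qed

section \<open>Explicit integrals over the real line\<close>

lemma field_differentiable_exp_linear: "(%z. exp (\<i> * z * c)) field_differentiable (at w)"
 unfolding field_differentiable_def
 by (rule exI[of _ "\<i> * c * exp (\<i> * w * c)"]) (auto intro!: derivative_eq_intros)

lemma has_integral_reflect_half_line:
 fixes f :: "real => complex"
 assumes "(f has_integral I) {0..}"
 shows "((%x. f (- x)) has_integral I) {..0}"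
 unfolding has_integral'[of _ I "{..0}"]
proof (intro allI impI)
 fix e :: real assume "e > 0"
 then obtain B where B: "B > 0" "\<And>a b. ball 0 B \<subseteq> cbox a b ==>
   \<exists>z. ((%x. if x \<in> {0..} then f x else 0) has_integral z) (cbox a b) \<and> norm (z - I) < e"
  using assms unfolding has_integral'[of f I "{0..}"] by meson
 show "\<exists>B>0. \<forall>a b. ball 0 B \<subseteq> cbox a b \<longrightarrow>
   (\<exists>z. ((%x. if x \<in> {..0} then f (- x) else 0) has_integral z) (cbox a b) \<and> norm (z - I) < e)"
 proof (intro exI[of _ B] conjI allI impI)
  fix a b :: real assume ab: "ball 0 B \<subseteq> cbox a b"
  have "ball 0 B \<subseteq> cbox (- b) (- a)"
  proof
   fix y :: real assume "y \<in> ball 0 B"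
   hence "- y \<in> ball 0 B" by simp
   hence "- y \<in> cbox a b" using ab by blast
   thus "y \<in> cbox (- b) (- a)" by auto
  qed
  then obtain z where z: "((%x. if x \<in> {0..} then f x else 0) has_integral z) (cbox (- b) (- a))" "norm (z - I) < e"
   using B(2) by blast
  have "((%x. if - x \<in> {0..} then f (- x) else 0) has_integral z) (cbox (- (- a)) (- (- b)))"
   using has_integral_reflect_lemma[OF z(1)] by simp
  hence "((%x. if x \<in> {..0} then f (- x) else 0) has_integral z) (cbox a b)" by simp
  thus "\<exists>z. ((%x. if x \<in> {..0} then f (- x) else 0) has_integral z) (cbox a b) \<and> norm (z - I) < e"
   using z(2) by blast
 qed (rule B(1))
qed

lemma has_integral_line_from_rays:
 assumes "(ray_integrand h 0 has_integral I1) {0..}" "(ray_integrand h pi has_integral I2) {0..}"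
 shows "((%k. h (of_real k)) has_integral (I1 - I2)) UNIV"
proof -
 have "((%k. h (of_real k)) has_integral I1) {0..}"
  using assms(1) by (simp add: ray_integrand_def[abs_def])
 moreover have "((%k. h (of_real k)) has_integral - I2) {..0}"
 proof -
  have "((%x. - ray_integrand h pi x) has_integral - I2) {0..}"
   using assms(2) by (rule has_integral_neg)
  from has_integral_reflect_half_line[OF this] show ?thesis by (simp add: ray_integrand_def)
 qed
 ultimately have "((%k. h (of_real k)) has_integral (I1 + - I2)) ({0..} \<union> {..0})"
  proof (rule has_integral_Un)
  have "{0..} \<inter> {..0} = {0 :: real}" by auto
  thus "negligible ({0..} \<inter> {..0 :: real})" by simp
 qed
 moreover have "{0..} \<union> {..0} = (UNIV :: real set)" by auto
 ultimately show ?thesis by simp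
qed

lemma decay_of_eventual_decay:
 fixes f :: "real => complex"
 assumes cont: "continuous_on {0..} f" and ev: "\<And>r. r \<ge> R0 ==> r ^ n * norm (f r) \<le> C"
 obtains K where "K \<ge> 0" "\<And>r. r \<ge> 0 ==> norm (f r) \<le> K / (1 + r) ^ n"
proof -
 define R where "R = max R0 1"
 have "compact (f ` {0..R})"
  by (intro compact_continuous_image continuous_on_subset[OF cont]) auto
 then obtain B where B: "B > 0" "\<And>r. r \<in> {0..R} ==> norm (f r) \<le> B"
  using compact_imp_bounded bounded_pos by (metis image_eqI)
 define K where "K = max (B * (1 + R) ^ n) (2 ^ n * \<bar>C\<bar>)"
 have "norm (f r) \<le> K / (1 + r) ^ n" if "r \<ge> 0" for r
 proof (cases "r \<le> R")
  case True
  have "norm (f r) * (1 + r) ^ n \<le> B * (1 + R) ^ n"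
   using True that B by (intro mult_mono power_mono) auto
  also have "\<dots> \<le> K" by (simp add: K_def)
  finally show ?thesis using that by (simp add: pos_le_divide_eq)
 next
  case False
  hence r: "r \<ge> 1" "r \<ge> R0" by (auto simp: R_def)
  have "norm (f r) * (1 + r) ^ n \<le> norm (f r) * (2 * r) ^ n"
   using r by (intro mult_left_mono power_mono) auto
  also have "\<dots> = 2 ^ n * (r ^ n * norm (f r))" by (simp add: power_mult_distrib)
  also have "\<dots> \<le> 2 ^ n * \<bar>C\<bar>" using ev[OF r(2)] by (intro mult_left_mono) auto
  also have "\<dots> \<le> K" by (simp add: K_def)
  finally show ?thesis using that by (simp add: pos_le_divide_eq)
 qed
 moreover have "K \<ge> 0" by (simp add: K_def le_max_iff_disj)
 ultimately show ?thesis using that by blast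
qed

lemma has_integral_inverse_quadratic:
 assumes "\<mu> > 0"
 shows "((%r. 1 / (complex_of_real r ^ 2 + of_real \<mu> ^ 2)) has_integral of_real (pi / (2 * \<mu>))) {0..}"
proof -
 have "((%r. complex_of_real (1 / (r\<^sup>2 + \<mu>\<^sup>2))) has_integral
   (of_real (pi / (2 * \<mu>)) - of_real (arctan (0 / \<mu>) / \<mu>))) {0..}"
 proof (rule has_integral_half_line_FTC[where G="%r. complex_of_real (arctan (r / \<mu>) / \<mu>)"])
  fix r :: real assume "r \<ge> 0"
  have "((%r. arctan (r / \<mu>) / \<mu>) has_field_derivative (inverse (1 + (r / \<mu>)\<^sup>2) * (1 / \<mu>) / \<mu>)) (at r within {0..})"
   using assms by (auto intro!: derivative_eq_intros)
  moreover have "1 + (r / \<mu>)\<^sup>2 = (r\<^sup>2 + \<mu>\<^sup>2) / \<mu>\<^sup>2"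
   using assms by (simp add: power_divide add_divide_distrib)
  ultimately have "((%r. arctan (r / \<mu>) / \<mu>) has_field_derivative (1 / (r\<^sup>2 + \<mu>\<^sup>2))) (at r within {0..})"
   using assms by (simp add: power2_eq_square inverse_eq_divide)
  thus "((%r. complex_of_real (arctan (r / \<mu>) / \<mu>)) has_vector_derivative of_real (1 / (r\<^sup>2 + \<mu>\<^sup>2))) (at r within {0..})"
   by (rule has_vector_derivative_of_real)
 next
  have "filterlim (%r::real. r / \<mu>) at_top at_top"
   using assms by real_asymp
  hence "((%r. arctan (r / \<mu>)) \<longlongrightarrow> pi / 2) at_top"
   by (rule filterlim_compose[OF tendsto_arctan_at_top])
  hence "((%r. complex_of_real (arctan (r / \<mu>) / \<mu>)) \<longlongrightarrow> of_real (pi / 2 / \<mu>)) at_top"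
   using assms by (intro tendsto_intros) auto
  thus "((%r. complex_of_real (arctan (r / \<mu>) / \<mu>)) \<longlongrightarrow> of_real (pi / (2 * \<mu>))) at_top" by simp
 qed
 thus ?thesis by simp
qed

text \<open>
 The pole is removed by subtracting a rational function with the same residue; what is left is
 holomorphic in the upper half-plane, and the rational function is integrated by hand.
\<close>

lemma exp_over_pole_rays:
 fixes \<mu> x :: real
 assumes "\<mu> > 0" "x > 0"
 obtains I0 Ip where
  "(ray_integrand (%z. exi x z / (z - \<i> * of_real \<mu>)) 0 has_integral I0) {0..}"
  "(ray_integrand (%z. exi x z / (z - \<i> * of_real \<mu>)) pi has_integral Ip) {0..}"
  "I0 - Ip = 2 * of_real pi * \<i> * exp (- of_real (\<mu> * x))"
proof -
 define E :: complex where "E = exp (- of_real (\<mu> * x))"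
 define a :: complex where "a = \<i> * of_real \<mu>"
 define G where "G = (%z. exi x z - E * (2 * a) / (z + a))"
 define q where "q = (%z. if z = a then deriv G a else (G z - G a) / (z - a))"
 have a0: "a \<noteq> 0" using assms by (simp add: a_def)
 have na: "norm a = \<mu>" using assms by (simp add: a_def norm_mult)
 have Ga: "G a = 0"
 proof -
  have "\<i> * a * of_real x = - of_real (\<mu> * x)" by (simp add: a_def)
  thus ?thesis using a0 by (simp add: G_def E_def)
 qed
 define S where "S = {z. Im z > - \<mu>}"
 have holG: "G holomorphic_on S"
  unfolding G_def S_def by (intro holomorphic_intros) (auto simp: a_def complex_eq_iff)
 have holq: "q holomorphic_on S"
  unfolding q_def by (rule pole_lemma_open[OF holG]) (simp add: S_def open_halfspace_Im_gt)
 have inS: "pol r th \<in> S" if "r \<ge> 0" "0 \<le> th" "th \<le> pi" for r th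
  using that assms sin_ge_zero[of th] by (auto simp: S_def intro: less_le_trans[of _ 0])
 have E1: "norm E \<le> 1" using assms by (simp add: E_def)
 have nq: "norm (q (pol r th)) \<le> 2 * (exp (- (r * sin th * x)) + 4 * \<mu> / r) / r"
  if r: "r \<ge> max 1 (2 * \<mu>)" for r th
 proof -
  define z where "z = pol r th"
  have nz: "norm z = r" using r by (simp add: z_def norm_mult)
  have "z \<noteq> a" using nz na r assms by auto
  have zm: "norm (z - a) \<ge> r / 2" using norm_triangle_ineq2[of z a] nz na r by auto
  have zp: "norm (z + a) \<ge> r / 2" using norm_triangle_ineq2[of z "- a"] nz na r by auto
  have r0: "r > 0" using r by auto
  have e: "norm (exi x z) = exp (- (r * sin th * x))" by (simp add: z_def)
  have "norm (E * (2 * a) / (z + a)) \<le> 1 * (2 * \<mu>) / (r / 2)"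
   unfolding norm_divide norm_mult using E1 na zp r0 assms by (intro frac_le mult_mono) auto
  hence "norm (E * (2 * a) / (z + a)) \<le> 4 * \<mu> / r" by simp
  hence "norm (G z) \<le> exp (- (r * sin th * x)) + 4 * \<mu> / r"
   unfolding G_def using norm_triangle_ineq4[of "exi x z" "E * (2 * a) / (z + a)"] e
   by linarith
  hence "norm (G z) / norm (z - a) \<le> (exp (- (r * sin th * x)) + 4 * \<mu> / r) / (r / 2)"
   using zm r0 assms by (intro frac_le) auto
  thus ?thesis using \<open>z \<noteq> a\<close> Ga unfolding z_def[symmetric] by (simp add: q_def norm_divide mult.commute)
 qed
 have rotate: "(ray_integrand q th1 has_integral I) {0..} \<longleftrightarrow> (ray_integrand q th2 has_integral I) {0..}"
  if th: "0 \<le> th1" "th1 < th2" "th2 \<le> pi" for th1 th2 I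
 proof (rule has_integral_rotate_ray[where L="max 1 (2 * \<mu>)" and C=6])
  show "continuous_on (wedge th1 th2) q"
   by (rule continuous_on_subset[OF holomorphic_on_imp_continuous_on[OF holq]])
     (use inS th in \<open>auto simp: wedge_def\<close>)
  show "q field_differentiable at (pol r t)" if "r > 0" "th1 < t" "t < th2" for r t
   using holq inS[of r t] that th unfolding S_def
   by (auto intro!: holomorphic_on_imp_differentiable_at open_halfspace_Im_gt simp del: )
  show "r * norm (q (pol r t)) \<le> 6" if r: "r \<ge> max 1 (2 * \<mu>)" and "th1 \<le> t" "t \<le> th2" for r t
  proof -
   have "sin t \<ge> 0" using that th by (intro sin_ge_zero) auto
   hence "exp (- (r * sin t * x)) \<le> 1" using r assms by simp
   moreover have "4 * \<mu> / r \<le> 2" using r by (simp add: divide_le_eq)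
   ultimately have "exp (- (r * sin t * x)) + 4 * \<mu> / r \<le> 1 + 2" by (rule add_mono)
   hence "2 * (exp (- (r * sin t * x)) + 4 * \<mu> / r) \<le> 6" by simp
   hence "2 * (exp (- (r * sin t * x)) + 4 * \<mu> / r) / r \<le> 6 / r"
    using r by (intro divide_right_mono) auto
   hence "norm (q (pol r t)) \<le> 6 / r" using nq[OF r, of t] by linarith
   thus ?thesis using r by (simp add: pos_le_divide_eq mult.commute)
  qed
  show "((%r. r * norm (q (pol r t))) \<longlongrightarrow> 0) at_top" if "th1 < t" "t < th2" for t
  proof (rule Lim_null_comparison)
   have s: "sin t > 0" using that th by (intro sin_gt_zero) auto
   define c where "c = sin t * x"
   have c: "c > 0" using s assms by (simp add: c_def)
   show "\<forall>\<^sub>F r in at_top. norm (r * norm (q (pol r t))) \<le> 2 * (exp (- (r * c)) + 4 * \<mu> / r)"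
    using eventually_ge_at_top[of "max 1 (2 * \<mu>)"]
   proof eventually_elim
    case (elim r)
    thus ?case using nq[OF elim, of t] by (simp add: c_def pos_le_divide_eq mult_ac)
   qed
   show "((%r. 2 * (exp (- (r * c)) + 4 * \<mu> / r)) \<longlongrightarrow> 0) at_top" using c by real_asymp
  qed
 qed (use th in auto)
 have "ray_integrand q (pi / 2) integrable_on {0..}"
 proof -
  have c: "continuous_on {0..} (ray_integrand q (pi / 2))"
   by (rule continuous_on_ray_integrand[OF holomorphic_on_imp_continuous_on[OF holq]])
     (use inS[of _ "pi / 2"] in auto)
  have "r\<^sup>2 * norm (ray_integrand q (pi / 2) r) \<le> 2 * (exp x * fact 1 / x ^ 1) + 8 * \<mu>" if r: "r \<ge> max 1 (2 * \<mu>)" for r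
  proof -
   have r0: "r > 0" using r by auto
   have "norm (q (pol r (pi / 2))) \<le> 2 * (exp (- (x * r)) + 4 * \<mu> / r) / r"
    using nq[OF r, of "pi / 2"] by (simp add: mult.commute)
   hence "r\<^sup>2 * norm (q (pol r (pi / 2))) \<le> r\<^sup>2 * (2 * (exp (- (x * r)) + 4 * \<mu> / r) / r)"
    by (rule mult_left_mono) simp
   also have "\<dots> = 2 * (r * exp (- (x * r))) + 8 * \<mu>"
    using r0 by (simp add: field_simps power2_eq_square)
   also have "r * exp (- (x * r)) \<le> (1 + r) ^ 1 * exp (- (x * r))" by simp
   also have "\<dots> \<le> exp x * fact 1 / x ^ 1" by (rule exp_beats_power) (use assms r0 in auto)
   finally show ?thesis by (simp add: norm_ray_integrand)
  qed
  then obtain K where "\<And>r. r \<ge> 0 ==> norm (ray_integrand q (pi / 2) r) \<le> K / (1 + r)\<^sup>2"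
   using decay_of_eventual_decay[OF c, of "max 1 (2 * \<mu>)" 2] by blast
  thus ?thesis by (rule integrable_on_quadratic_decay[OF c])
 qed
 then obtain J where J: "(ray_integrand q (pi / 2) has_integral J) {0..}" by blast
 have J0: "(ray_integrand q 0 has_integral J) {0..}" using rotate[of 0 "pi / 2" J] J by simp
 have Jp: "(ray_integrand q pi has_integral J) {0..}" using rotate[of "pi / 2" pi J] J by simp
 define h where "h = (%z. exi x z / (z - \<i> * of_real \<mu>))"
 have split: "h (of_real r) = q (of_real r) + (E * (2 * a)) * (1 / (of_real r ^ 2 + of_real \<mu> ^ 2))" for r :: real
 proof -
  have "of_real r - a \<noteq> 0" "of_real r + a \<noteq> 0" using assms by (auto simp: a_def complex_eq_iff)
  moreover have "(of_real r - a) * (of_real r + a) = of_real r ^ 2 + of_real \<mu> ^ 2"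
   by (simp add: a_def algebra_simps power2_eq_square)
  ultimately have "h (of_real r) - q (of_real r) = (E * (2 * a)) / ((of_real r + a) * (of_real r - a))"
   unfolding h_def q_def G_def a_def[symmetric] using Ga by (simp add: G_def diff_divide_distrib)
  thus ?thesis using \<open>(of_real r - a) * (of_real r + a) = of_real r ^ 2 + of_real \<mu> ^ 2\<close>
   by (simp add: algebra_simps)
 qed
 define P where "P = (E * (2 * a)) * of_real (pi / (2 * \<mu>))"
 have P0: "((%r. (E * (2 * a)) * (1 / (complex_of_real r ^ 2 + of_real \<mu> ^ 2))) has_integral P) {0..}"
  unfolding P_def by (rule has_integral_mult_right[OF has_integral_inverse_quadratic[OF assms(1)]])
 have "(ray_integrand h 0 has_integral (J + P)) {0..}"
  using has_integral_add[OF J0 P0] split by (simp add: ray_integrand_def[abs_def])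
 moreover have "(ray_integrand h pi has_integral (J - P)) {0..}"
  using has_integral_diff[OF Jp P0] split[of "- r" for r] by (simp add: ray_integrand_def[abs_def])
 moreover have "(J + P) - (J - P) = 2 * of_real pi * \<i> * exp (- of_real (\<mu> * x))"
  using assms by (simp add: P_def E_def a_def)
 ultimately show ?thesis using that unfolding h_def by blast
qed

lemma ray_derivative:
 fixes G :: "complex => complex"
 assumes G: "\<And>k. Im k \<le> 0 ==> (G has_field_derivative G' k) (at k within {k. Im k \<le> 0})"
  and dir: "sin th \<le> 0" and r: "r \<ge> 0"
 shows "((%r. G (pol r th)) has_vector_derivative ray_integrand G' th r) (at r within {0..})"
proof -
 have "((%r. pol r th) has_vector_derivative cis th) (at r within {0..})"
  by (auto intro!: derivative_eq_intros)
 moreover have "(G has_field_derivative G' (pol r th)) (at (pol r th) within (%r. pol r th) ` {0..})"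
  by (rule DERIV_subset[OF G]) (use dir r in \<open>auto simp: mult_nonneg_nonpos\<close>)
 ultimately have "((G \<circ> (%r. pol r th)) has_vector_derivative cis th * G' (pol r th)) (at r within {0..})"
  by (rule field_vector_diff_chain_within)
 thus ?thesis by (simp add: o_def ray_integrand_def mult.commute)
qed

text \<open>Integrating a derivative along the two halves of the real line gives the same value twice.\<close>

lemma derivative_rays_agree:
 assumes G: "\<And>k. Im k \<le> 0 ==> (G has_field_derivative G' k) (at k within {k. Im k \<le> 0})"
  and lim: "((%r. G (of_real r)) \<longlongrightarrow> 0) at_top" "((%r. G (- of_real r)) \<longlongrightarrow> 0) at_top"
 shows "(ray_integrand G' 0 has_integral - G 0) {0..}" "(ray_integrand G' pi has_integral - G 0) {0..}"
proof -
 show "(ray_integrand G' 0 has_integral - G 0) {0..}"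
  using has_integral_half_line_FTC[OF ray_derivative[OF G, of 0], of 0] lim(1) by simp
 show "(ray_integrand G' pi has_integral - G 0) {0..}"
  using has_integral_half_line_FTC[OF ray_derivative[OF G, of pi], of 0] lim(2) by simp
qed

text \<open>
 Division of a function vanishing at \<open>x\<close> by the distance to \<open>x\<close>: the quotient is the average of
 the derivative over the segment from \<open>x\<close>.
\<close>

lemma hadamard_quotient:
 fixes h h1 h2 :: "real => complex"
 assumes S: "convex S" "x \<in> S"
  and d0: "\<And>y. y \<in> S ==> (h has_vector_derivative h1 y) (at y within S)"
  and d1: "\<And>y. y \<in> S ==> (h1 has_vector_derivative h2 y) (at y within S)"
  and c2: "continuous_on S h2" and hx: "h x = 0"
 obtains q q' where "\<And>y. y \<in> S ==> h y = of_real (y - x) * q y"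
  "\<And>y. y \<in> S ==> (q has_vector_derivative q' y) (at y within S)" "continuous_on S q'"
proof -
 define p where "p = (%y s. x + s * (y - x))"
 have pS: "p y s \<in> S" if "y \<in> S" "s \<in> {0..1}" for y s
 proof -
  have "(1 - s) *\<^sub>R x + s *\<^sub>R y \<in> S" using S that by (intro convexD) auto
  thus ?thesis by (simp add: p_def algebra_simps)
 qed
 define q where "q = (%y. integral (cbox 0 1) (%s. h1 (p y s)))"
 define q' where "q' = (%y. integral (cbox 0 1) (%s. of_real s * h2 (p y s)))"
 have c1: "continuous_on S h1" by (rule continuous_on_vector_derivative[OF d1])
 have cont': "continuous_on (S \<times> cbox 0 1) (%(y, s). of_real s * h2 (p y s))"
  unfolding case_prod_unfold p_def
  by (intro continuous_intros continuous_on_compose2[OF c2]) (use pS in \<open>auto simp: p_def\<close>)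
 have i1: "(%s. h1 (p y s)) integrable_on cbox 0 1" if "y \<in> S" for y
  unfolding cbox_interval p_def
  by (intro integrable_continuous_real continuous_intros continuous_on_compose2[OF c1])
    (use pS that in \<open>auto simp: p_def\<close>)
 have "(q has_vector_derivative q' y) (at y within S)" if y: "y \<in> S" for y
  unfolding q_def q'_def
 proof (rule leibniz_rule_vector_derivative[OF _ i1 cont' y S(1)])
  fix y s :: real assume ys: "y \<in> S" "s \<in> cbox 0 1"
  have "((%y. p y s) has_vector_derivative s) (at y within S)"
   unfolding p_def by (auto intro!: derivative_eq_intros simp: has_real_derivative_iff_has_vector_derivative[symmetric])
  moreover have "(h1 has_vector_derivative h2 (p y s)) (at (p y s) within (%y. p y s) ` S)"
   by (rule has_vector_derivative_within_subset[OF d1]) (use pS ys in auto)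
  ultimately have "((h1 \<circ> (%y. p y s)) has_vector_derivative s *\<^sub>R h2 (p y s)) (at y within S)"
   by (rule vector_diff_chain_within)
  thus "((%y. h1 (p y s)) has_vector_derivative of_real s * h2 (p y s)) (at y within S)"
   by (simp add: o_def scaleR_conv_of_real)
 qed
 moreover have "continuous_on S q'"
  unfolding q'_def by (rule integral_continuous_on_param[OF cont'])
 moreover have "h y = of_real (y - x) * q y" if y: "y \<in> S" for y
 proof -
  have "((%s. of_real (y - x) * h1 (p y s)) has_integral (h (p y 1) - h (p y 0))) {0..1}"
  proof (rule fundamental_theorem_of_calculus)
   fix s :: real assume s: "s \<in> {0..1}"
   have "((%s. p y s) has_vector_derivative (y - x)) (at s within {0..1})"
    unfolding p_def by (auto intro!: derivative_eq_intros simp: has_real_derivative_iff_has_vector_derivative[symmetric])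
   moreover have "(h has_vector_derivative h1 (p y s)) (at (p y s) within (%s. p y s) ` {0..1})"
    by (rule has_vector_derivative_within_subset[OF d0]) (use pS y s in auto)
   ultimately have "((h \<circ> (%s. p y s)) has_vector_derivative (y - x) *\<^sub>R h1 (p y s)) (at s within {0..1})"
    by (rule vector_diff_chain_within)
   thus "((%s. h (p y s)) has_vector_derivative of_real (y - x) * h1 (p y s)) (at s within {0..1})"
    by (simp add: o_def scaleR_conv_of_real)
  qed simp
  moreover have "((%s. of_real (y - x) * h1 (p y s)) has_integral of_real (y - x) * q y) {0..1}"
   using has_integral_mult_right[OF integrable_integral[OF i1[OF y]]] by (simp add: q_def)
  ultimately have "of_real (y - x) * q y = h (p y 1) - h (p y 0)" by (rule has_integral_unique[rotated])
  thus ?thesis using hx by (simp add: p_def)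
 qed
 ultimately show ?thesis using that by blast
qed

section \<open>Sums over roots of unity\<close>

lemma root_omega_eq_cis: "root_omega j = cis (2 * pi / real (od j))"
 by (simp add: root_omega_def cis_conv_exp mult_ac)

lemma root_omega_power_eq_1_iff: "root_omega j ^ m = 1 \<longleftrightarrow> (od j) dvd m"
proof -
 have "root_omega j ^ m = exp (2 * of_real pi * \<i> * of_nat m / of_nat (od j))"
  unfolding root_omega_def by (simp add: exp_of_nat_mult[symmetric] mult_ac)
 thus ?thesis
  using complex_root_unity_eq_1[of "od j" m] by simp
qed

lemma root_omega_power_order: "root_omega j ^ od j = 1" "(root_omega j ^ m) ^ od j = 1"
proof -
 show 1: "root_omega j ^ od j = 1" by (simp only: root_omega_power_eq_1_iff dvd_refl)
 have "(root_omega j ^ m) ^ od j = (root_omega j ^ od j) ^ m"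
  by (simp only: power_mult[symmetric] mult.commute)
 thus "(root_omega j ^ m) ^ od j = 1" by (simp only: 1 power_one)
qed

lemma root_omega_nonzero [simp]: "root_omega j \<noteq> 0"
 by (simp add: root_omega_def)

lemma root_omega_power_period: "root_omega j ^ (m + (od j)) = root_omega j ^ m"
 by (simp only: power_add[of _ _ "od j"] root_omega_power_order mult_1_right)

lemma root_omega_power_inj:
 assumes "root_omega j ^ m = root_omega j ^ n" "m < n + (od j)" "n < m + (od j)"
 shows "m = n"
 using assms
proof (induction m n rule: linorder_wlog)
 case (le m n)
 have "root_omega j ^ n = root_omega j ^ m * root_omega j ^ (n - m)"
  using le(1) by (simp flip: power_add)
 hence "root_omega j ^ (n - m) = 1" using le(2) by simp
 hence "(od j) dvd (n - m)" by (simp add: root_omega_power_eq_1_iff)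
 moreover have "n - m < od j" using le by auto
 ultimately have "n - m = 0" by (meson nat_dvd_not_less neq0_conv)
 thus ?case using le(1) by simp
qed (metis)

text \<open>Each \<open>d\<close>-th root of unity, \<open>d = od j\<close>, is \<open>root_omega j ^ (d - p)\<close> for one \<open>p\<close> in \<open>{1..d}\<close>.\<close>

lemma sum_root_powers:
 "(\<Sum>p=1..od j. (root_omega j ^ (od j - p)) ^ m) = (if (od j) dvd m then of_nat (od j) else 0)"
proof -
 let ?d = "od j"
 have "(\<Sum>p=1..?d. (root_omega j ^ (?d - p)) ^ m) = (\<Sum>q<?d. (root_omega j ^ m) ^ q)"
  by (rule sum.reindex_bij_witness[where i="%q. ?d - q" and j="%p. ?d - p"])
    (auto simp: power_mult[symmetric] mult.commute)
 also have "\<dots> = (if ?d dvd m then of_nat ?d else 0)"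
 proof (cases "?d dvd m")
  case True
  thus ?thesis using root_omega_power_eq_1_iff[of j m] by simp
 next
  case False
  have "(root_omega j ^ m) ^ ?d = 1"
   by (rule root_omega_power_order)
  thus ?thesis using False root_omega_power_eq_1_iff[of j m] geometric_sum[of "root_omega j ^ m" ?d] by simp
 qed
 finally show ?thesis .
qed

lemma sum_root_poly_vanishes:
 fixes P :: "complex poly"
 assumes "degree P + e < 2 * (od j)" "od j < e"
 shows "(\<Sum>p=1..od j. poly P (root_omega j ^ (od j - p)) * (root_omega j ^ (od j - p)) ^ e) = 0"
proof -
 have "(\<Sum>p=1..od j. poly P (root_omega j ^ (od j - p)) * (root_omega j ^ (od j - p)) ^ e) =
   (\<Sum>p=1..od j. \<Sum>i\<le>degree P. coeff P i * (root_omega j ^ (od j - p)) ^ (i + e))"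
  by (simp add: poly_altdef sum_distrib_right power_add mult.assoc)
 also have "\<dots> = (\<Sum>i\<le>degree P. coeff P i * (\<Sum>p=1..od j. (root_omega j ^ (od j - p)) ^ (i + e)))"
  by (subst sum.swap) (simp only: sum_distrib_left)
 also have "\<dots> = (\<Sum>i\<le>degree P. 0)"
 proof (intro sum.cong refl)
  fix i assume "i \<in> {..degree P}"
  hence "od j < i + e" "i + e < 2 * (od j)" using assms by auto
  hence "\<not> (od j) dvd (i + e)"
  proof (intro notI)
   assume "(od j) dvd (i + e)" "od j < i + e" "i + e < 2 * (od j)"
   then obtain c where c: "i + e = (od j) * c" by (elim dvdE)
   hence "1 < c" using \<open>od j < i + e\<close> by (cases c) auto
   hence "(od j) * 2 \<le> (od j) * c" by (intro mult_le_mono2) simp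
   thus False using c \<open>i + e < 2 * (od j)\<close> by linarith
  qed
  thus "coeff P i * (\<Sum>p=1..od j. (root_omega j ^ (od j - p)) ^ (i + e)) = 0"
   unfolding sum_root_powers by simp
 qed
 finally show ?thesis by simp
qed

section \<open>The interpolation coefficients\<close>

text \<open>
 \<open>beta\<close> continues \<open>alpha\<close> to all \<open>p\<close> in \<open>{1..od j}\<close>, where the identities below become sums
 over all roots of unity.
\<close>

definition beta :: "nat => nat => nat => complex" where
 "beta j p n = root_omega j ^ (j + n) * root_omega j ^ (od j - p)"

definition lagrange_beta :: "nat => nat => nat => complex" where
 "lagrange_beta j p n = (\<Prod>m\<in>{1..j+1} - {n}. (1 - beta j p m) / (beta j p n - beta j p m))"

lemma beta_eq_power: "p \<le> od j ==> beta j p n = root_omega j ^ (j + n + (od j - p))"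
 by (simp only: beta_def power_add)

lemma alpha_eq_beta: "p \<le> j ==> alpha j p n = beta j p n"
proof -
 assume p: "p \<le> j"
 have "beta j p n = root_omega j ^ ((j - p + n) + (od j))"
 proof -
  have "j + n + (od j - p) = (j - p + n) + (od j)" using p by simp
  thus ?thesis using beta_eq_power[of p j n] p by (simp only:)
 qed
 thus ?thesis unfolding root_omega_power_period by (simp add: alpha_def)
qed

lemma lagrange_eq_beta: "p \<le> j ==> lagrange j p n 1 = lagrange_beta j p n"
 by (simp add: lagrange_def lagrange_beta_def alpha_eq_beta)

lemma alpha_inj: "inj_on (alpha j p) {1..j+1}"
proof
 fix m n assume "m \<in> {1..j+1}" "n \<in> {1..j+1}" "alpha j p m = alpha j p n"
 thus "m = n" using root_omega_power_inj[of j "j - p + m" "j - p + n"] by (auto simp: alpha_def)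
qed

lemma alpha_power_period: "alpha j p n ^ od j = 1"
 unfolding alpha_def by (rule root_omega_power_order)

lemma lagrange_beta_outside:
 assumes "q \<in> {1..j+1}" "n \<in> {1..j+1}"
 shows "lagrange_beta j (j + q) n = (if q = n then 1 else 0)" "beta j (j + q) q = 1"
proof -
 have b: "beta j (j + q) m = root_omega j ^ (j + m + (od j - (j + q)))" for m
  using assms by (intro beta_eq_power) auto
 show one: "beta j (j + q) q = 1"
 proof -
  have "j + q + (od j - (j + q)) = od j" using assms by simp
  thus ?thesis unfolding b by (simp only: root_omega_power_order)
 qed
 show "lagrange_beta j (j + q) n = (if q = n then 1 else 0)"
 proof (cases "q = n")
  case True
  have "(1 - beta j (j + q) m) / (beta j (j + q) n - beta j (j + q) m) = 1" if m: "m \<in> {1..j+1} - {n}" for m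
  proof -
   have "beta j (j + q) m \<noteq> beta j (j + q) q"
   proof
    assume "beta j (j + q) m = beta j (j + q) q"
    hence "j + m + (od j - (j + q)) = j + q + (od j - (j + q))"
     unfolding b by (rule root_omega_power_inj) (use m assms in auto)
    thus False using m True by auto
   qed
   thus ?thesis using True one by auto
  qed
  hence "lagrange_beta j (j + q) n = 1" unfolding lagrange_beta_def by (intro prod.neutral) blast
  thus ?thesis using True by simp
 next
  case False
  hence "q \<in> {1..j+1} - {n}" using assms by auto
  hence "lagrange_beta j (j + q) n = 0"
   unfolding lagrange_beta_def using one by (intro prod_zero) auto
  thus ?thesis using False by simp
 qed
qed

lemma sum_lagrange_beta_vanishes:
 assumes "n \<in> {1..j+1}" "l \<in> {1..j}"
 shows "(\<Sum>p=1..od j. lagrange_beta j p n * (root_omega j ^ (od j - p)) ^ (od j - l)) = 0"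
proof -
 let ?d = "od j" and ?M = "{1..j+1} - {n}"
 define c where "c m = root_omega j ^ (j + m)" for m
 define R where "R = (\<Prod>m\<in>?M. [:1, - c m:])"
 have cardM: "card ?M = j" using assms by simp
 have "degree R \<le> (\<Sum>m\<in>?M. degree [:1, - c m:])" unfolding R_def by (rule order_trans[OF degree_prod_sum_le]) (simp_all add: o_def)
 also have "\<dots> \<le> (\<Sum>m\<in>?M. 1)" by (intro sum_mono) simp
 finally have degR: "degree R \<le> j" using cardM by simp
 define K where "K = (\<Prod>m\<in>?M. inverse (c n - c m))"
 have trm: "lagrange_beta j p n * (root_omega j ^ (?d - p)) ^ (?d - l) =
   K * (poly R (root_omega j ^ (?d - p)) * (root_omega j ^ (?d - p)) ^ (2 * ?d - j - l))" for p
 proof -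
  define a where "a = root_omega j ^ (?d - p)"
  have a0: "a \<noteq> 0" by (simp add: a_def)
  have ad: "a ^ ?d = 1" unfolding a_def by (rule root_omega_power_order)
  have "lagrange_beta j p n = (\<Prod>m\<in>?M. (1 - a * c m) * (inverse (c n - c m) * inverse a))"
   unfolding lagrange_beta_def beta_def c_def[symmetric] a_def[symmetric]
  proof (intro prod.cong refl)
   fix m
   have "c n * a - c m * a = (c n - c m) * a" by (simp add: algebra_simps)
   thus "(1 - c m * a) / (c n * a - c m * a) = (1 - a * c m) * (inverse (c n - c m) * inverse a)"
    by (simp add: divide_inverse mult_ac)
  qed
  also have "\<dots> = poly R a * (K * inverse a ^ j)"
  proof -
   have "poly R a = (\<Prod>m\<in>?M. 1 - a * c m)" unfolding R_def poly_prod by (intro prod.cong refl) simp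
   thus ?thesis unfolding prod.distrib prod_constant cardM K_def by (simp only:)
  qed
  finally have L: "lagrange_beta j p n = poly R a * (K * inverse a ^ j)" .
  have "a ^ (2 * ?d - j - l) * a ^ j = a ^ ?d * a ^ (?d - l)"
   unfolding power_add[symmetric] using assms by (intro arg_cong[where f="%e. a ^ e"]) auto
  hence "a ^ (2 * ?d - j - l) = inverse (a ^ j) * (a ^ (2 * ?d - j - l) * a ^ j)"
   using a0 by (simp del: power_Suc add: field_simps)
  also have "\<dots> = inverse a ^ j * a ^ (?d - l)"
   unfolding \<open>a ^ (2 * ?d - j - l) * a ^ j = a ^ ?d * a ^ (?d - l)\<close> ad by (simp add: power_inverse)
  finally show ?thesis unfolding L a_def[symmetric] by (simp only: mult_ac)
 qed
 have "(\<Sum>p=1..?d. poly R (root_omega j ^ (?d - p)) * (root_omega j ^ (?d - p)) ^ (2 * ?d - j - l)) = 0"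
  by (rule sum_root_poly_vanishes) (use degR assms in auto)
 thus ?thesis unfolding trm sum_distrib_left[symmetric] by simp
qed

lemma sum_split_at_j: "(\<Sum>p=1..od j. f p) = (\<Sum>p=1..j. f p) + (\<Sum>q=1..j+1. f (j + q))" for f :: "nat => complex"
proof -
 have "{1..od j} = {1..j} \<union> {j + 1..od j}" by auto
 hence "(\<Sum>p=1..od j. f p) = (\<Sum>p=1..j. f p) + (\<Sum>p=j + 1..od j. f p)"
  by (simp add: sum.union_disjoint)
 also have "(\<Sum>p=j + 1..od j. f p) = (\<Sum>q=1..j+1. f (j + q))"
  by (rule sum.reindex_bij_witness[where i="%q. j + q" and j="%p. p - j"]) auto
 finally show ?thesis .
qed

text \<open>
 Over all roots of unity the sum vanishes, the exponents in play being no multiples of the order;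
 among the additional terms exactly one is nonzero, and it is one.
\<close>

theorem sum_lagrange_alpha:
 assumes "n \<in> {1..j+1}" "l \<in> {1..j}"
 shows "(\<Sum>p=1..j. lagrange j p n 1 * alpha j p n ^ (od j - l)) = - 1"
proof -
 let ?d = "od j"
 have "(\<Sum>p=1..?d. lagrange_beta j p n * beta j p n ^ (?d - l)) =
   root_omega j ^ ((j + n) * (?d - l)) * (\<Sum>p=1..?d. lagrange_beta j p n * (root_omega j ^ (?d - p)) ^ (?d - l))"
  unfolding sum_distrib_left
  by (intro sum.cong refl) (simp only: beta_def power_mult_distrib power_mult mult_ac)
 hence "(\<Sum>p=1..?d. lagrange_beta j p n * beta j p n ^ (?d - l)) = 0"
  using sum_lagrange_beta_vanishes[OF assms] by simp
 moreover have "(\<Sum>q=1..j+1. lagrange_beta j (j + q) n * beta j (j + q) n ^ (?d - l)) = (\<Sum>q=1..j+1. if q = n then 1 else 0)"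
  by (intro sum.cong refl) (use assms lagrange_beta_outside in auto)
 moreover have "(\<Sum>q=1..j+1. if q = n then 1 else (0::complex)) = 1" using assms by simp
 moreover have "(\<Sum>p=1..j. lagrange_beta j p n * beta j p n ^ (?d - l)) = (\<Sum>p=1..j. lagrange j p n 1 * alpha j p n ^ (?d - l))"
  by (intro sum.cong refl) (simp add: lagrange_eq_beta alpha_eq_beta)
 ultimately have "(\<Sum>p=1..j. lagrange j p n 1 * alpha j p n ^ (?d - l)) + 1 = 0"
  unfolding sum_split_at_j by (simp only:)
 thus ?thesis by (simp only: eq_neg_iff_add_eq_0)
qed

lemma pderiv_Qpoly_at_root:
 assumes n: "n \<in> {1..j+1}"
 shows "poly (pderiv (Qpoly j p)) (alpha j p n) = (\<Prod>m\<in>{1..j+1} - {n}. alpha j p n - alpha j p m)"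
proof -
 have "Qpoly j p = [:- alpha j p n, 1:] * (\<Prod>m\<in>{1..j+1} - {n}. [:- alpha j p m, 1:])"
  unfolding Qpoly_def using n by (subst prod.remove[of _ n]) auto
 moreover have "poly (pderiv ([:- a, 1:] * R)) a = poly R a" for a :: complex and R
  unfolding pderiv_mult by (simp add: pderiv_pCons)
 ultimately have "poly (pderiv (Qpoly j p)) (alpha j p n) = poly (\<Prod>m\<in>{1..j+1} - {n}. [:- alpha j p m, 1:]) (alpha j p n)"
  by (simp only:)
 thus ?thesis unfolding poly_prod by simp
qed

lemma Qpoly_ratio:
 assumes n: "n \<in> {1..j+1}"
 shows "poly (Qpoly j p) 1 / poly (pderiv (Qpoly j p)) (alpha j p n) = (1 - alpha j p n) * lagrange j p n 1"
proof -
 have "poly (Qpoly j p) 1 = (1 - alpha j p n) * (\<Prod>m\<in>{1..j+1} - {n}. 1 - alpha j p m)"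
  unfolding Qpoly_def poly_prod using n by (subst prod.remove[of _ n]) auto
 thus ?thesis
  unfolding pderiv_Qpoly_at_root[OF n] by (simp add: lagrange_def prod_dividef)
qed

lemma Qpoly_Squot_at_1:
 assumes p: "p \<in> {1..j}"
 shows "poly (Qpoly j p) 1 * poly (Squot j p l) 1 =
  1 - (\<Sum>n=1..j+1. alpha j p n ^ (od j - l) * lagrange j p n 1)"
proof -
 let ?d = "od j"
 define A where "A = alpha j p ` {1..j+1}"
 have cardA: "card A = j + 1" unfolding A_def using card_image[OF alpha_inj[of j p]] by simp
 define E where "E = monom 1 (?d - l) mod Qpoly j p"
 have degQ: "degree (Qpoly j p) = j + 1"
  unfolding Qpoly_def by (subst degree_prod_eq_sum_degree) auto
 hence Q0: "Qpoly j p \<noteq> 0" by auto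
 have degE: "degree E < card A"
  unfolding cardA E_def using degree_mod_less[OF Q0, of "monom 1 (?d - l)"] degQ by auto
 have root: "poly (Qpoly j p) (alpha j p n) = 0" if "n \<in> {1..j+1}" for n
  unfolding Qpoly_def poly_prod using that by (intro prod_zero) auto
 have div: "monom 1 (?d - l) = Qpoly j p * Squot j p l + E" unfolding Squot_def E_def by simp
 have Eval: "poly E (alpha j p n) = alpha j p n ^ (?d - l)" if "n \<in> {1..j+1}" for n
  using arg_cong[OF div, of "%P. poly P (alpha j p n)"] root[OF that] by (simp add: poly_monom)
 define B where "B n = (\<Prod>m\<in>{1..j+1} - {n}. smult (inverse (alpha j p n - alpha j p m)) [:- alpha j p m, 1:])" for n
 have polyB: "poly (B n) z = lagrange j p n z" for n z
  unfolding B_def poly_prod lagrange_def by (intro prod.cong refl) (simp add: divide_inverse algebra_simps)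
 have degB: "degree (B n) < card A" if n: "n \<in> {1..j+1}" for n
 proof -
  have "degree (B n) \<le> (\<Sum>m\<in>{1..j+1} - {n}. degree (smult (inverse (alpha j p n - alpha j p m)) [:- alpha j p m, 1:]))"
   unfolding B_def by (rule order_trans[OF degree_prod_sum_le]) (simp_all add: o_def)
  also have "\<dots> \<le> (\<Sum>m\<in>{1..j+1} - {n}. 1)" by (intro sum_mono) (simp add: order.trans[OF degree_smult_le])
  also have "\<dots> = j" using n by simp
  finally show ?thesis using cardA by simp
 qed
 have lag: "lagrange j p n (alpha j p m) = (if m = n then 1 else 0)" if "m \<in> {1..j+1}" "n \<in> {1..j+1}" for m n
 proof (cases "m = n")
  case True
  have "alpha j p n \<noteq> alpha j p i" if "i \<in> {1..j+1} - {n}" for i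
   using inj_onD[OF alpha_inj, of j p n i] that \<open>n \<in> {1..j+1}\<close> by auto
  hence "lagrange j p n (alpha j p m) = (\<Prod>i\<in>{1..j+1} - {n}. 1)"
   unfolding lagrange_def True by (intro prod.cong refl) simp
  thus ?thesis using True by simp
 next
  case False
  thus ?thesis unfolding lagrange_def using that by (auto intro!: prod_zero)
 qed
 define I where "I = (\<Sum>n=1..j+1. smult (alpha j p n ^ (?d - l)) (B n))"
 have "E = I"
 proof (rule poly_eqI_degree[of A])
  fix x assume "x \<in> A"
  then obtain m where m: "m \<in> {1..j+1}" "x = alpha j p m" by (auto simp: A_def)
  have "poly I x = (\<Sum>n=1..j+1. if m = n then alpha j p m ^ (?d - l) else 0)"
   unfolding I_def poly_sum poly_smult polyB m(2)
   by (intro sum.cong refl) (use lag m in auto)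
  also have "\<dots> = alpha j p m ^ (?d - l)" using m by simp
  finally show "poly E x = poly I x" using Eval[OF m(1)] m(2) by simp
 next
  have "degree I \<le> j" unfolding I_def
   by (rule degree_sum_le) (use degB cardA in \<open>auto intro: order.trans[OF degree_smult_le] simp: less_Suc_eq_le\<close>)
  thus "card A > degree I" using cardA by simp
 qed (rule degE)
 hence "poly E 1 = (\<Sum>n=1..j+1. alpha j p n ^ (?d - l) * lagrange j p n 1)"
  by (simp add: I_def poly_sum polyB)
 moreover have "1 = poly (Qpoly j p) 1 * poly (Squot j p l) 1 + poly E 1"
  using arg_cong[OF div, of "%P. poly P 1"] by (simp add: poly_monom)
 ultimately show ?thesis by (simp add: algebra_simps)
qed

text \<open>By Euclidean division at \<open>1\<close>, and interpolation of the remainder, \<open>ccoef j p l'\<close> is, up to a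
 constant, \<open>1\<close> minus a sum over the nodes.  Extended to all \<open>p\<close> in \<open>{1..d}\<close>, the first term is a sum over all
 roots of unity, which vanishes unless \<open>l = l'\<close>; the second one does so always.\<close>

theorem sum_ccoef:
 assumes l: "l \<in> {1..j}" and l': "l' \<in> {1..j}"
 shows "\<i> ^ l * (\<Sum>p=1..j. ccoef j p l' * root_omega j ^ (p * (od j + l - l'))) =
  (if l = l' then - of_nat (od j) else 0)"
proof -
 let ?d = "od j"
 define w where "w p = root_omega j ^ (p * (?d + l - l'))" for p
 have wa: "w p = (root_omega j ^ (?d - p)) ^ (?d + l' - l)" if p: "p \<le> ?d" for p
 proof -
  define a where "a = root_omega j ^ (?d - p)"
  have ad: "a ^ ?d = 1" unfolding a_def by (rule root_omega_power_order)
  have wd: "root_omega j ^ ?d = 1" by (rule root_omega_power_order)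
  have "root_omega j ^ p * a = 1" unfolding a_def power_add[symmetric] using p wd by simp
  hence "(root_omega j ^ p * a) ^ (?d + l - l') = 1" by simp
  hence 1: "w p * a ^ (?d + l - l') = 1" unfolding w_def power_mult_distrib power_mult .
  have "a ^ (?d + l - l') * a ^ (?d + l' - l) = a ^ ?d * a ^ ?d"
   unfolding power_add[symmetric] using l l' by (intro arg_cong[where f="%e. a ^ e"]) auto
  hence 2: "a ^ (?d + l - l') * a ^ (?d + l' - l) = 1" using ad by simp
  have "w p = w p * (a ^ (?d + l - l') * a ^ (?d + l' - l))" using 2 by simp
  also have "\<dots> = (w p * a ^ (?d + l - l')) * a ^ (?d + l' - l)" by (simp only: mult.assoc)
  finally show ?thesis unfolding 1 by (simp only: mult_1_left a_def)
 qed
 define X where "X p = 1 - (\<Sum>n=1..j+1. beta j p n ^ (?d - l') * lagrange_beta j p n)" for p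
 have "(\<Sum>p=1..?d. X p * w p) = (\<Sum>p=1..?d. w p) - (\<Sum>n=1..j+1. \<Sum>p=1..?d. beta j p n ^ (?d - l') * lagrange_beta j p n * w p)"
  unfolding X_def left_diff_distrib sum_subtractf sum_distrib_right by (subst sum.swap) simp
 also have "(\<Sum>p=1..?d. w p) = (if l = l' then of_nat ?d else 0)"
 proof -
  have "(\<Sum>p=1..?d. w p) = (\<Sum>p=1..?d. (root_omega j ^ (?d - p)) ^ (?d + l' - l))"
   by (intro sum.cong refl wa) auto
  moreover have "?d dvd (?d + l' - l) \<longleftrightarrow> l = l'"
  proof
   assume "?d dvd (?d + l' - l)"
   then obtain c where c: "?d + l' - l = ?d * c" by (elim dvdE)
   have "0 < ?d + l' - l" "?d + l' - l < ?d * 2" using l l' by auto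
   hence b: "0 < ?d * c" "?d * c < ?d * 2" unfolding c .
   hence "0 < c" by (simp only: nat_0_less_mult_iff)
   hence "c = 1" using mult_less_cancel1[of ?d c 2] b(2) by linarith
   thus "l = l'" using c l l' by auto
  qed simp
  ultimately show ?thesis unfolding sum_root_powers by simp
 qed
 also have "(\<Sum>n=1..j+1. \<Sum>p=1..?d. beta j p n ^ (?d - l') * lagrange_beta j p n * w p) = (\<Sum>n=1..j+1. 0)"
 proof (intro sum.cong refl)
  fix n assume n: "n \<in> {1..j+1}"
  have "(\<Sum>p=1..?d. beta j p n ^ (?d - l') * lagrange_beta j p n * w p) =
    (\<Sum>p=1..?d. (root_omega j ^ (j + n)) ^ (?d - l') * (lagrange_beta j p n * (root_omega j ^ (?d - p)) ^ (?d - l)))"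
  proof (intro sum.cong refl)
   fix p assume "p \<in> {1..?d}"
   define a where "a = root_omega j ^ (?d - p)"
   have ad: "a ^ ?d = 1" unfolding a_def by (rule root_omega_power_order)
   have "a ^ (?d - l') * a ^ (?d + l' - l) = a ^ ?d * a ^ (?d - l)"
    unfolding power_add[symmetric] using l l' by (intro arg_cong[where f="%e. a ^ e"]) auto
   hence aa: "a ^ (?d - l') * a ^ (?d + l' - l) = a ^ (?d - l)" using ad by simp
   have w: "w p = a ^ (?d + l' - l)" using wa[of p] \<open>p \<in> {1..?d}\<close> by (simp add: a_def)
   have "beta j p n ^ (?d - l') * lagrange_beta j p n * w p =
    (root_omega j ^ (j + n)) ^ (?d - l') * (lagrange_beta j p n * (a ^ (?d - l') * a ^ (?d + l' - l)))"
    unfolding beta_def a_def[symmetric] w power_mult_distrib by (simp only: mult_ac)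
   thus "beta j p n ^ (?d - l') * lagrange_beta j p n * w p =
    (root_omega j ^ (j + n)) ^ (?d - l') * (lagrange_beta j p n * (root_omega j ^ (?d - p)) ^ (?d - l))"
    unfolding aa by (simp only: a_def)
  qed
  also have "\<dots> = 0"
   unfolding sum_distrib_left[symmetric] sum_lagrange_beta_vanishes[OF n l] by simp
  finally show "(\<Sum>p=1..?d. beta j p n ^ (?d - l') * lagrange_beta j p n * w p) = 0" .
 qed
 finally have all: "(\<Sum>p=1..?d. X p * w p) = (if l = l' then of_nat ?d else 0)" by simp
 have out: "X (j + q) = 0" if q: "q \<in> {1..j+1}" for q
 proof -
  have "(\<Sum>n=1..j+1. beta j (j + q) n ^ (?d - l') * lagrange_beta j (j + q) n) = (\<Sum>n=1..j+1. if q = n then 1 else 0)"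
   by (intro sum.cong refl) (use q lagrange_beta_outside in auto)
  also have "\<dots> = 1" using q by simp
  finally show ?thesis by (simp add: X_def)
 qed
 have "(\<Sum>q=1..j+1. X (j + q) * w (j + q)) = 0" by (rule sum.neutral) (use out in auto)
 hence part: "(\<Sum>p=1..j. X p * w p) = (if l = l' then of_nat ?d else 0)"
  using all unfolding sum_split_at_j by simp
 have "ccoef j p l' = (-1) ^ (j + 1) * \<i> ^ (2 * j - l') * X p" if p: "p \<in> {1..j}" for p
 proof -
  have "poly (Qpoly j p) 1 * poly (Squot j p l') 1 = X p"
   unfolding Qpoly_Squot_at_1[OF p] X_def using p by (simp add: alpha_eq_beta lagrange_eq_beta)
  thus ?thesis unfolding ccoef_def by (simp add: mult.assoc)
 qed
 hence "(\<Sum>p=1..j. ccoef j p l' * w p) = (-1) ^ (j + 1) * \<i> ^ (2 * j - l') * (\<Sum>p=1..j. X p * w p)"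
  by (simp add: sum_distrib_left mult.assoc)
 also have "\<dots> = (-1) ^ (j + 1) * \<i> ^ (2 * j - l') * (if l = l' then of_nat ?d else 0)" unfolding part ..
 finally have S: "(\<Sum>p=1..j. ccoef j p l' * w p) = (-1) ^ (j + 1) * \<i> ^ (2 * j - l') * (if l = l' then of_nat ?d else 0)" .
 show ?thesis
 proof (cases "l = l'")
  case True
  have "\<i> ^ l * \<i> ^ (2 * j - l) = (\<i>\<^sup>2) ^ j"
   unfolding power_add[symmetric] power_mult[symmetric] using l by (intro arg_cong[where f="%e. \<i> ^ e"]) auto
  hence ii: "\<i> ^ l * \<i> ^ (2 * j - l) = (-1) ^ j" by simp
  have "\<i> ^ l * ((-1) ^ (j + 1) * \<i> ^ (2 * j - l) * of_nat ?d) = (-1) ^ (j + 1) * (\<i> ^ l * \<i> ^ (2 * j - l)) * of_nat ?d"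
   by (simp only: mult_ac)
  also have "\<dots> = ((-1) ^ (j + 1) * (-1) ^ j) * of_nat ?d" unfolding ii ..
  also have "(-1) ^ (j + 1) * (-1) ^ j = (- 1 :: complex)" by (simp flip: power_add mult_2)
  finally show ?thesis using S True unfolding w_def by simp
 next
  case False
  thus ?thesis using S unfolding w_def by simp
 qed
qed

section \<open>Superpositions of plane waves along a ray\<close>

lemma norm_diff_le_vector_derivative:
 fixes f :: "real => complex"
 assumes "convex U" "\<And>x. x \<in> U ==> (f has_vector_derivative f' x) (at x within U)"
  "\<And>x. x \<in> U ==> norm (f' x) \<le> B" "x \<in> U" "y \<in> U"
 shows "norm (f x - f y) \<le> B * norm (x - y)"
proof (rule differentiable_bound[OF assms(1), of f "%x h. h *\<^sub>R f' x"])
 show "(f has_derivative (%h. h *\<^sub>R f' x)) (at x within U)" if "x \<in> U" for x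
  using assms(2)[OF that] by (simp add: has_vector_derivative_def)
 show "onorm (%h. h *\<^sub>R f' x) \<le> B" if "x \<in> U" for x
 proof (rule onorm_bound)
  show "0 \<le> B" using assms(3)[OF that] norm_ge_zero order_trans by blast
  show "norm (h *\<^sub>R f' x) \<le> B * norm h" for h :: real
   using mult_left_mono[OF assms(3)[OF that], of "norm h"] by (simp add: mult.commute)
 qed
qed (use assms in auto)

lemma norm_exp_i_of_real: "norm (exi t w) = exp (- (Im w * t))"
 by simp

lemma Im_ray_power: "Im ((pol r th) ^ n) = r ^ n * sin (real n * th)"
 by (simp add: power_mult_distrib Complex.DeMoivre of_real_power[symmetric] del: of_real_power)

text \<open>The \<open>m\<close>-th derivative in \<open>x\<close> of the plane wave with wave number \<open>k\<close>.\<close>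

definition wave ::
 "nat => (complex => complex) => (real => complex => complex) => nat => real => real => complex => complex" where
 "wave j a b m t x k = (\<i> * k) ^ m * phase j t x k * (a k + duhamel (od j) b t k)"

definition ray_wave ::
 "nat => real => (complex => complex) => (real => complex => complex) => nat => real => real => complex" where
 "ray_wave j th a b m t x = integral {0..} (ray_integrand (wave j a b m t x) th)"

lemma phase_split: "phase j t x k = exi x k * exi t (k ^ od j)"
 by (simp add: phase_def exp_add)

text \<open>
 The amplitude \<open>a\<close> and the source \<open>b\<close> may grow along the ray as long as the exponential of
 \<open>\<i> * k * x\<close> compensates this for each positive \<open>x\<close>; on the real axis they have to decay themselves.
\<close>

locale ray_wave_data =
 fixes j :: nat and th T :: real and S :: "complex set" and a :: "complex => complex"
  and b :: "real => complex => complex"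
 assumes T: "0 < T" and dir: "sin th \<ge> 0" and dir_d: "sin (real (od j) * th) \<ge> 0"
  and ray: "\<And>r. r \<ge> 0 ==> pol r th \<in> S"
  and cont_a: "continuous_on S a"
  and cont_b: "continuous_on ({0..T} \<times> S) (%(ta, k). b ta k)"
  and bound_a: "\<And>x. x > 0 ==> \<exists>C. \<forall>r\<ge>0. exp (- (r * sin th * x)) * (1 + r) ^ (2 * j + 3) * norm (a (pol r th)) \<le> C"
  and bound_b: "\<And>x. x > 0 ==> \<exists>C. \<forall>ta\<in>{0..T}. \<forall>r\<ge>0. exp (- (r * sin th * x)) * (1 + r) ^ (2 * j + 3) * norm (b ta (pol r th)) \<le> C"
begin

abbreviation "d \<equiv> od j"

definition Z :: "real => complex => complex" where
 "Z t k = exi t (k ^ d) * (a k + duhamel d b t k)"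

lemma wave_eq_Z: "wave j a b m t x k = (\<i> * k) ^ m * exi x k * Z t k"
 by (simp add: wave_def Z_def phase_split mult.assoc)

lemma cont_Z: "t \<in> {0..T} ==> continuous_on S (Z t)"
 unfolding Z_def by (intro continuous_intros cont_a continuous_on_duhamel[OF cont_b]) auto

lemma Z_bound:
 assumes "x > 0"
 obtains C where "C \<ge> 0"
  "\<And>t r. t \<in> {0..T} ==> r \<ge> 0 ==> exp (- (r * sin th * x)) * norm (Z t (pol r th)) \<le> C / (1 + r) ^ (2 * j + 3)"
  "\<And>t r. t \<in> {0..T} ==> r \<ge> 0 ==> exp (- (r * sin th * x)) * norm (b t (pol r th)) \<le> C / (1 + r) ^ (2 * j + 3)"
proof -
 obtain A where A: "\<And>r. r \<ge> 0 ==> exp (- (r * sin th * x)) * (1 + r) ^ (2 * j + 3) * norm (a (pol r th)) \<le> A"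
  using bound_a[OF assms] by blast
 obtain B where B: "\<And>ta r. ta \<in> {0..T} ==> r \<ge> 0 ==>
   exp (- (r * sin th * x)) * (1 + r) ^ (2 * j + 3) * norm (b ta (pol r th)) \<le> B"
  using bound_b[OF assms] by blast
 have A0: "A \<ge> 0" by (rule order_trans[OF _ A[of 0]]) simp_all
 have B0: "B \<ge> 0" by (rule order_trans[OF _ B[of 0 0]]) (use T in simp_all)
 define C where "C = A + B * T + B"
 show ?thesis
 proof (rule that[of C])
  show "C \<ge> 0" using A0 B0 T by (simp add: C_def)
  fix t r :: real assume t: "t \<in> {0..T}" and r: "r \<ge> 0"
  define k where "k = pol r th"
  define w where "w = exp (- (r * sin th * x)) * (1 + r) ^ (2 * j + 3)"
  have w: "w > 0" using r by (simp add: w_def)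
  have Imk: "Im (k ^ d) \<ge> 0" unfolding k_def Im_ray_power using dir_d r by simp
  have kS: "k \<in> S" unfolding k_def by (rule ray[OF r])
  have na: "norm (a k) \<le> A / w" using A[OF r] w by (simp add: w_def k_def pos_le_divide_eq mult_ac)
  have nb: "norm (b ta k) \<le> B / w" if "ta \<in> {0..T}" for ta
   using B[OF that r] w by (simp add: w_def k_def pos_le_divide_eq mult_ac)
  have "norm (integral {0..t} (%ta. exi (t - ta) (k ^ d) * b ta k)) \<le> (B / w) * (t - 0)"
  proof (rule norm_time_integral_le)
   show "continuous_on {0..t} (%ta. b ta k)"
    by (rule continuous_on_subset[OF continuous_on_section[OF cont_b kS]]) (use t in auto)
   show "Im (k ^ d) * (t - ta) \<ge> 0" if "ta \<in> {0..t}" for ta using Imk that by simp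
  qed (use nb t in auto)
  also have "\<dots> \<le> (B / w) * T" using t B0 w by (intro mult_left_mono) auto
  finally have nd: "norm (exi t (k ^ d) * duhamel d b t k) \<le> (B / w) * T"
   unfolding exp_mult_duhamel .
  have "norm (exi t (k ^ d) * a k) \<le> 1 * norm (a k)"
   unfolding norm_mult norm_exp_i_of_real using mult_nonneg_nonneg[OF Imk, of t] t
   by (intro mult_right_mono) simp_all
  hence "norm (Z t k) \<le> A / w + (B / w) * T"
   unfolding Z_def distrib_left using nd na
   by (intro order_trans[OF norm_triangle_ineq] add_mono) auto
  also have "\<dots> \<le> C / w" using w B0 by (simp add: C_def add_divide_distrib)
  finally have "w * norm (Z t k) \<le> C" using w by (simp add: pos_le_divide_eq mult.commute)
  thus "exp (- (r * sin th * x)) * norm (Z t (pol r th)) \<le> C / (1 + r) ^ (2 * j + 3)"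
   using r by (simp add: w_def k_def pos_le_divide_eq mult_ac)
  have "w * norm (b t k) \<le> B" using nb[OF t] w by (simp add: pos_le_divide_eq mult.commute)
  also have "\<dots> \<le> C" using A0 B0 T by (simp add: C_def)
  finally show "exp (- (r * sin th * x)) * norm (b t (pol r th)) \<le> C / (1 + r) ^ (2 * j + 3)"
   using r by (simp add: w_def k_def pos_le_divide_eq mult_ac)
 qed
qed

lemma weight_le:
 fixes r y C :: real
 assumes "n \<le> d" "r \<ge> 0" "y \<le> C / (1 + r) ^ (2 * j + 3)" "C \<ge> 0"
 shows "r ^ n * y \<le> C / (1 + r)\<^sup>2"
proof -
 have "r ^ n \<le> (1 + r) ^ n" using assms by (intro power_mono) auto
 also have "\<dots> \<le> (1 + r) ^ d" using assms by (intro power_increasing) auto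
 finally have "r ^ n \<le> (1 + r) ^ d" .
 moreover have "r ^ n * y \<le> r ^ n * (C / (1 + r) ^ (2 * j + 3))" using assms by (intro mult_left_mono) auto
 moreover have "r ^ n * (C / (1 + r) ^ (2 * j + 3)) \<le> (1 + r) ^ d * (C / (1 + r) ^ (2 * j + 3))"
  using \<open>r ^ n \<le> (1 + r) ^ d\<close> assms by (intro mult_right_mono) auto
 moreover have "(1 + r) ^ d * (C / (1 + r) ^ (2 * j + 3)) = C / (1 + r)\<^sup>2"
 proof -
  have "(1 + r) ^ (2 * j + 3) = (1 + r) ^ d * (1 + r)\<^sup>2"
   unfolding power_add[symmetric] by (simp add: numeral_eq_Suc)
  thus ?thesis using assms by simp
 qed
 ultimately show ?thesis by linarith
qed

lemma wave_bound:
 assumes "x > 0"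
 obtains C where "C \<ge> 0" "\<And>m t r y. m \<le> d ==> t \<in> {0..T} ==> r \<ge> 0 ==> y \<ge> x ==>
   norm (ray_integrand (wave j a b m t y) th r) \<le> C / (1 + r)\<^sup>2"
  "\<And>t r y. t \<in> {0..T} ==> r \<ge> 0 ==> y \<ge> x ==>
   norm (ray_integrand (%k. exi y k * b t k) th r) \<le> C / (1 + r)\<^sup>2"
proof -
 obtain C where C: "C \<ge> 0"
  "\<And>t r. t \<in> {0..T} ==> r \<ge> 0 ==> exp (- (r * sin th * x)) * norm (Z t (pol r th)) \<le> C / (1 + r) ^ (2 * j + 3)"
  "\<And>t r. t \<in> {0..T} ==> r \<ge> 0 ==> exp (- (r * sin th * x)) * norm (b t (pol r th)) \<le> C / (1 + r) ^ (2 * j + 3)"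
  by (rule Z_bound[OF assms]) (rule that)
 have e: "exp (- (r * sin th * y)) \<le> exp (- (r * sin th * x))" if "r \<ge> 0" "y \<ge> x" for r y
  using that dir by (simp add: mult_left_mono)
 show ?thesis
 proof (rule that[OF C(1)])
  fix m and t r y :: real assume m: "m \<le> d" and t: "t \<in> {0..T}" and r: "r \<ge> 0" and y: "y \<ge> x"
  have "norm (ray_integrand (wave j a b m t y) th r) = r ^ m * (exp (- (r * sin th * y)) * norm (Z t (pol r th)))"
   using r unfolding norm_ray_integrand wave_eq_Z by (simp add: norm_mult norm_power power_mult_distrib)
  also have "\<dots> \<le> r ^ m * (exp (- (r * sin th * x)) * norm (Z t (pol r th)))"
   using e[OF r y] r by (intro mult_left_mono mult_right_mono) auto
  also have "\<dots> \<le> C / (1 + r)\<^sup>2" by (rule weight_le[OF m r C(2)[OF t r] C(1)])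
  finally show "norm (ray_integrand (wave j a b m t y) th r) \<le> C / (1 + r)\<^sup>2" .
 next
  fix t r y :: real assume t: "t \<in> {0..T}" and r: "r \<ge> 0" and y: "y \<ge> x"
  have "norm (ray_integrand (%k. exi y k * b t k) th r) = r ^ 0 * (exp (- (r * sin th * y)) * norm (b t (pol r th)))"
   unfolding norm_ray_integrand by (simp add: norm_mult)
  also have "\<dots> \<le> r ^ 0 * (exp (- (r * sin th * x)) * norm (b t (pol r th)))"
   using e[OF r y] r by (intro mult_left_mono mult_right_mono) auto
  also have "\<dots> \<le> C / (1 + r)\<^sup>2" by (rule weight_le[OF _ r C(3)[OF t r] C(1)]) simp
  finally show "norm (ray_integrand (%k. exi y k * b t k) th r) \<le> C / (1 + r)\<^sup>2" .
 qed
qed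

lemma cont_wave: "t \<in> {0..T} ==> continuous_on {0..} (ray_integrand (wave j a b m t x) th)"
 by (rule continuous_on_ray_integrand[of S])
   (auto simp: wave_eq_Z ray intro!: continuous_intros cont_Z)

lemma cont_source: "t \<in> {0..T} ==> continuous_on {0..} (ray_integrand (%k. exi x k * b t k) th)"
 by (rule continuous_on_ray_integrand[of S])
   (auto simp: ray intro!: continuous_intros continuous_on_section'[OF cont_b])

lemma integrable_wave:
 assumes "m \<le> d" "t \<in> {0..T}" "x > 0"
 shows "ray_integrand (wave j a b m t x) th integrable_on {0..}"
  "ray_integrand (%k. exi x k * b t k) th integrable_on {0..}"
proof -
 obtain C where "C \<ge> 0" "\<And>m t r y. m \<le> d ==> t \<in> {0..T} ==> r \<ge> 0 ==> y \<ge> x ==>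
   norm (ray_integrand (wave j a b m t y) th r) \<le> C / (1 + r)\<^sup>2"
  "\<And>t r y. t \<in> {0..T} ==> r \<ge> 0 ==> y \<ge> x ==>
   norm (ray_integrand (%k. exi y k * b t k) th r) \<le> C / (1 + r)\<^sup>2"
  by (rule wave_bound[OF assms(3)]) (rule that)
 thus "ray_integrand (wave j a b m t x) th integrable_on {0..}"
  "ray_integrand (%k. exi x k * b t k) th integrable_on {0..}"
  using assms by (auto intro!: integrable_on_quadratic_decay[where C=C] cont_wave cont_source)
qed

lemma ray_wave_x_derivative:
 assumes m: "m < d" and t: "t \<in> {0..T}" and x: "x > 0"
 shows "((%x. ray_wave j th a b m t x) has_vector_derivative ray_wave j th a b (Suc m) t x) (at x)"
proof -
 have x2: "x / 2 > 0" using x by simp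
 obtain C where C0: "C \<ge> 0" "\<And>m t r y. m \<le> d ==> t \<in> {0..T} ==> r \<ge> 0 ==> y \<ge> x / 2 ==>
   norm (ray_integrand (wave j a b m t y) th r) \<le> C / (1 + r)\<^sup>2"
  "\<And>t r y. t \<in> {0..T} ==> r \<ge> 0 ==> y \<ge> x / 2 ==>
   norm (ray_integrand (%k. exi y k * b t k) th r) \<le> C / (1 + r)\<^sup>2"
  by (rule wave_bound[OF x2]) (rule that)
 have der: "((%y. ray_integrand (wave j a b m t y) th r) has_vector_derivative ray_integrand (wave j a b (Suc m) t y) th r) (at y within U)" for y r U
 proof -
  define k where "k = pol r th"
  have "((%w. (\<i> * k) ^ m * exp (\<i> * k * w) * Z t k * cis th) has_field_derivative
    (\<i> * k) ^ Suc m * exi y k * Z t k * cis th) (at (of_real y))"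
   by (auto intro!: derivative_eq_intros)
  hence "((%y. (\<i> * k) ^ m * exi y k * Z t k * cis th) has_vector_derivative
    (\<i> * k) ^ Suc m * exi y k * Z t k * cis th) (at y within U)"
   by (rule has_vector_derivative_real_field)
  thus ?thesis unfolding ray_integrand_def wave_eq_Z k_def .
 qed
 have "((%x. ray_wave j th a b m t x) has_vector_derivative ray_wave j th a b (Suc m) t x) (at x within {x/2<..})"
  unfolding ray_wave_def
 proof (rule has_vector_derivative_integral_dominated[OF _ inverse_square_integrable[of C] _ _ der])
  show "ray_integrand (wave j a b m t y) th integrable_on {0..}" if "y \<in> {x/2<..}" for y
   by (rule integrable_wave) (use that m t x in auto)
  show "x \<in> {x/2<..}" using x by simp
  show "norm (ray_integrand (wave j a b m t y) th r - ray_integrand (wave j a b m t x) th r) \<le> C / (1 + r)\<^sup>2 * norm (y - x)"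
   if "y \<in> {x/2<..}" "r \<in> {0..}" for y r
   by (rule norm_diff_le_vector_derivative[of "{x/2<..}", OF _ der]) (use that C0(2)[of "Suc m" t r] m t x in auto)
  show "at x within {x/2<..} \<noteq> bot" using x by (simp add: at_within_open[of x "{x/2<..}"])
 qed
 thus ?thesis using x by (simp add: at_within_open[of x "{x/2<..}"])
qed

lemma ray_wave_t_derivative:
 assumes t: "t \<in> {0..T}" and x: "x > 0"
 shows "((%t. ray_wave j th a b 0 t x) has_vector_derivative
   (integral {0..} (ray_integrand (%k. exi x k * b t k) th) - (-1) ^ (j + 1) * ray_wave j th a b d t x))
   (at t within {0..T})"
proof -
 obtain C where C0: "C \<ge> 0" "\<And>m t r y. m \<le> d ==> t \<in> {0..T} ==> r \<ge> 0 ==> y \<ge> x ==>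
   norm (ray_integrand (wave j a b m t y) th r) \<le> C / (1 + r)\<^sup>2"
  "\<And>t r y. t \<in> {0..T} ==> r \<ge> 0 ==> y \<ge> x ==>
   norm (ray_integrand (%k. exi y k * b t k) th r) \<le> C / (1 + r)\<^sup>2"
  by (rule wave_bound[OF x]) (rule that)
 define g where "g = (%t r. ray_integrand (%k. exi x k * b t k) th r - (-1) ^ (j + 1) * ray_integrand (wave j a b d t x) th r)"
 have pow: "(-1) ^ (j + 1) * (\<i> * k) ^ d = - (\<i> * k ^ d)" for k :: complex
 proof -
  have "(\<i> * k) ^ d = (\<i>\<^sup>2) ^ j * \<i> * k ^ d"
   unfolding power_mult_distrib power_add power_mult by simp
  hence "(-1) ^ (j + 1) * (\<i> * k) ^ d = ((-1) ^ (j + 1) * (-1) ^ j) * (\<i> * k ^ d)" by (simp only: i_squared mult.assoc power2_i)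
  also have "(-1) ^ (j + 1) * (-1) ^ j = (- 1 :: complex)" by (simp flip: power_add mult_2)
  finally show ?thesis by simp
 qed
 have der: "((%t. ray_integrand (wave j a b 0 t x) th r) has_vector_derivative g t r) (at t within {0..T})"
  if t: "t \<in> {0..T}" and r: "r \<in> {0..}" for t r
 proof -
  define k where "k = pol r th"
  have kS: "k \<in> S" using ray r by (simp add: k_def)
  have e: "((%t. exi t (k ^ d)) has_vector_derivative \<i> * k ^ d * exi t (k ^ d)) (at t within {0..T})"
   by (rule has_vector_derivative_real_field) (auto intro!: derivative_eq_intros)
  have "((%t. a k + duhamel d b t k) has_vector_derivative (0 + exn t (k ^ d) * b t k)) (at t within {0..T})"
   by (intro has_vector_derivative_add has_vector_derivative_const, rule duhamel_has_vector_derivative)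
     (use continuous_on_section[OF cont_b kS] t in auto)
  from has_vector_derivative_mult[OF e this]
  have "((%t. Z t k) has_vector_derivative (exi t (k ^ d) * (0 + exn t (k ^ d) * b t k)
    + \<i> * k ^ d * exi t (k ^ d) * (a k + duhamel d b t k))) (at t within {0..T})"
   unfolding Z_def .
  moreover have "exi t (k ^ d) * (0 + exn t (k ^ d) * b t k)
    + \<i> * k ^ d * exi t (k ^ d) * (a k + duhamel d b t k) = b t k + \<i> * k ^ d * Z t k"
  proof -
   have "exi t (k ^ d) * exn t (k ^ d) = 1"
    by (simp flip: exp_add)
   thus ?thesis unfolding Z_def by (simp only: add_0_left mult.assoc[symmetric] mult_1_left)
  qed
  ultimately have "((%t. Z t k) has_vector_derivative (b t k + \<i> * k ^ d * Z t k)) (at t within {0..T})" by simp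
  hence "((%t. (exi x k * cis th) * Z t k) has_vector_derivative (exi x k * cis th) * (b t k + \<i> * k ^ d * Z t k)) (at t within {0..T})"
   by (rule has_vector_derivative_mult_right)
  moreover have "(exi x k * cis th) * (b t k + \<i> * k ^ d * Z t k) = g t r"
  proof -
   have "g t r = exi x k * b t k * cis th - ((-1) ^ (j + 1) * (\<i> * k) ^ d) * (exi x k * Z t k * cis th)"
    unfolding g_def ray_integrand_def wave_eq_Z k_def[symmetric] by (simp only: mult.assoc)
   thus ?thesis unfolding pow by (simp add: algebra_simps)
  qed
  ultimately show ?thesis unfolding ray_integrand_def wave_eq_Z k_def[symmetric] by (simp add: mult_ac)
 qed
 have gb: "norm (g t r) \<le> 2 * C / (1 + r)\<^sup>2" if "t \<in> {0..T}" "r \<ge> 0" for t r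
 proof -
  have "norm (g t r) \<le> C / (1 + r)\<^sup>2 + C / (1 + r)\<^sup>2"
   unfolding g_def using C0(2)[of d t r x] C0(3)[of t r x] that
   by (intro order_trans[OF norm_triangle_ineq4] add_mono) (auto simp: norm_mult norm_power)
  thus ?thesis by simp
 qed
 have "((%t. integral {0..} (ray_integrand (wave j a b 0 t x) th)) has_vector_derivative integral {0..} (g t)) (at t within {0..T})"
 proof (rule has_vector_derivative_integral_dominated[OF _ inverse_square_integrable[of "2 * C"] t _ der[OF t]])
  show "ray_integrand (wave j a b 0 t x) th integrable_on {0..}" if "t \<in> {0..T}" for t
   by (rule integrable_wave) (use that x in auto)
  show "norm (ray_integrand (wave j a b 0 s x) th r - ray_integrand (wave j a b 0 t x) th r) \<le> 2 * C / (1 + r)\<^sup>2 * norm (s - t)"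
   if "s \<in> {0..T}" "r \<in> {0..}" for s r
   by (rule norm_diff_le_vector_derivative[of "{0..T}", OF _ der]) (use that gb t in auto)
  show "at t within {0..T} \<noteq> bot" using t T by (simp add: trivial_limit_within islimpt_Icc)
 qed
 moreover have "integral {0..} (g t) = integral {0..} (ray_integrand (%k. exi x k * b t k) th) - (-1) ^ (j + 1) * ray_wave j th a b d t x"
 proof -
  have i1: "(%r. (-1) ^ (j + 1) * ray_integrand (wave j a b d t x) th r) integrable_on {0..}"
   by (intro integrable_on_mult_right integrable_wave(1)) (use t x in auto)
  have i2: "ray_integrand (%k. exi x k * b t k) th integrable_on {0..}"
   by (rule integrable_wave(2)[of 0]) (use t x in auto)
  show ?thesis unfolding g_def ray_wave_def integral_diff[OF i2 i1] integral_mult_right ..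
 qed
 ultimately show ?thesis unfolding ray_wave_def by simp
qed

end

text \<open>Passing to the limit \<open>x \<rightarrow> 0\<close> when the amplitude is integrable by itself.\<close>

lemma ray_integral_at_zero:
 assumes dir: "sin th \<ge> 0" and cont: "continuous_on {0..} (ray_integrand g th)"
  and bound: "\<And>r. r \<ge> 0 ==> norm (ray_integrand g th r) \<le> C / (1 + r)\<^sup>2"
 shows "ray_integrand g th integrable_on {0..}"
  "((%x. integral {0..} (ray_integrand (%k. exi x k * g k) th)) \<longlongrightarrow>
   integral {0..} (ray_integrand g th)) (at_right 0)"
proof -
 have eq: "ray_integrand (%k. exi x k * g k) th = (%r. exi x ((pol r th)) * ray_integrand g th r)" for x
  by (simp add: ray_integrand_def[abs_def] mult.assoc)
 have b: "norm (exi x ((pol r th)) * ray_integrand g th r) \<le> C / (1 + r)\<^sup>2" if "x > 0" "r \<ge> 0" for x r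
 proof -
  have "norm (exi x ((pol r th)) * ray_integrand g th r) \<le> 1 * norm (ray_integrand g th r)"
   unfolding norm_mult using that dir by (intro mult_right_mono) auto
  thus ?thesis using bound[OF that(2)] by simp
 qed
 show "ray_integrand g th integrable_on {0..}" by (rule integrable_on_quadratic_decay[OF cont bound])
 show "((%x. integral {0..} (ray_integrand (%k. exi x k * g k) th)) \<longlongrightarrow>
   integral {0..} (ray_integrand g th)) (at_right 0)"
  unfolding eq
 proof (rule tendsto_integral_dominated(2)[OF _ inverse_square_integrable[of C]])
  show "(%r. exi x ((pol r th)) * ray_integrand g th r) integrable_on {0..}" if "x \<in> {0<..}" for x
   by (rule integrable_on_quadratic_decay[where C=C]) (use b that in \<open>auto intro!: continuous_intros cont\<close>)
  show "((%x. exi x ((pol r th)) * ray_integrand g th r) \<longlongrightarrow> ray_integrand g th r) (at_right 0)" for r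
  proof -
   have "((%x. exi x ((pol r th)) * ray_integrand g th r) \<longlongrightarrow>
     exi 0 ((pol r th)) * ray_integrand g th r) (at_right 0)"
    by (intro tendsto_intros)
   thus ?thesis by simp
  qed
 qed (use b in auto)
qed

section \<open>Rotation criteria\<close>

text \<open>Stated for all values \<open>I\<close>, so that convergence along one ray implies convergence along the other.\<close>

definition rays_agree :: "(complex => complex) => real => real => bool" where
 "rays_agree h a b \<longleftrightarrow> (\<forall>I. (ray_integrand h a has_integral I) {0..} \<longleftrightarrow> (ray_integrand h b has_integral I) {0..})"

lemma rays_agree_integral: "rays_agree h a b ==> integral {0..} (ray_integrand h a) = integral {0..} (ray_integrand h b)"
 by (simp add: rays_agree_def integral_def integrable_on_def)

lemma rays_agree_if_small:
 assumes ab: "a < b" "b \<le> a + pi" and cont: "continuous_on (wedge a b) h"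
  and holo: "\<And>r th. r > 0 ==> a < th ==> th < b ==> h field_differentiable at (pol r th)"
  and bound: "\<And>r th. r \<ge> 0 ==> a \<le> th ==> th \<le> b ==> norm (h (pol r th)) \<le> C / (1 + r)\<^sup>2"
 shows "rays_agree h a b"
 unfolding rays_agree_def
proof (intro allI has_integral_rotate_ray[OF ab cont, where L=0 and C="\<bar>C\<bar>"])
 have b': "r * norm (h (pol r th)) \<le> \<bar>C\<bar> * (1 / (1 + r))" if "r \<ge> 0" "a \<le> th" "th \<le> b" for r th
 proof -
  have "r * norm (h (pol r th)) \<le> (1 + r) * (\<bar>C\<bar> / (1 + r)\<^sup>2)"
  proof (intro mult_mono)
   show "norm (h (pol r th)) \<le> \<bar>C\<bar> / (1 + r)\<^sup>2"
    by (rule order_trans[OF bound[OF that]]) (intro divide_right_mono; simp)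
  qed (use that in auto)
  also have "\<dots> = \<bar>C\<bar> * (1 / (1 + r))" using that by (simp add: power2_eq_square)
  finally show ?thesis .
 qed
 show "r * norm (h (pol r th)) \<le> \<bar>C\<bar>" if "r \<ge> 0" "a \<le> th" "th \<le> b" for r th
 proof -
  have "1 / (1 + r) \<le> 1" using that by simp
  hence "\<bar>C\<bar> * (1 / (1 + r)) \<le> \<bar>C\<bar> * 1" by (intro mult_left_mono) auto
  thus ?thesis using b'[OF that] by linarith
 qed
 show "((%r. r * norm (h (pol r th))) \<longlongrightarrow> 0) at_top" if "a < th" "th < b" for th
 proof (rule Lim_null_comparison)
  show "\<forall>\<^sub>F r in at_top. norm (r * norm (h (pol r th))) \<le> \<bar>C\<bar> * (1 / (1 + r))"
   using eventually_ge_at_top[of 0]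
  proof eventually_elim
   case (elim r)
   thus ?case using b'[OF elim, of th] that by simp
  qed
  have "((%r::real. 1 / (1 + r)) \<longlongrightarrow> 0) at_top" by real_asymp
  thus "((%r. \<bar>C\<bar> * (1 / (1 + r))) \<longlongrightarrow> 0) at_top" by (rule tendsto_mult_right_zero)
 qed
qed (rule holo)

lemma norm_exp_ray_power:
 "norm (exi y ((pol r th) ^ n)) = exp (- (r ^ n * (y * sin (real n * th))))"
 unfolding norm_exp_i_of_real Im_ray_power by (simp add: mult_ac)

lemma field_differentiable_exp_power: "(%z. exp (\<i> * z ^ n * c)) field_differentiable (at w)"
 unfolding field_differentiable_def
 by (rule exI[of _ "exp (\<i> * w ^ n * c) * (\<i> * (of_nat n * w ^ (n - 1)) * c)"]) (auto intro!: derivative_eq_intros)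

text \<open>The borderline case: the factor \<open>g\<close> decays only like \<open>1 / r\<close>, so that the integrals converge
 conditionally, and the exponential decays in the interior of the wedge only.\<close>

lemma rays_agree_jordan:
 assumes ab: "a < b" "b \<le> a + pi" and cont: "continuous_on (wedge a b) g"
  and holo: "\<And>r th. r > 0 ==> a < th ==> th < b ==> g field_differentiable at (pol r th)"
  and bound: "\<And>r th. r \<ge> 0 ==> a \<le> th ==> th \<le> b ==> norm (g (pol r th)) \<le> C / (1 + r)"
  and pos: "\<And>th. a < th ==> th < b ==> y * sin (real n * th) > 0"
  and nonneg: "\<And>th. a \<le> th ==> th \<le> b ==> y * sin (real n * th) \<ge> 0" and n: "n \<ge> 1"
 shows "rays_agree (%k. exi y (k ^ n) * g k) a b"
 unfolding rays_agree_def
proof (intro allI has_integral_rotate_ray[OF ab, where L=0 and C="\<bar>C\<bar>"])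
 show "continuous_on (wedge a b) (%k. exi y (k ^ n) * g k)"
  by (intro continuous_intros cont)
 show "(%k. exi y (k ^ n) * g k) field_differentiable at (pol r th)"
  if "r > 0" "a < th" "th < b" for r th
  by (rule field_differentiable_mult[OF field_differentiable_exp_power holo[OF that]])
 have b': "r * norm (exi y ((pol r th) ^ n) * g (pol r th))
   \<le> exp (- (r ^ n * (y * sin (real n * th)))) * \<bar>C\<bar>" if "r \<ge> 0" "a \<le> th" "th \<le> b" for r th
 proof -
  have "r * norm (g (pol r th)) \<le> (1 + r) * (\<bar>C\<bar> / (1 + r))"
  proof (intro mult_mono)
   show "norm (g (pol r th)) \<le> \<bar>C\<bar> / (1 + r)"
    by (rule order_trans[OF bound[OF that]]) (intro divide_right_mono; use that in simp)
  qed (use that in auto)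
  also have "\<dots> = \<bar>C\<bar>" using that by simp
  finally have "exp (- (r ^ n * (y * sin (real n * th)))) * (r * norm (g (pol r th)))
   \<le> exp (- (r ^ n * (y * sin (real n * th)))) * \<bar>C\<bar>" by (intro mult_left_mono) auto
  thus ?thesis unfolding norm_mult[of "exp _"] norm_exp_ray_power by (simp only: mult_ac)
 qed
 show "r * norm (exi y ((pol r th) ^ n) * g (pol r th)) \<le> \<bar>C\<bar>"
  if "r \<ge> 0" "a \<le> th" "th \<le> b" for r th
 proof -
  have "exp (- (r ^ n * (y * sin (real n * th)))) \<le> 1" using nonneg[of th] that by simp
  hence "exp (- (r ^ n * (y * sin (real n * th)))) * \<bar>C\<bar> \<le> 1 * \<bar>C\<bar>" by (intro mult_right_mono) auto
  thus ?thesis using b'[OF that] by linarith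
 qed
 show "((%r. r * norm (exi y ((pol r th) ^ n) * g (pol r th))) \<longlongrightarrow> 0) at_top"
  if th: "a < th" "th < b" for th
 proof (rule Lim_null_comparison)
  define c where "c = y * sin (real n * th)"
  have c: "c > 0" using pos[OF th] by (simp add: c_def)
  show "\<forall>\<^sub>F r in at_top. norm (r * norm (exi y ((pol r th) ^ n) * g (pol r th)))
    \<le> \<bar>C\<bar> * exp (- (c * r))"
   using eventually_ge_at_top[of 1]
  proof eventually_elim
   case (elim r)
   have "r ^ 1 \<le> r ^ n" using elim n by (intro power_increasing) auto
   hence "exp (- (r ^ n * c)) \<le> exp (- (c * r))" using c by (simp add: mult.commute)
   hence "exp (- (r ^ n * c)) * \<bar>C\<bar> \<le> exp (- (c * r)) * \<bar>C\<bar>" by (intro mult_right_mono) auto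
   hence "r * norm (exi y ((pol r th) ^ n) * g (pol r th)) \<le> exp (- (c * r)) * \<bar>C\<bar>"
    using b'[of r th] elim th unfolding c_def[symmetric] by linarith
   thus ?case using elim by (simp add: mult.commute)
  qed
  have "((%r. exp (- (c * r))) \<longlongrightarrow> 0) at_top" using c by real_asymp
  thus "((%r. \<bar>C\<bar> * exp (- (c * r))) \<longlongrightarrow> 0) at_top" by (rule tendsto_mult_right_zero)
 qed
qed

lemma exp_wedge_decay:
 assumes ab: "a \<le> b" and pos: "\<And>th. a \<le> th ==> th \<le> b ==> y * sin (real n * th) > 0" and n: "n \<ge> 1"
  and g: "\<And>r th. r \<ge> 0 ==> a \<le> th ==> th \<le> b ==> norm (g (pol r th)) \<le> C * (1 + r) ^ q"
 obtains K where "K \<ge> 0" "\<And>r th. r \<ge> 0 ==> a \<le> th ==> th \<le> b ==>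
   norm (exi y ((pol r th) ^ n) * g (pol r th)) \<le> K / (1 + r) ^ m"
proof -
 have "continuous_on {a..b} (%th. y * sin (real n * th))" by (intro continuous_intros)
 from continuous_attains_inf[OF _ _ this] ab obtain th0 where
  th0: "th0 \<in> {a..b}" "\<And>th. th \<in> {a..b} ==> y * sin (real n * th0) \<le> y * sin (real n * th)" by auto
 define c where "c = y * sin (real n * th0)"
 have c: "c > 0" using pos th0(1) by (simp add: c_def)
 have C: "C \<ge> 0" using order_trans[OF norm_ge_zero g[of 0 a]] ab by simp
 define K where "K = C * exp c * (exp c * fact (q + m) / c ^ (q + m))"
 have "K \<ge> 0" using C c by (simp add: K_def)
 moreover have "norm (exi y ((pol r th) ^ n) * g (pol r th)) \<le> K / (1 + r) ^ m"
  if r: "r \<ge> 0" "a \<le> th" "th \<le> b" for r th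
 proof -
  have "r \<le> r ^ n + 1"
  proof (cases "r \<ge> 1")
   case True
   hence "r ^ 1 \<le> r ^ n" using n by (intro power_increasing) auto
   thus ?thesis by simp
  qed (use r in \<open>auto intro: order_trans[of _ 1]\<close>)
  hence "c * r \<le> c * (r ^ n + 1)" using c by (intro mult_left_mono) auto
  also have "c * (r ^ n + 1) \<le> r ^ n * (y * sin (real n * th)) + c"
  proof -
   have "r ^ n * c \<le> r ^ n * (y * sin (real n * th))" using th0(2)[of th] r by (intro mult_left_mono) (auto simp: c_def)
   thus ?thesis by (simp add: distrib_left mult.commute)
  qed
  finally have "exp (- (r ^ n * (y * sin (real n * th)))) \<le> exp (c + - (c * r))" by simp
  hence e: "norm (exi y ((pol r th) ^ n)) \<le> exp c * exp (- (c * r))"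
   unfolding norm_exp_ray_power exp_add .
  have "norm (exi y ((pol r th) ^ n) * g (pol r th)) * (1 + r) ^ m
    \<le> (exp c * exp (- (c * r))) * (C * (1 + r) ^ q) * (1 + r) ^ m"
   unfolding norm_mult using e g[OF r] r by (intro mult_right_mono mult_mono) auto
  also have "\<dots> = (C * exp c) * ((1 + r) ^ (q + m) * exp (- (c * r)))" by (simp only: power_add mult_ac)
  also have "\<dots> \<le> (C * exp c) * (exp c * fact (q + m) / c ^ (q + m))"
   using C c r by (intro mult_left_mono exp_beats_power) auto
  also have "\<dots> = K" by (simp add: K_def)
  finally show ?thesis using r by (simp add: pos_le_divide_eq)
 qed
 ultimately show ?thesis using that by blast
qed

text \<open>If the exponential decays up to the boundary of the wedge, polynomial growth does no harm.\<close>

lemma rays_agree_exp_decay: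
 assumes ab: "a < b" "b \<le> a + pi" and cont: "continuous_on (wedge a b) g"
  and holo: "\<And>r th. r > 0 ==> a < th ==> th < b ==> g field_differentiable at (pol r th)"
  and pos: "\<And>th. a \<le> th ==> th \<le> b ==> y * sin (real n * th) > 0" and n: "n \<ge> 1"
  and g: "\<And>r th. r \<ge> 0 ==> a \<le> th ==> th \<le> b ==> norm (g (pol r th)) \<le> C * (1 + r) ^ q"
 shows "rays_agree (%k. exi y (k ^ n) * g k) a b"
proof -
 obtain K where K: "K \<ge> 0" "\<And>r th. r \<ge> 0 ==> a \<le> th ==> th \<le> b ==>
   norm (exi y ((pol r th) ^ n) * g (pol r th)) \<le> K / (1 + r) ^ 2"
  by (rule exp_wedge_decay[OF _ pos n g, of a b 2]) (use ab in auto)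
 show ?thesis
 proof (rule rays_agree_if_small[OF ab _ _ K(2)])
  show "continuous_on (wedge a b) (%k. exi y (k ^ n) * g k)"
   by (intro continuous_intros cont)
  show "(%k. exi y (k ^ n) * g k) field_differentiable at (pol r th)"
   if "r > 0" "a < th" "th < b" for r th
   by (rule field_differentiable_mult[OF field_differentiable_exp_power holo[OF that]])
 qed
qed

section \<open>A cone avoiding the pole of \<open>1 / (1 + \<i> * k)\<close>\<close>

text \<open>Everything but a sector around the positive imaginary axis; this sector contains the only zero \<open>\<i>\<close>
 of \<open>1 + \<i> * k\<close>.\<close>

definition cone :: "complex set" where
 "cone = {k. Im k \<le> \<bar>Re k\<bar>}"

lemma norm_one_plus_i_cone:
 assumes "k \<in> cone"
 shows "norm (1 + \<i> * k) \<ge> (1 + norm k) / 5"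
proof -
 have "norm (1 + \<i> * k) \<ge> 1 / 2"
 proof (rule ccontr)
  assume "\<not> norm (1 + \<i> * k) \<ge> 1 / 2"
  hence "\<bar>Re (1 + \<i> * k)\<bar> < 1 / 2" "\<bar>Im (1 + \<i> * k)\<bar> < 1 / 2"
   using abs_Re_le_cmod[of "1 + \<i> * k"] abs_Im_le_cmod[of "1 + \<i> * k"] by linarith+
  thus False using assms by (auto simp: cone_def)
 qed
 moreover have "norm k \<le> norm (1 + \<i> * k) + 1"
  using norm_triangle_ineq4[of "1 + \<i> * k" 1] by (simp add: norm_mult)
 ultimately show ?thesis by simp
qed

lemma one_plus_i_nonzero_cone: "k \<in> cone ==> 1 + \<i> * k \<noteq> 0"
proof
 assume k: "k \<in> cone" "1 + \<i> * k = 0"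
 have "0 < (1 + norm k) / 5" by (simp add: add_pos_nonneg)
 also have "\<dots> \<le> 0" using norm_one_plus_i_cone[OF k(1)] k(2) by simp
 finally show False by simp
qed

lemma lower_subset_cone: "Im k \<le> 0 ==> k \<in> cone"
 by (simp add: cone_def)

lemma norm_inverse_power_cone:
 assumes "k \<in> cone"
 shows "norm (c / (1 + \<i> * k) ^ Suc n) \<le> norm c * 5 ^ Suc n / (1 + norm k)"
proof -
 have n: "0 < (1 + norm k) / 5" by (simp add: add_pos_nonneg)
 have "(1 + norm k) / 5 ^ Suc n \<le> ((1 + norm k) / 5) ^ Suc n"
 proof -
  have "(1 + norm k) ^ 1 \<le> (1 + norm k) ^ Suc n" by (intro power_increasing) auto
  thus ?thesis unfolding power_divide by (intro divide_right_mono) auto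
 qed
 also have "\<dots> \<le> norm (1 + \<i> * k) ^ Suc n" by (intro power_mono norm_one_plus_i_cone assms) (use n in auto)
 finally have "norm c / norm (1 + \<i> * k) ^ Suc n \<le> norm c / ((1 + norm k) / 5 ^ Suc n)"
  using n by (intro divide_left_mono mult_pos_pos) (auto simp: one_plus_i_nonzero_cone[OF assms] add_pos_nonneg)
 thus ?thesis unfolding norm_divide norm_power by simp
qed

lemma cos_ge_sin_near_0:
 assumes "\<bar>th\<bar> \<le> pi / 4"
 shows "sin th \<le> cos th"
proof -
 have "sin (th - pi / 4) \<le> 0"
  using sin_ge_zero[of "pi / 4 - th"] assms sin_minus[of "pi / 4 - th"] by (simp add: abs_le_iff)
 thus ?thesis by (simp add: sin_diff sin_45 cos_45 mult_le_cancel_right)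
qed

text \<open>The cone contains all directions from slightly above the negative half-axis, through the lower
 half-plane, to slightly above the positive one.\<close>

lemma ray_in_cone:
 assumes "r \<ge> 0" "3 * pi / 4 \<le> th" "th \<le> 9 * pi / 4"
 shows "pol r th \<in> cone"
proof -
 have "sin th \<le> \<bar>cos th\<bar>"
 proof -
  consider "th \<le> pi" | "pi \<le> th" "th \<le> 2 * pi" | "2 * pi \<le> th" by linarith
  thus ?thesis
  proof cases
   case 1
   have "sin (pi - th) \<le> cos (pi - th)" using assms 1 by (intro cos_ge_sin_near_0) auto
   thus ?thesis by (simp add: sin_diff cos_diff)
  next
   case 2
   have "sin (th - pi) \<ge> 0" using 2 by (intro sin_ge_zero) auto
   thus ?thesis by (simp add: sin_diff)
  next
   case 3
   have "sin (th - 2 * pi) \<le> cos (th - 2 * pi)" using assms 3 by (intro cos_ge_sin_near_0) auto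
   thus ?thesis by (simp add: sin_diff cos_diff)
  qed
 qed
 hence "r * sin th \<le> r * \<bar>cos th\<bar>" using assms(1) by (rule mult_left_mono)
 thus ?thesis using assms(1) by (simp add: cone_def abs_mult)
qed

lemma ray_in_cone_near_0: "r \<ge> 0 ==> - (pi / 4) \<le> th ==> th \<le> pi / 4 ==> pol r th \<in> cone"
 using ray_in_cone[of r "th + 2 * pi"] by (simp add: complex_eq_iff sin_add cos_add) (simp add: cone_def)

section \<open>Inversion of the transforms\<close>

lemma lower_ray:
 assumes "pi \<le> th" "th \<le> 2 * pi"
 shows "r \<ge> 0 ==> Im (pol r th) \<le> 0"
  "r > 0 ==> pi < th ==> th < 2 * pi ==> Im (pol r th) < 0"
 using assms sin_le_zero[of th] sin_lt_zero[of th] by (auto simp: mult_nonneg_nonpos mult_pos_neg le_less)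

text \<open>Existence is seen on a ray inside the lower half-plane, where the exponential decays; both half-axes
 can be rotated there.\<close>

lemma half_rays_agree_lower:
 fixes y :: real
 assumes y: "y < 0" and cont: "continuous_on {k. Im k \<le> 0} h"
  and holo: "\<And>k. Im k < 0 ==> h field_differentiable at k"
  and bound: "\<And>k. Im k \<le> 0 ==> norm (h k) \<le> C / (1 + norm k)"
 obtains I where "(ray_integrand (%k. exi y k * h k) 0 has_integral I) {0..}"
  "(ray_integrand (%k. exi y k * h k) pi has_integral I) {0..}"
proof -
 let ?f = "%k. exi y (k ^ 1) * h k"
 have neg: "y * sin (real 1 * th) > 0" if "pi < th" "th < 2 * pi" for th
  using sin_lt_zero[of th] that y by (simp add: mult_neg_neg)
 have sub: "wedge a b \<subseteq> {k. Im k \<le> 0}" if "pi \<le> a" "b \<le> 2 * pi" for a b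
 proof
  fix k assume "k \<in> wedge a b"
  then obtain r th where k: "k = pol r th" "r \<ge> 0" "a \<le> th" "th \<le> b" unfolding wedge_def by blast
  have "Im k \<le> 0" unfolding k(1) by (rule lower_ray(1)) (use k that in auto)
  thus "k \<in> {k. Im k \<le> 0}" by simp
 qed
 have nb: "norm (h (pol r th)) \<le> C / (1 + r)" if "r \<ge> 0" "pi \<le> th" "th \<le> 2 * pi" for r th
  using bound[OF lower_ray(1)[OF that(2,3,1)]] that(1) by (simp add: norm_mult)
 have agree: "rays_agree ?f a b" if ab: "pi \<le> a" "a < b" "b \<le> 2 * pi" for a b
 proof (rule rays_agree_jordan[where C=C])
  show "continuous_on (wedge a b) h" by (rule continuous_on_subset[OF cont sub]) (use ab in auto)
  show "h field_differentiable at (pol r th)" if "r > 0" "a < th" "th < b" for r th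
   by (rule holo, rule lower_ray(2)) (use that ab in auto)
  show "y * sin (real 1 * th) > 0" if "a < th" "th < b" for th using neg[of th] that ab by simp
  show "y * sin (real 1 * th) \<ge> 0" if "a \<le> th" "th \<le> b" for th
   using sin_le_zero[of th] that ab y by (cases "th = 2 * pi") (auto intro: mult_nonpos_nonpos)
 qed (use ab nb in auto)
 define th where "th = 7 * pi / 4"
 have th: "pi < th" "th < 2 * pi" using pi_gt_zero by (auto simp: th_def)
 obtain K where K: "\<And>r th'. r \<ge> 0 ==> th \<le> th' ==> th' \<le> th ==>
   norm (exi y ((pol r th') ^ 1) * h (pol r th')) \<le> K / (1 + r) ^ 2"
 proof (rule exp_wedge_decay[of th th y 1 h C 0 2])
  show "norm (h (pol r th')) \<le> C * (1 + r) ^ 0" if "r \<ge> 0" "th \<le> th'" "th' \<le> th" for r th'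
  proof -
   have "C \<ge> 0" using order_trans[OF norm_ge_zero bound[of 0]] by simp
   hence "C / (1 + r) \<le> C / 1" using that by (intro divide_left_mono) auto
   thus ?thesis using nb[of r th'] that th by simp
  qed
 qed (use th neg that in auto)
 have "ray_integrand ?f th integrable_on {0..}"
 proof (rule integrable_on_quadratic_decay)
  show "continuous_on {0..} (ray_integrand ?f th)"
   by (rule continuous_on_ray_integrand[of "{k. Im k \<le> 0}"]) (use th lower_ray(1)[of th] in \<open>auto intro!: continuous_intros cont\<close>)
  show "norm (ray_integrand ?f th r) \<le> K / (1 + r)\<^sup>2" if "r \<ge> 0" for r
   unfolding norm_ray_integrand by (rule K[OF that order_refl order_refl])
 qed
 then obtain I where I: "(ray_integrand ?f th has_integral I) {0..}" by blast
 have "(ray_integrand ?f (2 * pi) has_integral I) {0..}" "(ray_integrand ?f pi has_integral I) {0..}"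
  using I agree[of th "2 * pi"] agree[of pi th] th unfolding rays_agree_def by auto
 moreover have "ray_integrand ?f (2 * pi) = ray_integrand ?f 0" by (simp add: ray_integrand_def fun_eq_iff)
 ultimately show ?thesis using that by simp
qed

lemma exp_over_one_plus_rays_agree:
 fixes y :: real
 assumes "y < 0"
 obtains I where
  "(ray_integrand (%z. exi y z / (1 + \<i> * z)) 0 has_integral I) {0..}"
  "(ray_integrand (%z. exi y z / (1 + \<i> * z)) pi has_integral I) {0..}"
proof (rule half_rays_agree_lower[OF assms, of "%z. 1 / (1 + \<i> * z)" 3])
 show "continuous_on {k. Im k \<le> 0} (%z. 1 / (1 + \<i> * z))"
  by (intro continuous_intros) (use one_plus_i_nonzero in auto)
 show "(%z. 1 / (1 + \<i> * z)) field_differentiable at k" if "Im k < 0" for k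
  using one_plus_i_nonzero[of k] that by (auto intro!: derivative_intros)
 show "norm (1 / (1 + \<i> * k)) \<le> 3 / (1 + norm k)" if "Im k \<le> 0" for k
 proof -
  have "1 / norm (1 + \<i> * k) \<le> 1 / ((1 + norm k) / 3)"
   using norm_one_plus_i_ge(1)[OF that] by (intro divide_left_mono) (auto intro!: mult_pos_pos add_pos_nonneg simp: one_plus_i_nonzero[OF that])
  thus ?thesis by (simp add: norm_divide)
 qed
qed (use that in simp)

text \<open>
 After subtracting the multiple \<open>g t * exp (t - s)\<close>, whose transform is explicit, the function of
 \<open>s\<close> vanishes at \<open>t\<close> and equals \<open>(s - t) * q s\<close>; then the integrand is \<open>\<i>\<close> times the derivative of
 \<open>exp (\<i> * k * t)\<close> times the transform of \<open>q\<close>, which tends to zero at both ends of the line.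
\<close>

theorem time_transform_inversion:
 fixes g g1 g2 :: "real => complex"
 assumes d0: "\<And>ta. ta \<in> {0..T} ==> (g has_vector_derivative g1 ta) (at ta within {0..T})"
  and d1: "\<And>ta. ta \<in> {0..T} ==> (g1 has_vector_derivative g2 ta) (at ta within {0..T})"
  and c2: "continuous_on {0..T} g2"
  and t: "0 < t" "t < T"
 obtains I0 Ip where
  "(ray_integrand (%k. exi t k * time_transform g T k) 0 has_integral I0) {0..}"
  "(ray_integrand (%k. exi t k * time_transform g T k) pi has_integral Ip) {0..}"
  "I0 - Ip = 2 * of_real pi * g t"
proof -
 define e where "e = (%ta. exp (complex_of_real (t - ta)))"
 define h where "h = (%ta. g ta - g t * e ta)"
 define h1 where "h1 = (%ta. g1 ta + g t * e ta)"
 define h2 where "h2 = (%ta. g2 ta - g t * e ta)"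
 have de: "(e has_vector_derivative - e ta) (at ta within S)" for ta S
 proof -
  have "((%w. exp (complex_of_real t - w)) has_field_derivative - exp (complex_of_real t - of_real ta)) (at (of_real ta))"
   by (auto intro!: derivative_eq_intros)
  hence "((%ta. exp (complex_of_real t - of_real ta)) has_vector_derivative - exp (complex_of_real t - of_real ta)) (at ta within S)"
   by (rule has_vector_derivative_real_field)
  thus ?thesis by (simp add: e_def)
 qed
 have ce: "continuous_on S e" for S unfolding e_def by (intro continuous_intros)
 have cg: "continuous_on {0..T} g" by (rule continuous_on_vector_derivative[OF d0])
 have dh: "(h has_vector_derivative h1 ta) (at ta within {0..T})" if "ta \<in> {0..T}" for ta
  unfolding h_def h1_def using d0[OF that] de[of ta "{0..T}"] by (auto intro!: derivative_eq_intros)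
 have dh1: "(h1 has_vector_derivative h2 ta) (at ta within {0..T})" if "ta \<in> {0..T}" for ta
  unfolding h1_def h2_def using d1[OF that] de[of ta "{0..T}"] by (auto intro!: derivative_eq_intros)
 have ch2: "continuous_on {0..T} h2" unfolding h2_def by (intro continuous_intros c2 ce)
 have ht: "h t = 0" by (simp add: h_def e_def)
 obtain q q' where q: "\<And>ta. ta \<in> {0..T} ==> h ta = of_real (ta - t) * q ta"
  and dq: "\<And>ta. ta \<in> {0..T} ==> (q has_vector_derivative q' ta) (at ta within {0..T})"
  and cq': "continuous_on {0..T} q'"
  by (rule hadamard_quotient[of "{0..T}" t h h1 h2]) (use dh dh1 ch2 ht t in auto)
 have cq: "continuous_on {0..T} q" by (rule continuous_on_vector_derivative[OF dq])
 define G where "G = (%k. \<i> * exi t k * time_transform q T k)"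
 define G' where "G' = (%k. exi t k * time_transform h T k)"
 have ii: "\<i> * (\<i> * z) = - z" for z by (simp flip: mult.assoc)
 have dG: "(G has_field_derivative G' k) (at k within {k. Im k \<le> 0})" for k
 proof -
  have "((%k. integral (cbox 0 T) (%ta. exn ta k * q ta)) has_field_derivative
    integral (cbox 0 T) (%ta. exn ta k * (- \<i> * of_real ta * q ta))) (at k within UNIV)"
  proof (rule leibniz_rule_field_derivative[where U=UNIV])
   show "((%k. exn ta k * q ta) has_field_derivative
     exn ta k * (- \<i> * of_real ta * q ta)) (at k within UNIV)" for k ta
    by (auto intro!: derivative_eq_intros)
   show "(%ta. exn ta k * q ta) integrable_on cbox 0 T" for k
    by (auto intro!: integrable_continuous_real continuous_intros cq)
   show "continuous_on (UNIV \<times> cbox 0 T) (%(k, ta). exn ta k * (- \<i> * of_real ta * q ta))"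
    unfolding case_prod_unfold by (intro continuous_intros continuous_on_compose2[OF cq]) auto
  qed auto
  hence 1: "(time_transform q T has_field_derivative time_transform (%ta. - \<i> * of_real ta * q ta) T k)
    (at k within {k. Im k \<le> 0})"
   by (auto simp: time_transform_def[abs_def] intro: DERIV_subset)
  have 2: "((%k. \<i> * exi t k) has_field_derivative (- of_real t * exi t k)) (at k within {k. Im k \<le> 0})"
   by (rule derivative_eq_intros refl)+ (simp add: ii mult_ac)
  have hh: "time_transform h T k = \<i> * time_transform (%ta. - \<i> * of_real ta * q ta) T k - of_real t * time_transform q T k"
  proof -
   have "((%y. \<i> * (exn y k * (- \<i> * of_real y * q y)) - of_real t * (exn y k * q y)) has_integral
     \<i> * time_transform (%y. - \<i> * of_real y * q y) T k - of_real t * time_transform q T k) {0..T}"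
    unfolding time_transform_def
    by (intro has_integral_diff has_integral_mult_right integrable_integral integrable_continuous_real continuous_intros cq)
   hence "((%y. exn y k * h y) has_integral
     \<i> * time_transform (%y. - \<i> * of_real y * q y) T k - of_real t * time_transform q T k) {0..T}"
    by (rule has_integral_eq[rotated], simp only: q, simp add: algebra_simps)
   thus ?thesis unfolding time_transform_def[of h] by (rule integral_unique)
  qed
  have alg: "- X * E * Q + A * (\<i> * E) = E * (\<i> * A - X * Q)" for X E Q A :: complex
   by (simp add: algebra_simps)
  have "- of_real t * exi t k * time_transform q T k +
    time_transform (%y. - \<i> * of_real y * q y) T k * (\<i> * exi t k) = G' k"
   unfolding G'_def hh by (rule alg)
  with DERIV_mult[OF 2 1] show ?thesis unfolding G_def by simp
 qed
 have cS: "continuous_on {0..T} (%ta. q' ta + q ta)" by (intro continuous_intros cq cq')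
 hence "compact ((%ta. q' ta + q ta) ` {0..T})" by (rule compact_continuous_image) auto
 hence "bounded ((%ta. q' ta + q ta) ` {0..T})" by (rule compact_imp_bounded)
 then obtain B where "\<forall>z\<in>(%ta. q' ta + q ta) ` {0..T}. norm z \<le> B" unfolding bounded_iff by blast
 hence B: "\<And>ta. ta \<in> {0..T} ==> norm (q' ta + q ta) \<le> B" by blast
 define K where "K = norm (q 0) + norm (q T) + B * T"
 have small: "norm (G k) \<le> (3 * K) * (1 / (1 + norm k))" if k: "Im k = 0" for k
 proof -
  have eq: "(1 + \<i> * k) * time_transform q T k = q 0 - exn T k * q T + time_transform (%ta. q' ta + q ta) T k"
   by (rule time_transform_plus_derivative[OF _ dq cq']) (use t in auto)
  have n1: "norm (exn ta k) = 1" for ta :: real using k by simp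
  have "norm (time_transform (%ta. q' ta + q ta) T k) \<le> B * (T - 0)"
   unfolding time_transform_def
  proof (rule integral_bound)
   show "continuous_on {0..T} (%ta. exn ta k * (q' ta + q ta))" by (intro continuous_intros cq cq')
   show "norm (exn ta k * (q' ta + q ta)) \<le> B" if "ta \<in> {0..T}" for ta
    unfolding norm_mult n1 using B[OF that] by simp
  qed (use t in simp)
  moreover have "norm (q 0 - exn T k * q T) \<le> norm (q 0) + norm (q T)"
   using norm_triangle_ineq4[of "q 0" "exn T k * q T"] unfolding norm_mult n1 by simp
  ultimately have "norm ((1 + \<i> * k) * time_transform q T k) \<le> (norm (q 0) + norm (q T)) + B * (T - 0)"
   unfolding eq by (intro order_trans[OF norm_triangle_ineq] add_mono)
  hence "norm ((1 + \<i> * k) * time_transform q T k) \<le> K" by (simp add: K_def)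
  moreover have "(1 + norm k) / 3 * norm (time_transform q T k) \<le> norm (1 + \<i> * k) * norm (time_transform q T k)"
   using norm_one_plus_i_ge(1)[of k] k by (intro mult_right_mono) auto
  ultimately have "(1 + norm k) / 3 * norm (time_transform q T k) \<le> K" unfolding norm_mult by linarith
  moreover have "norm (G k) = norm (time_transform q T k)" unfolding G_def norm_mult using k by simp
  moreover have "0 < 1 + norm k" by (simp add: add_pos_nonneg)
  ultimately show ?thesis by (simp add: pos_le_divide_eq mult.commute)
 qed
 have "((%r::real. 1 / (1 + r)) \<longlongrightarrow> 0) at_top" by real_asymp
 from tendsto_mult_right_zero[OF this] have lim: "((%r. (3 * K) * (1 / (1 + r))) \<longlongrightarrow> 0) at_top" .
 have "((%r. G (of_real r)) \<longlongrightarrow> 0) at_top" "((%r. G (- of_real r)) \<longlongrightarrow> 0) at_top"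
 proof -
  have "\<forall>\<^sub>F r in at_top. norm (G (of_real r)) \<le> (3 * K) * (1 / (1 + r))"
   using eventually_ge_at_top[of 0]
  proof eventually_elim
   case (elim r)
   thus ?case using small[of "of_real r"] by simp
  qed
  thus "((%r. G (of_real r)) \<longlongrightarrow> 0) at_top" by (rule Lim_null_comparison[OF _ lim])
  have "\<forall>\<^sub>F r in at_top. norm (G (- of_real r)) \<le> (3 * K) * (1 / (1 + r))"
   using eventually_ge_at_top[of 0]
  proof eventually_elim
   case (elim r)
   thus ?case using small[of "- of_real r"] by simp
  qed
  thus "((%r. G (- of_real r)) \<longlongrightarrow> 0) at_top" by (rule Lim_null_comparison[OF _ lim])
 qed
 hence ag: "(ray_integrand G' 0 has_integral - G 0) {0..}" "(ray_integrand G' pi has_integral - G 0) {0..}"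
  using derivative_rays_agree[of G G'] dG by blast+
 obtain J0 Jp where J: "(ray_integrand (%z. exi t z / (z - \<i> * of_real 1)) 0 has_integral J0) {0..}"
  "(ray_integrand (%z. exi t z / (z - \<i> * of_real 1)) pi has_integral Jp) {0..}"
  "J0 - Jp = 2 * of_real pi * \<i> * exp (- of_real (1 * t))"
  by (rule exp_over_pole_rays[of 1 t]) (use t in auto)
 obtain M where M: "(ray_integrand (%z. exi (t - T) z / (1 + \<i> * z)) 0 has_integral M) {0..}"
  "(ray_integrand (%z. exi (t - T) z / (1 + \<i> * z)) pi has_integral M) {0..}"
  by (rule exp_over_one_plus_rays_agree[of "t - T"]) (use t in auto)
 define w where "w = - \<i> * g t * exp (of_real t)"
 define v where "v = - g t * exp (of_real (t - T))"
 define f where "f = (%k. exi t k * time_transform g T k)"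
 have split: "f k = G' k + w * (exi t k / (k - \<i> * of_real 1)) + v * (exi (t - T) k / (1 + \<i> * k))"
  if k: "Im k = 0" for k
 proof -
  have nz: "1 + \<i> * k \<noteq> 0" using one_plus_i_nonzero[of k] k by simp
  have "(1 + \<i> * k) * time_transform e T k = e 0 - exn T k * e T + time_transform (%y. - e y + e y) T k"
   by (rule time_transform_plus_derivative[OF _ de]) (use t in \<open>auto intro!: continuous_on_minus ce\<close>)
  hence e1: "(1 + \<i> * k) * time_transform e T k = exp (of_real t) - exn T k * exp (of_real (t - T))"
   by (simp add: time_transform_def e_def)
  have hh: "time_transform h T k = time_transform g T k - g t * time_transform e T k"
  proof -
   have alg2: "E * G - X * (E * F) = E * (G - X * F)" for E F G X :: complex
    by (simp only: right_diff_distrib mult.left_commute)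
   have "((%y. exn y k * g y - g t * (exn y k * e y)) has_integral
     time_transform g T k - g t * time_transform e T k) {0..T}"
    unfolding time_transform_def
    by (intro has_integral_diff has_integral_mult_right integrable_integral integrable_continuous_real continuous_intros cg ce)
   moreover have "exn y k * g y - g t * (exn y k * e y) =
     exn y k * h y" for y
    unfolding h_def by (rule alg2)
   ultimately have "((%y. exn y k * h y) has_integral time_transform g T k - g t * time_transform e T k) {0..T}"
    by (simp only:)
   thus ?thesis unfolding time_transform_def[of h] by (rule integral_unique)
  qed
  have alg: "E * Y = E * (Y - X * Z) + (- \<i> * X * A) * (E / (k - \<i> * of_real 1)) + (- X * C) * (E2 / (1 + \<i> * k))"
   if "(1 + \<i> * k) * Z = A - B * C" "E2 = E * B" for E Y X Z A B C E2
  proof -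
   have kk: "k - \<i> * of_real 1 = (- \<i>) * (1 + \<i> * k)" by (simp add: algebra_simps)
   have Z: "Z = (A - B * C) / (1 + \<i> * k)" using that(1) nz by (simp add: nonzero_eq_divide_eq mult.commute)
   have "(- \<i> * X * A) * (E / ((- \<i>) * (1 + \<i> * k))) = X * A * E / (1 + \<i> * k)" using nz by simp
   thus ?thesis unfolding kk Z that(2) by (simp add: diff_divide_distrib algebra_simps)
  qed
  have E2: "exi (t - T) k = exi t k * exn T k"
   by (subst exp_add[symmetric]) (simp add: algebra_simps)
  show ?thesis unfolding f_def G'_def hh w_def v_def by (rule alg[OF e1 E2])
 qed
 have "(ray_integrand f 0 has_integral (- G 0 + w * J0 + v * M)) {0..}"
  using has_integral_add[OF has_integral_add[OF ag(1) has_integral_mult_right[OF J(1), of w]] has_integral_mult_right[OF M(1), of v]]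
  by (rule has_integral_eq[rotated], unfold ray_integrand_def, subst split, simp, simp only: ring_distribs mult.assoc)
 moreover have "(ray_integrand f pi has_integral (- G 0 + w * Jp + v * M)) {0..}"
  using has_integral_add[OF has_integral_add[OF ag(2) has_integral_mult_right[OF J(2), of w]] has_integral_mult_right[OF M(2), of v]]
  by (rule has_integral_eq[rotated], unfold ray_integrand_def, subst split, simp, simp only: ring_distribs mult.assoc)
 moreover have "(- G 0 + w * J0 + v * M) - (- G 0 + w * Jp + v * M) = 2 * of_real pi * g t"
 proof -
  have "(- G 0 + w * J0 + v * M) - (- G 0 + w * Jp + v * M) = w * (J0 - Jp)" by (simp add: algebra_simps)
  also have "\<dots> = - (\<i> * \<i>) * (2 * of_real pi * g t * (exp (of_real t) * exp (- of_real (1 * t))))"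
   unfolding J(3) w_def by (simp only: mult_minus_left mult_minus_right mult_ac)
  also have "exp (complex_of_real t) * exp (- of_real (1 * t)) = 1" by (simp add: exp_minus)
  finally show ?thesis by simp
 qed
 ultimately show ?thesis using that unfolding f_def by blast
qed

text \<open>
 Cutting the function at a point beyond \<open>x\<close> reduces the inversion to the one on a bounded interval:
 the transform of the tail carries a phase that decays in the lower half-plane.
\<close>

theorem half_line_ft_inversion:
 fixes g g1 g2 :: "real => complex"
 assumes d0: "\<And>y. y \<ge> 0 ==> (g has_vector_derivative g1 y) (at y within {0..})"
  and d1: "\<And>y. y \<ge> 0 ==> (g1 has_vector_derivative g2 y) (at y within {0..})"
  and c2: "continuous_on {0..} g2"
  and b0: "\<And>y. y \<ge> 0 ==> norm (g y) \<le> C / (1 + y) ^ 3"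
  and b1: "\<And>y. y \<ge> 0 ==> norm (g1 y) \<le> C / (1 + y) ^ 3"
  and x: "x > 0"
 obtains I0 Ip where
  "(ray_integrand (%k. exi x k * half_line_ft g k) 0 has_integral I0) {0..}"
  "(ray_integrand (%k. exi x k * half_line_ft g k) pi has_integral Ip) {0..}"
  "I0 - Ip = 2 * of_real pi * g x"
proof -
 define T where "T = x + 1"
 have T: "T > 0" using x by (simp add: T_def)
 define h where "h = (%s. g (T + s))"
 define h1 where "h1 = (%s. g1 (T + s))"
 have C: "C \<ge> 0" using order_trans[OF norm_ge_zero b0[of 0]] by simp
 have cg: "continuous_on {0..} g" and cg1: "continuous_on {0..} g1"
  using d0 d1 by (auto intro: continuous_on_vector_derivative)
 have ch: "continuous_on {0..} h" "continuous_on {0..} h1"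
  unfolding h_def h1_def using T by (auto intro!: continuous_intros continuous_on_compose2[OF cg] continuous_on_compose2[OF cg1])
 have dh: "(h has_vector_derivative h1 s) (at s within {0..})" if "s \<ge> 0" for s
 proof -
  have 1: "((+) T has_vector_derivative 1) (at s within {0..})" by (auto intro!: derivative_eq_intros)
  have 2: "(g has_vector_derivative g1 (T + s)) (at (T + s) within (+) T ` {0..})"
   by (rule has_vector_derivative_within_subset[OF d0]) (use that T in auto)
  show ?thesis using vector_diff_chain_within[OF 1 2] by (simp add: h_def h1_def o_def)
 qed
 have dec: "c \<le> C / (1 + s) ^ n" if "c \<le> C / (1 + (T + s)) ^ 3" "n \<le> 3" "s \<ge> 0" for c s n
 proof -
  have "(1 + s) ^ n \<le> (1 + (T + s)) ^ 3"
   by (rule order_trans[OF power_increasing power_mono]) (use that T in auto)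
  hence "C / (1 + (T + s)) ^ 3 \<le> C / (1 + s) ^ n"
   using C that T by (intro divide_left_mono mult_pos_pos zero_less_power) auto
  thus ?thesis using that by linarith
 qed
 have bh: "norm (h s) \<le> C / (1 + s) ^ n" "norm (h1 s) \<le> C / (1 + s) ^ n" if "s \<ge> 0" "n \<le> 3" for s n
  unfolding h_def h1_def using that T by (auto intro!: dec b0 b1)
 have split: "half_line_ft g k = time_transform g T k + exn T k * half_line_ft h k" if k: "Im k \<le> 0" for k
 proof -
  define f where "f = (%y. exn y k * g y)"
  define u where "u = (%s. exn s k * h s)"
  define e where "e = exn T k"
  have b2: "norm (g y) \<le> C / (1 + y)\<^sup>2" if "y \<ge> 0" for y
   using order_trans[OF b0[OF that] divide_left_mono[OF power_increasing[of 2 3 "1 + y"] C]] that by simp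
  have cf: "continuous_on {0..} f" and cu: "continuous_on {0..} u"
   unfolding f_def u_def by (intro continuous_intros cg ch)+
  have fi: "(f has_integral integral {0..R} f) {0..R}" and ui: "(u has_integral integral {0..R} u) {0..R}" for R
   by (intro integrable_integral integrable_continuous_real continuous_on_subset[OF cf] continuous_on_subset[OF cu]; auto)+
  have "(f has_integral half_line_ft g k) {0..}" "(u has_integral half_line_ft h k) {0..}"
   unfolding half_line_ft_def f_def u_def
   by (intro integrable_integral half_line_ft_integrable(1)[OF cg b2 k] half_line_ft_integrable(1)[OF ch(1) bh(1) k]; simp)+
  hence lim: "((%R. integral {0..R} f) \<longlongrightarrow> half_line_ft g k) at_top" "((%R. integral {0..R} u) \<longlongrightarrow> half_line_ft h k) at_top"
   using has_integral_half_line_iff[of f "%R. integral {0..R} f"] has_integral_half_line_iff[of u "%R. integral {0..R} u"] fi ui by blast+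
  have "integral {0..R + T} f = integral {0..T} f + e * integral {0..R} u" if R: "R \<ge> 0" for R
  proof -
   have "f (s + T) = e * u s" for s
    unfolding f_def e_def u_def h_def mult.assoc[symmetric] exp_add[symmetric] by (simp add: algebra_simps)
   hence "((%s. f (s + T)) has_integral e * integral {0..R} u) {0..R}" using has_integral_mult_right[OF ui] by simp
   hence "(f has_integral e * integral {0..R} u) {0 + T..R + T}" 
    unfolding has_integral_shift_Icc_real[symmetric] by (simp add: o_def add.commute)
   with fi[of T] have "(f has_integral (integral {0..T} f + e * integral {0..R} u)) {0..R + T}"
    by (intro has_integral_combine[of 0 T]) (use R T in auto)
   thus ?thesis by (rule integral_unique)
  qed
  hence "\<forall>\<^sub>F R in at_top. integral {0..T} f + e * integral {0..R} u = integral {0..R + T} f"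
   by (auto intro: eventually_mono[OF eventually_ge_at_top[of 0]])
  moreover have "((%R. integral {0..T} f + e * integral {0..R} u) \<longlongrightarrow> integral {0..T} f + e * half_line_ft h k) at_top"
   by (intro tendsto_intros lim)
  ultimately have "((%R. integral {0..R + T} f) \<longlongrightarrow> integral {0..T} f + e * half_line_ft h k) at_top"
   by (rule Lim_transform_eventually[rotated])
  moreover have "((%R. integral {0..R + T} f) \<longlongrightarrow> half_line_ft g k) at_top"
   by (rule filterlim_compose[OF lim(1)])
    (use filterlim_tendsto_add_at_top[OF tendsto_const[of T] filterlim_ident] in \<open>simp add: add.commute\<close>)
  ultimately have "half_line_ft g k = integral {0..T} f + e * half_line_ft h k" using tendsto_unique[OF trivial_limit_at_top_linorder] by blast
  thus ?thesis by (simp add: f_def e_def time_transform_def)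
 qed
 obtain J where J: "(ray_integrand (%k. exi (x - T) k * half_line_ft h k) 0 has_integral J) {0..}"
  "(ray_integrand (%k. exi (x - T) k * half_line_ft h k) pi has_integral J) {0..}"
 proof (rule half_rays_agree_lower[of "x - T" "half_line_ft h" "3 * (norm (h 0) + 2 * C)"])
  have deriv: "(half_line_ft h has_field_derivative half_line_ft (%x. - \<i> * of_real x * h x) k) (at k within {k. Im k \<le> 0})" if "Im k \<le> 0" for k
   by (rule has_field_derivative_half_line_ft[OF ch(1) bh(1) that]) auto
  show "continuous_on {k. Im k \<le> 0} (half_line_ft h)"
   unfolding continuous_on_eq_continuous_within using deriv by (blast intro: DERIV_continuous)
  show "half_line_ft h field_differentiable at k" if "Im k < 0" for k
  proof -
   have "(half_line_ft h has_field_derivative half_line_ft (%x. - \<i> * of_real x * h x) k) (at k within {k. Im k < 0})"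
    by (rule DERIV_subset[OF deriv]) (use that in auto)
   thus ?thesis using that by (auto simp: field_differentiable_def at_within_open[OF _ open_halfspace_Im_lt])
  qed
  show "norm (half_line_ft h k) \<le> 3 * (norm (h 0) + 2 * C) / (1 + norm k)" if k: "Im k \<le> 0" for k
  proof -
   have "(1 + \<i> * k) * half_line_ft h k = h 0 + half_line_ft (%x. h1 x + h x) k"
    by (rule half_line_ft_plus_derivative[OF ch(1) bh(1) ch(2) bh(2) dh k]) auto
   moreover have "norm (half_line_ft (%x. h1 x + h x) k) \<le> 2 * C"
   proof (rule half_line_ft_integrable(2)[OF _ _ k])
    show "norm (h1 s + h s) \<le> 2 * C / (1 + s)\<^sup>2" if "s \<ge> 0" for s
     using order_trans[OF norm_triangle_ineq add_mono[OF bh(2)[OF that, of 2] bh(1)[OF that, of 2]]] by simp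
   qed (intro continuous_intros ch)
   ultimately have "norm (1 + \<i> * k) * norm (half_line_ft h k) \<le> norm (h 0) + 2 * C"
    using norm_triangle_ineq[of "h 0" "half_line_ft (%x. h1 x + h x) k"] by (simp flip: norm_mult)
   moreover have "(1 + norm k) / 3 * norm (half_line_ft h k) \<le> norm (1 + \<i> * k) * norm (half_line_ft h k)"
    using norm_one_plus_i_ge(1)[OF k] by (intro mult_right_mono) auto
   ultimately have "(1 + norm k) / 3 * norm (half_line_ft h k) \<le> norm (h 0) + 2 * C" by linarith
   moreover have "0 < 1 + norm k" by (simp add: add_pos_nonneg)
   ultimately show ?thesis by (simp add: pos_le_divide_eq mult.commute)
  qed
 qed (use that in \<open>auto simp: T_def\<close>)
 obtain I0 Ip where I: "(ray_integrand (%k. exi x k * time_transform g T k) 0 has_integral I0) {0..}"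
  "(ray_integrand (%k. exi x k * time_transform g T k) pi has_integral Ip) {0..}"
  "I0 - Ip = 2 * of_real pi * g x"
 proof (rule time_transform_inversion[of T g g1 g2 x])
  show "(g has_vector_derivative g1 ta) (at ta within {0..T})" if "ta \<in> {0..T}" for ta
   by (rule has_vector_derivative_within_subset[OF d0]) (use that in auto)
  show "(g1 has_vector_derivative g2 ta) (at ta within {0..T})" if "ta \<in> {0..T}" for ta
   by (rule has_vector_derivative_within_subset[OF d1]) (use that in auto)
  show "continuous_on {0..T} g2" by (rule continuous_on_subset[OF c2]) auto
 qed (use x that in \<open>auto simp: T_def\<close>)
 have eq: "exi x k * time_transform g T k + exi (x - T) k * half_line_ft h k = exi x k * half_line_ft g k"
  if "Im k \<le> 0" for k
 proof -
  have "exi (x - T) k = exi x k * exn T k"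
   by (subst exp_add[symmetric]) (simp add: algebra_simps)
  thus ?thesis unfolding split[OF that] by (simp only: distrib_left mult.assoc)
 qed
 have sum: "(ray_integrand (%k. exi x k * half_line_ft g k) th has_integral (I + J)) {0..}"
  if "(ray_integrand (%k. exi x k * time_transform g T k) th has_integral I) {0..}"
   "(ray_integrand (%k. exi (x - T) k * half_line_ft h k) th has_integral J) {0..}" "th \<in> {0, pi}" for th I
  using has_integral_add[OF that(1,2)]
 proof (rule has_integral_eq[rotated])
  fix r :: real assume "r \<in> {0..}"
  hence "Im (pol r th) \<le> 0" using that(3) by auto
  from eq[OF this] show "ray_integrand (%k. exi x k * time_transform g T k) th r + ray_integrand (%k. exi (x - T) k * half_line_ft h k) th r =
    ray_integrand (%k. exi x k * half_line_ft g k) th r"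
   unfolding ray_integrand_def by (simp only: flip: distrib_right)
 qed
 show ?thesis by (rule that[OF sum[OF I(1) J(1)] sum[OF I(2) J(2)]]) (use I(3) in auto)
qed

section \<open>The transform of a smooth function, split at the order of the equation\<close>

text \<open>
 The transform is the sum of a part \<open>rest\<close> that decays fast enough for \<open>od j\<close> derivatives in
 \<open>x\<close> on the real line, and a rational part \<open>slow\<close> whose rays of integration can be rotated off it.
\<close>

locale space_family =
 fixes j :: nat and T C :: real and G :: "nat => real => real => complex"
 assumes T: "0 < T"
  and der: "\<And>b t x. b < 2 * j + 4 ==> t \<in> {0..T} ==> x \<ge> 0 ==>
   (G b t has_vector_derivative G (Suc b) t x) (at x within {0..})"
  and cont: "\<And>b. b \<le> 2 * j + 4 ==> continuous_on ({0..T} \<times> {0..}) (%(t, x). G b t x)"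
  and bound: "\<And>b t x. b \<le> 2 * j + 4 ==> t \<in> {0..T} ==> x \<ge> 0 ==> norm (G b t x) \<le> C / (1 + x) ^ 3"
begin

abbreviation "M \<equiv> 2 * j + 4"

definition ft :: "real => complex => complex" where
 "ft t = half_line_ft (G 0 t)"

definition co :: "nat => real => complex" where
 "co i t = boost i (%b. G b t) 0 0"

definition remainder :: "real => real => complex" where
 "remainder t = boost M (%b. G b t) 0"

definition rest :: "real => complex => complex" where
 "rest t k = half_line_ft (remainder t) k / (1 + \<i> * k) ^ M"

definition slow :: "real => complex => complex" where
 "slow t k = (\<Sum>i<M. co i t / (1 + \<i> * k) ^ Suc i)"

lemma C_nonneg: "C \<ge> 0"
 using order_trans[OF norm_ge_zero bound[of 0 0 0]] T by simp

lemma bound2: "b \<le> M ==> t \<in> {0..T} ==> x \<ge> 0 ==> norm (G b t x) \<le> C / (1 + x)\<^sup>2"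
 using decay_power_le[of x 2 3 "norm (G b t x)" C] bound[of b t x] C_nonneg
 by (simp add: pos_le_divide_eq mult.commute)

lemma cont_x: "b \<le> M ==> t \<in> {0..T} ==> continuous_on {0..} (G b t)"
 using continuous_on_section'[of "{0..T}" "{0..}" "G b" t] cont[of b] by simp

lemma cont_remainder: "continuous_on ({0..T} \<times> {0..}) (%(t, x). remainder t x)"
 unfolding remainder_def case_prod_unfold
 by (rule continuous_on_boost[of M _ "%p b. G b (fst p)" snd])
   (use cont in \<open>auto simp: case_prod_unfold\<close>)

lemma bound_remainder: "t \<in> {0..T} ==> x \<ge> 0 ==> norm (remainder t x) \<le> (2 ^ M * C) / (1 + x)\<^sup>2"
 unfolding remainder_def using norm_boost_le[of M "%b. G b t" x "C / (1 + x)\<^sup>2" 0 M] bound2 by simp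

lemma cont_remainder_x: "t \<in> {0..T} ==> continuous_on {0..} (remainder t)"
 using continuous_on_section'[OF cont_remainder] .

lemma ft_split: "t \<in> {0..T} ==> Im k \<le> 0 ==> ft t k = rest t k + slow t k"
 unfolding ft_def rest_def slow_def co_def remainder_def
 by (subst half_line_ft_expansion[of M "%b. G b t" C k M]) (use der cont_x bound2 in auto)

lemma cont_co: "i \<le> M ==> continuous_on {0..T} (co i)"
proof -
 assume i: "i \<le> M"
 have "continuous_on {0..T} (%t. G b t 0)" if "b \<le> M" for b
  using continuous_on_section[of "{0..T}" "{0..}" "G b" 0] cont[OF that] by simp
 thus ?thesis
  unfolding co_def using continuous_on_boost[of M "{0..T}" "%t b. G b t" "%_. 0" 0 i] i by simp
qed

lemma norm_co: "i \<le> M ==> t \<in> {0..T} ==> norm (co i t) \<le> 2 ^ i * C"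
 unfolding co_def using norm_boost_le[of M "%b. G b t" 0 C 0 i] bound[of _ t 0] by simp

lemma cont_ft: "continuous_on ({0..T} \<times> {k. Im k \<le> 0}) (%(t, k). ft t k)"
 unfolding ft_def by (rule continuous_on_half_line_ft_param[OF cont bound2]) auto

lemma cont_rest: "continuous_on ({0..T} \<times> {k. Im k \<le> 0}) (%(t, k). rest t k)"
 unfolding rest_def case_prod_unfold
 by (intro continuous_intros continuous_on_half_line_ft_param[OF cont_remainder bound_remainder, unfolded case_prod_unfold])
   (auto simp: one_plus_i_nonzero)

lemma cont_slow: "continuous_on ({0..T} \<times> cone) (%(t, k). slow t k)"
 unfolding slow_def case_prod_unfold
 by (intro continuous_intros continuous_on_compose2[OF cont_co])
   (auto simp: one_plus_i_nonzero_cone simp del: power_Suc)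

definition K :: real where
 "K = 2 ^ M * C * 3 ^ M + (\<Sum>i<M. 2 ^ i * C * 5 ^ Suc i)"

lemma sum_nonneg_K: "(\<Sum>i<M. 2 ^ i * C * 5 ^ Suc i) \<ge> 0"
 using C_nonneg by (intro sum_nonneg) auto

lemma K_nonneg: "K \<ge> 0"
 using C_nonneg sum_nonneg_K by (simp add: K_def)

lemma norm_rest:
 assumes "t \<in> {0..T}" "Im k \<le> 0"
 shows "norm (rest t k) \<le> K / (1 + norm k) ^ M"
proof -
 have p: "0 < (1 + norm k) / 3" by (simp add: add_pos_nonneg)
 have "norm (half_line_ft (remainder t) k) \<le> 2 ^ M * C"
  by (rule half_line_ft_integrable(2)[OF cont_remainder_x bound_remainder]) (use assms in auto)
 moreover have "((1 + norm k) / 3) ^ M \<le> norm (1 + \<i> * k) ^ M"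
  using p by (intro power_mono norm_one_plus_i_ge(1) assms) auto
 ultimately have "norm (rest t k) \<le> 2 ^ M * C / ((1 + norm k) / 3) ^ M"
  unfolding rest_def norm_divide norm_power using p C_nonneg by (intro frac_le) auto
 also have "\<dots> = 2 ^ M * C * 3 ^ M / (1 + norm k) ^ M" by (simp add: power_divide)
 also have "\<dots> \<le> K / (1 + norm k) ^ M"
  using sum_nonneg_K by (intro divide_right_mono) (auto simp: K_def add_nonneg_nonneg)
 finally show ?thesis .
qed

lemma norm_slow:
 assumes "t \<in> {0..T}" "k \<in> cone"
 shows "norm (slow t k) \<le> K / (1 + norm k)"
proof -
 have "norm (slow t k) \<le> (\<Sum>i<M. 2 ^ i * C * 5 ^ Suc i / (1 + norm k))"
  unfolding slow_def
 proof (rule order_trans[OF norm_sum], rule sum_mono)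
  fix i assume "i \<in> {..<M}"
  hence "norm (co i t) * 5 ^ Suc i / (1 + norm k) \<le> 2 ^ i * C * 5 ^ Suc i / (1 + norm k)"
   using norm_co[of i t] assms by (intro divide_right_mono mult_right_mono) auto
  thus "norm (co i t / (1 + \<i> * k) ^ Suc i) \<le> 2 ^ i * C * 5 ^ Suc i / (1 + norm k)"
   using norm_inverse_power_cone[OF assms(2), of "co i t" i] by linarith
 qed
 also have "\<dots> \<le> K / (1 + norm k)"
  unfolding sum_divide_distrib[symmetric] using C_nonneg by (intro divide_right_mono) (auto simp: K_def)
 finally show ?thesis .
qed

lemma power_decay_le: "c \<ge> 0 ==> n \<ge> 1 ==> r \<ge> 0 ==> c / (1 + r) ^ n \<le> c / (1 + r :: real)"
proof -
 assume "c \<ge> 0" "n \<ge> 1" "r \<ge> 0"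
 moreover from this have "(1 + r) ^ 1 \<le> (1 + r) ^ n" by (intro power_increasing) auto
 ultimately show ?thesis by (intro divide_left_mono) auto
qed

lemma norm_ft:
 assumes "t \<in> {0..T}" "Im k \<le> 0"
 shows "norm (ft t k) \<le> 2 * K / (1 + norm k)"
proof -
 have "norm (ft t k) \<le> K / (1 + norm k) ^ M + K / (1 + norm k)"
  unfolding ft_split[OF assms]
  by (rule order_trans[OF norm_triangle_ineq add_mono[OF norm_rest norm_slow]])
    (use assms lower_subset_cone in auto)
 moreover have "K / (1 + norm k) ^ M \<le> K / (1 + norm k)" by (rule power_decay_le[OF K_nonneg]) auto
 ultimately show ?thesis by simp
qed

lemma open_lower: "open {k. Im k < 0}" by (rule open_halfspace_Im_lt)

lemma half_line_ft_derivative_lower: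
 assumes "continuous_on {0..} g" "\<And>x. x \<ge> 0 ==> norm (g x) \<le> B / (1 + x) ^ 3" "Im k < 0"
 shows "(half_line_ft g has_field_derivative half_line_ft (%x. - \<i> * of_real x * g x) k) (at k)"
proof -
 have "(half_line_ft g has_field_derivative half_line_ft (%x. - \<i> * of_real x * g x) k) (at k within {k. Im k < 0})"
  by (rule DERIV_subset[OF has_field_derivative_half_line_ft[OF assms(1,2)]]) (use assms(3) in auto)
 thus ?thesis using assms(3) at_within_open[OF _ open_lower] by auto
qed

lemma ft_has_derivative:
 assumes "t \<in> {0..T}" "Im k < 0"
 shows "(ft t has_field_derivative half_line_ft (%x. - \<i> * of_real x * G 0 t x) k) (at k)"
 unfolding ft_def by (rule half_line_ft_derivative_lower[OF cont_x bound]) (use assms in auto)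

lemma bound_remainder3: "t \<in> {0..T} ==> x \<ge> 0 ==> norm (remainder t x) \<le> (2 ^ M * C) / (1 + x) ^ 3"
 unfolding remainder_def using norm_boost_le[of M "%b. G b t" x "C / (1 + x) ^ 3" 0 M] bound by simp

lemma rest_field_differentiable:
 assumes "t \<in> {0..T}" "Im k < 0"
 shows "rest t field_differentiable at k"
proof -
 have "half_line_ft (remainder t) field_differentiable at k"
  unfolding field_differentiable_def
  using half_line_ft_derivative_lower[OF cont_remainder_x bound_remainder3] assms by blast
 moreover have "(1 + \<i> * k) ^ M \<noteq> 0" using one_plus_i_nonzero[of k] assms by simp
 ultimately show ?thesis
  unfolding rest_def[abs_def] by (intro derivative_intros) auto
qed

lemma slow_field_differentiable:
 assumes "1 + \<i> * k \<noteq> 0"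
 shows "slow t field_differentiable at k"
 unfolding slow_def[abs_def]
 by (intro field_differentiable_sum derivative_intros) (use assms in auto)

lemma cont_ft': "continuous_on ({0..T} \<times> {k. Im k \<le> 0}) (%(t, k). half_line_ft (%x. - \<i> * of_real x * G 0 t x) k)"
proof (rule continuous_on_half_line_ft_param)
 show "continuous_on ({0..T} \<times> {0..}) (%(t, x). - \<i> * of_real x * G 0 t x)"
  using cont[of 0] unfolding case_prod_unfold by (intro continuous_intros) auto
 show "norm (- \<i> * of_real x * G 0 t x) \<le> C / (1 + x)\<^sup>2" if "t \<in> {0..T}" "x \<ge> 0" for t x
 proof -
  have "norm (- \<i> * of_real x * G 0 t x) = x * norm (G 0 t x)" using that by (simp add: norm_mult)
  also have "\<dots> \<le> (1 + x) * (C / (1 + x) ^ 3)" using that bound[of 0 t x] by (intro mult_mono) auto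
  also have "\<dots> = C / (1 + x)\<^sup>2" using that by (simp add: power2_eq_square power3_eq_cube)
  finally show ?thesis .
 qed
qed

lemma duhamel_ft_field_differentiable:
 assumes "t \<le> T" "Im k < 0"
 shows "duhamel d ft t field_differentiable at k"
proof -
 have "duhamel d ft t holomorphic_on {k. Im k < 0}"
 proof (rule duhamel_holomorphic[OF _ _ _ _ assms(1)])
  show "continuous_on ({0..T} \<times> {k. Im k < 0}) (%(t, k). ft t k)"
   by (rule continuous_on_subset[OF cont_ft]) auto
  show "continuous_on ({0..T} \<times> {k. Im k < 0}) (%(t, k). half_line_ft (%x. - \<i> * of_real x * G 0 t x) k)"
   by (rule continuous_on_subset[OF cont_ft']) auto
  show "(ft ta has_field_derivative half_line_ft (%x. - \<i> * of_real x * G 0 ta x) k) (at k within {k. Im k < 0})"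
   if "ta \<in> {0..T}" "k \<in> {k. Im k < 0}" for ta k
   by (rule has_field_derivative_at_within[OF ft_has_derivative]) (use that in auto)
 qed (rule convex_halfspace_Im_lt)
 thus ?thesis using assms(2) open_lower by (auto simp: holomorphic_on_open field_differentiable_def)
qed

lemma duhamel_slow_eq:
 assumes "t \<in> {0..T}"
 shows "duhamel d slow t k = (\<Sum>i<M. duhamel d (%ta _. co i ta) t k / (1 + \<i> * k) ^ Suc i)"
proof -
 have "((%ta. \<Sum>i<M. exn ta (k ^ d) * co i ta / (1 + \<i> * k) ^ Suc i) has_integral
   (\<Sum>i<M. duhamel d (%ta _. co i ta) t k / (1 + \<i> * k) ^ Suc i)) {0..t}"
  unfolding duhamel_def
 proof (intro has_integral_sum has_integral_divide integrable_integral)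
  show "(%ta. exn ta (k ^ d) * co i ta) integrable_on {0..t}" if "i \<in> {..<M}" for i
   by (intro integrable_continuous_real continuous_intros continuous_on_subset[OF cont_co])
     (use that assms in auto)
 qed auto
 moreover have "(\<Sum>i<M. exn ta (k ^ d) * co i ta / (1 + \<i> * k) ^ Suc i) =
   exn ta (k ^ d) * slow ta k" for ta
  unfolding slow_def sum_distrib_left by simp
 ultimately show ?thesis unfolding duhamel_def by (metis (no_types, lifting) integral_unique has_integral_cong)
qed

lemma duhamel_slow_field_differentiable:
 assumes "t \<in> {0..T}" "1 + \<i> * k \<noteq> 0"
 shows "duhamel d slow t field_differentiable at k"
proof -
 have "duhamel d (%ta _. co i ta) t field_differentiable at k" if "i \<le> M" for i
  using duhamel_time_holomorphic[OF cont_co[OF that], of t d] assms(1)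
  by (auto simp: holomorphic_on_open field_differentiable_def)
 hence "(%k. \<Sum>i<M. duhamel d (%ta _. co i ta) t k / (1 + \<i> * k) ^ Suc i) field_differentiable at k"
  by (intro field_differentiable_sum field_differentiable_divide derivative_intros) (use assms(2) in auto)
 moreover have "(%k. \<Sum>i<M. duhamel d (%ta _. co i ta) t k / (1 + \<i> * k) ^ Suc i) = duhamel d slow t"
  using duhamel_slow_eq[OF assms(1), of d] by auto
 ultimately show ?thesis by simp
qed

lemma duhamel_ft_split:
 assumes t: "t \<in> {0..T}" and k: "Im k \<le> 0"
 shows "duhamel d ft t k = duhamel d rest t k + duhamel d slow t k"
proof -
 have "continuous_on {0..t} (%ta. rest ta k)" "continuous_on {0..t} (%ta. slow ta k)"
  by (rule continuous_on_subset[OF continuous_on_section[OF cont_rest]], use t k in auto)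
    (rule continuous_on_subset[OF continuous_on_section[OF cont_slow]], use t k lower_subset_cone in auto)
 hence "((%ta. exn ta (k ^ d) * rest ta k + exn ta (k ^ d) * slow ta k)
   has_integral (duhamel d rest t k + duhamel d slow t k)) {0..t}"
  unfolding duhamel_def
  by (intro has_integral_add integrable_integral integrable_continuous_real continuous_intros)
 hence "((%ta. exn ta (k ^ d) * ft ta k) has_integral (duhamel d rest t k + duhamel d slow t k)) {0..t}"
  by (rule has_integral_eq[rotated]) (use t k in \<open>simp add: ft_split distrib_left\<close>)
 thus ?thesis unfolding duhamel_def by (rule integral_unique)
qed

end

section \<open>The integral over the real line\<close>

text \<open>A quarter of the unit in which the angles of the sectors are measured: rotating by it makes
 \<open>exp (\<i> * k ^ d * t)\<close> decay and stays in the cone.\<close>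

definition eps :: "nat => real" where
 "eps j = pi / (4 * real (od j))"

lemma eps_bounds: "0 < eps j" "eps j \<le> pi / 4" "real (od j) * eps j = pi / 4"
proof -
 show "0 < eps j" by (simp add: eps_def)
 have "4 * 1 \<le> 4 * real (od j)" by simp
 hence "pi / (4 * real (od j)) \<le> pi / (4 * 1)" by (intro divide_left_mono) auto
 thus "eps j \<le> pi / 4" by (simp add: eps_def)
 have "real (od j) \<noteq> 0" by simp
 thus "real (od j) * eps j = pi / 4" unfolding eps_def by (simp del: of_nat_add of_nat_mult of_nat_Suc)
qed

lemma sin_multiple_reflect: "sin (real (od j) * (pi - \<beta>)) = sin (real (od j) * \<beta>)"
proof -
 have "real (od j) * (pi - \<beta>) = real (od j) * pi - real (od j) * \<beta>" by (simp add: algebra_simps)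
 thus ?thesis
  using sin_npi[of "od j"] cos_npi[of "od j"] by (simp only: sin_diff) (simp del: of_nat_Suc of_nat_add)
qed

lemma sin_multiple_near_0:
 assumes "0 \<le> th" "th \<le> eps j"
 shows "sin (real (od j) * th) \<ge> 0"
proof (rule sin_ge_zero)
 show "0 \<le> real (od j) * th" using assms by simp
 have "real (od j) * th \<le> real (od j) * eps j" using assms by (intro mult_left_mono) auto
 also have "\<dots> = pi / 4" by (rule eps_bounds(3))
 also have "\<dots> \<le> pi" using pi_gt_zero by simp
 finally show "real (od j) * th \<le> pi" .
qed

lemma duhamel_scale: "duhamel n (%ta k. c * b ta k) t k = c * duhamel n b t k"
 unfolding duhamel_def by (simp add: mult.left_commute[of _ c])

lemma duhamel_0 [simp]: "duhamel n b 0 k = 0"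
 by (simp add: duhamel_def)

lemma wave_0_0: "wave j a b 0 0 x k = exi x k * a k"
 by (simp add: wave_def phase_def)

text \<open>A family \<open>E\<close> of successive derivatives in \<open>x\<close> whose zeroth member solves the equation with
 right-hand side \<open>s\<close>.\<close>

definition solution_family :: "nat => real => (nat => real => real => complex) => (real => real => complex) => bool" where
 "solution_family j T E s \<longleftrightarrow> (\<forall>t\<in>{0..T}. \<forall>x>0.
   (\<forall>m<od j. ((%x. E m t x) has_vector_derivative E (Suc m) t x) (at x)) \<and>
   ((%t. E 0 t x) has_vector_derivative (s t x - (-1) ^ (j + 1) * E (od j) t x)) (at t within {0..T}))"

lemma solution_family_add:
 assumes "solution_family j T E s" "solution_family j T E' s'"
 shows "solution_family j T (%m t x. E m t x + E' m t x) (%t x. s t x + s' t x)"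
proof -
 have eq: "s t x + s' t x - (-1) ^ (j + 1) * (E d t x + E' d t x) =
  (s t x - (-1) ^ (j + 1) * E d t x) + (s' t x - (-1) ^ (j + 1) * E' d t x)" for d t x
  by (simp add: algebra_simps)
 show ?thesis using assms unfolding solution_family_def eq by (auto intro: has_vector_derivative_add)
qed

lemma solution_family_scale:
 assumes "solution_family j T E s"
 shows "solution_family j T (%m t x. c * E m t x) (%t x. c * s t x)"
proof -
 have eq: "c * s t x - (-1) ^ (j + 1) * (c * E d t x) = c * (s t x - (-1) ^ (j + 1) * E d t x)" for d t x
  by (simp add: algebra_simps)
 show ?thesis using assms unfolding solution_family_def eq by (auto intro: has_vector_derivative_mult_right)
qed

lemma solution_family_diff:
 assumes "solution_family j T E s" "solution_family j T E' s'"
 shows "solution_family j T (%m t x. E m t x - E' m t x) (%t x. s t x - s' t x)"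
 using solution_family_add[OF assms(1) solution_family_scale[OF assms(2), of "-1"]] by simp

lemma solution_family_sum:
 assumes "finite A" "\<And>i. i \<in> A ==> solution_family j T (E i) (s i)"
 shows "solution_family j T (%m t x. \<Sum>i\<in>A. E i m t x) (%t x. \<Sum>i\<in>A. s i t x)"
 using assms
proof (induction A rule: finite_induct)
 case empty
 thus ?case by (simp add: solution_family_def)
next
 case (insert i A)
 thus ?case using solution_family_add[of j T "E i" "s i" "%m t x. \<Sum>i\<in>A. E i m t x" "%t x. \<Sum>i\<in>A. s i t x"] by simp
qed

lemma (in ray_wave_data) solution_family_ray_wave:
 "solution_family j T (ray_wave j th a b) (%t x. integral {0..} (ray_integrand (%k. exi x k * b t k) th))"
 unfolding solution_family_def using ray_wave_x_derivative ray_wave_t_derivative by auto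

context space_family
begin

lemma ray_wave_data_rest:
 assumes "sin th = 0" "sin (real (od j) * th) = 0"
 shows "ray_wave_data j th T {k. Im k \<le> 0} (%k. c1 * rest 0 k) (%ta k. c2 * rest ta k)"
proof
 have b: "exp (- (r * sin th * x)) * (1 + r) ^ (2 * j + 3) * norm (c * rest t (pol r th)) \<le> norm c * K"
  if "r \<ge> 0" "t \<in> {0..T}" for r t c x
 proof -
  have "norm (rest t (pol r th)) \<le> K / (1 + norm (pol r th)) ^ M"
   by (rule norm_rest) (use that assms in auto)
  hence n: "norm (rest t (pol r th)) \<le> K / (1 + r) ^ M" using that by (simp add: norm_mult)
  have "(1 + r) ^ (2 * j + 3) * norm (rest t (pol r th)) \<le> (1 + r) ^ M * norm (rest t (pol r th))"
   using that by (intro mult_right_mono power_increasing) auto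
  also have "\<dots> \<le> K" using n that by (simp add: pos_le_divide_eq mult.commute)
  finally have "norm c * ((1 + r) ^ (2 * j + 3) * norm (rest t (pol r th))) \<le> norm c * K"
   by (intro mult_left_mono) auto
  thus ?thesis using assms by (simp add: norm_mult mult_ac)
 qed
 show "\<exists>C. \<forall>r\<ge>0. exp (- (r * sin th * x)) * (1 + r) ^ (2 * j + 3) * norm (c1 * rest 0 (pol r th)) \<le> C" for x
  using b[of _ 0 x c1] T by auto
 show "\<exists>C. \<forall>ta\<in>{0..T}. \<forall>r\<ge>0. exp (- (r * sin th * x)) * (1 + r) ^ (2 * j + 3) * norm (c2 * rest ta (pol r th)) \<le> C" for x
  using b[of _ _ x c2] by (intro exI[of _ "norm c2 * K"]) blast
 show "continuous_on {k. Im k \<le> 0} (%k. c1 * rest 0 k)"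
  using T by (intro continuous_intros continuous_on_section'[OF cont_rest]) auto
 show "continuous_on ({0..T} \<times> {k. Im k \<le> 0}) (%(ta, k). c2 * rest ta k)"
  using cont_rest unfolding case_prod_unfold by (intro continuous_intros)
qed (use T assms in auto)

lemma ray_wave_data_slow:
 assumes "sin th > 0" "sin (real (od j) * th) \<ge> 0" "\<And>r. r \<ge> 0 ==> pol r th \<in> cone"
 shows "ray_wave_data j th T cone (%k. c1 * slow 0 k) (%ta k. c2 * slow ta k)"
proof
 have b: "exp (- (r * sin th * x)) * (1 + r) ^ (2 * j + 3) * norm (c * slow t (pol r th)) \<le>
   (exp (sin th * x) * fact (2 * j + 3) / (sin th * x) ^ (2 * j + 3)) * (norm c * K)"
  if "r \<ge> 0" "t \<in> {0..T}" "x > 0" for r t c x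
 proof -
  have "norm (slow t (pol r th)) \<le> K / (1 + norm (pol r th))"
   by (rule norm_slow) (use that assms in auto)
  also have "\<dots> \<le> K / 1" using K_nonneg by (intro divide_left_mono) (auto simp: add_pos_nonneg)
  finally have n: "norm (c * slow t (pol r th)) \<le> norm c * K"
   unfolding norm_mult by (intro mult_left_mono) auto
  have e: "(1 + r) ^ (2 * j + 3) * exp (- ((sin th * x) * r)) \<le> exp (sin th * x) * fact (2 * j + 3) / (sin th * x) ^ (2 * j + 3)"
   by (rule exp_beats_power) (use that assms in auto)
  have "((1 + r) ^ (2 * j + 3) * exp (- ((sin th * x) * r))) * norm (c * slow t (pol r th)) \<le>
   (exp (sin th * x) * fact (2 * j + 3) / (sin th * x) ^ (2 * j + 3)) * (norm c * K)"
   using that assms by (intro mult_mono e n) auto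
  thus ?thesis by (simp only: mult_ac)
 qed
 show "\<exists>C. \<forall>r\<ge>0. exp (- (r * sin th * x)) * (1 + r) ^ (2 * j + 3) * norm (c1 * slow 0 (pol r th)) \<le> C" if "x > 0" for x
  using b[of _ 0 x c1] T that by (meson atLeastAtMost_iff less_imp_le order_refl)
 show "\<exists>C. \<forall>ta\<in>{0..T}. \<forall>r\<ge>0. exp (- (r * sin th * x)) * (1 + r) ^ (2 * j + 3) * norm (c2 * slow ta (pol r th)) \<le> C" if "x > 0" for x
  using b[of _ _ x c2] that by blast
 show "continuous_on cone (%k. c1 * slow 0 k)"
  using T by (intro continuous_intros continuous_on_section'[OF cont_slow]) auto
 show "continuous_on ({0..T} \<times> cone) (%(ta, k). c2 * slow ta k)"
  using cont_slow unfolding case_prod_unfold by (intro continuous_intros)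
qed (use T assms in auto)

lemma rays: 
 "sin 0 = (0::real)" "sin (real (od j) * 0) = 0" "sin pi = (0::real)" "sin (real (od j) * pi) = 0"
 "sin (eps j) > 0" "sin (real (od j) * eps j) \<ge> 0" "sin (pi - eps j) > 0" "sin (real (od j) * (pi - eps j)) \<ge> 0"
proof -
 have "eps j < pi" using eps_bounds(2)[of j] pi_gt_zero by linarith
 thus "sin (eps j) > 0" using eps_bounds by (intro sin_gt_zero)
 thus "sin (pi - eps j) > 0" by (simp add: sin_diff)
 show "sin (real (od j) * eps j) \<ge> 0" using eps_bounds(1)[of j] by (intro sin_multiple_near_0) auto
 thus "sin (real (od j) * (pi - eps j)) \<ge> 0" unfolding sin_multiple_reflect .
 show "sin (real (od j) * pi) = 0" by (rule sin_npi)
qed auto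

lemma in_cone_near_0: "r \<ge> 0 ==> 0 \<le> th ==> th \<le> eps j ==> pol r th \<in> cone"
 using eps_bounds(2)[of j] by (intro ray_in_cone_near_0) auto

lemma in_cone_near_pi: "r \<ge> 0 ==> pi - eps j \<le> th ==> th \<le> pi ==> pol r th \<in> cone"
 using eps_bounds(2)[of j] by (intro ray_in_cone) auto

lemmas data_rest = ray_wave_data_rest[OF rays(1,2)] ray_wave_data_rest[OF rays(3,4)]

lemma data_slow:
 "ray_wave_data j (eps j) T cone (%k. c1 * slow 0 k) (%ta k. c2 * slow ta k)"
 "ray_wave_data j (pi - eps j) T cone (%k. c1 * slow 0 k) (%ta k. c2 * slow ta k)"
proof -
 show "ray_wave_data j (eps j) T cone (%k. c1 * slow 0 k) (%ta k. c2 * slow ta k)"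
  by (rule ray_wave_data_slow[OF rays(5,6)], rule in_cone_near_0) (use eps_bounds(1)[of j] in simp_all)
 show "ray_wave_data j (pi - eps j) T cone (%k. c1 * slow 0 k) (%ta k. c2 * slow ta k)"
  by (rule ray_wave_data_slow[OF rays(7,8)], rule in_cone_near_pi) (use eps_bounds(1)[of j] in simp_all)
qed

text \<open>The integral over the line, and its derivatives, with the slow part moved to the rotated rays.
 The constants select the initial data (\<open>c1\<close>) or the source (\<open>c2\<close>).\<close>

definition line_family :: "complex => complex => nat => real => real => complex" where
 "line_family c1 c2 m t x =
   (ray_wave j 0 (%k. c1 * rest 0 k) (%ta k. c2 * rest ta k) m t x
   - ray_wave j pi (%k. c1 * rest 0 k) (%ta k. c2 * rest ta k) m t x)
  + (ray_wave j (eps j) (%k. c1 * slow 0 k) (%ta k. c2 * slow ta k) m t x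
   - ray_wave j (pi - eps j) (%k. c1 * slow 0 k) (%ta k. c2 * slow ta k) m t x)"

text \<open>The factor besides \<open>exp (\<i> * k * x)\<close> stays bounded near the real axis, where the time
 evolution does not grow; so the rays of the slow part may be rotated back to the real axis.\<close>

lemma norm_slow_evolution:
 assumes t: "t \<in> {0..T}" and r: "r \<ge> 0" and s: "sin (real (od j) * th) \<ge> 0" and c: "pol r th \<in> cone"
 shows "norm (exi t ((pol r th) ^ od j) *
   (c1 * slow 0 (pol r th) + c2 * duhamel (od j) slow t (pol r th)))
   \<le> (norm c1 * K + norm c2 * (K * T)) / (1 + r)"
proof -
 define k where "k = pol r th"
 have nk: "norm k = r" using r by (simp add: k_def norm_mult)
 have Imk: "Im (k ^ od j) \<ge> 0" unfolding k_def Im_ray_power using s r by simp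
 have kc: "k \<in> cone" using c by (simp add: k_def)
 have ns: "norm (slow ta k) \<le> K / (1 + r)" if "ta \<in> {0..T}" for ta
  using norm_slow[OF that kc] nk by simp
 have e: "norm (exi t (k ^ od j)) \<le> 1"
  unfolding norm_exp_i_of_real using mult_nonneg_nonneg[OF Imk, of t] t by simp
 have "norm (integral {0..t} (%ta. exi (t - ta) (k ^ od j) * slow ta k)) \<le> K / (1 + r) * (t - 0)"
 proof (rule norm_time_integral_le)
  show "continuous_on {0..t} (%ta. slow ta k)"
   by (rule continuous_on_subset[OF continuous_on_section[OF cont_slow kc]]) (use t in auto)
  show "Im (k ^ od j) * (t - ta) \<ge> 0" if "ta \<in> {0..t}" for ta using Imk that by simp
 qed (use ns t in auto)
 also have "\<dots> \<le> K / (1 + r) * T" using t r K_nonneg by (intro mult_left_mono) auto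
 finally have nd: "norm (exi t (k ^ od j) * duhamel (od j) slow t k) \<le> K * T / (1 + r)"
  unfolding exp_mult_duhamel by simp
 have na: "norm (exi t (k ^ od j) * slow 0 k) \<le> 1 * (K / (1 + r))"
  unfolding norm_mult by (intro mult_mono e ns) (use T in auto)
 have "exi t (k ^ od j) * (c1 * slow 0 k + c2 * duhamel (od j) slow t k) =
   c1 * (exi t (k ^ od j) * slow 0 k) + c2 * (exi t (k ^ od j) * duhamel (od j) slow t k)"
  by (simp add: algebra_simps)
 also have "norm \<dots> \<le> norm c1 * (K / (1 + r)) + norm c2 * (K * T / (1 + r))"
 proof (rule order_trans[OF norm_triangle_ineq add_mono])
  show "norm (c1 * (exi t (k ^ od j) * slow 0 k)) \<le> norm c1 * (K / (1 + r))"
   unfolding norm_mult[of c1] using na unfolding mult_1_left by (rule mult_left_mono) simp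
  show "norm (c2 * (exi t (k ^ od j) * duhamel (od j) slow t k)) \<le> norm c2 * (K * T / (1 + r))"
   unfolding norm_mult[of c2] using nd by (rule mult_left_mono) simp
 qed
 finally show ?thesis unfolding k_def[symmetric] by (simp add: add_divide_distrib)
qed

lemma slow_rays_agree:
 assumes t: "t \<in> {0..T}" and x: "x > 0"
 shows "rays_agree (wave j (%k. c1 * slow 0 k) (%ta k. c2 * slow ta k) 0 t x) 0 (eps j)"
  "rays_agree (wave j (%k. c1 * slow 0 k) (%ta k. c2 * slow ta k) 0 t x) (pi - eps j) pi"
proof -
 define g where "g = (%k. exi t (k ^ od j) * (c1 * slow 0 k + c2 * duhamel (od j) slow t k))"
 have eq: "wave j (%k. c1 * slow 0 k) (%ta k. c2 * slow ta k) 0 t x = (%k. exi x (k ^ 1) * g k)"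
  by (rule ext) (simp only: wave_def g_def phase_split duhamel_scale power_0 mult_1_left power_one_right mult.assoc)
 have gd: "g field_differentiable at k" if "k \<in> cone" for k
  unfolding g_def
  by (intro derivative_intros field_differentiable_exp_power slow_field_differentiable duhamel_slow_field_differentiable
    one_plus_i_nonzero_cone that t field_differentiable_mult field_differentiable_add)
 have gc: "continuous_on A g" if "A \<subseteq> cone" for A
  by (rule continuous_at_imp_continuous_on) (use gd that field_differentiable_imp_continuous_at in blast)
 show "rays_agree (wave j (%k. c1 * slow 0 k) (%ta k. c2 * slow ta k) 0 t x) 0 (eps j)"
  unfolding eq
 proof (rule rays_agree_jordan[where C="norm c1 * K + norm c2 * (K * T)"])
  show "continuous_on (wedge 0 (eps j)) g" by (rule gc) (auto simp: wedge_def in_cone_near_0)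
  show "norm (g (pol r th)) \<le> (norm c1 * K + norm c2 * (K * T)) / (1 + r)"
   if "r \<ge> 0" "0 \<le> th" "th \<le> eps j" for r th
   unfolding g_def using that by (intro norm_slow_evolution t sin_multiple_near_0 in_cone_near_0)
  show "x * sin (real 1 * th) > 0" if "0 < th" "th < eps j" for th
   using that x eps_bounds(2)[of j] sin_gt_zero[of th] by simp
  show "x * sin (real 1 * th) \<ge> 0" if "0 \<le> th" "th \<le> eps j" for th
   using that x eps_bounds(2)[of j] sin_ge_zero[of th] by simp
 qed (use eps_bounds[of j] in \<open>auto intro!: gd in_cone_near_0\<close>)
 show "rays_agree (wave j (%k. c1 * slow 0 k) (%ta k. c2 * slow ta k) 0 t x) (pi - eps j) pi"
  unfolding eq
 proof (rule rays_agree_jordan[where C="norm c1 * K + norm c2 * (K * T)"])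
  show "continuous_on (wedge (pi - eps j) pi) g" by (rule gc) (auto simp: wedge_def in_cone_near_pi)
  show "norm (g (pol r th)) \<le> (norm c1 * K + norm c2 * (K * T)) / (1 + r)"
   if "r \<ge> 0" "pi - eps j \<le> th" "th \<le> pi" for r th
   unfolding g_def using that sin_multiple_near_0[of "pi - th" j] sin_multiple_reflect[of j "pi - th"]
   by (intro norm_slow_evolution t in_cone_near_pi) auto
  show "x * sin (real 1 * th) > 0" if "pi - eps j < th" "th < pi" for th
   using that x eps_bounds(2)[of j] sin_gt_zero[of th] by simp
  show "x * sin (real 1 * th) \<ge> 0" if "pi - eps j \<le> th" "th \<le> pi" for th
   using that x eps_bounds(2)[of j] sin_ge_zero[of th] by simp
 qed (use eps_bounds[of j] in \<open>auto intro!: gd in_cone_near_pi\<close>)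
qed

lemma Im_real_ray: "Im (pol r 0) \<le> 0" "Im (pol r pi) \<le> 0" by auto

lemma wave_ft_split:
 assumes "t \<in> {0..T}" "Im k \<le> 0"
 shows "wave j (%k. c1 * ft 0 k) (%ta k. c2 * ft ta k) m t x k =
  wave j (%k. c1 * rest 0 k) (%ta k. c2 * rest ta k) m t x k + wave j (%k. c1 * slow 0 k) (%ta k. c2 * slow ta k) m t x k"
 unfolding wave_def duhamel_scale duhamel_ft_split[OF assms] using ft_split[of 0 k] assms(2) T
 by (simp add: algebra_simps)

lemma line_rays:
 assumes t: "t \<in> {0..T}" and x: "x > 0"
 shows "(ray_integrand (wave j (%k. c1 * ft 0 k) (%ta k. c2 * ft ta k) 0 t x) 0 has_integral
   (ray_wave j 0 (%k. c1 * rest 0 k) (%ta k. c2 * rest ta k) 0 t x + ray_wave j (eps j) (%k. c1 * slow 0 k) (%ta k. c2 * slow ta k) 0 t x)) {0..}"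
  "(ray_integrand (wave j (%k. c1 * ft 0 k) (%ta k. c2 * ft ta k) 0 t x) pi has_integral
   (ray_wave j pi (%k. c1 * rest 0 k) (%ta k. c2 * rest ta k) 0 t x + ray_wave j (pi - eps j) (%k. c1 * slow 0 k) (%ta k. c2 * slow ta k) 0 t x)) {0..}"
proof -
 have r0: "(ray_integrand (wave j (%k. c1 * rest 0 k) (%ta k. c2 * rest ta k) 0 t x) 0 has_integral
   ray_wave j 0 (%k. c1 * rest 0 k) (%ta k. c2 * rest ta k) 0 t x) {0..}"
  unfolding ray_wave_def by (rule integrable_integral[OF ray_wave_data.integrable_wave(1)[OF data_rest(1) _ t x]]) simp
 have rp: "(ray_integrand (wave j (%k. c1 * rest 0 k) (%ta k. c2 * rest ta k) 0 t x) pi has_integral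
   ray_wave j pi (%k. c1 * rest 0 k) (%ta k. c2 * rest ta k) 0 t x) {0..}"
  unfolding ray_wave_def by (rule integrable_integral[OF ray_wave_data.integrable_wave(1)[OF data_rest(2) _ t x]]) simp
 have "(ray_integrand (wave j (%k. c1 * slow 0 k) (%ta k. c2 * slow ta k) 0 t x) (eps j) has_integral
   ray_wave j (eps j) (%k. c1 * slow 0 k) (%ta k. c2 * slow ta k) 0 t x) {0..}"
  unfolding ray_wave_def by (rule integrable_integral[OF ray_wave_data.integrable_wave(1)[OF data_slow(1) _ t x]]) simp
 hence s0: "(ray_integrand (wave j (%k. c1 * slow 0 k) (%ta k. c2 * slow ta k) 0 t x) 0 has_integral
   ray_wave j (eps j) (%k. c1 * slow 0 k) (%ta k. c2 * slow ta k) 0 t x) {0..}"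
  using slow_rays_agree(1)[OF t x] unfolding rays_agree_def by blast
 have "(ray_integrand (wave j (%k. c1 * slow 0 k) (%ta k. c2 * slow ta k) 0 t x) (pi - eps j) has_integral
   ray_wave j (pi - eps j) (%k. c1 * slow 0 k) (%ta k. c2 * slow ta k) 0 t x) {0..}"
  unfolding ray_wave_def by (rule integrable_integral[OF ray_wave_data.integrable_wave(1)[OF data_slow(2) _ t x]]) simp
 hence sp: "(ray_integrand (wave j (%k. c1 * slow 0 k) (%ta k. c2 * slow ta k) 0 t x) pi has_integral
   ray_wave j (pi - eps j) (%k. c1 * slow 0 k) (%ta k. c2 * slow ta k) 0 t x) {0..}"
  using slow_rays_agree(2)[OF t x] unfolding rays_agree_def by blast
 show "(ray_integrand (wave j (%k. c1 * ft 0 k) (%ta k. c2 * ft ta k) 0 t x) 0 has_integral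
   (ray_wave j 0 (%k. c1 * rest 0 k) (%ta k. c2 * rest ta k) 0 t x + ray_wave j (eps j) (%k. c1 * slow 0 k) (%ta k. c2 * slow ta k) 0 t x)) {0..}"
  using has_integral_add[OF r0 s0] unfolding ray_integrand_def wave_ft_split[OF t Im_real_ray(1)] by (simp only: distrib_right)
 show "(ray_integrand (wave j (%k. c1 * ft 0 k) (%ta k. c2 * ft ta k) 0 t x) pi has_integral
   (ray_wave j pi (%k. c1 * rest 0 k) (%ta k. c2 * rest ta k) 0 t x + ray_wave j (pi - eps j) (%k. c1 * slow 0 k) (%ta k. c2 * slow ta k) 0 t x)) {0..}"
  using has_integral_add[OF rp sp] unfolding ray_integrand_def wave_ft_split[OF t Im_real_ray(2)] by (simp only: distrib_right)
qed

text \<open>For \<open>m = 0\<close> the rotated rays give the integral over the line itself.\<close>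

theorem line_family_integral:
 assumes t: "t \<in> {0..T}" and x: "x > 0"
 shows "((%k. wave j (%k. c1 * ft 0 k) (%ta k. c2 * ft ta k) 0 t x (of_real k)) has_integral line_family c1 c2 0 t x) UNIV"
 using has_integral_line_from_rays[OF line_rays[OF assms]] by (simp add: line_family_def algebra_simps)

lemma inversion_split:
 assumes x: "x > 0"
 shows "line_family 1 0 0 0 x = 2 * of_real pi * G 0 0 x"
proof -
 have t: "0 \<in> {0..T}" using T by simp
 have "\<exists>I0 Ip. (ray_integrand (%k. exi x k * half_line_ft (G 0 0) k) 0 has_integral I0) {0..} \<and>
  (ray_integrand (%k. exi x k * half_line_ft (G 0 0) k) pi has_integral Ip) {0..} \<and>
  I0 - Ip = 2 * of_real pi * G 0 0 x"
 proof (rule half_line_ft_inversion[of "G 0 0" "G (Suc 0) 0" "G (Suc (Suc 0)) 0" C x])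
  show "(G 0 0 has_vector_derivative G (Suc 0) 0 y) (at y within {0..})" if "y \<ge> 0" for y
   by (rule der[OF _ t that]) simp
  show "(G (Suc 0) 0 has_vector_derivative G (Suc (Suc 0)) 0 y) (at y within {0..})" if "y \<ge> 0" for y
   by (rule der[OF _ t that]) simp
  show "continuous_on {0..} (G (Suc (Suc 0)) 0)" by (rule cont_x[OF _ t]) simp
  show "norm (G 0 0 y) \<le> C / (1 + y) ^ 3" "norm (G (Suc 0) 0 y) \<le> C / (1 + y) ^ 3" if "y \<ge> 0" for y
   by (rule bound[OF _ t that]; simp)+
 qed (use x in blast)+
 then obtain I0 Ip where I: "(ray_integrand (%k. exi x k * half_line_ft (G 0 0) k) 0 has_integral I0) {0..}"
  "(ray_integrand (%k. exi x k * half_line_ft (G 0 0) k) pi has_integral Ip) {0..}"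
  "I0 - Ip = 2 * of_real pi * G 0 0 x" by blast
 have eq: "wave j (%k. 1 * ft 0 k) (%ta k. 0 * ft ta k) 0 0 x = (%k. exi x k * half_line_ft (G 0 0) k)"
  unfolding wave_0_0[abs_def] ft_def by simp
 show ?thesis
  using has_integral_unique[OF line_rays(1)[OF t x, of 1 0, unfolded eq] I(1)]
   has_integral_unique[OF line_rays(2)[OF t x, of 1 0, unfolded eq] I(2)] I(3)
  by (simp add: line_family_def algebra_simps)
qed

end

text \<open>Inversion at an arbitrary time is inversion at time zero for the family frozen at that time.\<close>

lemma (in space_family) frozen: "t \<in> {0..T} ==> space_family j T C (%b _. G b t)"
proof
 fix b assume t: "t \<in> {0..T}" and b: "b \<le> 2 * j + 4"
 show "continuous_on ({0..T} \<times> {0..}) (%(s, x). G b t x)"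
  unfolding case_prod_unfold by (rule continuous_on_compose2[OF cont_x[OF b t]]) (auto intro!: continuous_intros)
qed (use T der bound in auto)

lemma (in space_family) source_integral:
 assumes t: "t \<in> {0..T}" and x: "x > 0"
 shows "(integral {0..} (ray_integrand (%k. exi x k * rest t k) 0)
   - integral {0..} (ray_integrand (%k. exi x k * rest t k) pi))
   + (integral {0..} (ray_integrand (%k. exi x k * slow t k) (eps j))
   - integral {0..} (ray_integrand (%k. exi x k * slow t k) (pi - eps j))) = 2 * of_real pi * G 0 t x"
proof -
 interpret F: space_family j T C "%b _. G b t" by (rule frozen[OF t])
 have "F.rest 0 = rest t" "F.slow 0 = slow t"
  by (simp_all add: fun_eq_iff F.rest_def rest_def F.slow_def slow_def F.co_def co_def F.remainder_def remainder_def)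
 thus ?thesis
  using F.inversion_split[OF x] by (simp add: F.line_family_def ray_wave_def wave_0_0[abs_def])
qed

text \<open>The source produced by the rays is the inversion integral of the transform of the source.\<close>

theorem (in space_family) line_family_solution:
 "solution_family j T (line_family c1 c2) (%t x. c2 * (2 * of_real pi * G 0 t x))"
proof -
 define X where "X th a b = solution_family j T (ray_wave j th a b) (%t x. integral {0..} (ray_integrand (%k. exi x k * b t k) th))" for th a b
 have "solution_family j T (line_family c1 c2) (%t x.
   (integral {0..} (ray_integrand (%k. exi x k * (c2 * rest t k)) 0)
    - integral {0..} (ray_integrand (%k. exi x k * (c2 * rest t k)) pi))
   + (integral {0..} (ray_integrand (%k. exi x k * (c2 * slow t k)) (eps j))
    - integral {0..} (ray_integrand (%k. exi x k * (c2 * slow t k)) (pi - eps j))))"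
  unfolding line_family_def[abs_def]
  by (intro solution_family_add solution_family_diff)
    (rule ray_wave_data.solution_family_ray_wave, rule data_rest data_slow)+
 moreover have sc: "integral {0..} (ray_integrand (%k. exi x k * (c2 * h k)) th) =
   c2 * integral {0..} (ray_integrand (%k. exi x k * h k) th)" for x h th
 proof -
  have "ray_integrand (%k. exi x k * (c2 * h k)) th = (%r. c2 * ray_integrand (%k. exi x k * h k) th r)"
   by (simp add: fun_eq_iff ray_integrand_def)
  thus ?thesis by simp
 qed
 ultimately have "solution_family j T (line_family c1 c2) (%t x. c2 * (
   (integral {0..} (ray_integrand (%k. exi x k * rest t k) 0)
    - integral {0..} (ray_integrand (%k. exi x k * rest t k) pi))
   + (integral {0..} (ray_integrand (%k. exi x k * slow t k) (eps j))
    - integral {0..} (ray_integrand (%k. exi x k * slow t k) (pi - eps j)))))"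
  by (simp only: sc right_diff_distrib distrib_left)
 thus ?thesis unfolding solution_family_def by (simp add: source_integral)
qed

section \<open>Sector boundaries\<close>

text \<open>Angles are measured in units of \<open>pi / (od j)\<close>.\<close>

definition ang :: "nat => real => real" where
 "ang j s = s * pi / real (od j)"

lemma lower_angle_eq: "lower_angle j p = ang j (2 * real p - 1)"
 by (simp add: lower_angle_def ang_def)

lemma upper_angle_eq: "upper_angle j p = ang j (2 * real p)"
 by (simp add: upper_angle_def ang_def)

lemma ang_mono: "s \<le> s' ==> ang j s \<le> ang j s'" "s < s' ==> ang j s < ang j s'"
 by (auto simp: ang_def intro!: divide_right_mono divide_strict_right_mono mult_right_mono mult_strict_right_mono)

lemma ang_simps: "ang j 0 = 0" "ang j (real (od j)) = pi" "ang j (2 * real (od j)) = 2 * pi"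
 "ang j (s + s') = ang j s + ang j s'" "ang j (s - s') = ang j s - ang j s'" "ang j (1 / 4) = eps j"
proof -
 have "real (od j) \<noteq> 0" by simp
 thus "ang j (real (od j)) = pi" "ang j (2 * real (od j)) = 2 * pi"
  unfolding ang_def by (simp_all del: of_nat_add of_nat_mult of_nat_Suc)
qed (auto simp: ang_def eps_def algebra_simps add_divide_distrib diff_divide_distrib)

lemma mult_ang: "real (od j) * ang j s = s * pi"
proof -
 have "real (od j) \<noteq> 0" by simp
 thus ?thesis unfolding ang_def by (simp del: of_nat_add of_nat_mult of_nat_Suc)
qed

lemma sector_angles:
 assumes "p \<in> {1..j}"
 shows "0 < lower_angle j p" "lower_angle j p < upper_angle j p" "upper_angle j p < pi"
proof -
 have p: "1 \<le> real p" "real p \<le> real j" using assms by auto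
 show "0 < lower_angle j p" using ang_mono(2)[of 0 "2 * real p - 1" j] p by (simp add: lower_angle_eq ang_simps)
 show "lower_angle j p < upper_angle j p" unfolding lower_angle_eq upper_angle_eq by (rule ang_mono) simp
 have "ang j (2 * real p) < ang j (real (od j))" using p by (intro ang_mono) simp
 thus "upper_angle j p < pi" by (simp only: upper_angle_eq ang_simps)
qed

lemma sector_sin_pos:
 assumes "p \<in> {1..j}" "lower_angle j p \<le> th" "th \<le> upper_angle j p"
 shows "sin th > 0"
 using sector_angles[OF assms(1)] assms(2,3) by (intro sin_gt_zero) auto

lemma sin_npi_real: "sin (real_of_int m * pi) = 0"
 using sin_npi_int[of m] by (simp add: mult.commute)

lemma sector_sin_d:
 "sin (real (od j) * lower_angle j p) = 0" "sin (real (od j) * upper_angle j p) = 0"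
proof -
 show "sin (real (od j) * lower_angle j p) = 0"
  unfolding lower_angle_eq mult_ang using sin_npi_real[of "2 * int p - 1"] by simp
 show "sin (real (od j) * upper_angle j p) = 0"
 proof -
  have "real (od j) * upper_angle j p = real_of_int (2 * int p) * pi" unfolding upper_angle_eq mult_ang by simp
  thus ?thesis by (simp only: sin_npi_real)
 qed
qed

lemma sin_shift_2pi_int: "sin (x + 2 * real_of_int m * pi) = sin x"
proof -
 have "2 * real_of_int m * pi = 2 * pi * real_of_int m" by simp
 thus ?thesis using sin_int_2pin[of m] cos_int_2pin[of m] by (simp only: sin_add)
qed

lemma sector_sin_d_nonpos:
 assumes "lower_angle j p \<le> th" "th \<le> upper_angle j p"
 shows "sin (real (od j) * th) \<le> 0"
proof -
 define u where "u = 2 * real p * pi - real (od j) * th"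
 have "real (od j) * lower_angle j p \<le> real (od j) * th" "real (od j) * th \<le> real (od j) * upper_angle j p"
  using assms by (auto intro!: mult_left_mono)
 hence "0 \<le> u" "u \<le> pi" unfolding lower_angle_eq upper_angle_eq mult_ang u_def by (auto simp: algebra_simps)
 hence "sin u \<ge> 0" by (rule sin_ge_zero)
 moreover have "sin (real (od j) * th) = - sin u"
 proof -
  have "real (od j) * th = - u + 2 * real_of_int (int p) * pi" by (simp add: u_def)
  thus ?thesis by (simp only: sin_shift_2pi_int sin_minus)
 qed
 ultimately show ?thesis by simp
qed

lemma alpha_cis: "alpha j p n = cis (ang j (2 * real (j - p + n)))"
 unfolding alpha_def root_omega_eq_cis Complex.DeMoivre by (simp add: ang_def mult_ac)

lemma alpha_ray: "alpha j p n * (pol r th) = of_real r * cis (th + ang j (2 * real (j - p + n)))"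
 unfolding alpha_cis by (simp add: cis_mult[symmetric] mult_ac)

lemma alpha_power_mult: "(alpha j p n * k) ^ od j = k ^ od j"
 unfolding power_mult_distrib alpha_power_period by simp

lemma alpha_angle_range:
 assumes p: "p \<in> {1..j}" and n: "n \<in> {1..j+1}"
 shows "lower_angle j p \<le> th ==> pi \<le> th + ang j (2 * real (j - p + n))"
  "th \<le> upper_angle j p ==> th + ang j (2 * real (j - p + n)) \<le> 2 * pi"
  "lower_angle j p < th ==> pi < th + ang j (2 * real (j - p + n))"
  "th < upper_angle j p ==> th + ang j (2 * real (j - p + n)) < 2 * pi"
proof -
 have r: "2 * real (j - p + n) = 2 * real j - 2 * real p + 2 * real n" using p by (simp add: of_nat_diff)
 have n': "1 \<le> real n" "real n \<le> real j + 1" using n by auto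
 have "ang j (real (od j)) \<le> ang j (2 * real p - 1 + 2 * real (j - p + n))"
  unfolding r using n' by (intro ang_mono) simp
 hence lo: "pi \<le> lower_angle j p + ang j (2 * real (j - p + n))" by (simp only: ang_simps lower_angle_eq)
 have "ang j (2 * real p + 2 * real (j - p + n)) \<le> ang j (2 * real (od j))"
  unfolding r using n' by (intro ang_mono) simp
 hence up: "upper_angle j p + ang j (2 * real (j - p + n)) \<le> 2 * pi" by (simp only: ang_simps upper_angle_eq)
 show "lower_angle j p \<le> th ==> pi \<le> th + ang j (2 * real (j - p + n))"
  "th \<le> upper_angle j p ==> th + ang j (2 * real (j - p + n)) \<le> 2 * pi"
  "lower_angle j p < th ==> pi < th + ang j (2 * real (j - p + n))"
  "th < upper_angle j p ==> th + ang j (2 * real (j - p + n)) < 2 * pi"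
  using lo up by linarith+
qed

text \<open>Multiplication by \<open>alpha j p n\<close> carries the sector into the lower half-plane, where the transforms
 are defined and analytic.\<close>

lemma alpha_lower:
 assumes p: "p \<in> {1..j}" and n: "n \<in> {1..j+1}" and r: "r \<ge> 0"
 shows "lower_angle j p \<le> th ==> th \<le> upper_angle j p ==> Im (alpha j p n * (pol r th)) \<le> 0"
  "r > 0 ==> lower_angle j p < th ==> th < upper_angle j p ==> Im (alpha j p n * (pol r th)) < 0"
proof -
 define \<psi> where "\<psi> = th + ang j (2 * real (j - p + n))"
 have s: "sin \<psi> = - sin (\<psi> - pi)" by (simp add: sin_diff)
 have im: "Im (alpha j p n * (pol r th)) = r * sin \<psi>" unfolding alpha_ray \<psi>_def by simp
 show "Im (alpha j p n * (pol r th)) \<le> 0" if "lower_angle j p \<le> th" "th \<le> upper_angle j p"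
 proof -
  have "sin (\<psi> - pi) \<ge> 0" using alpha_angle_range[OF p n] that by (intro sin_ge_zero) (auto simp: \<psi>_def)
  hence "sin \<psi> \<le> 0" using s by linarith
  thus ?thesis unfolding im using r by (intro mult_nonneg_nonpos)
 qed
 show "Im (alpha j p n * (pol r th)) < 0" if "r > 0" "lower_angle j p < th" "th < upper_angle j p"
 proof -
  have "sin (\<psi> - pi) > 0" using alpha_angle_range[OF p n] that by (intro sin_gt_zero) (auto simp: \<psi>_def)
  hence "sin \<psi> < 0" using s by linarith
  thus ?thesis unfolding im using that(1) by (intro mult_pos_neg)
 qed
qed

subsection \<open>Waves along a sector boundary\<close>

definition sector_family :: "nat => nat => (complex => complex) => nat => real => real => complex" where
 "sector_family j p h m t x =
   ray_wave j (lower_angle j p) h (%_ _. 0) m t x - ray_wave j (upper_angle j p) h (%_ _. 0) m t x"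

lemma duhamel_zero [simp]: "duhamel n (%_ _. 0) t k = 0"
 by (simp add: duhamel_def)

lemma wave_amplitude: "wave j h (%_ _. 0) 0 t x = (%k. phase j t x k * h k)"
 by (rule ext) (simp add: wave_def)

lemma sector_family_0: "sector_family j p h 0 t x = sector_integral j p (%k. phase j t x k * h k)"
 by (simp add: sector_family_def sector_integral_def ray_wave_def wave_amplitude)

lemma ray_wave_data_poly:
 assumes T: "0 < T" and s: "sin th > 0" "sin (real (od j) * th) \<ge> 0"
  and cont: "continuous_on (wedge th th) h"
  and bound: "\<And>r. r \<ge> 0 ==> norm (h (pol r th)) \<le> C * (1 + r) ^ q"
 shows "ray_wave_data j th T (wedge th th) h (%_ _. 0)"
proof
 have C: "C \<ge> 0" using order_trans[OF norm_ge_zero bound[of 0]] by simp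
 show "\<exists>B. \<forall>r\<ge>0. exp (- (r * sin th * x)) * (1 + r) ^ (2 * j + 3) * norm (h (pol r th)) \<le> B" if "x > 0" for x
 proof (intro exI allI impI)
  fix r :: real assume r: "r \<ge> 0"
  have "exp (- (r * sin th * x)) * (1 + r) ^ (2 * j + 3) * norm (h (pol r th)) \<le>
    exp (- (r * sin th * x)) * (1 + r) ^ (2 * j + 3) * (C * (1 + r) ^ q)"
   using bound[OF r] r by (intro mult_left_mono) auto
  also have "\<dots> = C * ((1 + r) ^ (2 * j + 3 + q) * exp (- ((sin th * x) * r)))" by (simp only: power_add mult_ac)
  also have "\<dots> \<le> C * (exp (sin th * x) * fact (2 * j + 3 + q) / (sin th * x) ^ (2 * j + 3 + q))"
   using C s that r by (intro mult_left_mono exp_beats_power) auto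
  finally show "exp (- (r * sin th * x)) * (1 + r) ^ (2 * j + 3) * norm (h (pol r th)) \<le>
    C * (exp (sin th * x) * fact (2 * j + 3 + q) / (sin th * x) ^ (2 * j + 3 + q))" .
 qed
qed (use assms in \<open>auto simp: ray_in_wedge\<close>)

lemma wedge_mono: "a \<le> a' ==> b' \<le> b ==> wedge a' b' \<subseteq> wedge a b"
 unfolding wedge_def by force

context
 fixes j p :: nat and T C :: real and q :: nat and h :: "complex => complex"
 assumes T: "0 < T" and p: "p \<in> {1..j}"
  and cont: "\<And>th. th \<in> edges j p ==> continuous_on (wedge th th) h"
  and bound: "\<And>r th. r \<ge> 0 ==> th \<in> edges j p ==>
   norm (h (pol r th)) \<le> C * (1 + r) ^ q"
begin

lemma sector_ray_wave_data:
 "th \<in> edges j p ==> ray_wave_data j th T (wedge th th) h (%_ _. 0)"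
proof (rule ray_wave_data_poly[OF T])
 assume th: "th \<in> edges j p"
 thus "sin th > 0" using sector_angles[OF p] sector_sin_pos[OF p] by fastforce
 show "sin (real (od j) * th) \<ge> 0" using th sector_sin_d[of j p] by (metis insertE order_refl singletonD)
 show "norm (h (pol r th)) \<le> C * (1 + r) ^ q" if "r \<ge> 0" for r by (rule bound[OF that th])
qed (rule cont)

lemma sector_family_integrable:
 assumes "t \<in> {0..T}" "x > 0"
 shows "sector_integrable j p (%k. phase j t x k * h k)"
 using ray_wave_data.integrable_wave(1)[OF sector_ray_wave_data _ assms, of _ 0]
 by (simp add: sector_integrable_def wave_amplitude)

lemma sector_family_solution: "solution_family j T (sector_family j p h) (%_ _. 0)"
proof -
 have z: "ray_integrand (%k. 0) th = (%_. 0)" for th by (simp add: ray_integrand_def fun_eq_iff)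
 have "solution_family j T (sector_family j p h) (%t x. 0 - 0)"
  unfolding sector_family_def[abs_def]
  by (rule solution_family_diff)
    (use ray_wave_data.solution_family_ray_wave[OF sector_ray_wave_data] in \<open>simp_all add: z\<close>)
 thus ?thesis by simp
qed

end

lemma sector_closes:
 assumes p: "p \<in> {1..j}"
  and cont: "continuous_on (wedge (lower_angle j p) (upper_angle j p)) h"
  and bound: "\<And>r th. r \<ge> 0 ==> lower_angle j p \<le> th ==> th \<le> upper_angle j p ==>
   norm (h (pol r th)) \<le> C * (1 + r) ^ q"
  and holo: "\<And>r th. r > 0 ==> lower_angle j p < th ==> th < upper_angle j p ==> h field_differentiable at (pol r th)"
  and x: "x > 0"
 shows "sector_integral j p (%k. exi x k * h k) = 0"
proof -
 have "rays_agree (%k. exi x (k ^ 1) * h k) (lower_angle j p) (upper_angle j p)"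
  by (rule rays_agree_exp_decay[OF _ _ cont holo _ _ bound]) (use sector_angles[OF p] sector_sin_pos[OF p] x in auto)
 thus ?thesis unfolding sector_integral_def using rays_agree_integral by fastforce
qed

subsection \<open>Closing a sector around the pole\<close>

lemma wedge_bound_of_eventual:
 fixes h :: "complex => complex"
 assumes cont: "continuous_on (wedge a b) h"
  and ev: "\<And>r th. r \<ge> L ==> r \<ge> 0 ==> a \<le> th ==> th \<le> b ==> norm (h (pol r th)) \<le> C * (1 + r) ^ q"
 obtains B where "B \<ge> 0" "\<And>r th. r \<ge> 0 ==> a \<le> th ==> th \<le> b ==> norm (h (pol r th)) \<le> B * (1 + r) ^ q"
proof -
 have "continuous_on ({0..L} \<times> {a..b}) (%z. h (pol (fst z) (snd z)))"
  by (intro continuous_on_compose2[OF cont] continuous_intros) (auto simp: ray_in_wedge)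
 hence "compact ((%z. h (pol (fst z) (snd z))) ` ({0..L} \<times> {a..b}))"
  by (rule compact_continuous_image) (intro compact_Times compact_Icc)
 hence "bounded ((%z. h (pol (fst z) (snd z))) ` ({0..L} \<times> {a..b}))" by (rule compact_imp_bounded)
 then obtain B0 where "\<forall>w\<in>(%z. h (pol (fst z) (snd z))) ` ({0..L} \<times> {a..b}). norm w \<le> B0"
  unfolding bounded_iff by blast
 hence B0: "norm (h (pol r th)) \<le> B0" if "0 \<le> r" "r \<le> L" "a \<le> th" "th \<le> b" for r th
  using that by force
 define B where "B = max \<bar>B0\<bar> \<bar>C\<bar>"
 have "norm (h (pol r th)) \<le> B * (1 + r) ^ q" if r: "r \<ge> 0" "a \<le> th" "th \<le> b" for r th
 proof (cases "r \<le> L")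
  case True
  have "norm (h (pol r th)) \<le> B * 1" using B0[OF r(1) True r(2,3)] by (simp add: B_def)
  also have "\<dots> \<le> B * (1 + r) ^ q" using r by (intro mult_left_mono one_le_power) (auto simp: B_def le_max_iff_disj)
  finally show ?thesis .
 next
  case False
  have "norm (h (pol r th)) \<le> C * (1 + r) ^ q" by (rule ev) (use False r in auto)
  also have "\<dots> \<le> B * (1 + r) ^ q" using r by (intro mult_right_mono) (auto simp: B_def)
  finally show ?thesis .
 qed
 moreover have "B \<ge> 0" by (simp add: B_def le_max_iff_disj)
 ultimately show ?thesis using that by blast
qed

lemma cos_eq_0_imp_half_pi: "0 < th ==> th < pi ==> cos th = 0 ==> th = pi / 2"
 by (rule cos_inj_pi) auto

lemma pole_location:
 assumes p: "p \<in> {1..j}" and r: "r \<ge> 0" and th: "lower_angle j p \<le> th" "th \<le> upper_angle j p"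
  and eq: "pol r th = \<i> * of_real \<gamma>" and "\<gamma> \<noteq> 0"
 shows "\<gamma> > 0 \<and> j = 2 * p - 1"
proof -
 have "r \<noteq> 0" using eq assms(6) by auto
 moreover have "r * cos th = 0" "r * sin th = \<gamma>" using eq by (auto simp: complex_eq_iff)
 ultimately have c: "cos th = 0" and rs: "r * sin th = \<gamma>" by auto
 have s: "sin th > 0" by (rule sector_sin_pos[OF p th])
 have "\<gamma> > 0" using rs s r \<open>r \<noteq> 0\<close> by (metis less_eq_real_def mult_pos_pos)
 moreover have "j = 2 * p - 1"
 proof -
  have th': "0 < th" "th < pi" using sector_angles[OF p] th by auto
  have "th = pi / 2" by (rule cos_eq_0_imp_half_pi[OF th' c])
  hence "real (od j) * lower_angle j p \<le> real (od j) * (pi / 2)"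
   "real (od j) * (pi / 2) \<le> real (od j) * upper_angle j p"
   using th by (auto intro!: mult_left_mono)
  hence "(2 * real p - 1) * pi \<le> (real (od j) / 2) * pi" "(real (od j) / 2) * pi \<le> (2 * real p) * pi"
   unfolding lower_angle_eq upper_angle_eq mult_ang by simp_all
  hence "2 * real p - 1 \<le> real (od j) / 2" "real (od j) / 2 \<le> 2 * real p"
   using pi_gt_zero by (auto simp only: mult_le_cancel_right_pos)
  hence "4 * real p - 2 \<le> real (od j)" "real (od j) \<le> 4 * real p" by simp_all
  hence "real (4 * p) \<le> real (2 * j + 3)" "real (od j) \<le> real (4 * p)" by simp_all
  hence "4 * p \<le> 2 * j + 3" "od j \<le> 4 * p" by (simp_all only: of_nat_le_iff)
  thus ?thesis by presburger
 qed
 ultimately show ?thesis by simp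
qed

lemma pole_factor_mult: "pole_factor \<gamma> m k = k ^ m * pole_factor \<gamma> 0 k"
 by (simp add: pole_factor_def)

lemma norm_minus_pole_ge: "r \<ge> 2 * \<bar>\<gamma>\<bar> ==> norm (pol r th - \<i> * of_real \<gamma>) \<ge> r / 2"
 using norm_triangle_ineq2[of "pol r th" "\<i> * of_real \<gamma>"] by (simp add: norm_mult)

lemma exp_over_pole_sector:
 assumes p: "p \<in> {1..j}" and \<gamma>: "\<gamma> > 0" and jp: "j = 2 * p - 1" and x: "x > 0"
 shows "sector_integral j p (%k. exi x k / (k - \<i> * of_real \<gamma>)) =
   2 * of_real pi * \<i> * exp (- of_real (\<gamma> * x))"
  "sector_integrable j p (%k. exi x k / (k - \<i> * of_real \<gamma>))"
proof -
 let ?h = "%k. exi x k / (k - \<i> * of_real \<gamma>)"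
 obtain I0 Ip where I: "(ray_integrand ?h 0 has_integral I0) {0..}" "(ray_integrand ?h pi has_integral Ip) {0..}"
  "I0 - Ip = 2 * of_real pi * \<i> * exp (- of_real (\<gamma> * x))"
  by (rule exp_over_pole_rays[OF \<gamma> x])
 have half: "ang j (real (od j) / 2) = pi / 2"
 proof -
  have "real (od j) \<noteq> 0" by simp
  thus ?thesis unfolding ang_def by (simp del: of_nat_add of_nat_mult of_nat_Suc)
 qed
 have jr: "real j = 2 * real p - 1" using jp p by (simp add: of_nat_diff)
 have lo: "lower_angle j p < pi / 2" unfolding half[symmetric] lower_angle_eq by (rule ang_mono) (simp add: jr)
 have up: "pi / 2 < upper_angle j p" unfolding half[symmetric] upper_angle_eq by (rule ang_mono) (simp add: jr)
 have agree: "rays_agree ?h a b" if ab: "0 \<le> a" "a < b" "b \<le> pi" "b < pi / 2 \<or> pi / 2 < a" for a b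
 proof -
  have nz: "pol r th - \<i> * of_real \<gamma> \<noteq> 0" if "a \<le> th" "th \<le> b" "r \<ge> 0" for r th
  proof
   assume "pol r th - \<i> * of_real \<gamma> = 0"
   hence "r * cos th = 0" "r * sin th = \<gamma>" by (auto simp: complex_eq_iff)
   hence "cos th = 0" using \<gamma> by auto
   moreover have "cos th \<noteq> 0"
   proof (cases "b < pi / 2")
    case True
    thus ?thesis using cos_gt_zero_pi[of th] that ab by auto
   next
    case False
    hence "cos (pi - th) > 0" using that ab by (intro cos_gt_zero_pi) auto
    thus ?thesis by (simp add: cos_diff)
   qed
   ultimately show False by simp
  qed
  have c: "continuous_on (wedge a b) (%k. 1 / (k - \<i> * of_real \<gamma>))"
   by (intro continuous_intros) (use nz in \<open>auto simp: wedge_def\<close>)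
  have c': "continuous_on (wedge a b) (%k. of_real (1 + norm k) * (1 / (k - \<i> * of_real \<gamma>)))"
   by (intro continuous_intros c)
  obtain B where B: "B \<ge> 0" "\<And>r th. r \<ge> 0 ==> a \<le> th ==> th \<le> b ==>
    norm (of_real (1 + norm (pol r th)) * (1 / (pol r th - \<i> * of_real \<gamma>))) \<le> B * (1 + r) ^ 0"
  proof (rule wedge_bound_of_eventual[OF c', of "max 1 (2 * \<bar>\<gamma>\<bar>)" 4 0])
   fix r th :: real assume r: "r \<ge> max 1 (2 * \<bar>\<gamma>\<bar>)" "r \<ge> 0"
   have "norm (of_real (1 + norm (pol r th)) * (1 / (pol r th - \<i> * of_real \<gamma>))) =
     (1 + r) / norm (pol r th - \<i> * of_real \<gamma>)"
    using r by (simp add: norm_mult norm_divide del: of_real_add)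
   also have "\<dots> \<le> (2 * r) / (r / 2)" using r norm_minus_pole_ge[of \<gamma> r th] by (intro frac_le) auto
   also have "\<dots> = 4" using r by simp
   finally show "norm (of_real (1 + norm (pol r th)) * (1 / (pol r th - \<i> * of_real \<gamma>))) \<le> 4 * (1 + r) ^ 0" by simp
  qed (rule that)
  have "rays_agree (%k. exi x (k ^ 1) * (1 / (k - \<i> * of_real \<gamma>))) a b"
  proof (rule rays_agree_jordan[OF _ _ c, where C=B])
   show "norm (1 / (pol r th - \<i> * of_real \<gamma>)) \<le> B / (1 + r)" if "r \<ge> 0" "a \<le> th" "th \<le> b" for r th
    using B(2)[OF that] that by (simp add: norm_mult norm_divide pos_le_divide_eq mult.commute del: of_real_add)
   show "(%k. 1 / (k - \<i> * of_real \<gamma>)) field_differentiable at (pol r th)" if "r > 0" "a < th" "th < b" for r th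
    by (intro derivative_intros) (use nz[of th r] that in auto)
   show "x * sin (real 1 * th) > 0" if "a < th" "th < b" for th using that ab x sin_gt_zero[of th] by simp
   show "x * sin (real 1 * th) \<ge> 0" if "a \<le> th" "th \<le> b" for th using that ab x sin_ge_zero[of th] by simp
  qed (use ab in auto)
  thus ?thesis by simp
 qed
 have "rays_agree ?h 0 (lower_angle j p)" "rays_agree ?h (upper_angle j p) pi"
  using sector_angles[OF p] lo up by (auto intro!: agree)
 hence L: "(ray_integrand ?h (lower_angle j p) has_integral I0) {0..}" and U: "(ray_integrand ?h (upper_angle j p) has_integral Ip) {0..}"
  using I(1,2) unfolding rays_agree_def by blast+
 show "sector_integral j p ?h = 2 * of_real pi * \<i> * exp (- of_real (\<gamma> * x))"
  unfolding sector_integral_def integral_unique[OF L] integral_unique[OF U] by (rule I(3))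
 show "sector_integrable j p ?h" unfolding sector_integrable_def using L U by blast
qed

lemma continuous_on_pole_quotient:
 fixes f q :: "complex => complex"
 assumes c: "continuous_on S f" and d: "isCont q z0" and q: "\<And>z. z \<in> S ==> z \<noteq> z0 ==> q z = (f z - w) / (z - z0)"
 shows "continuous_on S q"
 unfolding continuous_on_eq_continuous_within
proof
 fix z assume z: "z \<in> S"
 show "continuous (at z within S) q"
 proof (cases "z = z0")
  case True
  thus ?thesis using d continuous_at_imp_continuous_at_within by blast
 next
  case False
  have fz: "continuous (at z within S) f" using c z by (simp add: continuous_on_eq_continuous_within)
  have "continuous (at z within S) (%z. (f z - w) / (z - z0))"
   by (intro continuous_intros fz) (use False in auto)
  thus ?thesis
   by (rule continuous_transform_within[of _ _ _ "dist z z0"]) (use z False in \<open>auto simp: dist_commute intro!: q[symmetric]\<close>)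
 qed
qed

text \<open>Subtracting the value of \<open>k * h k\<close> at the pole leaves a function without singularity, whose contour
 closes.  What remains is an explicit integral over the real line.  The point \<open>\<i> * \<gamma>\<close> lies in the
 sector \<open>p\<close> exactly if \<open>\<gamma> > 0\<close> and \<open>j = 2 * p - 1\<close>.\<close>

theorem sector_closes_pole:
 assumes p: "p \<in> {1..j}" and x: "x > 0"
  and cont: "continuous_on (wedge (lower_angle j p) (upper_angle j p)) h"
  and bound: "\<And>r th. r \<ge> 0 ==> lower_angle j p \<le> th ==> th \<le> upper_angle j p ==>
   norm (h (pol r th)) \<le> C * (1 + r) ^ q"
  and holo: "\<And>r th. r > 0 ==> lower_angle j p < th ==> th < upper_angle j p ==> h field_differentiable at (pol r th)"
 shows "sector_integral j p (%k. exi x k * (pole_factor \<gamma> 0 k * h k)) =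
  (if \<gamma> > 0 \<and> j = 2 * p - 1 then 2 * of_real pi * \<i> * (\<i> * of_real \<gamma>) * h (\<i> * of_real \<gamma>) * exp (- of_real (\<gamma> * x)) else 0)"
proof -
 let ?a = "lower_angle j p" and ?b = "upper_angle j p"
 have ab: "?a < ?b" "?b \<le> ?a + pi" using sector_angles[OF p] by auto
 have C: "C \<ge> 0" using order_trans[OF norm_ge_zero bound[of 0 ?a]] ab by simp
 have pfb: "norm (pole_factor \<gamma> 0 (pol r th)) \<le> 2" if "r \<ge> max 1 (2 * \<bar>\<gamma>\<bar>)" for r th
 proof (cases "\<gamma> = 0")
  case False
  have "norm (pole_factor \<gamma> 0 (pol r th)) \<le> r / (r / 2)"
  proof -
   have "norm (pole_factor \<gamma> 0 (pol r th)) = r / norm (pol r th - \<i> * of_real \<gamma>)"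
    using that False by (simp add: pole_factor_def norm_divide norm_mult)
   also have "\<dots> \<le> r / (r / 2)" using that by (intro divide_left_mono norm_minus_pole_ge) (auto intro!: mult_pos_pos less_le_trans[OF _ norm_minus_pole_ge[of \<gamma> r th]])
   finally show ?thesis .
  qed
  thus ?thesis using that by simp
 qed (simp add: pole_factor_def)
 show ?thesis
 proof (cases "\<gamma> > 0 \<and> j = 2 * p - 1")
  case False
  have nz: "pol r th - \<i> * of_real \<gamma> \<noteq> 0" if "r \<ge> 0" "?a \<le> th" "th \<le> ?b" "\<gamma> \<noteq> 0" for r th
   using pole_location[OF p that(1-3), of \<gamma>] that(4) False by auto
  have cp: "continuous_on (wedge ?a ?b) (pole_factor \<gamma> 0)"
   unfolding pole_factor_def by (cases "\<gamma> = 0") (use nz in \<open>auto simp: wedge_def intro!: continuous_intros\<close>)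
  have ch: "continuous_on (wedge ?a ?b) (%k. pole_factor \<gamma> 0 k * h k)" by (intro continuous_intros cp cont)
  obtain B where B: "B \<ge> 0" "\<And>r th. r \<ge> 0 ==> ?a \<le> th ==> th \<le> ?b ==>
    norm (pole_factor \<gamma> 0 (pol r th) * h (pol r th)) \<le> B * (1 + r) ^ q"
  proof (rule wedge_bound_of_eventual[OF ch, of "max 1 (2 * \<bar>\<gamma>\<bar>)" "2 * C" q])
   fix r th assume r: "r \<ge> max 1 (2 * \<bar>\<gamma>\<bar>)" "r \<ge> 0" "?a \<le> th" "th \<le> ?b"
   have "norm (pole_factor \<gamma> 0 (pol r th) * h (pol r th)) \<le> 2 * (C * (1 + r) ^ q)"
    unfolding norm_mult using pfb[OF r(1)] bound[OF r(2-4)] by (intro mult_mono) auto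
   thus "norm (pole_factor \<gamma> 0 (pol r th) * h (pol r th)) \<le> 2 * C * (1 + r) ^ q" by simp
  qed (rule that)
  have "sector_integral j p (%k. exi x k * (pole_factor \<gamma> 0 k * h k)) = 0"
  proof (rule sector_closes[OF p ch B(2) _ x])
   show "(%k. pole_factor \<gamma> 0 k * h k) field_differentiable at (pol r th)" if "r > 0" "?a < th" "th < ?b" for r th
   proof -
    have "pole_factor \<gamma> 0 field_differentiable at (pol r th)"
     unfolding pole_factor_def by (cases "\<gamma> = 0") (use nz[of r th] that in \<open>auto intro!: derivative_intros\<close>)
    thus ?thesis by (rule field_differentiable_mult[OF _ holo[OF that]])
   qed
  qed
  thus ?thesis using False by auto
 next
  case True
  hence \<gamma>: "\<gamma> > 0" and jp: "j = 2 * p - 1" by auto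
  define z0 where "z0 = \<i> * of_real \<gamma>"
  define f where "f = (%k. k * h k)"
  define Q where "Q = (%z. if z = z0 then deriv f z0 else (f z - f z0) / (z - z0))"
  have pf: "pole_factor \<gamma> 0 k = k / (k - z0)" for k using \<gamma> by (simp add: pole_factor_def z0_def)
  have half: "ang j (real (od j) / 2) = pi / 2"
  proof -
   have "real (od j) \<noteq> 0" by simp
   thus ?thesis unfolding ang_def by (simp del: of_nat_add of_nat_mult of_nat_Suc)
  qed
  have jr: "real j = 2 * real p - 1" using jp p by (simp add: of_nat_diff)
  have lo: "?a < pi / 2" unfolding half[symmetric] lower_angle_eq by (rule ang_mono) (simp add: jr)
  have up: "pi / 2 < ?b" unfolding half[symmetric] upper_angle_eq by (rule ang_mono) (simp add: jr)
  define W where "W = {z. inner (\<i> * cis ?a) z > 0} \<inter> {z. inner (\<i> * cis ?b) z < 0}"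
  have Wopen: "open W" unfolding W_def by (intro open_Int open_halfspace_gt open_halfspace_lt)
  have Wsub: "\<exists>r th. z = pol r th \<and> r > 0 \<and> ?a < th \<and> th < ?b" if "z \<in> W" for z
  proof -
   have "W \<subseteq> wedge ?a ?b" unfolding wedge_eq_halfplanes[OF ab] W_def by auto
   hence "z \<in> interior (wedge ?a ?b)" using that Wopen interior_maximal by blast
   thus ?thesis using interior_wedge_subset[OF ab] by metis
  qed
  have inW: "pol r th \<in> W" if "r > 0" "?a < th" "th < ?b" for r th
  proof -
   have "sin (th - ?a) > 0" using that ab sector_angles[OF p] by (intro sin_gt_zero) auto
   moreover have "sin (?b - th) > 0" using that ab sector_angles[OF p] by (intro sin_gt_zero) auto
   ultimately show ?thesis using that sin_minus[of "?b - th"] by (simp add: W_def inner_i_cis mult_pos_neg)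
  qed
  have z0W: "z0 \<in> W" using inW[of \<gamma> "pi / 2"] \<gamma> lo up by (simp add: z0_def mult.commute)
  have hf: "f holomorphic_on W"
   unfolding holomorphic_on_def f_def
  proof (rule ballI)
   fix z assume "z \<in> W"
   then obtain r th where "z = pol r th" "r > 0" "?a < th" "th < ?b" using Wsub by blast
   hence "h field_differentiable at z" using holo by simp
   thus "(%k. k * h k) field_differentiable at z within W"
    by (rule field_differentiable_at_within[OF field_differentiable_mult[OF field_differentiable_ident]])
  qed
  have hQ: "Q holomorphic_on W" unfolding Q_def by (rule pole_lemma_open[OF hf Wopen])
  have cQ: "continuous_on (wedge ?a ?b) Q"
  proof (rule continuous_on_pole_quotient[of _ f z0 Q "f z0"])
   show "continuous_on (wedge ?a ?b) f" unfolding f_def by (intro continuous_intros cont)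
   have "Q field_differentiable at z0" using hQ z0W Wopen by (simp add: holomorphic_on_imp_differentiable_at)
   thus "isCont Q z0" by (rule field_differentiable_imp_continuous_at)
  qed (auto simp: Q_def)
  obtain B where B: "B \<ge> 0" "\<And>r th. r \<ge> 0 ==> ?a \<le> th ==> th \<le> ?b ==> norm (Q (pol r th)) \<le> B * (1 + r) ^ q"
  proof (rule wedge_bound_of_eventual[OF cQ, of "max 1 (2 * \<bar>\<gamma>\<bar>)" "2 * C + 2 * norm (f z0)" q])
   fix r th assume r: "r \<ge> max 1 (2 * \<bar>\<gamma>\<bar>)" "r \<ge> 0" "?a \<le> th" "th \<le> ?b"
   define k where "k = pol r th"
   have nk: "norm k = r" using r by (simp add: k_def norm_mult)
   have nz: "norm (k - z0) \<ge> r / 2" unfolding k_def z0_def by (rule norm_minus_pole_ge) (use r in auto)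
   hence "k \<noteq> z0" using r by auto
   have r1: "1 \<le> (1 + r) ^ q" using r by (intro one_le_power) auto
   have "norm (f k) \<le> r * (C * (1 + r) ^ q)"
    using mult_left_mono[OF bound[OF r(2-4)], of r] r(2) nk by (simp add: f_def norm_mult flip: k_def)
   hence "norm (f k - f z0) \<le> r * (C * (1 + r) ^ q) + norm (f z0)"
    using norm_triangle_ineq4[of "f k" "f z0"] by linarith
   also have "\<dots> \<le> r * (C * (1 + r) ^ q) + norm (f z0) * (r * (1 + r) ^ q)"
   proof -
    have "1 * 1 \<le> r * (1 + r) ^ q" using r1 r by (intro mult_mono) auto
    hence "norm (f z0) * 1 \<le> norm (f z0) * (r * (1 + r) ^ q)" by (intro mult_left_mono) auto
    thus ?thesis by simp
   qed
   also have "\<dots> = (C + norm (f z0)) * (1 + r) ^ q * r" by (simp only: distrib_right distrib_left mult_ac)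
   finally have fin: "norm (f k - f z0) \<le> (C + norm (f z0)) * (1 + r) ^ q * r" .
   have "norm (f k - f z0) / norm (k - z0) \<le> ((C + norm (f z0)) * (1 + r) ^ q * r) / (r / 2)"
   proof (rule frac_le)
    show "0 \<le> (C + norm (f z0)) * (1 + r) ^ q * r" using r(2) C by (intro mult_nonneg_nonneg add_nonneg_nonneg) auto
    show "0 < r / 2" using r(1) by simp
   qed (rule fin, rule nz)
   also have "\<dots> = (2 * C + 2 * norm (f z0)) * (1 + r) ^ q"
   proof -
    have "(A * P * r) / (r / 2) = 2 * A * P" for A P :: real using r by simp
    thus ?thesis by (simp only: distrib_left)
   qed
   finally show "norm (Q (pol r th)) \<le> (2 * C + 2 * norm (f z0)) * (1 + r) ^ q"
    using \<open>k \<noteq> z0\<close> by (simp only: Q_def norm_divide if_False flip: k_def)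
  qed (rule that)
  have zero: "sector_integral j p (%k. exi x k * Q k) = 0"
   by (rule sector_closes[OF p cQ B(2) _ x])
     (use hQ Wopen inW in \<open>auto intro!: holomorphic_on_imp_differentiable_at\<close>)
  have "sector_integrable j p (%k. phase j 0 x k * Q k)"
   using ab x by (intro sector_family_integrable[OF zero_less_one p continuous_on_subset[OF cQ wedge_mono] B(2)]) auto
  hence Qint: "ray_integrand (%k. exi x k * Q k) th integrable_on {0..}" if "th \<in> {?a, ?b}" for th
   using that by (auto simp: sector_integrable_def phase_def)
  have alg: "E * (q + w / d) * c = E * q * c + w * (E / d * c)" for E q w d c :: complex
   by (simp add: distrib_left distrib_right)
  let ?e = "%k. exi x k / (k - \<i> * of_real \<gamma>)"
  have eint: "ray_integrand ?e th integrable_on {0..}" if "th \<in> {?a, ?b}" for th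
   using exp_over_pole_sector(2)[OF p \<gamma> jp x] that by (auto simp: sector_integrable_def)
  have ray: "integral {0..} (ray_integrand (%k. exi x k * (pole_factor \<gamma> 0 k * h k)) th) =
    integral {0..} (ray_integrand (%k. exi x k * Q k) th) + f z0 * integral {0..} (ray_integrand ?e th)"
   if th: "th \<in> {?a, ?b}" for th
  proof -
   have "((%r. ray_integrand (%k. exi x k * Q k) th r + f z0 * ray_integrand ?e th r) has_integral
     (integral {0..} (ray_integrand (%k. exi x k * Q k) th) + f z0 * integral {0..} (ray_integrand ?e th))) {0..}"
    by (intro has_integral_add has_integral_mult_right integrable_integral Qint eint th)
   hence "(ray_integrand (%k. exi x k * (pole_factor \<gamma> 0 k * h k)) th has_integral
     (integral {0..} (ray_integrand (%k. exi x k * Q k) th) + f z0 * integral {0..} (ray_integrand ?e th))) {0..}"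
   proof (rule has_integral_eq[rotated])
    fix r :: real assume r: "r \<in> {0..}"
    define k where "k = pol r th"
    have c0: "cos th \<noteq> 0"
     using cos_eq_0_imp_half_pi[of th] th sector_angles[OF p] lo up by auto
    have "k \<noteq> z0"
    proof
     assume "k = z0"
     hence "r * cos th = 0" "r * sin th = \<gamma>" by (auto simp: k_def z0_def complex_eq_iff)
     thus False using c0 \<gamma> by auto
    qed
    hence "Q k = f k / (k - z0) - f z0 / (k - z0)" unfolding Q_def by (simp only: if_False diff_divide_distrib)
    moreover have "f k / (k - z0) = pole_factor \<gamma> 0 k * h k" unfolding pf f_def by simp
    ultimately have e: "pole_factor \<gamma> 0 k * h k = Q k + f z0 / (k - z0)" by (simp only: diff_add_cancel)
    show "ray_integrand (%k. exi x k * Q k) th r + f z0 * ray_integrand ?e th r =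
      ray_integrand (%k. exi x k * (pole_factor \<gamma> 0 k * h k)) th r"
     by (simp only: ray_integrand_def e alg flip: k_def z0_def)
   qed
   thus ?thesis by (rule integral_unique)
  qed
  have "sector_integral j p (%k. exi x k * (pole_factor \<gamma> 0 k * h k)) =
    sector_integral j p (%k. exi x k * Q k) + f z0 * sector_integral j p ?e"
   unfolding sector_integral_def by (simp add: ray right_diff_distrib)
  also have "\<dots> = f z0 * (2 * of_real pi * \<i> * exp (- of_real (\<gamma> * x)))"
   unfolding zero exp_over_pole_sector(1)[OF p \<gamma> jp x] by simp
  also have "\<dots> = 2 * of_real pi * \<i> * (\<i> * of_real \<gamma>) * h (\<i> * of_real \<gamma>) * exp (- of_real (\<gamma> * x))"
   unfolding f_def z0_def by (simp only: mult_ac)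
  finally show ?thesis using True by auto
 qed
qed

section \<open>Boundary values of the data terms\<close>

subsection \<open>Integrals along a sector boundary\<close>

lemma sector_integral_cong:
 assumes "\<And>r th. r \<ge> 0 ==> th \<in> edges j p ==> f (pol r th) = g (pol r th)"
 shows "sector_integral j p f = sector_integral j p g" "sector_integrable j p f = sector_integrable j p g"
proof -
 have "integral {0..} (ray_integrand f th) = integral {0..} (ray_integrand g th)"
  "ray_integrand f th integrable_on {0..} \<longleftrightarrow> ray_integrand g th integrable_on {0..}"
  if "th \<in> edges j p" for th
  using assms that by (auto simp: ray_integrand_def intro!: integral_cong integrable_cong)
 thus "sector_integral j p f = sector_integral j p g" "sector_integrable j p f = sector_integrable j p g"
  by (simp_all add: sector_integral_def sector_integrable_def)
qed

lemma ray_integrand_lin: "ray_integrand (%k. f k + g k) th = (%r. ray_integrand f th r + ray_integrand g th r)"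
 "ray_integrand (%k. c * f k) th = (%r. c * ray_integrand f th r)"
 by (auto simp: ray_integrand_def algebra_simps)

lemma sector_integral_add:
 assumes "sector_integrable j p f" "sector_integrable j p g"
 shows "sector_integral j p (%k. f k + g k) = sector_integral j p f + sector_integral j p g"
 using assms by (simp add: sector_integral_def sector_integrable_def ray_integrand_lin integral_add)

lemma sector_integral_mult: "sector_integral j p (%k. c * f k) = c * sector_integral j p f"
 by (simp add: sector_integral_def ray_integrand_lin right_diff_distrib)

lemma sector_exp_integrable:
 assumes "p \<in> {1..j}" "x > 0"
  and "\<And>th. th \<in> edges j p ==> continuous_on (wedge th th) f"
  and "\<And>r th. r \<ge> 0 ==> th \<in> edges j p ==> norm (f (pol r th)) \<le> C * (1 + r) ^ q"
 shows "sector_integrable j p (%k. exi x k * f k)"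
 using sector_family_integrable[OF zero_less_one assms(1,3,4), of 0 x] assms(2) by (simp add: phase_def)

lemma sector_family_eq:
 "sector_family j p h m t x = sector_integral j p (%k. exi x k * ((\<i> * k) ^ m * exi t (k ^ od j) * h k))"
 unfolding sector_family_def ray_wave_def sector_integral_def wave_def[abs_def] phase_split duhamel_zero add_0_right
 by (simp only: mult_ac)

lemma norm_exp_sector_ray:
 assumes "th \<in> edges j p"
 shows "norm (exi t ((pol r th) ^ od j)) = 1"
 using assms sector_sin_d[of j p] by (auto simp only: norm_exp_ray_power insert_iff empty_iff) simp_all

lemma sector_cos_nonzero:
 assumes p: "p \<in> {1..j}" and th: "th \<in> edges j p"
 shows "cos th \<noteq> 0"
proof
 assume "cos th = 0"
 hence "th = pi / 2" using cos_eq_0_imp_half_pi[of th] sector_angles[OF p] th by auto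
 hence "real (od j) * th = real (od j) / 2 * pi" by simp
 hence "\<exists>s. s \<in> {2 * real p - 1, 2 * real p} \<and> s * pi = real (od j) / 2 * pi"
  using th unfolding lower_angle_eq upper_angle_eq by (metis insert_iff mult_ang singletonD)
 then obtain s where s: "s \<in> {2 * real p - 1, 2 * real p}" "s * pi = real (od j) / 2 * pi" by blast
 have "s = real (od j) / 2" by (rule mult_right_cancel[THEN iffD1, OF _ s(2)]) simp
 hence "real (4 * p) = real (2 * j + 3) \<or> real (4 * p) = real (od j)" using s(1) by auto
 hence "4 * p = 2 * j + 3 \<or> 4 * p = od j" by (simp only: of_nat_eq_iff)
 thus False by presburger
qed

text \<open>The pole \<open>\<i> * \<gamma>\<close> lies on the imaginary axis, which no boundary ray of a sector touches.\<close>

lemma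
 assumes "cos th \<noteq> 0" "r \<ge> 0"
 shows pole_off_ray: "\<gamma> \<noteq> 0 ==> pol r th - \<i> * of_real \<gamma> \<noteq> 0"
  and norm_pole_factor_ray: "norm (pole_factor \<gamma> m (pol r th)) \<le> (1 / \<bar>cos th\<bar>) * r ^ m"
proof -
 show nz: "pol r th - \<i> * of_real \<gamma> \<noteq> 0" if "\<gamma> \<noteq> 0"
 proof
  assume "pol r th - \<i> * of_real \<gamma> = 0"
  hence "r * cos th = 0" "r * sin th = \<gamma>" by (auto simp: complex_eq_iff)
  thus False using assms that by auto
 qed
 have "norm (pole_factor \<gamma> 0 (pol r th)) \<le> 1 / \<bar>cos th\<bar>"
 proof (cases "\<gamma> = 0")
  case True
  thus ?thesis using assms by (simp add: pole_factor_def pos_le_divide_eq)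
 next
  case False
  have "r * \<bar>cos th\<bar> \<le> norm (pol r th - \<i> * of_real \<gamma>)"
   using abs_Re_le_cmod[of "pol r th - \<i> * of_real \<gamma>"] assms by (simp add: abs_mult)
  hence "r \<le> 1 / \<bar>cos th\<bar> * norm (pol r th - \<i> * of_real \<gamma>)"
   using assms by (simp add: pos_le_divide_eq)
  thus ?thesis using nz[OF False] False assms by (simp add: pole_factor_def norm_divide norm_mult pos_divide_le_eq)
 qed
 hence "r ^ m * norm (pole_factor \<gamma> 0 (pol r th)) \<le> r ^ m * (1 / \<bar>cos th\<bar>)"
  using assms by (intro mult_left_mono) auto
 thus "norm (pole_factor \<gamma> m (pol r th)) \<le> (1 / \<bar>cos th\<bar>) * r ^ m"
  unfolding pole_factor_mult[of \<gamma> m] using assms by (simp only: norm_mult norm_power norm_of_real norm_cis) (simp add: mult.commute)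
qed

lemma continuous_on_pole_factor_ray: "cos th \<noteq> 0 ==> continuous_on (wedge th th) (pole_factor \<gamma> m)"
 unfolding pole_factor_def[abs_def] using pole_off_ray[of th _ \<gamma>]
 by (cases "\<gamma> = 0") (auto simp: wedge_def intro!: continuous_intros)

lemma rotated_ray_integrand:
 "ray_integrand (%k. f (cis \<phi> * k)) th r = cis (- \<phi>) * ray_integrand f (th + \<phi>) r"
proof -
 have "cis \<phi> * (pol r th) = pol r (th + \<phi>)" by (simp add: cis_mult[symmetric] mult_ac)
 moreover have "cis th = cis (- \<phi>) * cis (th + \<phi>)" by (simp add: cis_mult)
 ultimately have "f (cis \<phi> * (pol r th)) * cis th = cis (- \<phi>) * (f (pol r (th + \<phi>)) * cis (th + \<phi>))"
  by (simp only: mult_ac)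
 thus ?thesis by (simp only: ray_integrand_def)
qed

lemma rotated_ray_limit:
 assumes "sin th \<ge> 0" "continuous_on {0..} (ray_integrand f (th + \<phi>))"
  and "\<And>r. r \<ge> 0 ==> norm (f (pol r (th + \<phi>))) \<le> C / (1 + r)\<^sup>2"
 shows "((%x. integral {0..} (ray_integrand (%k. exi x k * f (cis \<phi> * k)) th)) \<longlongrightarrow>
   cis (- \<phi>) * integral {0..} (ray_integrand f (th + \<phi>))) (at_right 0)"
proof -
 have eq: "ray_integrand (%k. f (cis \<phi> * k)) th = (%r. cis (- \<phi>) * ray_integrand f (th + \<phi>) r)"
  by (rule ext) (rule rotated_ray_integrand)
 have "((%x. integral {0..} (ray_integrand (%k. exi x k * f (cis \<phi> * k)) th)) \<longlongrightarrow>
   integral {0..} (ray_integrand (%k. f (cis \<phi> * k)) th)) (at_right 0)"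
 proof (rule ray_integral_at_zero(2)[OF assms(1)])
  show "continuous_on {0..} (ray_integrand (%k. f (cis \<phi> * k)) th)" unfolding eq by (intro continuous_intros assms(2))
  show "norm (ray_integrand (%k. f (cis \<phi> * k)) th r) \<le> C / (1 + r)\<^sup>2" if "r \<ge> 0" for r
   using assms(3)[OF that] by (simp add: eq norm_mult ray_integrand_def)
 qed
 thus ?thesis by (simp add: eq)
qed

subsection \<open>The boundary operator\<close>

text \<open>The symbol of \<open>(\<partial>\<^sub>x + \<gamma>) \<partial>\<^sub>x\<^sup>l\<^sup>-\<^sup>1\<close>.\<close>

definition bsym :: "real => nat => complex => complex" where
 "bsym \<gamma> l k = (\<i> * k) ^ l + of_real \<gamma> * (\<i> * k) ^ (l - 1)"

lemma norm_bsym: "norm (bsym \<gamma> l k) \<le> (1 + \<bar>\<gamma>\<bar>) * (1 + norm k) ^ l"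
proof -
 have a: "norm k ^ l \<le> (1 + norm k) ^ l" by (intro power_mono) auto
 have b: "norm k ^ (l - 1) \<le> (1 + norm k) ^ l"
  by (rule order_trans[OF power_mono[of _ "1 + norm k"] power_increasing]) auto
 have "norm (bsym \<gamma> l k) \<le> norm k ^ l + \<bar>\<gamma>\<bar> * norm k ^ (l - 1)"
  unfolding bsym_def by (rule order_trans[OF norm_triangle_ineq]) (simp add: norm_mult norm_power)
 also have "\<dots> \<le> (1 + norm k) ^ l + \<bar>\<gamma>\<bar> * (1 + norm k) ^ l" by (intro add_mono mult_left_mono a b) auto
 finally show ?thesis by (simp only: distrib_right mult_1_left)
qed

lemma bsym_field_differentiable: "bsym \<gamma> l field_differentiable at k"
 unfolding bsym_def[abs_def]
 by (intro field_differentiable_add field_differentiable_mult field_differentiable_power field_differentiable_const field_differentiable_ident)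

lemma bsym_Suc: "bsym \<gamma> (Suc m) k = (\<i> * k) ^ m * (\<i> * k + of_real \<gamma>)"
 by (simp add: bsym_def algebra_simps)

text \<open>The symbol cancels the pole of the coefficient; by \<open>Qpoly_ratio\<close> what is left is the symbol at the
 rotated wave number.\<close>

lemma bsym_Pcoef:
 assumes p: "p \<in> {1..j}" and n: "n \<in> {1..j+1}" and l: "1 \<le> l" "l \<le> j" and k: "\<gamma> \<noteq> 0 ==> k - \<i> * of_real \<gamma> \<noteq> 0"
 shows "bsym \<gamma> l k * Pcoef j \<gamma> p n k =
  lagrange j p n 1 * alpha j p n ^ (od j - l) * (alpha j p n * bsym \<gamma> l (alpha j p n * k))"
proof -
 obtain m where m: "l = Suc m" using l by (cases l) auto
 define a L where "a = alpha j p n" and "L = lagrange j p n 1"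
 have pole: "(\<i> * k + of_real \<gamma>) * pole_factor \<gamma> 0 k = \<i> * k"
 proof (cases "\<gamma> = 0")
  case False
  have "\<i> * k + of_real \<gamma> = \<i> * (k - \<i> * of_real \<gamma>)" by (simp add: algebra_simps)
  thus ?thesis using k[OF False] False by (simp add: pole_factor_def)
 qed (simp add: pole_factor_def)
 have "(\<i> * k + of_real \<gamma>) * Pcoef j \<gamma> p n k = (\<i> * k + of_real \<gamma>) * L - (1 - a) * L * ((\<i> * k + of_real \<gamma>) * pole_factor \<gamma> 0 k)"
  unfolding Pcoef_def Qpoly_ratio[OF n] a_def L_def by (simp add: right_diff_distrib mult_ac)
 also have "\<dots> = L * (\<i> * (a * k) + of_real \<gamma>)" unfolding pole by (simp add: algebra_simps)
 finally have e: "(\<i> * k + of_real \<gamma>) * Pcoef j \<gamma> p n k = L * (\<i> * (a * k) + of_real \<gamma>)" .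
 have "od j - l + 1 + m = od j" using l m by simp
 hence ap: "a ^ (od j - l) * (a * a ^ m) = 1"
  using alpha_power_period[of j p n] unfolding a_def by (metis (no_types, lifting) Suc_eq_plus1 add.assoc plus_1_eq_Suc power_Suc power_add)
 have "bsym \<gamma> l k * Pcoef j \<gamma> p n k = (\<i> * k) ^ m * ((\<i> * k + of_real \<gamma>) * Pcoef j \<gamma> p n k)"
  unfolding m bsym_Suc by (simp only: mult_ac)
 also have "\<dots> = (a ^ (od j - l) * (a * a ^ m)) * ((\<i> * k) ^ m * (L * (\<i> * (a * k) + of_real \<gamma>)))" unfolding e ap by simp
 also have "\<dots> = L * a ^ (od j - l) * (a * bsym \<gamma> l (a * k))"
  unfolding m bsym_Suc power_mult_distrib by (simp only: mult_ac)
 finally show ?thesis unfolding a_def L_def .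
qed

subsection \<open>Evolution of an amplitude\<close>

text \<open>The initial amplitude together with the source acting up to time \<open>s\<close>, both propagated to time \<open>t\<close>.\<close>

definition evolution :: "nat => complex => complex => (real => complex => complex) => real => real => complex => complex" where
 "evolution j c1 c2 a s t k = exi t (k ^ od j) * (c1 * a 0 k + c2 * duhamel (od j) a s k)"

lemma bsym_evolution:
 "exi x k * (bsym \<gamma> l k * evolution j c1 c2 a t t k) =
  wave j (%k. c1 * a 0 k) (%ta k. c2 * a ta k) l t x k + of_real \<gamma> * wave j (%k. c1 * a 0 k) (%ta k. c2 * a ta k) (l - 1) t x k"
 unfolding wave_def phase_split evolution_def bsym_def duhamel_scale by (simp add: distrib_left distrib_right mult_ac)

lemma
 assumes c: "continuous_on {0..t} (%ta. a ta k)" and t: "0 < t"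
  and B: "\<And>ta. ta \<in> {0..t} ==> norm (a ta k) \<le> B" and Im: "Im (k ^ od j) \<ge> 0"
 shows norm_evolution: "norm (evolution j c1 c2 a t t k) \<le> (norm c1 + norm c2 * t) * B"
  and norm_evolution_decay:
   "(1 + Im (k ^ od j)) * norm (evolution j c1 c2 a t t k) \<le> (norm c1 * (1 + 1 / t) + norm c2 * (t + 1)) * B"
proof -
 define c where "c = Im (k ^ od j)"
 define E where "E = norm (exi t (k ^ od j))"
 define I where "I = norm (integral {0..t} (%ta. exi (t - ta) (k ^ od j) * a ta k))"
 have c0: "c \<ge> 0" using Im by (simp add: c_def)
 have B0: "B \<ge> 0" using order_trans[OF norm_ge_zero B[of 0]] t by simp
 have Eeq: "E = exp (- (c * t))" by (simp only: E_def c_def norm_exp_i_of_real)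
 have E1: "E \<le> 1" unfolding Eeq using c0 t by simp
 have Ec: "c * E \<le> 1 / t"
 proof -
  have "c * t \<le> exp (c * t)" using exp_ge_add_one_self[of "c * t"] by linarith
  hence "c * t * exp (- (c * t)) \<le> 1" by (simp add: exp_minus divide_simps)
  thus ?thesis unfolding Eeq using t by (simp add: pos_le_divide_eq mult_ac)
 qed
 have I1: "I \<le> t * B" unfolding I_def
  using norm_time_integral_le[OF _ c B, of "k ^ od j" t] t Im by (simp add: mult.commute)
 have Ic: "c * I \<le> B"
 proof (cases "c = 0")
  case False
  hence cp: "c > 0" using c0 by simp
  have "((%ta. exp (- (c * (t - ta))) * B) has_integral (exp (- (c * (t - t))) * B / c - exp (- (c * (t - 0))) * B / c)) {0..t}"
   using t cp by (intro fundamental_theorem_of_calculus)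
    (auto intro!: derivative_eq_intros simp flip: has_real_derivative_iff_has_vector_derivative simp: field_simps)
  hence hi: "(%ta. exp (- (c * (t - ta))) * B) integrable_on {0..t}"
   "integral {0..t} (%ta. exp (- (c * (t - ta))) * B) = (1 - exp (- (c * t))) * B / c"
   by (auto simp: left_diff_distrib diff_divide_distrib simp del: integral_mult_left intro!: integral_unique)
  have "I \<le> integral {0..t} (%ta. exp (- (c * (t - ta))) * B)" unfolding I_def
  proof (rule integral_norm_bound_integral[OF _ hi(1)])
   show "(%ta. exi (t - ta) (k ^ od j) * a ta k) integrable_on {0..t}"
    by (intro integrable_continuous_real continuous_intros c)
   show "norm (exi (t - ta) (k ^ od j) * a ta k) \<le> exp (- (c * (t - ta))) * B" if "ta \<in> {0..t}" for ta
    unfolding norm_mult norm_exp_i_of_real c_def using B[OF that] by (intro mult_left_mono) auto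
  qed
  also have "\<dots> \<le> 1 * B / c" unfolding hi(2) using cp B0 by (intro divide_right_mono mult_right_mono) auto
  finally show ?thesis using cp by (simp add: pos_le_divide_eq mult.commute)
 qed (use B0 in simp)
 have N: "norm (evolution j c1 c2 a t t k) \<le> norm c1 * (E * B) + norm c2 * I"
 proof -
  have "evolution j c1 c2 a t t k = c1 * (exi t (k ^ od j) * a 0 k) +
    c2 * (exi t (k ^ od j) * duhamel (od j) a t k)"
   by (simp add: evolution_def algebra_simps)
  moreover have "norm (exi t (k ^ od j) * duhamel (od j) a t k) = I" unfolding exp_mult_duhamel I_def by simp
  moreover have "norm (exi t (k ^ od j) * a 0 k) \<le> E * B"
   unfolding norm_mult E_def using B[of 0] t by (intro mult_left_mono) auto
  ultimately show ?thesis
   using norm_triangle_ineq[of "c1 * (exi t (k ^ od j) * a 0 k)" "c2 * (exi t (k ^ od j) * duhamel (od j) a t k)"]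
   by (smt (verit) mult_left_mono norm_ge_zero norm_mult)
 qed
 also have "\<dots> \<le> norm c1 * (1 * B) + norm c2 * (t * B)"
  by (intro add_mono mult_left_mono mult_right_mono E1 I1 B0) auto
 finally show "norm (evolution j c1 c2 a t t k) \<le> (norm c1 + norm c2 * t) * B" by (simp add: distrib_right mult.assoc)
 have "(1 + c) * norm (evolution j c1 c2 a t t k) \<le> (1 + c) * (norm c1 * (E * B) + norm c2 * I)"
  using c0 by (intro mult_left_mono N) auto
 also have "\<dots> = norm c1 * ((E + c * E) * B) + norm c2 * (I + c * I)" by (simp add: algebra_simps)
 also have "\<dots> \<le> norm c1 * ((1 + 1 / t) * B) + norm c2 * (t * B + B)"
  by (intro add_mono mult_left_mono mult_right_mono E1 Ec I1 Ic B0) auto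
 finally show "(1 + Im (k ^ od j)) * norm (evolution j c1 c2 a t t k) \<le> (norm c1 * (1 + 1 / t) + norm c2 * (t + 1)) * B"
  unfolding c_def by (simp add: distrib_right distrib_left mult.assoc)
qed

lemma sin_ge_sin_quarter:
 assumes "pi / 4 \<le> u" "u \<le> 3 * pi / 4"
 shows "sin u \<ge> sin (pi / 4)"
proof (cases "u \<le> pi / 2")
 case True
 thus ?thesis using assms pi_gt_zero by (intro sin_monotone_2pi_le) auto
next
 case False
 hence "sin (pi / 4) \<le> sin (pi - u)" using assms pi_gt_zero by (intro sin_monotone_2pi_le) auto
 thus ?thesis by simp
qed

lemma sin_d_band:
 assumes "ang j (2 * real m + s) \<le> th" "th \<le> ang j (2 * real m + 1 - s)"
 obtains u where "s * pi \<le> u" "u \<le> (1 - s) * pi" "sin (real (od j) * th) = sin u"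
proof
 let ?u = "real (od j) * th - 2 * real m * pi"
 have "real (od j) * ang j (2 * real m + s) \<le> real (od j) * th" "real (od j) * th \<le> real (od j) * ang j (2 * real m + 1 - s)"
  using assms by (auto intro!: mult_left_mono)
 thus "s * pi \<le> ?u" "?u \<le> (1 - s) * pi" unfolding mult_ang by (simp_all add: left_diff_distrib distrib_right)
 have "real (od j) * th = ?u + 2 * real_of_int (int m) * pi" by simp
 thus "sin (real (od j) * th) = sin ?u" by (metis sin_shift_2pi_int)
qed

lemma sin_d_nonneg:
 assumes "ang j (2 * real m) \<le> th" "th \<le> ang j (2 * real m + 1)"
 shows "sin (real (od j) * th) \<ge> 0"
proof -
 obtain u where "0 * pi \<le> u" "u \<le> (1 - 0) * pi" "sin (real (od j) * th) = sin u"
  by (rule sin_d_band[of j m 0 th]) (use assms in auto)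
 thus ?thesis using sin_ge_zero[of u] by simp
qed

lemma sin_d_large:
 assumes "ang j (2 * real m + 1 / 4) \<le> th" "th \<le> ang j (2 * real m + 3 / 4)"
 shows "sin (real (od j) * th) \<ge> sin (pi / 4)"
proof -
 obtain u where "1 / 4 * pi \<le> u" "u \<le> (1 - 1 / 4) * pi" "sin (real (od j) * th) = sin u"
  by (rule sin_d_band[of j m "1 / 4" th]) (use assms in \<open>simp_all add: add_ac\<close>)
 thus ?thesis using sin_ge_sin_quarter[of u] by simp
qed

lemma power_one_plus_le: "r \<ge> 0 ==> (1 + r) ^ n \<le> 2 ^ n * (1 + r ^ n)" for r :: real
proof (cases "r \<le> 1")
 case True
 assume "r \<ge> 0"
 hence "(1 + r) ^ n \<le> 2 ^ n" "0 \<le> r ^ n" using True by (auto intro: power_mono)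
 thus ?thesis by (simp add: distrib_left add_increasing2)
next
 case False
 hence "(1 + r) ^ n \<le> (2 * r) ^ n" by (intro power_mono) auto
 thus ?thesis by (simp add: power_mult_distrib distrib_left add_increasing)
qed

text \<open>The boundary operator acts on a family of sector integrals through its symbol.\<close>

lemma sector_family_bsym:
 assumes p: "p \<in> {1..j}" and x: "x > 0"
  and cont: "\<And>th. th \<in> edges j p ==> continuous_on (wedge th th) h"
  and bound: "\<And>r th. r \<ge> 0 ==> th \<in> edges j p ==> norm (h (pol r th)) \<le> C * (1 + r) ^ q"
 shows "sector_family j p h l t x + of_real \<gamma> * sector_family j p h (l - 1) t x =
  sector_integral j p (%k. exi x k * (bsym \<gamma> l k * (exi t (k ^ od j) * h k)))"
proof -
 let ?f = "%m k. (\<i> * k) ^ m * exi t (k ^ od j) * h k"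
 have int: "sector_integrable j p (%k. exi x k * ?f m k)" for m
 proof (rule sector_exp_integrable[OF p x])
  fix r :: real and th assume r: "r \<ge> 0" and th: "th \<in> edges j p"
  have "norm (?f m (pol r th)) = r ^ m * norm (h (pol r th))"
   unfolding norm_mult norm_exp_sector_ray[OF th] using r by (simp add: norm_mult norm_power)
  also have "\<dots> \<le> (1 + r) ^ m * (C * (1 + r) ^ q)"
   using r by (intro mult_mono bound th power_mono) auto
  finally show "norm (?f m (pol r th)) \<le> C * (1 + r) ^ (m + q)" by (simp add: power_add mult_ac)
 qed (intro continuous_intros cont)
 have "sector_integrable j p (%k. of_real \<gamma> * (exi x k * ?f (l - 1) k))"
  using int[of "l - 1"] unfolding sector_integrable_def ray_integrand_lin by (blast intro: integrable_on_mult_right)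
 hence "sector_family j p h l t x + of_real \<gamma> * sector_family j p h (l - 1) t x =
   sector_integral j p (%k. exi x k * ?f l k + of_real \<gamma> * (exi x k * ?f (l - 1) k))"
  unfolding sector_family_eq by (simp only: sector_integral_add int sector_integral_mult)
 also have "(%k. exi x k * ?f l k + of_real \<gamma> * (exi x k * ?f (l - 1) k)) =
   (%k. exi x k * (bsym \<gamma> l k * (exi t (k ^ od j) * h k)))"
  by (rule ext) (simp only: bsym_def distrib_left distrib_right mult_ac)
 finally show ?thesis .
qed

lemma ray_wave_bsym:
 assumes "ray_wave_data j th T S (%k. c1 * a 0 k) (%ta k. c2 * a ta k)" "l \<le> od j" "t \<in> {0..T}" "x > 0"
 shows "ray_wave j th (%k. c1 * a 0 k) (%ta k. c2 * a ta k) l t x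
   + of_real \<gamma> * ray_wave j th (%k. c1 * a 0 k) (%ta k. c2 * a ta k) (l - 1) t x =
  integral {0..} (ray_integrand (%k. exi x k * (bsym \<gamma> l k * evolution j c1 c2 a t t k)) th)"
 unfolding bsym_evolution ray_integrand_lin ray_wave_def
 using ray_wave_data.integrable_wave(1)[OF assms(1) assms(2,3,4)] ray_wave_data.integrable_wave(1)[OF assms(1) _ assms(3,4), of "l - 1"] assms(2)
 by (subst integral_add) (auto intro: integrable_on_mult_right)

lemma field_differentiable_scale:
 assumes "f field_differentiable at (c * k)"
 shows "(%k. f (c * k)) field_differentiable at k"
 using field_differentiable_compose[of "%k. c * k" k f] assms by (simp add: o_def field_differentiable_mult field_differentiable_const field_differentiable_ident)

context space_family
begin

lemma evolution_slow_field_differentiable: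
 assumes "s \<in> {0..T}" "k \<in> cone"
 shows "evolution j c1 c2 slow s t field_differentiable at k"
 unfolding evolution_def[abs_def]
 by (intro derivative_intros field_differentiable_exp_power slow_field_differentiable duhamel_slow_field_differentiable
   one_plus_i_nonzero_cone assms field_differentiable_mult field_differentiable_add)

lemma duhamel_rest_field_differentiable:
 assumes s: "s \<in> {0..T}" and k: "Im k < 0"
 shows "duhamel (od j) rest s field_differentiable at k"
proof -
 have "(%k. duhamel (od j) ft s k - duhamel (od j) slow s k) field_differentiable at k"
  using s k by (intro field_differentiable_diff duhamel_ft_field_differentiable duhamel_slow_field_differentiable
    one_plus_i_nonzero_cone lower_subset_cone) auto
 then obtain D where "((%k. duhamel (od j) ft s k - duhamel (od j) slow s k) has_field_derivative D) (at k)"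
  by (auto simp: field_differentiable_def)
 hence "(duhamel (od j) rest s has_field_derivative D) (at k)"
  by (rule has_field_derivative_transform_within_open[OF _ open_lower]) (use k duhamel_ft_split[OF s] in auto)
 thus ?thesis by (auto simp: field_differentiable_def)
qed

lemma evolution_rest_field_differentiable:
 assumes "s \<in> {0..T}" "Im k < 0"
 shows "evolution j c1 c2 rest s t field_differentiable at k"
 unfolding evolution_def[abs_def] using T
 by (intro derivative_intros field_differentiable_exp_power rest_field_differentiable duhamel_rest_field_differentiable
   assms field_differentiable_mult field_differentiable_add) auto

lemma continuous_on_evolution_rest:
 assumes "s \<in> {0..T}"
 shows "continuous_on {k. Im k \<le> 0} (evolution j c1 c2 rest s t)"
 unfolding evolution_def[abs_def] using assms T
 by (intro continuous_intros continuous_on_duhamel[OF cont_rest] continuous_on_section'[OF cont_rest]) auto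

text \<open>The transform of the data is bounded in the closed sectors in which its evolution is analytic.\<close>

lemma norm_duhamel_ft:
 assumes s: "s \<in> {0..T}" and k: "Im k \<le> 0" "Im (k ^ od j) \<le> 0"
 shows "norm (duhamel (od j) ft s k) \<le> 2 * K * T"
proof -
 have c: "continuous_on {0..s} (%ta. ft ta k)"
  by (rule continuous_on_subset[OF continuous_on_section[OF cont_ft]]) (use s k in auto)
 have b: "norm (ft ta k) \<le> 2 * K" if "ta \<in> {0..s}" for ta
 proof -
  have "norm (ft ta k) \<le> 2 * K / (1 + norm k)" using that s k by (intro norm_ft) auto
  also have "\<dots> \<le> 2 * K / 1" using K_nonneg by (intro divide_left_mono) (auto intro: add_pos_nonneg)
  finally show ?thesis by simp
 qed
 have "norm (integral {0..s} (%ta. exi (0 - ta) (k ^ od j) * ft ta k)) \<le> 2 * K * (s - 0)"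
  using s k by (intro norm_time_integral_le c b) (auto intro!: mult_nonpos_nonneg simp del: power_Suc)
 also have "\<dots> \<le> 2 * K * T" using s K_nonneg by (intro mult_left_mono) auto
 finally show ?thesis unfolding exp_mult_duhamel[symmetric] by simp
qed

definition transformed_data :: "complex => complex => nat => nat => complex => complex" where
 "transformed_data c1 c2 p n k = c1 * ft 0 (alpha j p n * k) + c2 * duhamel (od j) ft T (alpha j p n * k)"

context
 fixes p n :: nat
 assumes p: "p \<in> {1..j}" and n: "n \<in> {1..j+1}"
begin

lemma Im_power_sector:
 assumes "r \<ge> 0" "lower_angle j p \<le> th" "th \<le> upper_angle j p"
 shows "Im ((alpha j p n * (pol r th)) ^ od j) \<le> 0"
 unfolding alpha_power_mult Im_ray_power using sector_sin_d_nonpos[OF assms(2,3)] assms(1) by (intro mult_nonneg_nonpos) auto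

lemma sector_lower: "k \<in> wedge (lower_angle j p) (upper_angle j p) ==> Im (alpha j p n * k) \<le> 0"
 unfolding wedge_def using alpha_lower(1)[OF p n] by auto

lemma continuous_on_lower_scaled:
 assumes "continuous_on {k. Im k \<le> 0} f"
 shows "continuous_on (wedge (lower_angle j p) (upper_angle j p)) (%k. f (alpha j p n * k))"
 by (rule continuous_on_compose2[OF assms]) (auto intro!: continuous_intros sector_lower)

lemma continuous_on_transformed_data:
 "continuous_on (wedge (lower_angle j p) (upper_angle j p)) (transformed_data c1 c2 p n)"
 unfolding transformed_data_def[abs_def] using T
 by (intro continuous_intros continuous_on_lower_scaled continuous_on_duhamel[OF cont_ft] continuous_on_section'[OF cont_ft]) auto

lemma norm_transformed_data:
 assumes "r \<ge> 0" "lower_angle j p \<le> th" "th \<le> upper_angle j p"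
 shows "norm (transformed_data c1 c2 p n (pol r th)) \<le> (norm c1 + norm c2 * T) * (2 * K)"
proof -
 have k: "Im (alpha j p n * (pol r th)) \<le> 0" using alpha_lower(1)[OF p n assms] .
 have "norm (ft 0 (alpha j p n * (pol r th))) \<le> 2 * K / (1 + norm (alpha j p n * (pol r th)))"
  using T by (intro norm_ft k) auto
 also have "\<dots> \<le> 2 * K / 1" using K_nonneg by (intro divide_left_mono) (auto intro: add_pos_nonneg)
 finally have a: "norm (ft 0 (alpha j p n * (pol r th))) \<le> 2 * K" by simp
 have "norm (transformed_data c1 c2 p n (pol r th)) \<le> norm c1 * (2 * K) + norm c2 * (2 * K * T)"
  unfolding transformed_data_def
 proof (rule order_trans[OF norm_triangle_ineq add_mono])
  show "norm (c1 * ft 0 (alpha j p n * (pol r th))) \<le> norm c1 * (2 * K)"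
   unfolding norm_mult[of c1] by (rule mult_left_mono[OF a]) simp
  have "norm (duhamel (od j) ft T (alpha j p n * (pol r th))) \<le> 2 * K * T"
   using T by (intro norm_duhamel_ft k Im_power_sector[OF assms]) simp
  thus "norm (c2 * duhamel (od j) ft T (alpha j p n * (pol r th))) \<le> norm c2 * (2 * K * T)"
   unfolding norm_mult[of c2] by (rule mult_left_mono) simp
 qed
 thus ?thesis by (simp add: algebra_simps)
qed

lemma transformed_data_field_differentiable:
 assumes "r > 0" "lower_angle j p < th" "th < upper_angle j p"
 shows "transformed_data c1 c2 p n field_differentiable at (pol r th)"
proof -
 have k: "Im (alpha j p n * (pol r th)) < 0" using alpha_lower(2)[OF p n _ assms] assms(1) by simp
 have "ft 0 field_differentiable at (alpha j p n * (pol r th))"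
  using ft_has_derivative[OF _ k, of 0] T by (auto simp: field_differentiable_def)
 thus ?thesis
  unfolding transformed_data_def[abs_def]
  by (intro field_differentiable_add field_differentiable_mult field_differentiable_const field_differentiable_scale
    duhamel_ft_field_differentiable k order_refl)
qed

lemma data_amplitude:
 assumes "th \<in> edges j p"
 shows "continuous_on (wedge th th) (%k. transformed_data c1 c2 p n k * Pcoef j \<gamma> p n k)"
  "r \<ge> 0 ==> norm (transformed_data c1 c2 p n (pol r th) * Pcoef j \<gamma> p n (pol r th)) \<le>
    ((norm c1 + norm c2 * T) * (2 * K)) * (norm (lagrange j p n 1) +
     norm (poly (Qpoly j p) 1 / poly (pderiv (Qpoly j p)) (alpha j p n)) * (1 / \<bar>cos th\<bar>))"
proof -
 have le: "lower_angle j p \<le> th" "th \<le> upper_angle j p" using assms sector_angles[OF p] by auto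
 note c = sector_cos_nonzero[OF p assms]
 show "continuous_on (wedge th th) (%k. transformed_data c1 c2 p n k * Pcoef j \<gamma> p n k)"
  unfolding Pcoef_def
  by (intro continuous_intros continuous_on_subset[OF continuous_on_transformed_data wedge_mono[OF le]] continuous_on_pole_factor_ray c)
 show "norm (transformed_data c1 c2 p n (pol r th) * Pcoef j \<gamma> p n (pol r th)) \<le>
    ((norm c1 + norm c2 * T) * (2 * K)) * (norm (lagrange j p n 1) +
     norm (poly (Qpoly j p) 1 / poly (pderiv (Qpoly j p)) (alpha j p n)) * (1 / \<bar>cos th\<bar>))" if r: "r \<ge> 0"
  unfolding norm_mult[of "transformed_data c1 c2 p n (pol r th)"]
 proof (rule mult_mono[OF norm_transformed_data[OF r le]])
  show "norm (Pcoef j \<gamma> p n (pol r th)) \<le> norm (lagrange j p n 1) +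
     norm (poly (Qpoly j p) 1 / poly (pderiv (Qpoly j p)) (alpha j p n)) * (1 / \<bar>cos th\<bar>)"
   unfolding Pcoef_def
   by (intro order_trans[OF norm_triangle_ineq4] add_left_mono)
    (simp only: norm_mult, intro mult_left_mono, use norm_pole_factor_ray[OF c r, of \<gamma> 0] in auto)
  show "0 \<le> (norm c1 + norm c2 * T) * (2 * K)" using T K_nonneg by (intro mult_nonneg_nonneg add_nonneg_nonneg) auto
 qed simp
qed

end

end

context space_family
begin

context
 fixes c1 c2 :: complex and \<gamma> t :: real and l :: nat
 assumes l: "1 \<le> l" "l \<le> j" and t: "0 < t" "t \<le> T"
begin

definition brest :: "complex => complex" where
 "brest k = bsym \<gamma> l k * evolution j c1 c2 rest t t k"

definition bslow :: "complex => complex" where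
 "bslow k = bsym \<gamma> l k * evolution j c1 c2 slow t t k"

lemma tT: "t \<in> {0..T}" using t by simp

lemma bslow_field_differentiable: "k \<in> cone ==> bslow field_differentiable at k"
 unfolding bslow_def[abs_def] by (intro field_differentiable_mult bsym_field_differentiable evolution_slow_field_differentiable tT)

lemma brest_field_differentiable: "Im k < 0 ==> brest field_differentiable at k"
 unfolding brest_def[abs_def] by (intro field_differentiable_mult bsym_field_differentiable evolution_rest_field_differentiable tT)

lemma continuous_on_bsym: "continuous_on A (bsym \<gamma> l)"
 unfolding bsym_def[abs_def] by (intro continuous_intros)

lemma continuous_on_brest: "continuous_on {k. Im k \<le> 0} brest"
 unfolding brest_def[abs_def] by (intro continuous_intros continuous_on_bsym continuous_on_evolution_rest tT)

lemma continuous_on_bslow: "A \<subseteq> cone ==> continuous_on A bslow"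
 by (rule continuous_at_imp_continuous_on) (use bslow_field_differentiable field_differentiable_imp_continuous_at in blast)

lemma norm_brest:
 assumes k: "Im k \<le> 0" "Im (k ^ od j) \<ge> 0"
 shows "norm (brest k) \<le> ((1 + \<bar>\<gamma>\<bar>) * ((norm c1 + norm c2 * t) * K)) / (1 + norm k)\<^sup>2"
proof -
 have c: "continuous_on {0..t} (%ta. rest ta k)"
  by (rule continuous_on_subset[OF continuous_on_section[OF cont_rest]]) (use t k in auto)
 have "norm (evolution j c1 c2 rest t t k) \<le> (norm c1 + norm c2 * t) * (K / (1 + norm k) ^ M)"
  using t k by (intro norm_evolution c norm_rest) auto
 hence "norm (brest k) \<le> ((1 + \<bar>\<gamma>\<bar>) * (1 + norm k) ^ l) * ((norm c1 + norm c2 * t) * (K / (1 + norm k) ^ M))"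
  unfolding brest_def norm_mult by (intro mult_mono norm_bsym) auto
 also have "\<dots> = ((1 + \<bar>\<gamma>\<bar>) * ((norm c1 + norm c2 * t) * K)) * ((1 + norm k) ^ l / (1 + norm k) ^ M)" by simp
 also have "\<dots> \<le> ((1 + \<bar>\<gamma>\<bar>) * ((norm c1 + norm c2 * t) * K)) * (1 / (1 + norm k)\<^sup>2)"
 proof (rule mult_left_mono)
  have "(1 + norm k) ^ l * (1 + norm k)\<^sup>2 \<le> (1 + norm k) ^ M"
   unfolding power_add[symmetric] using l by (intro power_increasing) auto
  moreover have "0 < 1 + norm k" by (rule add_pos_nonneg) auto
  hence "0 < (1 + norm k) ^ M" "0 < (1 + norm k)\<^sup>2" by (rule zero_less_power)+
  ultimately show "(1 + norm k) ^ l / (1 + norm k) ^ M \<le> 1 / (1 + norm k)\<^sup>2"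
   by (simp only: divide_simps) (auto simp: mult.commute)
 qed (use t K_nonneg in \<open>auto intro!: mult_nonneg_nonneg add_nonneg_nonneg\<close>)
 finally show ?thesis by simp
qed

lemma
 assumes c: "k \<in> cone" and Im: "Im (k ^ od j) \<ge> 0"
 shows norm_bslow: "norm (bslow k) \<le> ((1 + \<bar>\<gamma>\<bar>) * ((norm c1 + norm c2 * t) * K)) * (1 + norm k) ^ l"
  and norm_evolution_slow_decay: "(1 + Im (k ^ od j)) * norm (evolution j c1 c2 slow t t k) \<le>
   (norm c1 * (1 + 1 / t) + norm c2 * (t + 1)) * (K / (1 + norm k))"
proof -
 have cont: "continuous_on {0..t} (%ta. slow ta k)"
  by (rule continuous_on_subset[OF continuous_on_section[OF cont_slow c]]) (use t in auto)
 have b: "norm (slow ta k) \<le> K / (1 + norm k)" if "ta \<in> {0..t}" for ta using that t by (intro norm_slow c) auto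
 show "(1 + Im (k ^ od j)) * norm (evolution j c1 c2 slow t t k) \<le>
   (norm c1 * (1 + 1 / t) + norm c2 * (t + 1)) * (K / (1 + norm k))"
  by (rule norm_evolution_decay[where a=slow, OF cont t(1) b Im])
 have "norm (evolution j c1 c2 slow t t k) \<le> (norm c1 + norm c2 * t) * (K / (1 + norm k))"
  by (rule norm_evolution[where a=slow, OF cont t(1) b Im])
 also have "\<dots> \<le> (norm c1 + norm c2 * t) * (K / 1)"
  using t K_nonneg by (intro mult_left_mono divide_left_mono) (auto intro: add_pos_nonneg)
 finally have "norm (bslow k) \<le> ((1 + \<bar>\<gamma>\<bar>) * (1 + norm k) ^ l) * ((norm c1 + norm c2 * t) * (K / 1))"
  unfolding bslow_def norm_mult by (intro mult_mono norm_bsym) auto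
 thus "norm (bslow k) \<le> ((1 + \<bar>\<gamma>\<bar>) * ((norm c1 + norm c2 * t) * K)) * (1 + norm k) ^ l" by (simp add: mult_ac)
qed

text \<open>Off the real axis the evolution factor beats the slow decay of the transform.\<close>

lemma norm_bslow_decay:
 assumes r: "r \<ge> 0" and c: "pol r th \<in> cone" and s: "sin (real (od j) * th) \<ge> sin (pi / 4)"
 shows "norm (bslow (pol r th)) \<le>
  ((1 + \<bar>\<gamma>\<bar>) * (2 ^ od j / sin (pi / 4)) * ((norm c1 * (1 + 1 / t) + norm c2 * (t + 1)) * K)) / (1 + r)\<^sup>2"
proof -
 define k where "k = pol r th"
 define ev where "ev = norm (evolution j c1 c2 slow t t k)"
 define A where "A = norm c1 * (1 + 1 / t) + norm c2 * (t + 1)"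
 define c where "c = Im (k ^ od j)"
 have s0: "0 < sin (pi / 4)" "sin (pi / 4) \<le> 1" by (auto intro!: sin_gt_zero)
 have nk: "norm k = r" using r by (simp add: k_def norm_mult)
 have cr: "c \<ge> sin (pi / 4) * r ^ od j"
  unfolding c_def k_def Im_ray_power using mult_left_mono[OF s, of "r ^ od j"] r by (simp add: mult.commute)
 have c0: "c \<ge> 0" using cr mult_nonneg_nonneg[of "sin (pi / 4)" "r ^ od j"] s0 r by (smt (verit) zero_le_power)
 have ev: "(1 + c) * ev \<le> A * (K / (1 + r))"
  using norm_evolution_slow_decay[of k] assms c0 nk by (simp only: c_def ev_def A_def k_def)
 have ev0: "ev \<ge> 0" by (simp add: ev_def)
 have p: "(1 + r) ^ od j \<le> (2 ^ od j / sin (pi / 4)) * (1 + c)"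
 proof -
  have "sin (pi / 4) * (1 + r ^ od j) \<le> 1 + c"
   unfolding distrib_left mult_1_right by (intro add_mono s0 cr)
  hence "1 + r ^ od j \<le> (1 + c) / sin (pi / 4)" using s0 by (simp add: pos_le_divide_eq mult.commute)
  hence "2 ^ od j * (1 + r ^ od j) \<le> 2 ^ od j * ((1 + c) / sin (pi / 4))" by (intro mult_left_mono) auto
  with power_one_plus_le[OF r, of "od j"] show ?thesis by simp
 qed
 have "norm (bslow k) * (1 + r)\<^sup>2 \<le> ((1 + \<bar>\<gamma>\<bar>) * (1 + r) ^ l * ev) * (1 + r)\<^sup>2"
  unfolding bslow_def norm_mult ev_def[symmetric] using norm_bsym[of \<gamma> l k] nk ev0 by (intro mult_right_mono) auto
 also have "\<dots> = (1 + \<bar>\<gamma>\<bar>) * ((1 + r) * (ev * (1 + r) ^ (l + 1)))" by (simp add: power2_eq_square)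
 also have "\<dots> \<le> (1 + \<bar>\<gamma>\<bar>) * ((1 + r) * (ev * ((2 ^ od j / sin (pi / 4)) * (1 + c))))"
 proof -
  have "(1 + r) ^ (l + 1) \<le> (1 + r) ^ od j" using r l by (intro power_increasing) auto
  with p have "(1 + r) ^ (l + 1) \<le> (2 ^ od j / sin (pi / 4)) * (1 + c)" by linarith
  thus ?thesis using r ev0 by (intro mult_left_mono) auto
 qed
 also have "\<dots> = (1 + \<bar>\<gamma>\<bar>) * (2 ^ od j / sin (pi / 4)) * ((1 + r) * ((1 + c) * ev))" by (simp only: mult_ac)
 also have "\<dots> \<le> (1 + \<bar>\<gamma>\<bar>) * (2 ^ od j / sin (pi / 4)) * ((1 + r) * (A * (K / (1 + r))))"
  using r s0 by (intro mult_left_mono ev) auto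
 also have "\<dots> = (1 + \<bar>\<gamma>\<bar>) * (2 ^ od j / sin (pi / 4)) * (A * K)" using r by simp
 finally show ?thesis unfolding k_def A_def using r by (simp only: pos_le_divide_eq zero_less_power add_pos_nonneg zero_less_one)
qed

definition rest_ray :: "real => complex" where
 "rest_ray s = integral {0..} (ray_integrand brest (ang j s))"

definition slow_ray :: "real => complex" where
 "slow_ray s = integral {0..} (ray_integrand bslow (ang j s))"

lemma ang_full_turn:
 "ray_integrand f (ang j (s + 2 * real (od j))) = ray_integrand f (ang j s)"
proof -
 have "cis (ang j (s + 2 * real (od j))) = cis (ang j s)" unfolding ang_simps by (simp add: cis.ctr)
 thus ?thesis by (simp add: ray_integrand_def fun_eq_iff)
qed

lemma ang_between:
 assumes "j + 1 \<le> m" "m \<le> 2 * j"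
 shows "pi \<le> ang j (2 * real m)" "ang j (2 * real m + 1) \<le> 2 * pi"
proof -
 have "real (j + 1) \<le> real m" "real m \<le> real (2 * j)" using assms by (simp_all only: of_nat_le_iff)
 hence m: "real j + 1 \<le> real m" "real m \<le> 2 * real j" by simp_all
 have "ang j (real (od j)) \<le> ang j (2 * real m)" using m by (intro ang_mono) simp
 thus "pi \<le> ang j (2 * real m)" by (simp only: ang_simps)
 have "ang j (2 * real m + 1) \<le> ang j (2 * real (od j))" using m by (intro ang_mono) simp
 thus "ang j (2 * real m + 1) \<le> 2 * pi" by (simp only: ang_simps)
qed

text \<open>
 Between two consecutive sectors of the lower half-plane the evolution factor decays, so that the
 contour between them contributes nothing.
\<close>

lemma gap_closes:
 assumes m: "j + 1 \<le> m" "m \<le> 2 * j"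
 shows "rest_ray (2 * real m) = rest_ray (2 * real m + 1)"
  "slow_ray (2 * real m + 1 / 4) = slow_ray (2 * real m + 3 / 4)"
proof -
 note b = ang_between[OF m]
 have lt: "ang j (2 * real m) < ang j (2 * real m + 1)" by (rule ang_mono) simp
 have "rays_agree brest (ang j (2 * real m)) (ang j (2 * real m + 1))"
 proof (rule rays_agree_if_small[OF lt])
  show "ang j (2 * real m + 1) \<le> ang j (2 * real m) + pi" using b by linarith
  show "continuous_on (wedge (ang j (2 * real m)) (ang j (2 * real m + 1))) brest"
  proof (rule continuous_on_subset[OF continuous_on_brest], rule subsetI)
   fix z assume "z \<in> wedge (ang j (2 * real m)) (ang j (2 * real m + 1))"
   then obtain r th where z: "z = pol r th" "r \<ge> 0" "ang j (2 * real m) \<le> th" "th \<le> ang j (2 * real m + 1)"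
    unfolding wedge_def by blast
   hence "Im z \<le> 0" unfolding z(1) using b by (intro lower_ray(1)) auto
   thus "z \<in> {k. Im k \<le> 0}" by simp
  qed
  show "brest field_differentiable at (pol r th)"
   if "r > 0" "ang j (2 * real m) < th" "th < ang j (2 * real m + 1)" for r th
   using that b by (intro brest_field_differentiable lower_ray(2)) auto
  show "norm (brest (pol r th)) \<le> ((1 + \<bar>\<gamma>\<bar>) * ((norm c1 + norm c2 * t) * K)) / (1 + r)\<^sup>2"
   if "r \<ge> 0" "ang j (2 * real m) \<le> th" "th \<le> ang j (2 * real m + 1)" for r th
  proof -
   have "Im ((pol r th) ^ od j) \<ge> 0"
    unfolding Im_ray_power using sin_d_nonneg[OF that(2,3)] that(1) by (intro mult_nonneg_nonneg) auto
   moreover have "Im (pol r th) \<le> 0" using that b by (intro lower_ray(1)) auto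
   ultimately show ?thesis using norm_brest[of "pol r th"] that(1) by (simp add: norm_mult)
  qed
 qed
 thus "rest_ray (2 * real m) = rest_ray (2 * real m + 1)" unfolding rest_ray_def by (rule rays_agree_integral)
 have b': "ang j (2 * real m) \<le> ang j (2 * real m + 1 / 4)" "ang j (2 * real m + 3 / 4) \<le> ang j (2 * real m + 1)"
  by (auto intro: ang_mono)
 have cone: "pol r th \<in> cone" if "r \<ge> 0" "ang j (2 * real m + 1 / 4) \<le> th" "th \<le> ang j (2 * real m + 3 / 4)" for r th
  by (rule lower_subset_cone, rule lower_ray(1)) (use that b b' in linarith)+
 have lt': "ang j (2 * real m + 1 / 4) < ang j (2 * real m + 3 / 4)" by (rule ang_mono) simp
 have "rays_agree bslow (ang j (2 * real m + 1 / 4)) (ang j (2 * real m + 3 / 4))"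
 proof (rule rays_agree_if_small[OF lt'])
  show "ang j (2 * real m + 3 / 4) \<le> ang j (2 * real m + 1 / 4) + pi" using b b' by linarith
  show "continuous_on (wedge (ang j (2 * real m + 1 / 4)) (ang j (2 * real m + 3 / 4))) bslow"
   by (rule continuous_on_bslow) (use cone in \<open>unfold wedge_def, blast\<close>)
  show "bslow field_differentiable at (pol r th)"
   if "r > 0" "ang j (2 * real m + 1 / 4) < th" "th < ang j (2 * real m + 3 / 4)" for r th
   using that by (intro bslow_field_differentiable cone) auto
  show "norm (bslow (pol r th)) \<le>
    ((1 + \<bar>\<gamma>\<bar>) * (2 ^ od j / sin (pi / 4)) * ((norm c1 * (1 + 1 / t) + norm c2 * (t + 1)) * K)) / (1 + r)\<^sup>2"
   if "r \<ge> 0" "ang j (2 * real m + 1 / 4) \<le> th" "th \<le> ang j (2 * real m + 3 / 4)" for r th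
   using that by (intro norm_bslow_decay cone sin_d_large)
 qed
 thus "slow_ray (2 * real m + 1 / 4) = slow_ray (2 * real m + 3 / 4)" unfolding slow_ray_def by (rule rays_agree_integral)
qed

definition outer_value :: "real => complex" where
 "outer_value n = rest_ray (2 * real j + 2 * n - 1) + slow_ray (2 * real j + 2 * n - 1 - 1 / 4)
  - (rest_ray (2 * real j + 2 * n) + slow_ray (2 * real j + 2 * n + 1 / 4))"

text \<open>The rotated sectors tile the boundary of the lower half-plane, up to the gaps just closed.\<close>

lemma sum_outer_value:
 "(\<Sum>n=1..j+1. outer_value (real n)) = rest_ray (real (od j)) + slow_ray (real (od j) - 1 / 4)
   - (rest_ray 0 + slow_ray (1 / 4))"
proof -
 define low where "low n = rest_ray (2 * real j + 2 * real n - 1) + slow_ray (2 * real j + 2 * real n - 1 - 1 / 4)" for n :: nat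
 define up where "up n = rest_ray (2 * real j + 2 * real n) + slow_ray (2 * real j + 2 * real n + 1 / 4)" for n :: nat
 have step: "up n = low (n + 1)" if "1 \<le> n" "n \<le> j" for n
  unfolding up_def low_def using gap_closes[of "j + n"] that by (simp add: distrib_left add_ac)
 have "(\<Sum>n=1..m+1. low n - up n) = low 1 - up (m + 1)" if "m \<le> j" for m
  using that by (induction m) (auto simp: step)
 from this[of j] have "(\<Sum>n=1..j+1. outer_value (real n)) = low 1 - up (j + 1)" by (simp add: outer_value_def low_def up_def)
 moreover have "low 1 = rest_ray (real (od j)) + slow_ray (real (od j) - 1 / 4)" by (simp add: low_def)
 moreover have "up (j + 1) = rest_ray 0 + slow_ray (1 / 4)"
 proof -
  have "2 * real j + 2 * real (j + 1) = 0 + 2 * real (od j)" "2 * real j + 2 * real (j + 1) + 1 / 4 = 1 / 4 + 2 * real (od j)"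
   by simp_all
  thus ?thesis unfolding up_def rest_ray_def slow_ray_def by (simp only: ang_full_turn)
 qed
 ultimately show ?thesis by simp
qed


lemma brest_limit:
 assumes "sin th \<ge> 0" and low: "\<And>r. r \<ge> 0 ==> Im (pol r (th + \<phi>)) \<le> 0"
  and s: "sin (real (od j) * (th + \<phi>)) \<ge> 0"
 shows "((%x. integral {0..} (ray_integrand (%k. exi x k * brest (cis \<phi> * k)) th)) \<longlongrightarrow>
   cis (- \<phi>) * integral {0..} (ray_integrand brest (th + \<phi>))) (at_right 0)"
proof (rule rotated_ray_limit[OF assms(1)])
 show "continuous_on {0..} (ray_integrand brest (th + \<phi>))"
  by (rule continuous_on_ray_integrand[OF continuous_on_brest]) (use low in simp)
 show "norm (brest (pol r (th + \<phi>))) \<le> ((1 + \<bar>\<gamma>\<bar>) * ((norm c1 + norm c2 * t) * K)) / (1 + r)\<^sup>2" if "r \<ge> 0" for r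
 proof -
  have "Im ((pol r (th + \<phi>)) ^ od j) \<ge> 0"
   unfolding Im_ray_power using s that by (intro mult_nonneg_nonneg) auto
  thus ?thesis using norm_brest[OF low[OF that]] that by (simp add: norm_mult)
 qed
qed

lemma bslow_limit:
 assumes "sin th \<ge> 0" and c: "\<And>r. r \<ge> 0 ==> pol r (th + \<phi>) \<in> cone"
  and s: "sin (real (od j) * (th + \<phi>)) \<ge> sin (pi / 4)"
 shows "((%x. integral {0..} (ray_integrand (%k. exi x k * bslow (cis \<phi> * k)) th)) \<longlongrightarrow>
   cis (- \<phi>) * integral {0..} (ray_integrand bslow (th + \<phi>))) (at_right 0)"
proof (rule rotated_ray_limit[OF assms(1)])
 show "continuous_on {0..} (ray_integrand bslow (th + \<phi>))"
  by (rule continuous_on_ray_integrand[OF continuous_on_bslow[OF order_refl]]) (use c in simp)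
qed (rule norm_bslow_decay[OF _ c s])

lemma eps_rays: "eps j = ang j (1 / 4)" "pi - eps j = ang j (real (od j) - 1 / 4)"
 by (simp_all only: ang_simps)

text \<open>After the rotation of the slow part the limit \<open>x = 0\<close> may be taken under the integral.\<close>

lemma line_limit:
 "((%x. line_family c1 c2 l t x + of_real \<gamma> * line_family c1 c2 (l - 1) t x) \<longlongrightarrow>
   rest_ray 0 + slow_ray (1 / 4) - (rest_ray (real (od j)) + slow_ray (real (od j) - 1 / 4))) (at_right 0)"
proof -
 let ?R = "%th x. integral {0..} (ray_integrand (%k. exi x k * brest (cis 0 * k)) th)"
 let ?S = "%th x. integral {0..} (ray_integrand (%k. exi x k * bslow (cis 0 * k)) th)"
 have l': "l \<le> od j" using l by simp
 have eq: "line_family c1 c2 l t x + of_real \<gamma> * line_family c1 c2 (l - 1) t x = ?R 0 x - ?R pi x + (?S (eps j) x - ?S (pi - eps j) x)"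
  if "x > 0" for x
 proof -
  have alg: "(a - b + (c - e)) + g * (a' - b' + (c' - e')) = ((a + g * a') - (b + g * b')) + ((c + g * c') - (e + g * e'))"
   for a b c e a' b' c' e' g :: complex by (simp add: algebra_simps)
  show ?thesis
   unfolding line_family_def alg cis_zero mult_1_left brest_def bslow_def
   by (simp only: ray_wave_bsym[OF data_rest(1) l' tT that] ray_wave_bsym[OF data_rest(2) l' tT that]
     ray_wave_bsym[OF data_slow(1) l' tT that] ray_wave_bsym[OF data_slow(2) l' tT that])
 qed
 have R: "(?R th \<longlongrightarrow> integral {0..} (ray_integrand brest th)) (at_right 0)" if "th \<in> {0, pi}" for th
  using brest_limit[of th 0] that rays(1-4) by auto
 have large: "sin (real (od j) * eps j) \<ge> sin (pi / 4)" "sin (real (od j) * (pi - eps j)) \<ge> sin (pi / 4)"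
  unfolding sin_multiple_reflect eps_bounds(3) by simp_all
 have S: "(?S th \<longlongrightarrow> integral {0..} (ray_integrand bslow th)) (at_right 0)" if "th \<in> {eps j, pi - eps j}" for th
 proof -
  have "pol r (th + 0) \<in> cone" if "r \<ge> 0" for r
   using \<open>th \<in> {eps j, pi - eps j}\<close> in_cone_near_0[OF that, of th] in_cone_near_pi[OF that, of th] eps_bounds[of j] by auto
  moreover have "sin th \<ge> 0" using that rays(5,7) by (auto simp del: sin_pi_minus)
  moreover have "sin (real (od j) * (th + 0)) \<ge> sin (pi / 4)" using that large by (auto simp only: add_0_right insert_iff empty_iff)
  ultimately show ?thesis using bslow_limit[of th 0] by simp
 qed
 have "((%x. ?R 0 x - ?R pi x + (?S (eps j) x - ?S (pi - eps j) x)) \<longlongrightarrow>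
   (integral {0..} (ray_integrand brest 0) - integral {0..} (ray_integrand brest pi)
   + (integral {0..} (ray_integrand bslow (eps j)) - integral {0..} (ray_integrand bslow (pi - eps j))))) (at_right 0)"
  by (intro tendsto_intros R S) auto
 hence "((%x. line_family c1 c2 l t x + of_real \<gamma> * line_family c1 c2 (l - 1) t x) \<longlongrightarrow>
   (integral {0..} (ray_integrand brest 0) - integral {0..} (ray_integrand brest pi)
   + (integral {0..} (ray_integrand bslow (eps j)) - integral {0..} (ray_integrand bslow (pi - eps j))))) (at_right 0)"
  by (rule Lim_transform_eventually) (use eventually_at_right_less[of 0] in \<open>eventually_elim, simp only: eq\<close>)
 moreover have "rest_ray 0 = integral {0..} (ray_integrand brest 0)" "rest_ray (real (od j)) = integral {0..} (ray_integrand brest pi)"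
  "slow_ray (1 / 4) = integral {0..} (ray_integrand bslow (eps j))"
  "slow_ray (real (od j) - 1 / 4) = integral {0..} (ray_integrand bslow (pi - eps j))"
  unfolding rest_ray_def slow_ray_def eps_rays by (simp_all only: ang_simps)
 ultimately show ?thesis by (simp add: algebra_simps)
qed

text \<open>The part of the evolution after time \<open>t\<close>; it is analytic and bounded inside the sectors.\<close>

definition future :: "complex => complex" where
 "future k = bsym \<gamma> l k * (exi t (k ^ od j) * (c2 * (duhamel (od j) ft T k - duhamel (od j) ft t k)))"

lemma norm_future:
 assumes k: "Im k \<le> 0" "Im (k ^ od j) \<le> 0"
 shows "norm (future k) \<le> ((1 + \<bar>\<gamma>\<bar>) * (norm c2 * (2 * K * T))) * (1 + norm k) ^ l"
proof -
 let ?f = "%ta. exi (t - ta) (k ^ od j) * ft ta k"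
 have c: "continuous_on {0..T} (%ta. ft ta k)" by (rule continuous_on_section[OF cont_ft]) (use k in simp)
 have b: "norm (ft ta k) \<le> 2 * K" if "ta \<in> {0..T}" for ta
 proof -
  have "norm (ft ta k) \<le> 2 * K / (1 + norm k)" using that k by (intro norm_ft) auto
  also have "\<dots> \<le> 2 * K / 1" using K_nonneg by (intro divide_left_mono) (auto intro: add_pos_nonneg)
  finally show ?thesis by simp
 qed
 have "integral {0..t} ?f + integral {t..T} ?f = integral {0..T} ?f"
 proof (rule Henstock_Kurzweil_Integration.integral_combine)
  show "?f integrable_on {0..T}" by (intro integrable_continuous_real continuous_intros c)
 qed (use t in auto)
 hence "exi t (k ^ od j) * (duhamel (od j) ft T k - duhamel (od j) ft t k) = integral {t..T} ?f"
  unfolding right_diff_distrib exp_mult_duhamel by (simp add: algebra_simps)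
 moreover have "norm (integral {t..T} ?f) \<le> 2 * K * (T - t)"
  using t k by (intro norm_time_integral_le continuous_on_subset[OF c] b)
   (auto intro!: mult_nonpos_nonpos simp del: power_Suc)
 moreover have "2 * K * (T - t) \<le> 2 * K * T" using t K_nonneg by (intro mult_left_mono) auto
 ultimately have "norm (exi t (k ^ od j) * (duhamel (od j) ft T k - duhamel (od j) ft t k)) \<le> 2 * K * T"
  by simp
 hence "norm (bsym \<gamma> l k * (c2 * (exi t (k ^ od j) * (duhamel (od j) ft T k - duhamel (od j) ft t k)))) \<le>
   ((1 + \<bar>\<gamma>\<bar>) * (1 + norm k) ^ l) * (norm c2 * (2 * K * T))"
  unfolding norm_mult[of "bsym \<gamma> l k"] norm_mult[of c2] by (intro mult_mono norm_bsym mult_left_mono) auto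
 thus ?thesis unfolding future_def by (simp only: mult_ac)
qed

context
 fixes p n :: nat
 assumes p: "p \<in> {1..j}" and n: "n \<in> {1..j+1}"
begin

abbreviation "arg \<equiv> ang j (2 * real (j - p + n))"

lemma shifted_angle: "ang j s + arg = ang j (s - 2 * real p + 2 * real j + 2 * real n)"
proof -
 have "real (j - p) = real j - real p" using p by (simp add: of_nat_diff)
 hence "s + 2 * real (j - p + n) = s - 2 * real p + 2 * real j + 2 * real n" by simp
 thus ?thesis by (simp only: ang_simps(4)[symmetric])
qed

lemma shifted_angle_bounds:
 assumes "2 * real p - 1 - 1 / 4 \<le> s" "s \<le> 2 * real p + 1 / 4"
 shows "3 * pi / 4 \<le> ang j s + arg" "ang j s + arg \<le> 9 * pi / 4"
proof -
 have n': "1 \<le> real n" "real n \<le> real j + 1" using n by auto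
 have "ang j (real (od j) - 1 / 4) \<le> ang j (s - 2 * real p + 2 * real j + 2 * real n)" using assms n' by (intro ang_mono) simp
 hence "pi - eps j \<le> ang j s + arg" unfolding shifted_angle by (simp only: ang_simps)
 thus "3 * pi / 4 \<le> ang j s + arg" using eps_bounds(2)[of j] by simp
 have "ang j (s - 2 * real p + 2 * real j + 2 * real n) \<le> ang j (2 * real (od j) + 1 / 4)" using assms n' by (intro ang_mono) simp
 hence "ang j s + arg \<le> 2 * pi + eps j" unfolding shifted_angle by (simp only: ang_simps)
 thus "ang j s + arg \<le> 9 * pi / 4" using eps_bounds(2)[of j] by simp
qed

text \<open>For \<open>x > 0\<close> the boundary rays of a sector may be rotated out of it, as long as the rotated wave number
 stays in the cone and the evolution factor does not grow.\<close>

lemma bslow_rays_agree: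
 assumes x: "x > 0" and s: "s < s'" "2 * real p - 1 - 1 / 4 \<le> s" "s' \<le> 2 * real p + 1 / 4"
  and m: "2 * real m \<le> s - 2 * real p + 2 * real j + 2 * real n" "s' - 2 * real p + 2 * real j + 2 * real n \<le> 2 * real m + 1"
 shows "rays_agree (%k. exi x k * bslow (cis arg * k)) (ang j s) (ang j s')"
proof -
 have lt: "ang j s < ang j s'" by (rule ang_mono(2)[OF s(1)])
 have p': "1 \<le> real p" "real p \<le> real j" using p by auto
 have lo: "0 < ang j s" using ang_mono(2)[of 0 s j] s p' by (simp add: ang_simps)
 have "ang j s' < ang j (real (od j))" using s p' by (intro ang_mono) simp
 hence up: "ang j s' < pi" by (simp only: ang_simps)
 have cone: "cis arg * (pol r th) \<in> cone" if "r \<ge> 0" "ang j s \<le> th" "th \<le> ang j s'" for r th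
 proof -
  have eq: "cis arg * (pol r th) = pol r (th + arg)" by (simp add: cis_mult[symmetric] mult_ac)
  have "3 * pi / 4 \<le> th + arg" "th + arg \<le> 9 * pi / 4"
   using shifted_angle_bounds[of s] shifted_angle_bounds[of s'] s that by linarith+
  thus ?thesis unfolding eq by (rule ray_in_cone[OF that(1)])
 qed
 have "rays_agree (%k. exi x (k ^ 1) * bslow (cis arg * k)) (ang j s) (ang j s')"
 proof (rule rays_agree_exp_decay[OF lt, where q=l])
  show "ang j s' \<le> ang j s + pi" using lo up by simp
  show fd: "(%k. bslow (cis arg * k)) field_differentiable at (pol r th)"
   if "r > 0" "ang j s < th" "th < ang j s'" for r th
   using that by (intro field_differentiable_scale bslow_field_differentiable cone) auto
  show "continuous_on (wedge (ang j s) (ang j s')) (%k. bslow (cis arg * k))"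
   by (rule continuous_on_compose2[OF continuous_on_bslow[OF order_refl]])
     (use cone in \<open>auto simp: wedge_def intro!: continuous_intros\<close>)
  show "x * sin (real 1 * th) > 0" if "ang j s \<le> th" "th \<le> ang j s'" for th
   using x that lo up sin_gt_zero[of th] by simp
  show "norm (bslow (cis arg * (pol r th))) \<le> ((1 + \<bar>\<gamma>\<bar>) * ((norm c1 + norm c2 * t) * K)) * (1 + r) ^ l"
   if r: "r \<ge> 0" "ang j s \<le> th" "th \<le> ang j s'" for r th
  proof -
   have eq: "cis arg * (pol r th) = pol r (th + arg)" by (simp add: cis_mult[symmetric] mult_ac)
   have "ang j (2 * real m) \<le> ang j s + arg" unfolding shifted_angle by (intro ang_mono m)
   moreover have "ang j s' + arg \<le> ang j (2 * real m + 1)" unfolding shifted_angle by (intro ang_mono m)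
   ultimately have "sin (real (od j) * (th + arg)) \<ge> 0" using r by (intro sin_d_nonneg[of j m]) auto
   hence "Im ((pol r (th + arg)) ^ od j) \<ge> 0"
    unfolding Im_ray_power using r by (intro mult_nonneg_nonneg) auto
   thus ?thesis using norm_bslow[of "pol r (th + arg)"] cone[OF r] r unfolding eq by (simp add: norm_mult)
  qed
 qed simp
 thus ?thesis by simp
qed

text \<open>
 In a sector, the boundary operator turns the coefficient of the data into a function of the
 rotated variable \<open>alpha j p n * k\<close> alone, except for a constant factor.
\<close>

lemma data_amplitude_bsym:
 assumes k: "Im (alpha j p n * k) \<le> 0" and "\<gamma> \<noteq> 0 ==> k - \<i> * of_real \<gamma> \<noteq> 0"
 shows "bsym \<gamma> l k * (exi t (k ^ od j) * (transformed_data c1 c2 p n k * Pcoef j \<gamma> p n k)) =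
  lagrange j p n 1 * alpha j p n ^ (od j - l) * (alpha j p n * (brest (alpha j p n * k) + bslow (alpha j p n * k) + future (alpha j p n * k)))"
proof -
 define \<kappa> where "\<kappa> = alpha j p n * k"
 have split: "c1 * ft 0 \<kappa> + c2 * duhamel (od j) ft T \<kappa> =
   (c1 * rest 0 \<kappa> + c2 * duhamel (od j) rest t \<kappa>) + (c1 * slow 0 \<kappa> + c2 * duhamel (od j) slow t \<kappa>)
   + c2 * (duhamel (od j) ft T \<kappa> - duhamel (od j) ft t \<kappa>)"
  using ft_split[of 0 \<kappa>] duhamel_ft_split[OF tT, of \<kappa>] k T by (simp add: \<kappa>_def algebra_simps)
 have "bsym \<gamma> l k * (exi t (k ^ od j) * (transformed_data c1 c2 p n k * Pcoef j \<gamma> p n k)) =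
   (bsym \<gamma> l k * Pcoef j \<gamma> p n k) * (exi t (\<kappa> ^ od j) * (c1 * ft 0 \<kappa> + c2 * duhamel (od j) ft T \<kappa>))"
  unfolding transformed_data_def \<kappa>_def alpha_power_mult by (simp only: mult_ac)
 also have "\<dots> = lagrange j p n 1 * alpha j p n ^ (od j - l) * (alpha j p n * (brest \<kappa> + bslow \<kappa> + future \<kappa>))"
 proof -
  have bP: "bsym \<gamma> l k * Pcoef j \<gamma> p n k = lagrange j p n 1 * alpha j p n ^ (od j - l) * (alpha j p n * bsym \<gamma> l \<kappa>)"
   unfolding \<kappa>_def by (rule bsym_Pcoef[OF p n l]) (rule assms(2))
  have alg: "L * (a * b) * (E * (u + v + w)) = L * (a * (b * (E * u) + b * (E * v) + b * (E * w)))" for L a b E u v w :: complex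
   by (simp add: algebra_simps)
  show ?thesis unfolding split bP alg brest_def bslow_def future_def evolution_def ..
 qed
 finally show ?thesis unfolding \<kappa>_def .
qed

lemma sector_ray_lower: "r \<ge> 0 ==> th \<in> edges j p ==> Im (alpha j p n * (pol r th)) \<le> 0"
 using alpha_lower(1)[OF p n, of r th] sector_angles[OF p] by auto

lemma sector_ray_Im_power: "r \<ge> 0 ==> th \<in> edges j p ==> Im ((alpha j p n * (pol r th)) ^ od j) = 0"
 unfolding alpha_power_mult Im_ray_power using sector_sin_d[of j p] by auto

lemma sector_pieces_integrable:
 assumes x: "x > 0"
 shows "sector_integrable j p (%k. exi x k * brest (alpha j p n * k))"
  "sector_integrable j p (%k. exi x k * bslow (alpha j p n * k))"
  "sector_integrable j p (%k. exi x k * future (alpha j p n * k))"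
  "sector_integral j p (%k. exi x k * future (alpha j p n * k)) = 0"
proof -
 have na: "norm (alpha j p n * (pol r th)) = r" if "r \<ge> 0" for r th
  using that by (simp add: norm_mult alpha_cis)
 have sub: "wedge th th \<subseteq> wedge (lower_angle j p) (upper_angle j p)" if "th \<in> edges j p" for th
  using that sector_angles[OF p] by (intro wedge_mono) auto
 have cr: "continuous_on (wedge (lower_angle j p) (upper_angle j p)) (%k. brest (alpha j p n * k))"
  by (rule continuous_on_lower_scaled[OF p n continuous_on_brest])
 have cs: "continuous_on (wedge (lower_angle j p) (upper_angle j p)) (%k. bslow (alpha j p n * k))"
  by (rule continuous_on_lower_scaled[OF p n continuous_on_bslow]) (auto intro: lower_subset_cone)
 have cf: "continuous_on (wedge (lower_angle j p) (upper_angle j p)) (%k. future (alpha j p n * k))"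
  unfolding future_def using t
  by (intro continuous_on_lower_scaled[OF p n] continuous_intros continuous_on_bsym continuous_on_duhamel[OF cont_ft]) auto
 show "sector_integrable j p (%k. exi x k * brest (alpha j p n * k))"
 proof (rule sector_exp_integrable[OF p x continuous_on_subset[OF cr sub], where q=0])
  show "norm (brest (alpha j p n * (pol r th))) \<le> ((1 + \<bar>\<gamma>\<bar>) * ((norm c1 + norm c2 * t) * K)) * (1 + r) ^ 0"
   if r: "r \<ge> 0" "th \<in> edges j p" for r th
  proof -
   have "norm (brest (alpha j p n * (pol r th))) \<le> ((1 + \<bar>\<gamma>\<bar>) * ((norm c1 + norm c2 * t) * K)) / (1 + r)\<^sup>2"
    using norm_brest[OF sector_ray_lower[OF r]] sector_ray_Im_power[OF r] na[OF r(1)] by simp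
   also have "\<dots> \<le> ((1 + \<bar>\<gamma>\<bar>) * ((norm c1 + norm c2 * t) * K)) / 1"
    using r t K_nonneg by (intro divide_left_mono mult_nonneg_nonneg add_nonneg_nonneg) auto
   finally show ?thesis by simp
  qed
 qed
 show "sector_integrable j p (%k. exi x k * bslow (alpha j p n * k))"
 proof (rule sector_exp_integrable[OF p x continuous_on_subset[OF cs sub]])
  show "norm (bslow (alpha j p n * (pol r th))) \<le> ((1 + \<bar>\<gamma>\<bar>) * ((norm c1 + norm c2 * t) * K)) * (1 + r) ^ l"
   if r: "r \<ge> 0" "th \<in> edges j p" for r th
   using norm_bslow[OF lower_subset_cone[OF sector_ray_lower[OF r]]] sector_ray_Im_power[OF r] na[OF r(1)] by simp
 qed
 have nf: "norm (future (alpha j p n * (pol r th))) \<le> ((1 + \<bar>\<gamma>\<bar>) * (norm c2 * (2 * K * T))) * (1 + r) ^ l"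
  if r: "r \<ge> 0" "lower_angle j p \<le> th" "th \<le> upper_angle j p" for r th
  using norm_future[OF alpha_lower(1)[OF p n r] Im_power_sector[OF p n r]] na[OF r(1)] by simp
 show "sector_integrable j p (%k. exi x k * future (alpha j p n * k))"
  using sector_angles[OF p]
  by (intro sector_exp_integrable[OF p x continuous_on_subset[OF cf sub] nf]) auto
 show "sector_integral j p (%k. exi x k * future (alpha j p n * k)) = 0"
 proof (rule sector_closes[OF p cf nf _ x])
  show "(%k. future (alpha j p n * k)) field_differentiable at (pol r th)"
   if r: "r > 0" "lower_angle j p < th" "th < upper_angle j p" for r th
  proof -
   have "Im (alpha j p n * (pol r th)) < 0" using alpha_lower(2)[OF p n _ r] r by simp
   hence "future field_differentiable at (alpha j p n * (pol r th))" unfolding future_def[abs_def]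
    by (intro field_differentiable_mult bsym_field_differentiable field_differentiable_exp_power
      field_differentiable_const field_differentiable_diff duhamel_ft_field_differentiable order_refl t(2))
   thus ?thesis by (rule field_differentiable_scale)
  qed
 qed
qed

text \<open>The limit depends on \<open>p\<close> through a constant factor only.\<close>

lemma data_sector_limit:
 "((%x. sector_family j p (%k. transformed_data c1 c2 p n k * Pcoef j \<gamma> p n k) l t x
   + of_real \<gamma> * sector_family j p (%k. transformed_data c1 c2 p n k * Pcoef j \<gamma> p n k) (l - 1) t x) \<longlongrightarrow>
   lagrange j p n 1 * alpha j p n ^ (od j - l) * outer_value (real n)) (at_right 0)"
proof -
 let ?h = "%k. transformed_data c1 c2 p n k * Pcoef j \<gamma> p n k"
 let ?c = "lagrange j p n 1 * alpha j p n ^ (od j - l) * alpha j p n"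
 let ?R = "%th x. integral {0..} (ray_integrand (%k. exi x k * brest (cis arg * k)) th)"
 let ?S = "%th x. integral {0..} (ray_integrand (%k. exi x k * bslow (cis arg * k)) th)"
 define lo up where "lo = ang j (2 * real p - 1 - 1 / 4)" and "up = ang j (2 * real p + 1 / 4)"
 define B where "B = ((norm c1 + norm c2 * T) * (2 * K)) * (norm (lagrange j p n 1) +
   norm (poly (Qpoly j p) 1 / poly (pderiv (Qpoly j p)) (alpha j p n)) * (1 / \<bar>cos (lower_angle j p)\<bar> + 1 / \<bar>cos (upper_angle j p)\<bar>))"
 have eq: "sector_family j p ?h l t x + of_real \<gamma> * sector_family j p ?h (l - 1) t x =
   ?c * (?R (lower_angle j p) x - ?R (upper_angle j p) x + (?S lo x - ?S up x))" if x: "x > 0" for x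
 proof -
  have "sector_family j p ?h l t x + of_real \<gamma> * sector_family j p ?h (l - 1) t x =
    sector_integral j p (%k. exi x k * (bsym \<gamma> l k * (exi t (k ^ od j) * ?h k)))"
  proof (rule sector_family_bsym[OF p x data_amplitude(1)[OF p n], where C=B and q=0])
   fix r :: real and th assume r: "r \<ge> 0" and th: "th \<in> edges j p"
   have "norm (?h (pol r th)) \<le> ((norm c1 + norm c2 * T) * (2 * K)) * (norm (lagrange j p n 1) +
     norm (poly (Qpoly j p) 1 / poly (pderiv (Qpoly j p)) (alpha j p n)) * (1 / \<bar>cos th\<bar>))"
    by (rule data_amplitude(2)[OF p n th r])
   also have "\<dots> \<le> B" unfolding B_def
    using th T K_nonneg by (intro mult_left_mono add_left_mono mult_nonneg_nonneg add_nonneg_nonneg) auto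
   finally show "norm (?h (pol r th)) \<le> B * (1 + r) ^ 0" by simp
  qed
  also have "\<dots> = sector_integral j p (%k. ?c * ((exi x k * brest (alpha j p n * k) + exi x k * bslow (alpha j p n * k))
    + exi x k * future (alpha j p n * k)))"
  proof (rule sector_integral_cong(1))
   fix r :: real and th assume r: "r \<ge> 0" "th \<in> edges j p"
   have alg: "E * (L * A * (a * (u + v + w))) = L * A * a * (E * u + E * v + E * w)" for E L A a u v w :: complex
    by (simp add: algebra_simps)
   show "exi x ((pol r th)) * (bsym \<gamma> l (pol r th) * (exi t ((pol r th) ^ od j) * ?h (pol r th))) =
    ?c * ((exi x ((pol r th)) * brest (alpha j p n * (pol r th)) + exi x ((pol r th)) * bslow (alpha j p n * (pol r th)))
    + exi x ((pol r th)) * future (alpha j p n * (pol r th)))"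
    by (subst data_amplitude_bsym[OF sector_ray_lower[OF r]], erule pole_off_ray[OF sector_cos_nonzero[OF p r(2)] r(1)], rule alg)
  qed
  also have "\<dots> = ?c * (sector_integral j p (%k. exi x k * brest (alpha j p n * k)) + sector_integral j p (%k. exi x k * bslow (alpha j p n * k)))"
  proof -
   have i: "sector_integrable j p (%k. exi x k * brest (alpha j p n * k) + exi x k * bslow (alpha j p n * k))"
    using sector_pieces_integrable(1,2)[OF x] by (auto simp: sector_integrable_def ray_integrand_lin intro: integrable_add)
   show ?thesis
    by (simp only: sector_integral_mult sector_integral_add[OF i sector_pieces_integrable(3)[OF x]] sector_pieces_integrable(4)[OF x]
      sector_integral_add[OF sector_pieces_integrable(1,2)[OF x]] add_0_right)
  qed
  also have "sector_integral j p (%k. exi x k * bslow (alpha j p n * k)) = ?S lo x - ?S up x"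
  proof -
   have n': "real (j + n - Suc 0) = real j + real n - 1" using n by (simp add: of_nat_diff)
   have A1: "rays_agree (%k. exi x k * bslow (cis arg * k)) lo (lower_angle j p)"
    unfolding lower_angle_eq lo_def by (rule bslow_rays_agree[OF x, where m="j + n - 1"]) (simp_all add: n')
   have A2: "rays_agree (%k. exi x k * bslow (cis arg * k)) (upper_angle j p) up"
    unfolding upper_angle_eq up_def by (rule bslow_rays_agree[OF x, where m="j + n"]) simp_all
   show ?thesis unfolding sector_integral_def alpha_cis rays_agree_integral[OF A1] rays_agree_integral[OF A2] ..
  qed
  finally show ?thesis unfolding sector_integral_def alpha_cis .
 qed
 have sh: "lower_angle j p + arg = ang j (2 * real j + 2 * real n - 1)" "upper_angle j p + arg = ang j (2 * real j + 2 * real n)"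
  "lo + arg = ang j (2 * real j + 2 * real n - 1 - 1 / 4)" "up + arg = ang j (2 * real j + 2 * real n + 1 / 4)"
  unfolding lower_angle_eq upper_angle_eq lo_def up_def shifted_angle by (simp_all add: algebra_simps)
 have R: "(?R th \<longlongrightarrow> cis (- arg) * integral {0..} (ray_integrand brest (th + arg))) (at_right 0)" if "th \<in> edges j p" for th
 proof (rule brest_limit)
  show "sin th \<ge> 0" using that sector_angles[OF p] by (auto intro!: sin_ge_zero)
  show "Im (pol r (th + arg)) \<le> 0" if "r \<ge> 0" for r using sector_ray_lower[OF that \<open>th \<in> _\<close>] unfolding alpha_ray .
  have "Im ((pol 1 (th + arg)) ^ od j) = 0" using sector_ray_Im_power[of 1, OF _ that] unfolding alpha_ray by simp
  thus "sin (real (od j) * (th + arg)) \<ge> 0" unfolding Im_ray_power by simp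
 qed
 have p': "1 \<le> real p" "real p \<le> real j" using p by auto
 have lo0: "0 < lo" "lo < pi" "0 < up" "up < pi"
 proof -
  show "0 < lo" using ang_mono(2)[of 0 "2 * real p - 1 - 1 / 4" j] p' by (simp add: lo_def ang_simps(1))
  have "up < ang j (real (od j))" unfolding up_def using p' by (intro ang_mono) simp
  thus "up < pi" by (simp only: ang_simps)
  moreover have "lo < up" unfolding lo_def up_def by (rule ang_mono) simp
  ultimately show "lo < pi" "0 < up" using \<open>0 < lo\<close> by auto
 qed
 have S: "(?S th \<longlongrightarrow> cis (- arg) * integral {0..} (ray_integrand bslow (th + arg))) (at_right 0)" if "th \<in> {lo, up}" for th
 proof (rule bslow_limit)
  show "sin th \<ge> 0" using that lo0 by (auto intro!: sin_ge_zero)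
  show "pol r (th + arg) \<in> cone" if "r \<ge> 0" for r
   using ray_in_cone[OF that] shifted_angle_bounds[of "2 * real p - 1 - 1 / 4"] shifted_angle_bounds[of "2 * real p + 1 / 4"] \<open>th \<in> _\<close>
   by (auto simp: lo_def up_def)
  have n': "real (j + n - Suc 0) = real j + real n - 1" using n by (simp add: of_nat_diff)
  have "sin (real (od j) * (lo + arg)) \<ge> sin (pi / 4)" unfolding sh
   by (rule sin_d_large[of j "j + n - 1"]) (auto intro!: ang_mono simp: n')
  moreover have "sin (real (od j) * (up + arg)) \<ge> sin (pi / 4)" unfolding sh
   by (rule sin_d_large[of j "j + n"]) (auto intro!: ang_mono)
  ultimately show "sin (real (od j) * (th + arg)) \<ge> sin (pi / 4)" using that by auto
 qed
 have "((%x. ?c * (?R (lower_angle j p) x - ?R (upper_angle j p) x + (?S lo x - ?S up x))) \<longlongrightarrow>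
   ?c * (cis (- arg) * integral {0..} (ray_integrand brest (lower_angle j p + arg)) - cis (- arg) * integral {0..} (ray_integrand brest (upper_angle j p + arg))
    + (cis (- arg) * integral {0..} (ray_integrand bslow (lo + arg)) - cis (- arg) * integral {0..} (ray_integrand bslow (up + arg))))) (at_right 0)"
  by (intro tendsto_intros R S) auto
 moreover have "?c * (cis (- arg) * integral {0..} (ray_integrand brest (lower_angle j p + arg)) - cis (- arg) * integral {0..} (ray_integrand brest (upper_angle j p + arg))
    + (cis (- arg) * integral {0..} (ray_integrand bslow (lo + arg)) - cis (- arg) * integral {0..} (ray_integrand bslow (up + arg)))) =
   lagrange j p n 1 * alpha j p n ^ (od j - l) * outer_value (real n)"
 proof -
  have inv: "alpha j p n * cis (- arg) = 1" unfolding alpha_cis by (simp add: cis_mult)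
  have alg: "L * a * (e * R1 - e * R2 + (e * S1 - e * S2)) = (a * e) * (L * ((R1 + S1) - (R2 + S2)))" for L a e R1 R2 S1 S2 :: complex
   by (simp add: algebra_simps)
  show ?thesis unfolding alg inv sh outer_value_def rest_ray_def slow_ray_def by simp
 qed
 ultimately show ?thesis
  by (simp only:) (erule Lim_transform_eventually, use eventually_at_right_less[of 0] in \<open>eventually_elim, simp only: eq\<close>)
qed

end

text \<open>
 The data do not contribute to the boundary values: weighted by the powers of \<open>alpha\<close>, the sectors
 sum to minus the boundary of the lower half-plane, which cancels the integral over the line.
\<close>

theorem data_boundary_values:
 "((%x. line_family c1 c2 l t x + of_real \<gamma> * line_family c1 c2 (l - 1) t x
   - (\<Sum>p=1..j. \<Sum>n=1..j+1. sector_family j p (%k. transformed_data c1 c2 p n k * Pcoef j \<gamma> p n k) l t x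
   + of_real \<gamma> * sector_family j p (%k. transformed_data c1 c2 p n k * Pcoef j \<gamma> p n k) (l - 1) t x)) \<longlongrightarrow> 0) (at_right 0)"
proof -
 have "(\<Sum>p=1..j. \<Sum>n=1..j+1. lagrange j p n 1 * alpha j p n ^ (od j - l) * outer_value (real n)) =
   (\<Sum>n=1..j+1. (\<Sum>p=1..j. lagrange j p n 1 * alpha j p n ^ (od j - l)) * outer_value (real n))"
  by (subst sum.swap) (simp only: sum_distrib_right)
 also have "\<dots> = (\<Sum>n=1..j+1. - outer_value (real n))"
 proof (rule sum.cong[OF refl])
  fix n assume n: "n \<in> {1..j+1}"
  show "(\<Sum>p=1..j. lagrange j p n 1 * alpha j p n ^ (od j - l)) * outer_value (real n) = - outer_value (real n)"
   using l by (subst sum_lagrange_alpha[OF n]) auto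
 qed
 also have "\<dots> = rest_ray 0 + slow_ray (1 / 4) - (rest_ray (real (od j)) + slow_ray (real (od j) - 1 / 4))"
  unfolding sum_negf sum_outer_value by simp
 finally have e: "(\<Sum>p=1..j. \<Sum>n=1..j+1. lagrange j p n 1 * alpha j p n ^ (od j - l) * outer_value (real n)) =
   rest_ray 0 + slow_ray (1 / 4) - (rest_ray (real (od j)) + slow_ray (real (od j) - 1 / 4))" .
 have "((%x. \<Sum>p=1..j. \<Sum>n=1..j+1. sector_family j p (%k. transformed_data c1 c2 p n k * Pcoef j \<gamma> p n k) l t x
   + of_real \<gamma> * sector_family j p (%k. transformed_data c1 c2 p n k * Pcoef j \<gamma> p n k) (l - 1) t x) \<longlongrightarrow>
   (\<Sum>p=1..j. \<Sum>n=1..j+1. lagrange j p n 1 * alpha j p n ^ (od j - l) * outer_value (real n))) (at_right 0)"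
  by (intro tendsto_sum data_sector_limit)
 thus ?thesis unfolding e using tendsto_diff[OF line_limit] by fastforce
qed

end

end

section \<open>Boundary values of the boundary terms\<close>

lemma cis_rays_mult: "(pol r th) ^ n = pol (r ^ n) (real n * th)"
 by (simp add: power_mult_distrib Complex.DeMoivre)

text \<open>The substitution \<open>z = k ^ od j\<close> along a ray.\<close>

lemma has_integral_ray_power:
 assumes int: "(ray_integrand F (real (od j) * th) has_integral I) {0..}"
  and cont: "continuous_on {0..} (ray_integrand F (real (od j) * th))"
 shows "(ray_integrand (%k. k ^ (2 * j) * F (k ^ od j)) th has_integral I / of_nat (od j)) {0..}"
proof -
 let ?d = "od j"
 define f where "f = ray_integrand F (real ?d * th)"
 define G where "G R = integral {0..R} f" for R
 have cf: "continuous_on {0..R} f" for R using cont unfolding f_def by (rule continuous_on_subset) auto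
 have hG: "(f has_integral G R) {0..R}" for R unfolding G_def by (intro integrable_integral integrable_continuous_real cf)
 have lim: "(G \<longlongrightarrow> I) at_top" using has_integral_half_line_iff[of f G I] hG int by (simp add: f_def)
 have dG: "(G has_vector_derivative f r) (at r within {0..})" if "r \<ge> 0" for r
 proof -
  have "(G has_vector_derivative f r) (at r within {0..r + 1})"
   unfolding G_def[abs_def] using that by (intro integral_has_vector_derivative cf) auto
  moreover have "at r within {0..r + 1} = at r within {0..}"
   by (rule at_within_nhd[of _ "{..<r + 1}"]) auto
  ultimately show ?thesis by simp
 qed
 let ?H = "%r. G (r ^ ?d) / of_nat ?d"
 have dn: "of_nat ?d \<noteq> (0::complex)" by (simp del: of_nat_add of_nat_mult of_nat_Suc)
 have dH: "(?H has_vector_derivative ray_integrand (%k. k ^ (2 * j) * F (k ^ ?d)) th r) (at r within {0..})" if r: "r \<ge> 0" for r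
 proof -
  have 1: "((%r. r ^ ?d) has_vector_derivative (real ?d * r ^ (2 * j))) (at r within {0..})"
   unfolding has_real_derivative_iff_has_vector_derivative[symmetric] using DERIV_pow[of ?d r "{0..}"] by simp
  have 2: "(G has_vector_derivative f (r ^ ?d)) (at (r ^ ?d) within (%r. r ^ ?d) ` {0..})"
   by (rule has_vector_derivative_within_subset[OF dG]) (use r in auto)
  have "((%r. G (r ^ ?d)) has_vector_derivative (real ?d * r ^ (2 * j)) *\<^sub>R f (r ^ ?d)) (at r within {0..})"
   using vector_diff_chain_within[OF 1 2] by (simp add: o_def)
  hence "(?H has_vector_derivative ((real ?d * r ^ (2 * j)) *\<^sub>R f (r ^ ?d)) / of_nat ?d) (at r within {0..})"
   by (rule has_vector_derivative_divide)
  moreover have "((real ?d * r ^ (2 * j)) *\<^sub>R f (r ^ ?d)) / of_nat ?d = of_real (r ^ (2 * j)) * f (r ^ ?d)"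
  proof -
   have "((real ?d * y) *\<^sub>R w) / of_nat ?d = of_real y * w" for y :: real and w :: complex
    using dn by (simp add: scaleR_conv_of_real del: of_nat_add of_nat_mult of_nat_Suc)
   thus ?thesis .
  qed
  moreover have "of_real (r ^ (2 * j)) * f (r ^ ?d) = ray_integrand (%k. k ^ (2 * j) * F (k ^ ?d)) th r"
  proof -
   have "cis (real ?d * th) = cis (real (2 * j) * th) * cis th" by (simp add: cis_mult algebra_simps)
   thus ?thesis unfolding f_def ray_integrand_def cis_rays_mult by (simp only: mult_ac)
  qed
  ultimately show ?thesis by simp
 qed
 have "filterlim (%r::real. r ^ ?d) at_top at_top" by (rule filterlim_pow_at_top) (auto intro: filterlim_ident)
 hence "(?H \<longlongrightarrow> I / of_nat ?d) at_top" by (intro tendsto_divide tendsto_const filterlim_compose[OF lim] dn)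
 from has_integral_half_line_FTC[OF dH this] show ?thesis by (simp add: G_def)
qed

lemma root_omega_power_cis: "root_omega j ^ m = cis (ang j (2 * real m))"
 unfolding root_omega_eq_cis Complex.DeMoivre by (simp add: ang_def mult_ac)

text \<open>Integrands that depend on \<open>k ^ od j\<close> look the same, up to a root of unity, in all sectors.\<close>

lemma ray_integrand_rotate_sector:
 "ray_integrand (%k. k ^ q * F (k ^ od j)) (ang j (s + 2 * real p)) r =
  root_omega j ^ (p * (q + 1)) * ray_integrand (%k. k ^ q * F (k ^ od j)) (ang j s) r"
proof -
 define w where "w = root_omega j ^ p"
 define k where "k = pol r (ang j s)"
 have w: "w = cis (ang j (2 * real p))" unfolding w_def by (rule root_omega_power_cis)
 have c: "cis (ang j (s + 2 * real p)) = w * cis (ang j s)" unfolding ang_simps w by (simp add: cis_mult add.commute)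
 have k': "pol r (ang j (s + 2 * real p)) = w * k" unfolding c k_def by (simp only: mult_ac)
 have wd: "w ^ od j = 1"
 proof -
  have "w ^ od j = cis (real (od j) * ang j (2 * real p))" unfolding w Complex.DeMoivre ..
  also have "\<dots> = cis (2 * pi * real p)" unfolding mult_ang by (simp add: mult_ac)
  also have "\<dots> = 1" using cis_multiple_2pi[of "real p"] by (simp add: mult_ac)
  finally show ?thesis .
 qed
 have wk: "(w * k) ^ od j = k ^ od j" unfolding power_mult_distrib wd by simp
 have L: "ray_integrand (%k. k ^ q * F (k ^ od j)) (ang j (s + 2 * real p)) r = (w * k) ^ q * F (k ^ od j) * (w * cis (ang j s))"
  unfolding ray_integrand_def k' wk by (simp only: c)
 have R: "ray_integrand (%k. k ^ q * F (k ^ od j)) (ang j s) r = k ^ q * F (k ^ od j) * cis (ang j s)"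
  by (simp only: ray_integrand_def k_def)
 have alg: "(w ^ q * kq) * f * (w * c) = w ^ q * w * (kq * f * c)" for kq f c by (simp only: mult_ac)
 show ?thesis unfolding L R power_mult_distrib[of w k q] alg
  by (simp add: w_def power_mult power_add)
qed

lemma norm_time_transform:
 assumes "0 \<le> T" "continuous_on {0..T} g" "\<And>ta. ta \<in> {0..T} ==> norm (g ta) \<le> B" "Im z \<le> 0"
 shows "norm (time_transform g T z) \<le> B * T"
proof -
 have "norm (integral {0..T} (%ta. exi (0 - ta) z * g ta)) \<le> B * (T - 0)"
  using assms by (intro norm_time_integral_le) (auto intro!: mult_nonpos_nonneg)
 thus ?thesis by (simp add: time_transform_def)
qed

lemma bsym_pole_factor:
 assumes "1 \<le> l" "l' \<le> 2 * j" and k: "\<gamma> \<noteq> 0 ==> k - \<i> * of_real \<gamma> \<noteq> 0"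
 shows "bsym \<gamma> l k * pole_factor \<gamma> (2 * j - l') k = \<i> ^ l * k ^ (2 * j + l - l')"
proof -
 obtain m where m: "l = Suc m" using assms by (cases l) auto
 have pole: "(\<i> * k + of_real \<gamma>) * pole_factor \<gamma> 0 k = \<i> * k"
 proof (cases "\<gamma> = 0")
  case False
  have "\<i> * k + of_real \<gamma> = \<i> * (k - \<i> * of_real \<gamma>)" by (simp add: algebra_simps)
  thus ?thesis using k[OF False] False by (simp add: pole_factor_def)
 qed (simp add: pole_factor_def)
 have "bsym \<gamma> l k * pole_factor \<gamma> (2 * j - l') k = (\<i> * k) ^ m * k ^ (2 * j - l') * ((\<i> * k + of_real \<gamma>) * pole_factor \<gamma> 0 k)"
  unfolding m bsym_Suc pole_factor_mult[of \<gamma> "2 * j - l'"] by (simp only: mult_ac)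
 also have "\<dots> = \<i> ^ l * (k ^ l * k ^ (2 * j - l'))" unfolding pole m power_mult_distrib by (simp add: mult_ac)
 also have "k ^ l * k ^ (2 * j - l') = k ^ (2 * j + l - l')"
  unfolding power_add[symmetric] using assms by (intro arg_cong[where f="%n. k ^ n"]) simp
 finally show ?thesis .
qed

lemma power_compose_field_differentiable:
 assumes "F field_differentiable at (k ^ od j)"
 shows "(%k. k ^ q * F (k ^ od j)) field_differentiable at k"
proof -
 have "(%k. F (k ^ od j)) field_differentiable at k"
  using field_differentiable_compose[of "%k. k ^ od j" k F] assms
  by (simp add: o_def field_differentiable_power field_differentiable_ident del: power_Suc)
 thus ?thesis by (intro field_differentiable_mult field_differentiable_power field_differentiable_ident)
qed

lemma continuous_on_power_compose:
 assumes "\<And>k. k \<in> A ==> F field_differentiable at (k ^ od j)"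
 shows "continuous_on A (%k. k ^ q * F (k ^ od j))"
 by (rule continuous_at_imp_continuous_on)
  (use assms power_compose_field_differentiable field_differentiable_imp_continuous_at in blast)

text \<open>Around a sector, \<open>k ^ od j\<close> stays away from the singularity \<open>\<i>\<close> of the end point terms.\<close>

lemma power_in_cone:
 assumes "r \<ge> 0" "ang j (2 * real m + 3 / 4) \<le> th" "th \<le> ang j (2 * real m + 9 / 4)"
 shows "(pol r th) ^ od j \<in> cone"
proof -
 let ?u = "real (od j) * th - 2 * real m * pi"
 have "real (od j) * ang j (2 * real m + 3 / 4) \<le> real (od j) * th" "real (od j) * th \<le> real (od j) * ang j (2 * real m + 9 / 4)"
  using assms by (auto intro!: mult_left_mono)
 hence u: "3 * pi / 4 \<le> ?u" "?u \<le> 9 * pi / 4" unfolding mult_ang by (simp_all add: left_diff_distrib distrib_right)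
 have "cis (real (od j) * th) = cis (?u + 2 * pi * real m)" by (simp add: algebra_simps)
 also have "\<dots> = cis ?u * cis (2 * pi * real m)" by (rule cis_mult[symmetric])
 also have "cis (2 * pi * real m) = 1" by (rule cis_multiple_2pi) simp
 finally have c: "cis (real (od j) * th) = cis ?u" by simp
 have "of_real (r ^ od j) * cis ?u \<in> cone" by (rule ray_in_cone[OF _ u]) (use assms in simp)
 thus ?thesis unfolding cis_rays_mult c .
qed

lemma ang_sub_band:
 assumes p: "p \<in> {1..j}"
 shows "2 * real (p - 1) + a = 2 * real p - 2 + a"
 using p by (simp add: of_nat_diff)

lemma sector_power_real:
 assumes "th \<in> edges j p" "k \<in> wedge th th"
 shows "Im (k ^ od j) = 0"
proof -
 obtain r where k: "k = pol r th" using assms(2) by (auto simp: wedge_def)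
 show ?thesis unfolding k Im_ray_power using assms(1) sector_sin_d[of j p] by auto
qed

context
 fixes j :: nat and T t :: real and g g1 g2 :: "real => complex"
 assumes j: "1 \<le> j" and t: "0 < t" "t < T"
  and d0: "\<And>ta. ta \<in> {0..T} ==> (g has_vector_derivative g1 ta) (at ta within {0..T})"
  and d1: "\<And>ta. ta \<in> {0..T} ==> (g1 has_vector_derivative g2 ta) (at ta within {0..T})"
  and c2: "continuous_on {0..T} g2"
begin

lemma c1: "continuous_on {0..T} g1"
 using d1 has_vector_derivative_continuous by (fastforce simp: continuous_on_eq_continuous_within)

lemma c0: "continuous_on {0..T} g"
 using d0 has_vector_derivative_continuous by (fastforce simp: continuous_on_eq_continuous_within)

text \<open>
 The transform splits into the contributions of the two end points of the time interval, each
 decaying like the reciprocal, and a remainder that decays quadratically.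
\<close>

definition start_part :: "complex => complex" where
 "start_part z = exi t z * (g 0 / (1 + \<i> * z))"

definition end_part :: "complex => complex" where
 "end_part z = - (exi (t - T) z * (g T / (1 + \<i> * z)))"

definition whole :: "complex => complex" where
 "whole z = exi t z * time_transform g T z"

definition smooth_part :: "complex => complex" where
 "smooth_part z = whole z - start_part z - end_part z"

lemma whole_split: "whole z = smooth_part z + start_part z + end_part z"
 by (simp add: smooth_part_def)

lemma norm_smooth_part:
 obtains C where "C \<ge> 0" "\<And>z. Im z = 0 ==> norm (smooth_part z) \<le> C / (1 + norm z)\<^sup>2"
proof -
 let ?h = "%ta. g1 ta + g ta" and ?h' = "%ta. (g2 ta + g1 ta) + (g1 ta + g ta)"
 have T: "0 \<le> T" using t by simp
 have ch': "continuous_on {0..T} ?h'" by (intro continuous_intros c0 c1 c2)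
 hence "bounded (?h' ` {0..T})" by (intro compact_imp_bounded compact_continuous_image) auto
 then obtain B where "\<forall>y\<in>?h' ` {0..T}. norm y \<le> B" unfolding bounded_iff by blast
 hence B: "norm (?h' ta) \<le> B" if "ta \<in> {0..T}" for ta using that by blast
 have B0: "B \<ge> 0" using order_trans[OF norm_ge_zero B[of 0]] T by simp
 define C where "C = (norm (?h 0) + norm (?h T) + B * T) * 9"
 have "norm (smooth_part z) \<le> C / (1 + norm z)\<^sup>2" if z: "Im z = 0" for z
 proof -
  have nz: "1 + \<i> * z \<noteq> 0" using one_plus_i_nonzero[of z] z by simp
  have e1: "norm (exi y z) = 1" for y unfolding norm_exp_i_of_real using z by simp
  have "norm (- \<i> * z * of_real T) = norm (\<i> * z * of_real (- T))" by (simp add: norm_mult)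
  have e2: "norm (exn T z) = 1" using e1[of "- T"] by simp
  have E: "exi t z * exn T z = exi (t - T) z"
   unfolding exp_add[symmetric] by (simp add: algebra_simps)
  define V where "V = time_transform ?h T z"
  have V: "(1 + \<i> * z) * V = ?h 0 - exn T z * ?h T + time_transform ?h' T z"
   unfolding V_def
   by (rule time_transform_plus_derivative[OF T]) (auto intro!: has_vector_derivative_add d0 d1 continuous_intros c0 c1 c2)
  have "norm ((1 + \<i> * z) * V) \<le> norm (?h 0) + norm (?h T) + B * T"
  proof -
   have "norm (exn T z * ?h T) = norm (?h T)" by (simp only: norm_mult e2 mult_1_left)
   moreover have "norm (time_transform ?h' T z) \<le> B * T" using z by (intro norm_time_transform T ch' B) auto
   ultimately show ?thesis unfolding V
    using norm_triangle_ineq[of "?h 0 - exn T z * ?h T" "time_transform ?h' T z"]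
     norm_triangle_ineq4[of "?h 0" "exn T z * ?h T"] by linarith
  qed
  moreover have "(1 + \<i> * z) * time_transform g T z = g 0 - exn T z * g T + V"
   unfolding V_def by (rule time_transform_plus_derivative[OF T]) (auto intro!: d0 c1)
  hence "(1 + \<i> * z) * smooth_part z = exi t z * V"
  proof -
   assume a: "(1 + \<i> * z) * time_transform g T z = g 0 - exn T z * g T + V"
   have alg: "w * (e * tt - e * (a / w) - (- (e' * (b / w)))) = e * (w * tt) - e * a + e' * b" if "w \<noteq> 0" for w e tt a b e' :: complex
    using that by (simp add: field_simps)
   show ?thesis unfolding smooth_part_def whole_def start_part_def end_part_def alg[OF nz] a E[symmetric] by (simp add: algebra_simps)
  qed
  hence "norm (1 + \<i> * z) * norm (smooth_part z) = norm V"
   by (metis e1 mult_1_left norm_mult)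
  ultimately have "(norm (1 + \<i> * z))\<^sup>2 * norm (smooth_part z) \<le> norm (?h 0) + norm (?h T) + B * T"
   by (simp add: power2_eq_square norm_mult mult.assoc)
  moreover have "((1 + norm z) / 3)\<^sup>2 * norm (smooth_part z) \<le> (norm (1 + \<i> * z))\<^sup>2 * norm (smooth_part z)"
   using norm_one_plus_i_ge(1)[of z] z by (intro mult_right_mono power_mono) auto
  ultimately have "((1 + norm z) / 3)\<^sup>2 * norm (smooth_part z) \<le> C / 9" by (simp add: C_def)
  hence "norm (smooth_part z) * (1 + norm z)\<^sup>2 \<le> C" by (simp add: power_divide mult.commute)
  moreover have "0 < 1 + norm z" by (rule add_pos_nonneg) auto
  ultimately show ?thesis by (simp add: pos_le_divide_eq)
 qed
 moreover have "C \<ge> 0" unfolding C_def using B0 T by simp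
 ultimately show ?thesis using that by blast
qed

lemma whole_field_differentiable: "whole field_differentiable at z"
proof -
 have "duhamel 1 (%ta _. g ta) T holomorphic_on UNIV" by (rule duhamel_time_holomorphic[OF c0 order_refl])
 moreover have "duhamel 1 (%ta _. g ta) T = time_transform g T"
  by (rule ext) (use time_transform_eq_duhamel[of g T _ 1] in simp)
 ultimately have "time_transform g T field_differentiable at z" by (simp add: holomorphic_on_def)
 thus ?thesis unfolding whole_def[abs_def]
  by (intro field_differentiable_mult field_differentiable_exp_linear) (simp add: field_differentiable_exp_power[of 1, simplified])
qed

lemma start_part_field_differentiable: "1 + \<i> * z \<noteq> 0 ==> start_part field_differentiable at z"
 unfolding start_part_def[abs_def]
 by (intro field_differentiable_mult field_differentiable_divide field_differentiable_const field_differentiable_add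
   field_differentiable_ident) (simp_all add: field_differentiable_exp_power[of 1, simplified])

lemma end_part_field_differentiable: "1 + \<i> * z \<noteq> 0 ==> end_part field_differentiable at z"
 unfolding end_part_def[abs_def]
 by (intro field_differentiable_minus field_differentiable_mult field_differentiable_divide field_differentiable_const field_differentiable_add
   field_differentiable_ident) (simp_all add: field_differentiable_exp_power[of 1, simplified])

lemma smooth_part_field_differentiable: "1 + \<i> * z \<noteq> 0 ==> smooth_part field_differentiable at z"
 unfolding smooth_part_def[abs_def]
 by (intro field_differentiable_diff whole_field_differentiable start_part_field_differentiable end_part_field_differentiable)

lemma norm_start_part: "z \<in> cone ==> Im z \<ge> 0 ==> norm (start_part z) \<le> norm (g 0) * 5"
proof -
 assume z: "z \<in> cone" "Im z \<ge> 0"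
 have n: "norm (g 0 / (1 + \<i> * z)) \<le> norm (g 0) * 5 / (1 + norm z)" using norm_inverse_power_cone[OF z(1), of "g 0" 0] by simp
 also have "\<dots> \<le> norm (g 0) * 5 / 1" by (intro divide_left_mono) (auto intro: add_pos_nonneg)
 finally have "norm (exi t z) * norm (g 0 / (1 + \<i> * z)) \<le> 1 * (norm (g 0) * 5)"
  unfolding norm_exp_i_of_real using z t by (intro mult_mono) auto
 thus ?thesis unfolding start_part_def norm_mult mult_1_left .
qed

lemma norm_end_part: "Im z \<le> 0 ==> norm (end_part z) \<le> norm (g T)"
proof -
 assume z: "Im z \<le> 0"
 have "norm (g T / (1 + \<i> * z)) \<le> norm (g T) / 1"
  unfolding norm_divide using norm_one_plus_i_ge(2)[OF z] by (intro divide_left_mono) auto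
 hence "norm (exi (t - T) z) * norm (g T / (1 + \<i> * z)) \<le> 1 * norm (g T)"
  unfolding norm_exp_i_of_real using z t by (intro mult_mono) (auto intro: mult_nonpos_nonpos)
 thus ?thesis unfolding end_part_def norm_minus_cancel norm_mult mult_1_left .
qed


definition ray_value :: "nat => (complex => complex) => real => complex" where
 "ray_value q F s = integral {0..} (ray_integrand (%k. k ^ q * F (k ^ od j)) (ang j s))"

lemma ray_value_shift: "ray_value q F (s + 2 * real p) = root_omega j ^ (p * (q + 1)) * ray_value q F s"
proof -
 have "ray_integrand (%k. k ^ q * F (k ^ od j)) (ang j (s + 2 * real p)) =
   (%r. root_omega j ^ (p * (q + 1)) * ray_integrand (%k. k ^ q * F (k ^ od j)) (ang j s) r)"
  by (rule ext) (rule ray_integrand_rotate_sector)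
 thus ?thesis unfolding ray_value_def by (simp only: integral_mult_right)
qed

text \<open>The common limit for all sectors: the contour around the sector for \<open>p = 0\<close>, with the contribution of
 the initial time rotated out of it.\<close>

definition boundary_value :: "nat => complex" where
 "boundary_value q = ray_value q smooth_part (- 1) - ray_value q smooth_part 0
   + (ray_value q start_part (- (5 / 4)) - ray_value q start_part (1 / 4))"

text \<open>The contribution of the final time decays inside the sector, where its contour closes; the one of the
 initial time decays outside of it, where its rays are rotated; the remainder is integrable on the
 rays themselves.\<close>

lemma boundary_sector_limit:
 assumes p: "p \<in> {1..j}" and q: "q + 2 \<le> 2 * (od j)"
 shows "((%x. sector_integral j p (%k. exi x k * (k ^ q * whole (k ^ od j)))) \<longlongrightarrow>
   root_omega j ^ (p * (q + 1)) * boundary_value q) (at_right 0)"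
proof -
 let ?L = "lower_angle j p" and ?U = "upper_angle j p"
 let ?P = "%F k. k ^ q * F (k ^ od j)"
 let ?I = "%F th x. integral {0..} (ray_integrand (%k. exi x k * ?P F k) th)"
 define lo up where "lo = ang j (- (5 / 4) + 2 * real p)" and "up = ang j (1 / 4 + 2 * real p)"
 have LU: "?L = ang j (- 1 + 2 * real p)" "?U = ang j (0 + 2 * real p)"
  by (simp_all add: lower_angle_eq upper_angle_eq)
 have p': "1 \<le> real p" "real p \<le> real j" using p by auto
 have ordered: "0 < lo" "lo < ?L" "?L < ?U" "?U < up" "up < pi"
 proof -
  show "0 < lo" using ang_mono(2)[of 0 "- (5 / 4) + 2 * real p" j] p' by (simp add: lo_def ang_simps(1))
  show "lo < ?L" "?U < up" "?L < ?U" unfolding lo_def up_def LU by (auto intro: ang_mono)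
  have "up < ang j (real (od j))" unfolding up_def using p' by (intro ang_mono) simp
  thus "up < pi" by (simp only: ang_simps)
 qed
 have cone: "(pol r th) ^ od j \<in> cone" if "r \<ge> 0" "lo \<le> th \<and> th \<le> ?L \<or> ?U \<le> th \<and> th \<le> up" for r th
 proof -
  have b: "ang j (2 * real (p - 1) + 3 / 4) \<le> lo" "up \<le> ang j (2 * real (p - 1) + 9 / 4)"
   unfolding lo_def up_def ang_sub_band[OF p] by (auto intro!: ang_mono)
  show ?thesis by (rule power_in_cone[where m="p - 1"]) (use that b ordered in linarith)+
 qed
 have Im0: "Im ((pol r th) ^ od j) \<ge> 0" if r: "r \<ge> 0" and th: "lo \<le> th \<and> th \<le> ?L \<or> ?U \<le> th \<and> th \<le> up" for r th
 proof -
  have "sin (real (od j) * th) \<ge> 0"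
  proof (cases "th \<le> ?L")
   case True
   have "ang j (2 * real (p - 1) + 0) \<le> lo" "?L \<le> ang j (2 * real (p - 1) + 1)"
    unfolding lo_def LU ang_sub_band[OF p] by (auto intro!: ang_mono)
   thus ?thesis using True th ordered by (intro sin_d_nonneg[of j "p - 1"]) auto
  next
   case False
   have "ang j (2 * real p) \<le> ?U" "up \<le> ang j (2 * real p + 1)"
    unfolding up_def LU by (auto intro!: ang_mono)
   thus ?thesis using False th ordered by (intro sin_d_nonneg[of j p]) auto
  qed
  thus ?thesis unfolding Im_ray_power using r by (intro mult_nonneg_nonneg) auto
 qed
 have nzr: "1 + \<i> * k ^ od j \<noteq> 0" if "th \<in> {?L, ?U}" "k \<in> wedge th th" for th k
  using one_plus_i_nonzero[of "k ^ od j"] sector_power_real[OF that] by simp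
 have npow: "norm ((pol r th) ^ n) = r ^ n" if "r \<ge> 0" for r th n using that by (simp add: norm_mult norm_power)
 have real0: "Im ((pol r th) ^ od j) = 0" if "r \<ge> 0" "th \<in> {?L, ?U}" for r th
  using sector_power_real[OF that(2), of "pol r th"] that(1) by (simp add: ray_in_wedge)
 obtain C where C: "C \<ge> 0" "\<And>z. Im z = 0 ==> norm (smooth_part z) \<le> C / (1 + norm z)\<^sup>2"
  by (rule norm_smooth_part) (rule that)
 have smooth_bound: "norm (?P smooth_part (pol r th)) \<le> (C * (2 ^ od j)\<^sup>2) / (1 + r)\<^sup>2" if r: "r \<ge> 0" "th \<in> {?L, ?U}" for r th
 proof -
  have a: "(1 + r) ^ (q + 2) \<le> (2 ^ od j)\<^sup>2 * (1 + r ^ od j)\<^sup>2"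
  proof -
   have "(1 + r) ^ (q + 2) \<le> (1 + r) ^ (2 * (od j))" using r q by (intro power_increasing) auto
   also have "\<dots> = ((1 + r) ^ od j)\<^sup>2" by (simp only: power_mult mult.commute[of 2])
   also have "\<dots> \<le> (2 ^ od j * (1 + r ^ od j))\<^sup>2" using r by (intro power_mono power_one_plus_le) auto
   finally show ?thesis by (simp only: power_mult_distrib)
  qed
  have pos: "0 < (1 + r ^ od j)\<^sup>2" using r by (intro zero_less_power add_pos_nonneg) auto
  have "norm (?P smooth_part (pol r th)) \<le> (1 + r) ^ q * (C / (1 + r ^ od j)\<^sup>2)"
   unfolding norm_mult npow[OF r(1)] using C(2)[OF real0[OF r]] r unfolding npow[OF r(1)]
   by (intro mult_mono power_mono) auto
  hence "norm (?P smooth_part (pol r th)) * (1 + r)\<^sup>2 \<le> (1 + r) ^ q * (C / (1 + r ^ od j)\<^sup>2) * (1 + r)\<^sup>2"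
   by (intro mult_right_mono) auto
  also have "\<dots> = C * ((1 + r) ^ (q + 2) / (1 + r ^ od j)\<^sup>2)"
   by (simp only: power_add times_divide_eq_right times_divide_eq_left mult_ac)
  also have "\<dots> \<le> C * (2 ^ od j)\<^sup>2"
   using a pos C(1) by (intro mult_left_mono) (auto simp only: pos_divide_le_eq)
  finally show ?thesis using r by (simp add: pos_le_divide_eq)
 qed
 have cont_smooth: "continuous_on (wedge th th) (?P smooth_part)" if "th \<in> {?L, ?U}" for th
  by (intro continuous_on_power_compose smooth_part_field_differentiable nzr[OF that])
 have wedge_cone: "k ^ od j \<in> cone" if "k \<in> wedge a b" "lo \<le> a \<and> b \<le> ?L \<or> ?U \<le> a \<and> b \<le> up" for k a b
 proof -
  obtain r th where k: "k = pol r th" "r \<ge> 0" "a \<le> th" "th \<le> b" using \<open>k \<in> wedge a b\<close> unfolding wedge_def by blast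
  show ?thesis unfolding k(1) by (rule cone[OF k(2)]) (use that(2) k in linarith)
 qed
 have cont_start: "continuous_on (wedge a b) (?P start_part)" if "lo \<le> a \<and> b \<le> ?L \<or> ?U \<le> a \<and> b \<le> up" for a b
  by (intro continuous_on_power_compose start_part_field_differentiable one_plus_i_nonzero_cone wedge_cone[OF _ that])
 have start_bound: "norm (?P start_part (pol r th)) \<le> (norm (g 0) * 5) * (1 + r) ^ q"
  if r: "r \<ge> 0" "lo \<le> th \<and> th \<le> ?L \<or> ?U \<le> th \<and> th \<le> up" for r th
 proof -
  have "norm (?P start_part (pol r th)) \<le> (1 + r) ^ q * (norm (g 0) * 5)"
   unfolding norm_mult npow[OF r(1)] using r by (intro mult_mono power_mono norm_start_part cone Im0) auto
  thus ?thesis by (simp add: mult.commute)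
 qed
 have sector_lower': "Im (k ^ od j) \<le> 0" if "k \<in> wedge ?L ?U" for k
 proof -
  obtain r th where k: "k = pol r th" "r \<ge> 0" "?L \<le> th" "th \<le> ?U" using \<open>k \<in> wedge ?L ?U\<close> unfolding wedge_def by blast
  show ?thesis unfolding k(1) Im_ray_power using sector_sin_d_nonpos[OF k(3,4)] k(2) by (intro mult_nonneg_nonpos) auto
 qed
 have cont_end: "continuous_on (wedge ?L ?U) (?P end_part)"
  by (intro continuous_on_power_compose end_part_field_differentiable one_plus_i_nonzero sector_lower')
 have end_bound: "norm (?P end_part (pol r th)) \<le> norm (g T) * (1 + r) ^ q" if r: "r \<ge> 0" "?L \<le> th" "th \<le> ?U" for r th
 proof -
  have "norm (?P end_part (pol r th)) \<le> (1 + r) ^ q * norm (g T)"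
   unfolding norm_mult npow[OF r(1)] using r by (intro mult_mono power_mono norm_end_part sector_lower') (auto simp: ray_in_wedge)
  thus ?thesis by (simp add: mult.commute)
 qed
 have eq: "sector_integral j p (%k. exi x k * ?P whole k) =
   ?I smooth_part ?L x - ?I smooth_part ?U x + (?I start_part lo x - ?I start_part up x)" if x: "x > 0" for x
 proof -
  let ?e = "%F k. exi x k * ?P F k"
  have i1: "sector_integrable j p (?e smooth_part)"
  proof (rule sector_exp_integrable[OF p x cont_smooth, where q=0])
   show "norm (?P smooth_part (pol r th)) \<le> C * (2 ^ od j)\<^sup>2 * (1 + r) ^ 0" if "r \<ge> 0" "th \<in> {?L, ?U}" for r th
   proof -
    have "(C * (2 ^ od j)\<^sup>2) / (1 + r)\<^sup>2 \<le> (C * (2 ^ od j)\<^sup>2) / 1"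
     using that C(1) by (intro divide_left_mono) auto
    thus ?thesis using smooth_bound[OF that] by simp
   qed
  qed
  have i2: "sector_integrable j p (?e start_part)"
   by (rule sector_exp_integrable[OF p x cont_start start_bound]) (use ordered in auto)
  have i3: "sector_integrable j p (?e end_part)"
   by (rule sector_exp_integrable[OF p x continuous_on_subset[OF cont_end wedge_mono] end_bound]) (use ordered in auto)
  have z: "sector_integral j p (?e end_part) = 0"
  proof (rule sector_closes[OF p cont_end end_bound _ x])
   show "?P end_part field_differentiable at (pol r th)" if "r > 0" "?L < th" "th < ?U" for r th
    using that by (intro power_compose_field_differentiable end_part_field_differentiable one_plus_i_nonzero sector_lower') (auto simp: ray_in_wedge)
  qed
  have ag: "rays_agree (?e start_part) a b" if ab: "a < b" "lo \<le> a \<and> b \<le> ?L \<or> ?U \<le> a \<and> b \<le> up" for a b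
  proof -
   have "rays_agree (%k. exi x (k ^ 1) * ?P start_part k) a b"
   proof (rule rays_agree_exp_decay[OF ab(1) _ cont_start[OF ab(2)], where q=q])
    show "b \<le> a + pi" using ab ordered by linarith
    show "?P start_part field_differentiable at (pol r th)" if "r > 0" "a < th" "th < b" for r th
     using that by (intro power_compose_field_differentiable start_part_field_differentiable one_plus_i_nonzero_cone wedge_cone[OF _ ab(2)]) (auto simp: ray_in_wedge)
    show "x * sin (real 1 * th) > 0" if "a \<le> th" "th \<le> b" for th
    proof -
     have "0 < th" "th < pi" using that ab ordered by linarith+
     thus ?thesis using x sin_gt_zero[of th] by simp
    qed
    show "norm (?P start_part (pol r th)) \<le> (norm (g 0) * 5) * (1 + r) ^ q" if "r \<ge> 0" "a \<le> th" "th \<le> b" for r th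
     by (rule start_bound) (use that ab in linarith)+
   qed simp
   thus ?thesis by simp
  qed
  have A1: "rays_agree (?e start_part) lo ?L" and A2: "rays_agree (?e start_part) ?U up"
   by (rule ag; use ordered in linarith)+
  have "(%k. exi x k * ?P whole k) = (%k. (?e smooth_part k + ?e start_part k) + ?e end_part k)"
   unfolding whole_split by (simp only: distrib_left)
  moreover have "sector_integrable j p (%k. ?e smooth_part k + ?e start_part k)"
   using i1 i2 unfolding sector_integrable_def ray_integrand_lin by (blast intro: integrable_add)
  ultimately have "sector_integral j p (%k. exi x k * ?P whole k) =
    sector_integral j p (?e smooth_part) + sector_integral j p (?e start_part)"
   using sector_integral_add[OF i1 i2] sector_integral_add[OF _ i3] z by simp
  also have "sector_integral j p (?e start_part) = ?I start_part lo x - ?I start_part up x"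
   unfolding sector_integral_def rays_agree_integral[OF A1] rays_agree_integral[OF A2] ..
  finally show ?thesis unfolding sector_integral_def .
 qed
 have R: "(?I smooth_part th \<longlongrightarrow> integral {0..} (ray_integrand (?P smooth_part) th)) (at_right 0)" if th: "th \<in> {?L, ?U}" for th
 proof (rule ray_integral_at_zero(2))
  show "sin th \<ge> 0" using th ordered by (auto intro!: sin_ge_zero)
  show "continuous_on {0..} (ray_integrand (?P smooth_part) th)"
   by (rule continuous_on_ray_integrand[OF cont_smooth[OF th]]) (simp add: ray_in_wedge)
  show "norm (ray_integrand (?P smooth_part) th r) \<le> (C * (2 ^ od j)\<^sup>2) / (1 + r)\<^sup>2" if "r \<ge> 0" for r
   unfolding norm_ray_integrand by (rule smooth_bound[OF that th])
 qed
 have S: "(?I start_part th \<longlongrightarrow> integral {0..} (ray_integrand (?P start_part) th)) (at_right 0)" if th: "th \<in> {lo, up}" for th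
 proof -
  have th': "lo \<le> th \<and> th \<le> ?L \<or> ?U \<le> th \<and> th \<le> up" using th ordered by auto
  have large: "sin (real (od j) * th) > 0"
  proof -
   have "sin (real (od j) * lo) \<ge> sin (pi / 4)"
    by (rule sin_d_large[of j "p - 1"]) (unfold lo_def ang_sub_band[OF p], auto intro!: ang_mono)
   moreover have "sin (real (od j) * up) \<ge> sin (pi / 4)"
    by (rule sin_d_large[of j p]) (auto simp: up_def intro!: ang_mono)
   moreover have "sin (pi / 4) > 0" by (rule sin_gt_zero) auto
   ultimately show ?thesis using th by auto
  qed
  define G where "G = (%k::complex. k ^ q * (g 0 / (1 + \<i> * k ^ od j)))"
  have PG: "?P start_part k = exi t (k ^ od j) * G k" for k
   unfolding start_part_def G_def by (simp only: mult_ac)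
  obtain K where K: "K \<ge> 0" "\<And>r th'. r \<ge> 0 ==> th \<le> th' ==> th' \<le> th ==>
    norm (exi t ((pol r th') ^ od j) * G (pol r th')) \<le> K / (1 + r) ^ 2"
  proof (rule exp_wedge_decay[of th th t "od j" G "norm (g 0) * 5" q 2])
   show "t * sin (real (od j) * th'') > 0" if "th \<le> th''" "th'' \<le> th" for th''
    using that t large by (simp add: order.antisym del: of_nat_add of_nat_mult of_nat_Suc)
   show "norm (G (pol r th'')) \<le> (norm (g 0) * 5) * (1 + r) ^ q" if "r \<ge> 0" "th \<le> th''" "th'' \<le> th" for r th''
   proof -
    have "th'' = th" using that by simp
    hence zc: "(pol r th'') ^ od j \<in> cone" using cone[OF that(1) th'] by simp
    have "norm (g 0 / (1 + \<i> * (pol r th'') ^ od j)) \<le> norm (g 0) * 5 / (1 + norm ((pol r th'') ^ od j))"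
     using norm_inverse_power_cone[OF zc, of "g 0" 0] by simp
    also have "\<dots> \<le> norm (g 0) * 5 / 1" by (intro divide_left_mono) (auto intro: add_pos_nonneg)
    finally have "norm (G (pol r th'')) \<le> (1 + r) ^ q * (norm (g 0) * 5)"
     unfolding G_def norm_mult npow[OF that(1)] using that by (intro mult_mono power_mono) auto
    thus ?thesis by (simp add: mult.commute)
   qed
  qed (auto intro: that)
  show ?thesis
  proof (rule ray_integral_at_zero(2))
   show "sin th \<ge> 0" using th ordered by (auto intro!: sin_ge_zero)
   show "continuous_on {0..} (ray_integrand (?P start_part) th)"
    by (rule continuous_on_ray_integrand[OF cont_start[of th th]]) (use th' in \<open>auto simp: ray_in_wedge\<close>)
   show "norm (ray_integrand (?P start_part) th r) \<le> K / (1 + r)\<^sup>2" if "r \<ge> 0" for r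
    unfolding norm_ray_integrand PG by (rule K(2)[OF that order_refl order_refl])
  qed
 qed
 have "((%x. ?I smooth_part ?L x - ?I smooth_part ?U x + (?I start_part lo x - ?I start_part up x)) \<longlongrightarrow>
   integral {0..} (ray_integrand (?P smooth_part) ?L) - integral {0..} (ray_integrand (?P smooth_part) ?U)
   + (integral {0..} (ray_integrand (?P start_part) lo) - integral {0..} (ray_integrand (?P start_part) up))) (at_right 0)"
  by (intro tendsto_intros R S) auto
 moreover have "integral {0..} (ray_integrand (?P smooth_part) ?L) - integral {0..} (ray_integrand (?P smooth_part) ?U)
   + (integral {0..} (ray_integrand (?P start_part) lo) - integral {0..} (ray_integrand (?P start_part) up)) =
   root_omega j ^ (p * (q + 1)) * boundary_value q"
  unfolding LU lo_def up_def ray_value_def[symmetric] ray_value_shift boundary_value_def by (simp only: right_diff_distrib distrib_left)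
 ultimately show ?thesis
  by (simp only:) (erule Lim_transform_eventually, use eventually_at_right_less[of 0] in \<open>eventually_elim, simp only: eq\<close>)
qed


text \<open>
 For \<open>q = 2 * j\<close> the substitution \<open>z = k ^ od j\<close> turns the boundary value into the inversion
 integral of the transform in time.
\<close>

lemma boundary_value_inversion: "boundary_value (2 * j) = - (2 * of_real pi * g t) / of_nat (od j)"
proof -
 let ?d = "of_nat (od j) :: complex"
 obtain I0 Ip where I: "(ray_integrand (%k. exi t k * time_transform g T k) 0 has_integral I0) {0..}"
  "(ray_integrand (%k. exi t k * time_transform g T k) pi has_integral Ip) {0..}"
  "I0 - Ip = 2 * of_real pi * g t"
  by (rule time_transform_inversion[OF d0 d1 c2 t]) (simp, simp, rule that)
 have W: "(ray_integrand whole 0 has_integral I0) {0..}" "(ray_integrand whole pi has_integral Ip) {0..}"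
  using I(1,2) unfolding whole_def[abs_def] .
 obtain E where E: "(ray_integrand (%z. exi (t - T) z / (1 + \<i> * z)) 0 has_integral E) {0..}"
  "(ray_integrand (%z. exi (t - T) z / (1 + \<i> * z)) pi has_integral E) {0..}"
  by (rule exp_over_one_plus_rays_agree[of "t - T"]) (use t in simp, rule that)
 have end_eq: "ray_integrand end_part th = (%r. - g T * ray_integrand (%z. exi (t - T) z / (1 + \<i> * z)) th r)" for th
  by (rule ext) (simp add: ray_integrand_def end_part_def)
 have En: "(ray_integrand end_part 0 has_integral (- g T * E)) {0..}" "(ray_integrand end_part pi has_integral (- g T * E)) {0..}"
  unfolding end_eq by (rule has_integral_mult_right, rule E)+
 have fd0: "1 + \<i> * (pol r th) \<noteq> 0" if "r \<ge> 0" "th \<in> {0, pi}" for r th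
  using that by (intro one_plus_i_nonzero) auto
 have cont_ray: "continuous_on {0..} (ray_integrand F th)" if "\<And>r. r \<ge> 0 ==> F field_differentiable at (pol r th)" for F th
 proof (rule continuous_on_ray_integrand)
  show "continuous_on (wedge th th) F"
   by (rule continuous_at_imp_continuous_on) (auto simp: wedge_def intro!: field_differentiable_imp_continuous_at that order.antisym)
 qed (simp add: ray_in_wedge)
 obtain C where C: "C \<ge> 0" "\<And>z. Im z = 0 ==> norm (smooth_part z) \<le> C / (1 + norm z)\<^sup>2"
  by (rule norm_smooth_part) (rule that)
 have cs: "continuous_on {0..} (ray_integrand smooth_part th)" if "th \<in> {0, pi}" for th
  by (intro cont_ray smooth_part_field_differentiable fd0 that)
 have "ray_integrand smooth_part th integrable_on {0..}" if th: "th \<in> {0, pi}" for th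
 proof (rule integrable_on_quadratic_decay[OF cs[OF th]])
  show "norm (ray_integrand smooth_part th r) \<le> C / (1 + r)\<^sup>2" if r: "r \<ge> 0" for r
   unfolding norm_ray_integrand using C(2)[of "pol r th"] r th by (auto simp: norm_mult)
 qed
 then obtain R0 Rp where R: "(ray_integrand smooth_part 0 has_integral R0) {0..}" "(ray_integrand smooth_part pi has_integral Rp) {0..}"
  by blast
 have start_eq: "ray_integrand start_part th = (%r. ray_integrand whole th r - ray_integrand smooth_part th r - ray_integrand end_part th r)" for th
  by (rule ext) (simp add: ray_integrand_def whole_split algebra_simps)
 have S: "(ray_integrand start_part 0 has_integral (I0 - R0 - - g T * E)) {0..}" "(ray_integrand start_part pi has_integral (Ip - Rp - - g T * E)) {0..}"
  unfolding start_eq by (intro has_integral_diff W R En)+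
 have agree: "rays_agree start_part a b" if ab: "a < b" "0 \<le> a" "b \<le> pi" "3 * pi / 4 \<le> a \<or> b \<le> pi / 4" for a b
 proof -
  have cone: "pol r th \<in> cone" if "r \<ge> 0" "a \<le> th" "th \<le> b" for r th
   using ab(4)
  proof
   assume "3 * pi / 4 \<le> a"
   thus ?thesis using that ab pi_gt_zero by (intro ray_in_cone) linarith+
  next
   assume "b \<le> pi / 4"
   thus ?thesis using that ab pi_gt_zero by (intro ray_in_cone_near_0) linarith+
  qed
  have "rays_agree (%z. exi t (z ^ 1) * (g 0 / (1 + \<i> * z))) a b"
  proof (rule rays_agree_jordan[OF ab(1), where C="norm (g 0) * 5"])
   show "b \<le> a + pi" using ab by linarith
   show "continuous_on (wedge a b) (%z. g 0 / (1 + \<i> * z))"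
    by (intro continuous_intros) (auto simp: wedge_def dest!: cone one_plus_i_nonzero_cone)
   show "(%z. g 0 / (1 + \<i> * z)) field_differentiable at (pol r th)" if "r > 0" "a < th" "th < b" for r th
    using that by (intro field_differentiable_divide field_differentiable_const field_differentiable_add field_differentiable_mult
      field_differentiable_ident one_plus_i_nonzero_cone cone) auto
   show "norm (g 0 / (1 + \<i> * (pol r th))) \<le> norm (g 0) * 5 / (1 + r)" if "r \<ge> 0" "a \<le> th" "th \<le> b" for r th
    using norm_inverse_power_cone[OF cone[OF that], of "g 0" 0] that by (simp add: norm_mult)
   show "t * sin (real 1 * th) > 0" if "a < th" "th < b" for th using that ab t sin_gt_zero[of th] by simp
   show "t * sin (real 1 * th) \<ge> 0" if "a \<le> th" "th \<le> b" for th using that ab t sin_ge_zero[of th] by simp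
  qed simp
  thus ?thesis unfolding start_part_def[abs_def] by simp
 qed
 have S': "(ray_integrand start_part (pi / 4) has_integral (I0 - R0 - - g T * E)) {0..}" "(ray_integrand start_part (3 * pi / 4) has_integral (Ip - Rp - - g T * E)) {0..}"
  using S agree[of 0 "pi / 4"] agree[of "3 * pi / 4" pi] pi_gt_zero unfolding rays_agree_def by auto
 have turn: "ray_integrand F (th - 2 * pi) = ray_integrand F th" for F th
 proof -
  have "cis (th - 2 * pi) = cis th" by (simp flip: cis_divide)
  thus ?thesis by (simp add: ray_integrand_def fun_eq_iff)
 qed
 have val: "ray_value (2 * j) F s = J / ?d"
  if J: "(ray_integrand F (s * pi) has_integral J) {0..}" and c: "continuous_on {0..} (ray_integrand F (s * pi))" for F s J
  unfolding ray_value_def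
  by (rule integral_unique) (rule has_integral_ray_power; unfold mult_ang; rule J c)
 have cst: "continuous_on {0..} (ray_integrand start_part th)" if "th \<in> {pi / 4, 3 * pi / 4}" for th
 proof (intro cont_ray start_part_field_differentiable one_plus_i_nonzero_cone)
  show "pol r th \<in> cone" if "r \<ge> 0" for r
  proof (cases "th = pi / 4")
   case True
   show ?thesis unfolding True using pi_gt_zero by (intro ray_in_cone_near_0 that) linarith+
  next
   case False
   hence "th = 3 * pi / 4" using \<open>th \<in> _\<close> by simp
   thus ?thesis using pi_gt_zero by (intro ray_in_cone that) linarith+
  qed
 qed
 have neg: "- 1 * pi = pi - 2 * pi" "- (5 / 4) * pi = 3 * pi / 4 - 2 * pi" "(0::real) * pi = 0" "1 / 4 * pi = pi / 4" by auto
 have "ray_value (2 * j) smooth_part (- 1) = Rp / ?d" by (rule val, unfold neg turn, rule R, rule cs, simp)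
 moreover have "ray_value (2 * j) smooth_part 0 = R0 / ?d" by (rule val, unfold neg turn, rule R, rule cs, simp)
 moreover have "ray_value (2 * j) start_part (- (5 / 4)) = (Ip - Rp - - g T * E) / ?d" by (rule val, unfold neg turn, rule S', rule cst, simp)
 moreover have "ray_value (2 * j) start_part (1 / 4) = (I0 - R0 - - g T * E) / ?d" by (rule val, unfold neg turn, rule S', rule cst, simp)
 ultimately have "boundary_value (2 * j) = (Ip - I0) / ?d"
  unfolding boundary_value_def by (simp only: diff_divide_distrib[symmetric] add_divide_distrib[symmetric]) simp
 also have "Ip - I0 = - (2 * of_real pi * g t)" unfolding I(3)[symmetric] by simp
 finally show ?thesis .
qed

lemma norm_time_transform_le:
 obtains B where "B \<ge> 0" "\<And>z. Im z \<le> 0 ==> norm (time_transform g T z) \<le> B"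
proof -
 have T: "0 \<le> T" using t by simp
 have "bounded (g ` {0..T})" by (intro compact_imp_bounded compact_continuous_image c0) auto
 then obtain B where "\<forall>y\<in>g ` {0..T}. norm y \<le> B" unfolding bounded_iff by blast
 hence B: "norm (g ta) \<le> B" if "ta \<in> {0..T}" for ta using that by blast
 have "B \<ge> 0" using order_trans[OF norm_ge_zero B[of 0]] T by simp
 hence "B * T \<ge> 0" using T by simp
 moreover have "norm (time_transform g T z) \<le> B * T" if "Im z \<le> 0" for z
  by (rule norm_time_transform[OF T c0 B that])
 ultimately show ?thesis using that by blast
qed


lemma time_transform_field_differentiable: "time_transform g T field_differentiable at z"
proof -
 have "time_transform g T = (%z. exi (- t) z * whole z)"
  by (rule ext) (simp add: whole_def exp_minus mult.assoc[symmetric])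
 thus ?thesis
  by (simp only:) (intro field_differentiable_mult whole_field_differentiable field_differentiable_exp_power[of 1, unfolded power_one_right])
qed

lemma boundary_amplitude_continuous:
 assumes "p \<in> {1..j}" "th \<in> edges j p"
 shows "continuous_on (wedge th th) (%k. pole_factor \<gamma> m k * time_transform g T (k ^ od j))"
proof -
 have "continuous_on (wedge th th) (%k. k ^ 0 * time_transform g T (k ^ od j))"
  by (intro continuous_on_power_compose time_transform_field_differentiable)
 thus ?thesis by (intro continuous_intros continuous_on_pole_factor_ray sector_cos_nonzero[OF assms]) simp
qed

lemma boundary_amplitude_bound:
 assumes p: "p \<in> {1..j}"
 obtains C where "\<And>r th. r \<ge> 0 ==> th \<in> edges j p ==>
   norm (pole_factor \<gamma> m (pol r th) * time_transform g T ((pol r th) ^ od j)) \<le> C * (1 + r) ^ m"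
proof -
 obtain B where B: "B \<ge> 0" "\<And>z. Im z \<le> 0 ==> norm (time_transform g T z) \<le> B"
  by (rule norm_time_transform_le) (rule that)
 define A where "A = 1 / \<bar>cos (lower_angle j p)\<bar> + 1 / \<bar>cos (upper_angle j p)\<bar>"
 have "norm (pole_factor \<gamma> m (pol r th) * time_transform g T ((pol r th) ^ od j)) \<le> (A * B) * (1 + r) ^ m"
  if r: "r \<ge> 0" "th \<in> edges j p" for r th
 proof -
  have "norm (pole_factor \<gamma> m (pol r th)) \<le> (1 / \<bar>cos th\<bar>) * r ^ m"
   by (rule norm_pole_factor_ray[OF sector_cos_nonzero[OF p r(2)] r(1)])
  also have "\<dots> \<le> A * (1 + r) ^ m" using r by (intro mult_mono power_mono) (auto simp: A_def)
  finally have 1: "norm (pole_factor \<gamma> m (pol r th)) \<le> A * (1 + r) ^ m" .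
  have "pol r th \<in> wedge th th" using r by (simp add: ray_in_wedge)
  hence 2: "norm (time_transform g T ((pol r th) ^ od j)) \<le> B"
   by (intro B eq_refl sector_power_real[OF r(2)])
  have "norm (pole_factor \<gamma> m (pol r th) * time_transform g T ((pol r th) ^ od j)) \<le> (A * (1 + r) ^ m) * B"
   unfolding norm_mult using r by (intro mult_mono 1 2) (auto simp: A_def)
  thus ?thesis by (simp add: mult_ac)
 qed
 thus ?thesis using that by blast
qed

theorem boundary_sector_values:
 assumes p: "p \<in> {1..j}" and l: "l \<in> {1..j}" "l' \<in> {1..j}"
 shows "((%x. sector_family j p (%k. pole_factor \<gamma> (2 * j - l') k * time_transform g T (k ^ od j)) l t x
   + of_real \<gamma> * sector_family j p (%k. pole_factor \<gamma> (2 * j - l') k * time_transform g T (k ^ od j)) (l - 1) t x) \<longlongrightarrow>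
   \<i> ^ l * (root_omega j ^ (p * (od j + l - l')) * boundary_value (2 * j + l - l'))) (at_right 0)"
proof -
 let ?h = "%k. pole_factor \<gamma> (2 * j - l') k * time_transform g T (k ^ od j)"
 let ?q = "2 * j + l - l'"
 obtain C where C: "\<And>r th. r \<ge> 0 ==> th \<in> edges j p ==> norm (?h (pol r th)) \<le> C * (1 + r) ^ (2 * j - l')"
  by (rule boundary_amplitude_bound[OF p]) (rule that)
 have eq: "sector_family j p ?h l t x + of_real \<gamma> * sector_family j p ?h (l - 1) t x =
   \<i> ^ l * sector_integral j p (%k. exi x k * (k ^ ?q * whole (k ^ od j)))" if x: "x > 0" for x
 proof -
  have "sector_family j p ?h l t x + of_real \<gamma> * sector_family j p ?h (l - 1) t x =
    sector_integral j p (%k. exi x k * (bsym \<gamma> l k * (exi t (k ^ od j) * ?h k)))"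
   by (rule sector_family_bsym[OF p x boundary_amplitude_continuous[OF p] C])
  also have "\<dots> = sector_integral j p (%k. \<i> ^ l * (exi x k * (k ^ ?q * whole (k ^ od j))))"
  proof (rule sector_integral_cong(1))
   fix r :: real and th assume r: "r \<ge> 0" "th \<in> edges j p"
   define k where "k = pol r th"
   have b: "bsym \<gamma> l k * pole_factor \<gamma> (2 * j - l') k = \<i> ^ l * k ^ ?q"
    unfolding k_def using l by (intro bsym_pole_factor pole_off_ray[OF sector_cos_nonzero[OF p r(2)] r(1)]) auto
   have "exi x k * (bsym \<gamma> l k * (exi t (k ^ od j) * ?h k)) =
     exi x k * ((bsym \<gamma> l k * pole_factor \<gamma> (2 * j - l') k) * whole (k ^ od j))"
    unfolding whole_def by (simp only: mult_ac)
   also have "\<dots> = \<i> ^ l * (exi x k * (k ^ ?q * whole (k ^ od j)))"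
    unfolding b by (simp only: mult_ac)
   finally show "exi x ((pol r th)) * (bsym \<gamma> l (pol r th) * (exi t ((pol r th) ^ od j) * ?h (pol r th))) =
     \<i> ^ l * (exi x ((pol r th)) * ((pol r th) ^ ?q * whole ((pol r th) ^ od j)))"
    unfolding k_def .
  qed
  finally show ?thesis unfolding sector_integral_mult .
 qed
 have q1: "?q + 1 = od j + l - l'" and q2: "?q + 2 \<le> 2 * (od j)" using l by auto
 have "((%x. \<i> ^ l * sector_integral j p (%k. exi x k * (k ^ ?q * whole (k ^ od j)))) \<longlongrightarrow>
   \<i> ^ l * (root_omega j ^ (p * (od j + l - l')) * boundary_value ?q)) (at_right 0)"
  using boundary_sector_limit[OF p q2] unfolding q1 by (rule tendsto_mult_left)
 thus ?thesis
  by (rule Lim_transform_eventually) (use eventually_at_right_less[of 0] in \<open>eventually_elim, simp only: eq\<close>)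
qed

end

section \<open>The solution formula\<close>

text \<open>
 At \<open>t = 0\<close> the sectors can be closed at infinity; only the pole of the coefficient remains.
\<close>

lemma Pcoef_sector_closes:
 assumes p: "p \<in> {1..j}" and x: "x > 0"
  and cont: "continuous_on (wedge (lower_angle j p) (upper_angle j p)) h"
  and bound: "\<And>r th. r \<ge> 0 ==> lower_angle j p \<le> th ==> th \<le> upper_angle j p ==> norm (h (pol r th)) \<le> C"
  and holo: "\<And>r th. r > 0 ==> lower_angle j p < th ==> th < upper_angle j p ==> h field_differentiable at (pol r th)"
 shows "sector_integral j p (%k. exi x k * (h k * Pcoef j \<gamma> p n k)) =
  - (poly (Qpoly j p) 1 / poly (pderiv (Qpoly j p)) (alpha j p n)) *
  (if \<gamma> > 0 \<and> j = 2 * p - 1 then 2 * of_real pi * \<i> * (\<i> * of_real \<gamma>) * h (\<i> * of_real \<gamma>) * exp (- of_real (\<gamma> * x)) else 0)"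
proof -
 let ?c = "poly (Qpoly j p) 1 / poly (pderiv (Qpoly j p)) (alpha j p n)"
 have ab: "lower_angle j p < upper_angle j p" using sector_angles[OF p] by simp
 have bound': "norm (h (pol r th)) \<le> C * (1 + r) ^ 0" if "r \<ge> 0" "lower_angle j p \<le> th" "th \<le> upper_angle j p" for r th
  using bound[OF that] by simp
 have C: "C \<ge> 0" using order_trans[OF norm_ge_zero bound[of 0 "lower_angle j p"]] ab by simp
 have cr: "continuous_on (wedge th th) h" if "th \<in> edges j p" for th
  by (rule continuous_on_subset[OF cont wedge_mono]) (use that ab in auto)
 have br: "norm (h (pol r th)) \<le> C * (1 + r) ^ 0" if "r \<ge> 0" "th \<in> edges j p" for r th
  by (rule bound') (use that ab in auto)
 have i1: "sector_integrable j p (%k. exi x k * h k)"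
  by (rule sector_exp_integrable[OF p x cr br])
 have i2: "sector_integrable j p (%k. exi x k * (pole_factor \<gamma> 0 k * h k))"
 proof (rule sector_exp_integrable[OF p x])
  show "continuous_on (wedge th th) (%k. pole_factor \<gamma> 0 k * h k)" if "th \<in> edges j p" for th
   by (intro continuous_intros cr that continuous_on_pole_factor_ray sector_cos_nonzero[OF p that])
  let ?A = "1 / \<bar>cos (lower_angle j p)\<bar> + 1 / \<bar>cos (upper_angle j p)\<bar>"
  show "norm (pole_factor \<gamma> 0 (pol r th) * h (pol r th)) \<le> (?A * C) * (1 + r) ^ 0"
   if r: "r \<ge> 0" "th \<in> edges j p" for r th
  proof -
   have "norm (pole_factor \<gamma> 0 (pol r th)) \<le> (1 / \<bar>cos th\<bar>) * r ^ 0"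
    by (rule norm_pole_factor_ray[OF sector_cos_nonzero[OF p r(2)] r(1)])
   also have "\<dots> \<le> ?A" using r by auto
   finally have "norm (pole_factor \<gamma> 0 (pol r th)) * norm (h (pol r th)) \<le> ?A * C"
    using br[OF r] by (intro mult_mono) auto
   thus ?thesis by (simp add: norm_mult)
  qed
 qed
 have i3: "sector_integrable j p (%k. - ?c * (exi x k * (pole_factor \<gamma> 0 k * h k)))"
  "sector_integrable j p (%k. lagrange j p n 1 * (exi x k * h k))"
  using i1 i2 unfolding sector_integrable_def ray_integrand_lin by (blast intro: integrable_on_mult_right)+
 have alg: "E * (hk * (L - c * P)) = L * (E * hk) + - c * (E * (P * hk))" for E hk L c P :: complex by (simp add: algebra_simps)
 have "sector_integral j p (%k. exi x k * (h k * Pcoef j \<gamma> p n k)) =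
   lagrange j p n 1 * sector_integral j p (%k. exi x k * h k)
   + - ?c * sector_integral j p (%k. exi x k * (pole_factor \<gamma> 0 k * h k))"
  unfolding Pcoef_def alg sector_integral_add[OF i3(2,1)] sector_integral_mult ..
 moreover have "sector_integral j p (%k. exi x k * h k) = 0"
  by (rule sector_closes[OF p cont bound' holo x])
 moreover have "sector_integral j p (%k. exi x k * (pole_factor \<gamma> 0 k * h k)) =
  (if \<gamma> > 0 \<and> j = 2 * p - 1 then 2 * of_real pi * \<i> * (\<i> * of_real \<gamma>) * h (\<i> * of_real \<gamma>) * exp (- of_real (\<gamma> * x)) else 0)"
  by (rule sector_closes_pole[OF p x cont bound' holo])
 ultimately show ?thesis by (simp only: mult_zero_right add_0_left)
qed

locale ibvp_data = U: space_family j T CU "%b _. U b" + F: space_family j T CF G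
 for j :: nat and T CU CF :: real and U :: "nat => real => complex" and G :: "nat => real => real => complex" +
 fixes \<gamma> :: real and u0 :: "real => complex" and \<phi> :: "nat => real => complex" and f :: "real => real => complex"
  and B1 B2 :: "nat => real => complex"
 assumes j: "1 \<le> j"
  and u0: "\<And>x. x \<ge> 0 ==> U 0 x = u0 x"
  and f: "\<And>ta x. ta \<in> {0..T} ==> x \<ge> 0 ==> G 0 ta x = f ta x"
  and \<phi>1: "\<And>l ta. l \<in> {1..j} ==> ta \<in> {0..T} ==> (\<phi> l has_vector_derivative B1 l ta) (at ta within {0..T})"
  and \<phi>2: "\<And>l ta. l \<in> {1..j} ==> ta \<in> {0..T} ==> (B1 l has_vector_derivative B2 l ta) (at ta within {0..T})"
  and cB2: "\<And>l. l \<in> {1..j} ==> continuous_on {0..T} (B2 l)"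
begin

lemma T_pos: "0 < T" by (rule U.T)

lemma half_line_ft_cong: "(\<And>x. x \<ge> 0 ==> g x = h x) ==> half_line_ft g = half_line_ft h"
 unfolding half_line_ft_def[abs_def] by (intro ext integral_cong) auto

lemma ft_u0: "U.ft 0 = half_line_ft u0"
 unfolding U.ft_def by (rule half_line_ft_cong) (rule u0)

lemma ft_f: "ta \<in> {0..T} ==> F.ft ta = half_line_ft (f ta)"
 unfolding F.ft_def by (rule half_line_ft_cong) (rule f)

lemma Fterm_eq: "t \<in> {0..T} ==> Fterm j f t k = duhamel (od j) F.ft t k"
 unfolding Fterm_eq_duhamel duhamel_def by (intro integral_cong) (simp add: ft_f)

text \<open>The initial data and the source, transformed, in a sector.\<close>

definition datum :: "nat => nat => complex => complex" where
 "datum p n k = U.transformed_data 1 0 p n k + F.transformed_data 0 1 p n k"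

lemma datum_eq: "datum p n k = half_line_ft u0 (alpha j p n * k) + Fterm j f T (alpha j p n * k)"
 unfolding datum_def U.transformed_data_def F.transformed_data_def using T_pos by (simp add: ft_u0 Fterm_eq)

abbreviation bterm :: "nat => complex => complex" where
 "bterm l \<equiv> %k. pole_factor \<gamma> (2 * j - l) k * time_transform (\<phi> l) T (k ^ od j)"

abbreviation uterm :: "nat => nat => complex => complex" where
 "uterm p n \<equiv> %k. U.transformed_data 1 0 p n k * Pcoef j \<gamma> p n k"

abbreviation fterm :: "nat => nat => complex => complex" where
 "fterm p n \<equiv> %k. F.transformed_data 0 1 p n k * Pcoef j \<gamma> p n k"

lemma mid: "0 < T / 2" "T / 2 < T" using T_pos by auto

lemma bterm_continuous: "p \<in> {1..j} ==> l \<in> {1..j} ==> th \<in> edges j p ==> continuous_on (wedge th th) (bterm l)"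
 by (rule boundary_amplitude_continuous[OF j mid \<phi>1 \<phi>2 cB2])

lemma bterm_bound:
 assumes "p \<in> {1..j}" "l \<in> {1..j}"
 obtains C where "\<And>r th. r \<ge> 0 ==> th \<in> edges j p ==>
  norm (bterm l (pol r th)) \<le> C * (1 + r) ^ (2 * j - l)"
 by (rule boundary_amplitude_bound[OF j mid \<phi>1[OF assms(2)] \<phi>2[OF assms(2)] cB2[OF assms(2)] assms(1)]) (assumption | rule that)+

lemma data_bound:
 assumes "p \<in> {1..j}" "n \<in> {1..j+1}"
 obtains C where "\<And>r th. r \<ge> 0 ==> th \<in> edges j p ==> norm (uterm p n (pol r th)) \<le> C * (1 + r) ^ 0"
  "\<And>r th. r \<ge> 0 ==> th \<in> edges j p ==> norm (fterm p n (pol r th)) \<le> C * (1 + r) ^ 0"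
proof -
 define A where "A th = norm (lagrange j p n 1) + norm (poly (Qpoly j p) 1 / poly (pderiv (Qpoly j p)) (alpha j p n)) * (1 / \<bar>cos th\<bar>)" for th
 define C where "C = (\<Sum>th\<in>edges j p. ((norm (1::complex) + norm (0::complex) * T) * (2 * U.K)) * A th + ((norm (0::complex) + norm (1::complex) * T) * (2 * F.K)) * A th)"
 have A: "A th \<ge> 0" for th by (simp add: A_def)
 have pos: "0 \<le> ((norm (1::complex) + norm (0::complex) * T) * (2 * U.K)) * A th" "0 \<le> ((norm (0::complex) + norm (1::complex) * T) * (2 * F.K)) * A th" for th
  using U.K_nonneg F.K_nonneg A T_pos by auto
 have le: "((norm (1::complex) + norm (0::complex) * T) * (2 * U.K)) * A th + ((norm (0::complex) + norm (1::complex) * T) * (2 * F.K)) * A th \<le> C"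
  if "th \<in> edges j p" for th
  unfolding C_def by (rule member_le_sum[OF that]) (rule add_nonneg_nonneg[OF pos], simp)
 show ?thesis
 proof (rule that)
  show "norm (uterm p n (pol r th)) \<le> C * (1 + r) ^ 0" if "r \<ge> 0" "th \<in> edges j p" for r th
   using U.data_amplitude(2)[OF assms that(2,1), of 1 0 \<gamma>] le[OF that(2)] pos[of th] unfolding A_def power_0 mult_1_right by linarith
  show "norm (fterm p n (pol r th)) \<le> C * (1 + r) ^ 0" if "r \<ge> 0" "th \<in> edges j p" for r th
   using F.data_amplitude(2)[OF assms that(2,1), of 0 1 \<gamma>] le[OF that(2)] pos[of th] unfolding A_def power_0 mult_1_right by linarith
 qed
qed

lemma data_integrable:
 assumes p: "p \<in> {1..j}" and n: "n \<in> {1..j+1}" and t: "t \<in> {0..T}" and x: "x > 0"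
 shows "sector_integrable j p (%k. phase j t x k * uterm p n k)" "sector_integrable j p (%k. phase j t x k * fterm p n k)"
  "solution_family j T (sector_family j p (uterm p n)) (%_ _. 0)" "solution_family j T (sector_family j p (fterm p n)) (%_ _. 0)"
proof -
 obtain C where C: "\<And>r th. r \<ge> 0 ==> th \<in> edges j p ==> norm (uterm p n (pol r th)) \<le> C * (1 + r) ^ 0"
  "\<And>r th. r \<ge> 0 ==> th \<in> edges j p ==> norm (fterm p n (pol r th)) \<le> C * (1 + r) ^ 0"
  by (rule data_bound[OF p n]) (rule that)
 show "sector_integrable j p (%k. phase j t x k * uterm p n k)" by (rule sector_family_integrable[OF T_pos p U.data_amplitude(1)[OF p n] C(1) t x])
 show "sector_integrable j p (%k. phase j t x k * fterm p n k)" by (rule sector_family_integrable[OF T_pos p F.data_amplitude(1)[OF p n] C(2) t x])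
 show "solution_family j T (sector_family j p (uterm p n)) (%_ _. 0)" by (rule sector_family_solution[OF T_pos p U.data_amplitude(1)[OF p n] C(1)])
 show "solution_family j T (sector_family j p (fterm p n)) (%_ _. 0)" by (rule sector_family_solution[OF T_pos p F.data_amplitude(1)[OF p n] C(2)])
qed

lemma bterm_integrable:
 assumes p: "p \<in> {1..j}" and l: "l \<in> {1..j}"
 shows "t \<in> {0..T} ==> x > 0 ==> sector_integrable j p (%k. phase j t x k * bterm l k)"
  "solution_family j T (sector_family j p (bterm l)) (%_ _. 0)"
proof -
 obtain C where C: "\<And>r th. r \<ge> 0 ==> th \<in> edges j p ==> norm (bterm l (pol r th)) \<le> C * (1 + r) ^ (2 * j - l)"
  by (rule bterm_bound[OF p l]) (rule that)
 show "sector_integrable j p (%k. phase j t x k * bterm l k)" if "t \<in> {0..T}" "x > 0"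
  by (rule sector_family_integrable[OF T_pos p bterm_continuous[OF p l] C that])
 show "solution_family j T (sector_family j p (bterm l)) (%_ _. 0)"
  by (rule sector_family_solution[OF T_pos p bterm_continuous[OF p l] C])
qed

lemma data_integrand_eq: "data_integrand j \<gamma> T u0 f t x p n = (%k. phase j t x k * uterm p n k + phase j t x k * fterm p n k)"
 unfolding data_integrand_def[abs_def] datum_eq[symmetric] datum_def by (simp only: distrib_left distrib_right mult_ac)

lemma boundary_integrand_eq: "boundary_integrand j \<gamma> T \<phi> t x l = (%k. phase j t x k * bterm l k)"
 unfolding boundary_integrand_def[abs_def] by (simp only: mult_ac)

lemma line_integral:
 assumes t: "t \<in> {0..T}" and x: "x > 0"
 shows "(line_integrand j u0 f t x has_integral (U.line_family 1 0 0 t x + F.line_family 0 1 0 t x)) UNIV"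
proof -
 have "line_integrand j u0 f t x = (%k. wave j (%k. 1 * U.ft 0 k) (%ta k. 0 * U.ft ta k) 0 t x (of_real k) + wave j (%k. 0 * F.ft 0 k) (%ta k. 1 * F.ft ta k) 0 t x (of_real k))"
  by (rule ext) (simp add: line_integrand_def wave_def ft_u0 Fterm_eq[OF t] distrib_left del: mult_zero_left)
 thus ?thesis using has_integral_add[OF U.line_family_integral[OF t x, of 1 0] F.line_family_integral[OF t x, of 0 1]] by simp
qed

lemma converges:
 assumes t: "t \<in> {0..T}" and x: "x > 0"
 shows "formula_converges j \<gamma> T u0 \<phi> f t x"
 unfolding formula_converges_def
proof (intro conjI ballI)
 show "line_integrand j u0 f t x integrable_on UNIV" using line_integral[OF t x] by blast
 show "sector_integrable j p (data_integrand j \<gamma> T u0 f t x p n)" if "p \<in> {1..j}" "n \<in> {1..j+1}" for p n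
  unfolding data_integrand_eq using data_integrable(1,2)[OF that t x] unfolding sector_integrable_def ray_integrand_lin by (blast intro: integrable_add)
 show "sector_integrable j p (boundary_integrand j \<gamma> T \<phi> t x l)" if "p \<in> {1..j}" "l \<in> {1..j}" for p l
  unfolding boundary_integrand_eq by (rule bterm_integrable(1)[OF that t x])
qed

definition residue_coefficient :: complex where
 "residue_coefficient = residue_term j \<gamma> T u0 \<phi> f 0 0"

definition residue_family :: "nat => real => real => complex" where
 "residue_family m t x = residue_coefficient * of_real ((- \<gamma>) ^ m * exp (- \<gamma> * x + \<gamma> ^ od j * t))"

lemma residue_term_eq: "residue_term j \<gamma> T u0 \<phi> f t x = residue_family 0 t x"
proof (cases "odd j \<and> \<gamma> > 0")
 case True
 thus ?thesis unfolding residue_family_def residue_coefficient_def residue_term_def Let_def by (simp add: algebra_simps)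
next
 case False
 thus ?thesis unfolding residue_family_def residue_coefficient_def residue_term_def by (simp only: if_False) simp
qed

lemma residue_coefficient_0: "even j ==> residue_coefficient = 0"
 by (simp add: residue_coefficient_def residue_term_def)

lemma residue_family_solution: "solution_family j T residue_family (%_ _. 0)"
 unfolding solution_family_def
proof (intro ballI allI impI conjI)
 fix t x :: real and m :: nat
 have "((%x. (- \<gamma>) ^ m * exp (- \<gamma> * x + \<gamma> ^ od j * t)) has_real_derivative (- \<gamma>) ^ Suc m * exp (- \<gamma> * x + \<gamma> ^ od j * t)) (at x)"
  by (auto intro!: derivative_eq_intros)
 thus "((%x. residue_family m t x) has_vector_derivative residue_family (Suc m) t x) (at x)"
  unfolding residue_family_def
  by (intro has_vector_derivative_mult_right has_vector_derivative_of_real) (simp add: has_real_derivative_iff_has_vector_derivative)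
next
 fix t x :: real
 have "((%t. exp (- \<gamma> * x + \<gamma> ^ od j * t)) has_real_derivative \<gamma> ^ od j * exp (- \<gamma> * x + \<gamma> ^ od j * t)) (at t within {0..T})"
  by (auto intro!: derivative_eq_intros)
 hence "((%t. residue_family 0 t x) has_vector_derivative residue_coefficient * of_real (\<gamma> ^ od j * exp (- \<gamma> * x + \<gamma> ^ od j * t))) (at t within {0..T})"
  unfolding residue_family_def
  by (intro has_vector_derivative_mult_right has_vector_derivative_of_real) (simp add: has_real_derivative_iff_has_vector_derivative)
 moreover have "residue_coefficient * of_real (\<gamma> ^ od j * exp (- \<gamma> * x + \<gamma> ^ od j * t)) = 0 - (- 1) ^ (j + 1) * residue_family (od j) t x"
 proof (cases "odd j")
  case True
  hence "(- 1 :: complex) ^ (j + 1) = 1" "(- \<gamma>) ^ od j = - (\<gamma> ^ od j)" by auto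
  thus ?thesis unfolding residue_family_def by (simp only:) simp
 qed (simp add: residue_coefficient_0 residue_family_def)
 ultimately show "((%t. residue_family 0 t x) has_vector_derivative 0 - (- 1) ^ (j + 1) * residue_family (od j) t x) (at t within {0..T})" by simp
qed

definition contours :: "nat => real => real => complex" where
 "contours m t x = ((U.line_family 1 0 m t x + F.line_family 0 1 m t x)
   - (\<Sum>p=1..j. \<Sum>n=1..j+1. sector_family j p (uterm p n) m t x + sector_family j p (fterm p n) m t x))
   + (\<Sum>p=1..j. \<Sum>l=1..j. ccoef j p l * sector_family j p (bterm l) m t x)"

definition solution :: "nat => real => real => complex" where
 "solution m t x = 1 / (2 * of_real pi) * contours m t x + residue_family m t x"

lemma u_formula_eq:
 assumes t: "t \<in> {0..T}" and x: "x > 0"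
 shows "u_formula j \<gamma> T u0 \<phi> f t x = solution 0 t x"
proof -
 have d: "sector_integral j p (data_integrand j \<gamma> T u0 f t x p n) = sector_family j p (uterm p n) 0 t x + sector_family j p (fterm p n) 0 t x"
  if "p \<in> {1..j}" "n \<in> {1..j+1}" for p n
  unfolding data_integrand_eq sector_family_0 by (rule sector_integral_add[OF data_integrable(1,2)[OF that t x]])
 have D: "(\<Sum>p=1..j. \<Sum>n=1..j+1. sector_integral j p (data_integrand j \<gamma> T u0 f t x p n)) =
   (\<Sum>p=1..j. \<Sum>n=1..j+1. sector_family j p (uterm p n) 0 t x + sector_family j p (fterm p n) 0 t x)"
  by (intro sum.cong refl d)
 show ?thesis
  unfolding u_formula_def solution_def contours_def residue_term_eq D boundary_integrand_eq sector_family_0[symmetric]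
   integral_unique[OF line_integral[OF t x]]
  by (simp only: distrib_left right_diff_distrib)
qed

text \<open>Only the line integral of the source contributes a right-hand side.\<close>

lemma solution_solution_family: "solution_family j T solution (%t x. G 0 t x)"
proof -
 have a: "solution_family j T (%m t x. U.line_family 1 0 m t x + F.line_family 0 1 m t x)
   (%t x. 0 * (2 * of_real pi * U 0 x) + 1 * (2 * of_real pi * G 0 t x))"
  by (rule solution_family_add[OF U.line_family_solution F.line_family_solution])
 have b: "solution_family j T (%m t x. \<Sum>p=1..j. \<Sum>n=1..j+1. sector_family j p (uterm p n) m t x + sector_family j p (fterm p n) m t x)
   (%t x. \<Sum>p=1..j. \<Sum>n=1..j+1. 0 + 0)"
  by (intro solution_family_sum solution_family_add finite_atLeastAtMost data_integrable(3,4)[of _ _ 0 1])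
   (use T_pos in auto)
 have c: "solution_family j T (%m t x. \<Sum>p=1..j. \<Sum>l=1..j. ccoef j p l * sector_family j p (bterm l) m t x)
   (%t x. \<Sum>p=1..j. \<Sum>l=1..j. ccoef j p l * 0)"
  by (intro solution_family_sum solution_family_scale finite_atLeastAtMost bterm_integrable(2))
 have "solution_family j T solution (%t x. 1 / (2 * of_real pi) * ((0 * (2 * of_real pi * U 0 x) + 1 * (2 * of_real pi * G 0 t x)) - (\<Sum>p=1..j. \<Sum>n=1..j+1. 0 + 0)
   + (\<Sum>p=1..j. \<Sum>l=1..j. ccoef j p l * 0)) + 0)"
  unfolding solution_def[abs_def] contours_def
  by (intro solution_family_add solution_family_scale solution_family_diff a[THEN solution_family_diff[OF _ b]] c residue_family_solution)
 thus ?thesis by simp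
qed

lemma iter_deriv_solution:
 assumes t: "0 < t" "t < T"
 shows "m \<le> od j ==> x > 0 ==> iter_deriv m (u_formula j \<gamma> T u0 \<phi> f t) x = solution m t x"
proof (induction m arbitrary: x)
 case 0
 thus ?case using t by (simp add: iter_deriv_def u_formula_eq)
next
 case (Suc m)
 have tT: "t \<in> {0..T}" using t by simp
 have "((%x. solution m t x) has_vector_derivative solution (Suc m) t x) (at x)"
  using solution_solution_family tT Suc.prems unfolding solution_family_def by (meson Suc_le_lessD)
 hence "(iter_deriv m (u_formula j \<gamma> T u0 \<phi> f t) has_vector_derivative solution (Suc m) t x) (at x)"
  by (rule has_vector_derivative_transform_within_open[where S="{0<..}"]) (use Suc in auto)
 thus ?case by (simp add: iter_deriv_def vector_derivative_at)
qed

lemma iter_deriv_differentiable: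
 assumes t: "0 < t" "t < T" and m: "m < od j" and x: "x > 0"
 shows "iter_deriv m (u_formula j \<gamma> T u0 \<phi> f t) differentiable (at x)"
proof -
 have tT: "t \<in> {0..T}" using t by simp
 have "((%x. solution m t x) has_vector_derivative solution (Suc m) t x) (at x)"
  using solution_solution_family tT x m unfolding solution_family_def by meson
 hence "(iter_deriv m (u_formula j \<gamma> T u0 \<phi> f t) has_vector_derivative solution (Suc m) t x) (at x)"
  by (rule has_vector_derivative_transform_within_open[where S="{0<..}"]) (use iter_deriv_solution[OF t] m x in auto)
 thus ?thesis by (rule differentiableI_vector)
qed

lemma equation:
 assumes t: "0 < t" "t < T" and x: "x > 0"
 shows "(%s. u_formula j \<gamma> T u0 \<phi> f s x) differentiable (at t)"
  "vector_derivative (%s. u_formula j \<gamma> T u0 \<phi> f s x) (at t) + (-1) ^ (j + 1) * iter_deriv (od j) (u_formula j \<gamma> T u0 \<phi> f t) x = f t x"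
proof -
 have tT: "t \<in> {0..T}" using t by simp
 have "((%t. solution 0 t x) has_vector_derivative (G 0 t x - (-1) ^ (j + 1) * solution (od j) t x)) (at t within {0..T})"
  using solution_solution_family tT x unfolding solution_family_def by blast
 hence "((%t. solution 0 t x) has_vector_derivative (G 0 t x - (-1) ^ (j + 1) * solution (od j) t x)) (at t)"
  using t by (simp add: at_within_Icc_at)
 hence D: "((%s. u_formula j \<gamma> T u0 \<phi> f s x) has_vector_derivative (G 0 t x - (-1) ^ (j + 1) * solution (od j) t x)) (at t)"
  by (rule has_vector_derivative_transform_within_open[where S="{0<..<T}"]) (use t x u_formula_eq in auto)
 thus "(%s. u_formula j \<gamma> T u0 \<phi> f s x) differentiable (at t)" by (rule differentiableI_vector)
 show "vector_derivative (%s. u_formula j \<gamma> T u0 \<phi> f s x) (at t) + (-1) ^ (j + 1) * iter_deriv (od j) (u_formula j \<gamma> T u0 \<phi> f t) x = f t x"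
  unfolding vector_derivative_at[OF D] iter_deriv_solution[OF t order_refl x] using f[OF tT, of x] x by simp
qed

text \<open>
 The boundary values: the data cancel, the residue is annihilated by \<open>\<partial>\<^sub>x + \<gamma>\<close>, and the
 coefficients of the boundary terms are orthogonal to all but one of the transforms.
\<close>

lemma boundary_condition:
 assumes t: "0 < t" "t < T" and l: "1 \<le> l" "l \<le> j"
 shows "((%x. iter_deriv l (u_formula j \<gamma> T u0 \<phi> f t) x + of_real \<gamma> * iter_deriv (l - 1) (u_formula j \<gamma> T u0 \<phi> f t) x) \<longlongrightarrow> \<phi> l t) (at_right 0)"
proof -
 have lj: "l \<in> {1..j}" using l by simp
 let ?B = "%E x. E l t x + of_real \<gamma> * E (l - 1) t x :: complex"
 let ?V = "%l'. boundary_value j T t (\<phi> l') (2 * j + l - l')"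
 define X where "X x = ?B (U.line_family 1 0) x - (\<Sum>p=1..j. \<Sum>n=1..j+1. ?B (sector_family j p (uterm p n)) x)" for x
 define Y where "Y x = ?B (F.line_family 0 1) x - (\<Sum>p=1..j. \<Sum>n=1..j+1. ?B (sector_family j p (fterm p n)) x)" for x
 define Z where "Z x = (\<Sum>p=1..j. \<Sum>l'=1..j. ccoef j p l' * ?B (sector_family j p (bterm l')) x)" for x
 have "(X \<longlongrightarrow> 0) (at_right 0)" unfolding X_def using t by (intro U.data_boundary_values l) auto
 moreover have "(Y \<longlongrightarrow> 0) (at_right 0)" unfolding Y_def using t by (intro F.data_boundary_values l) auto
 moreover have "(Z \<longlongrightarrow> (\<Sum>p=1..j. \<Sum>l'=1..j. ccoef j p l' * (\<i> ^ l * (root_omega j ^ (p * (od j + l - l')) * ?V l')))) (at_right 0)"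
  unfolding Z_def
  by (intro tendsto_sum tendsto_mult_left boundary_sector_values[OF j t \<phi>1 \<phi>2 cB2] lj)
 ultimately have lim: "((%x. 1 / (2 * of_real pi) * (X x + Y x + Z x)) \<longlongrightarrow>
   1 / (2 * of_real pi) * (0 + 0 + (\<Sum>p=1..j. \<Sum>l'=1..j. ccoef j p l' * (\<i> ^ l * (root_omega j ^ (p * (od j + l - l')) * ?V l'))))) (at_right 0)"
  by (intro tendsto_mult_left tendsto_add)
 have "(\<Sum>p=1..j. \<Sum>l'=1..j. ccoef j p l' * (\<i> ^ l * (root_omega j ^ (p * (od j + l - l')) * ?V l'))) =
   (\<Sum>l'=1..j. (\<i> ^ l * (\<Sum>p=1..j. ccoef j p l' * root_omega j ^ (p * (od j + l - l')))) * ?V l')"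
  by (subst sum.swap) (simp only: sum_distrib_left sum_distrib_right mult_ac)
 also have "\<dots> = (\<Sum>l'=1..j. if l' = l then - of_nat (od j) * ?V l else 0)"
 proof (rule sum.cong[OF refl])
  fix l' assume l': "l' \<in> {1..j}"
  show "(\<i> ^ l * (\<Sum>p=1..j. ccoef j p l' * root_omega j ^ (p * (od j + l - l')))) * ?V l' = (if l' = l then - of_nat (od j) * ?V l else 0)"
   unfolding sum_ccoef[OF lj l'] by auto
 qed
 also have "\<dots> = - of_nat (od j) * ?V l" using lj by (subst sum.delta) auto
 also have "?V l = - (2 * of_real pi * \<phi> l t) / of_nat (od j)"
  using boundary_value_inversion[OF j t \<phi>1[OF lj] \<phi>2[OF lj] cB2[OF lj]] by simp
 finally have val: "1 / (2 * of_real pi) * (0 + 0 + (\<Sum>p=1..j. \<Sum>l'=1..j. ccoef j p l' * (\<i> ^ l * (root_omega j ^ (p * (od j + l - l')) * ?V l')))) = \<phi> l t"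
  by (simp del: of_nat_add of_nat_mult of_nat_Suc)
 have eq: "1 / (2 * of_real pi) * (X x + Y x + Z x) = iter_deriv l (u_formula j \<gamma> T u0 \<phi> f t) x + of_real \<gamma> * iter_deriv (l - 1) (u_formula j \<gamma> T u0 \<phi> f t) x"
  if x: "x > 0" for x
 proof -
  have res: "?B residue_family x = 0"
  proof -
   obtain m where "l = Suc m" using l by (cases l) auto
   thus ?thesis by (simp add: residue_family_def algebra_simps)
  qed
  have S: "(\<Sum>p=1..j. \<Sum>n=1..j+1. ?B (sector_family j p (h p n)) x) =
    (\<Sum>p=1..j. \<Sum>n=1..j+1. sector_family j p (h p n) l t x) + of_real \<gamma> * (\<Sum>p=1..j. \<Sum>n=1..j+1. sector_family j p (h p n) (l - 1) t x)" for h
   by (simp only: sum.distrib sum_distrib_left)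
  have Zx: "Z x = (\<Sum>p=1..j. \<Sum>l'=1..j. ccoef j p l' * sector_family j p (bterm l') l t x)
    + of_real \<gamma> * (\<Sum>p=1..j. \<Sum>l'=1..j. ccoef j p l' * sector_family j p (bterm l') (l - 1) t x)"
   unfolding Z_def by (simp only: sum.distrib sum_distrib_left distrib_left mult_ac)
  have "X x + Y x + Z x = ?B contours x"
   unfolding X_def Y_def S Zx contours_def by (simp only: sum.distrib) (simp only: algebra_simps)
  hence "1 / (2 * of_real pi) * (X x + Y x + Z x) = 1 / (2 * of_real pi) * ?B contours x + ?B residue_family x"
   unfolding res by simp
  also have "\<dots> = ?B solution x" unfolding solution_def by (simp only: distrib_left add_ac mult_ac)
  finally show ?thesis using l x by (simp add: iter_deriv_solution[OF t])
 qed
 show ?thesis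
  using lim unfolding val
  by (rule Lim_transform_eventually) (use eventually_at_right_less[of 0] in \<open>eventually_elim, simp only: eq\<close>)
qed


lemma sector_family_start: "sector_family j p h 0 0 x = sector_integral j p (%k. exi x k * h k)"
 unfolding sector_family_0 by (simp add: phase_def)

lemma data_at_start:
 assumes p: "p \<in> {1..j}" and n: "n \<in> {1..j+1}" and x: "x > 0"
 shows "sector_family j p (uterm p n) 0 0 x + sector_family j p (fterm p n) 0 0 x =
  - (poly (Qpoly j p) 1 / poly (pderiv (Qpoly j p)) (alpha j p n)) *
  (if \<gamma> > 0 \<and> j = 2 * p - 1 then 2 * of_real pi * \<i> * (\<i> * of_real \<gamma>) * datum p n (\<i> * of_real \<gamma>) * exp (- of_real (\<gamma> * x)) else 0)"
proof -
 let ?v = "%h. - (poly (Qpoly j p) 1 / poly (pderiv (Qpoly j p)) (alpha j p n)) *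
  (if \<gamma> > 0 \<and> j = 2 * p - 1 then 2 * of_real pi * \<i> * (\<i> * of_real \<gamma>) * h (\<i> * of_real \<gamma>) * exp (- of_real (\<gamma> * x)) else 0)"
 have 1: "sector_family j p (uterm p n) 0 0 x = ?v (U.transformed_data 1 0 p n)" unfolding sector_family_start
  by (rule Pcoef_sector_closes[OF p x U.continuous_on_transformed_data[OF p n] U.norm_transformed_data[OF p n] U.transformed_data_field_differentiable[OF p n]])
 have 2: "sector_family j p (fterm p n) 0 0 x = ?v (F.transformed_data 0 1 p n)" unfolding sector_family_start
  by (rule Pcoef_sector_closes[OF p x F.continuous_on_transformed_data[OF p n] F.norm_transformed_data[OF p n] F.transformed_data_field_differentiable[OF p n]])
 show ?thesis unfolding 1 2 datum_def
  by (cases "\<gamma> > 0 \<and> j = 2 * p - 1") (simp_all only: if_True if_False simp_thms distrib_left distrib_right mult_zero_right add_0_left)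
qed

lemma bterm_at_start:
 assumes p: "p \<in> {1..j}" and l: "l \<in> {1..j}" and x: "x > 0"
 shows "sector_family j p (bterm l) 0 0 x =
  (if \<gamma> > 0 \<and> j = 2 * p - 1 then 2 * of_real pi * \<i> * (\<i> * of_real \<gamma>) *
   ((\<i> * of_real \<gamma>) ^ (2 * j - l) * time_transform (\<phi> l) T ((\<i> * of_real \<gamma>) ^ od j)) * exp (- of_real (\<gamma> * x)) else 0)"
proof -
 note fd = time_transform_field_differentiable[OF j mid \<phi>1[OF l] \<phi>2[OF l] cB2[OF l]]
 have eq: "exi x k * bterm l k = exi x k * (pole_factor \<gamma> 0 k * (k ^ (2 * j - l) * time_transform (\<phi> l) T (k ^ od j)))" for k
  unfolding pole_factor_mult[of \<gamma> "2 * j - l"] by (simp only: mult_ac)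
 obtain B where B: "B \<ge> 0" "\<And>z. Im z \<le> 0 ==> norm (time_transform (\<phi> l) T z) \<le> B"
  by (rule norm_time_transform_le[OF j mid \<phi>1[OF l] \<phi>2[OF l] cB2[OF l]]) (assumption | rule that)+
 show ?thesis unfolding sector_family_start eq
 proof (rule sector_closes_pole[OF p x])
  show "continuous_on (wedge (lower_angle j p) (upper_angle j p)) (%k. k ^ (2 * j - l) * time_transform (\<phi> l) T (k ^ od j))"
   by (intro continuous_on_power_compose fd)
  show "(%k. k ^ (2 * j - l) * time_transform (\<phi> l) T (k ^ od j)) field_differentiable at (pol r th)" for r th
   by (intro power_compose_field_differentiable fd)
  show "norm ((pol r th) ^ (2 * j - l) * time_transform (\<phi> l) T ((pol r th) ^ od j)) \<le> B * (1 + r) ^ (2 * j - l)"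
   if r: "r \<ge> 0" "lower_angle j p \<le> th" "th \<le> upper_angle j p" for r th
  proof -
   have "Im ((pol r th) ^ od j) \<le> 0"
    unfolding Im_ray_power using sector_sin_d_nonpos[OF r(2,3)] r(1) by (intro mult_nonneg_nonpos) auto
   hence "norm (time_transform (\<phi> l) T ((pol r th) ^ od j)) \<le> B" by (rule B)
   moreover have "norm ((pol r th) ^ (2 * j - l)) \<le> (1 + r) ^ (2 * j - l)"
    using r by (simp add: norm_power norm_mult power_mono)
   ultimately have "norm ((pol r th) ^ (2 * j - l)) * norm (time_transform (\<phi> l) T ((pol r th) ^ od j)) \<le> (1 + r) ^ (2 * j - l) * B"
    using r by (intro mult_mono) auto
   thus ?thesis by (simp only: norm_mult mult.commute)
  qed
 qed
qed

lemma F_line_start: "x > 0 ==> F.line_family 0 1 0 0 x = 0"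
proof -
 assume x: "x > 0"
 have "((%k. wave j (%k. 0 * F.ft 0 k) (%ta k. 1 * F.ft ta k) 0 0 x (of_real k)) has_integral F.line_family 0 1 0 0 x) UNIV"
  by (rule F.line_family_integral) (use T_pos x in auto)
 hence "((%_::real. 0 :: complex) has_integral F.line_family 0 1 0 0 x) UNIV" unfolding wave_0_0 by (simp only: mult_zero_left mult_zero_right)
 thus ?thesis by (simp add: has_integral_iff)
qed

text \<open>The residue at the pole is what the last term of the formula compensates.\<close>

lemma initial_value:
 assumes x: "x > 0"
 shows "solution 0 0 x = u0 x"
proof -
 let ?w = "\<i> * of_real \<gamma>" and ?e = "exp (- of_real (\<gamma> * x)) :: complex"
 let ?q = "%p n. poly (Qpoly j p) 1 / poly (pderiv (Qpoly j p)) (alpha j p n)"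
 let ?D = "%p. \<Sum>n=1..j+1. ?q p n * (2 * of_real pi * \<i> * ?w * datum p n ?w * ?e)"
 let ?P = "%p. \<Sum>l=1..j. ccoef j p l * (2 * of_real pi * \<i> * ?w * (?w ^ (2 * j - l) * time_transform (\<phi> l) T (?w ^ od j)) * ?e)"
 have A: "(\<Sum>p=1..j. \<Sum>n=1..j+1. sector_family j p (uterm p n) 0 0 x + sector_family j p (fterm p n) 0 0 x) =
   - (\<Sum>p=1..j. if \<gamma> > 0 \<and> j = 2 * p - 1 then ?D p else 0)"
  unfolding sum_negf[symmetric]
 proof (rule sum.cong[OF refl])
  fix p assume p: "p \<in> {1..j}"
  have "(\<Sum>n=1..j+1. sector_family j p (uterm p n) 0 0 x + sector_family j p (fterm p n) 0 0 x) =
    (\<Sum>n=1..j+1. - ?q p n * (if \<gamma> > 0 \<and> j = 2 * p - 1 then 2 * of_real pi * \<i> * ?w * datum p n ?w * ?e else 0))"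
   by (rule sum.cong[OF refl]) (rule data_at_start[OF p _ x])
  also have "\<dots> = - (if \<gamma> > 0 \<and> j = 2 * p - 1 then ?D p else 0)"
   by (cases "\<gamma> > 0 \<and> j = 2 * p - 1") (simp_all only: if_True if_False mult_minus_left sum_negf mult_zero_right sum.neutral_const simp_thms minus_zero)
  finally show "(\<Sum>n=1..j+1. sector_family j p (uterm p n) 0 0 x + sector_family j p (fterm p n) 0 0 x) = - (if \<gamma> > 0 \<and> j = 2 * p - 1 then ?D p else 0)" .
 qed
 have B: "(\<Sum>p=1..j. \<Sum>l=1..j. ccoef j p l * sector_family j p (bterm l) 0 0 x) = (\<Sum>p=1..j. if \<gamma> > 0 \<and> j = 2 * p - 1 then ?P p else 0)"
 proof (rule sum.cong[OF refl])
  fix p assume p: "p \<in> {1..j}"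
  have "(\<Sum>l=1..j. ccoef j p l * sector_family j p (bterm l) 0 0 x) = (\<Sum>l=1..j. ccoef j p l * (if \<gamma> > 0 \<and> j = 2 * p - 1 then 2 * of_real pi * \<i> * ?w * (?w ^ (2 * j - l) * time_transform (\<phi> l) T (?w ^ od j)) * ?e else 0))"
   by (rule sum.cong[OF refl]) (simp only: bterm_at_start[OF p _ x])
  also have "\<dots> = (if \<gamma> > 0 \<and> j = 2 * p - 1 then ?P p else 0)"
   by (cases "\<gamma> > 0 \<and> j = 2 * p - 1") (simp_all only: if_True if_False mult_zero_right sum.neutral_const simp_thms)
  finally show "(\<Sum>l=1..j. ccoef j p l * sector_family j p (bterm l) 0 0 x) = (if \<gamma> > 0 \<and> j = 2 * p - 1 then ?P p else 0)" .
 qed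
 have line: "U.line_family 1 0 0 0 x + F.line_family 0 1 0 0 x = 2 * of_real pi * u0 x"
  using U.inversion_split[OF x] F_line_start[OF x] u0[of x] x by simp
 have pole: "1 / (2 * of_real pi) * ((\<Sum>p=1..j. if \<gamma> > 0 \<and> j = 2 * p - 1 then ?D p else 0) + (\<Sum>p=1..j. if \<gamma> > 0 \<and> j = 2 * p - 1 then ?P p else 0))
   + residue_family 0 0 x = 0"
 proof (cases "odd j \<and> \<gamma> > 0")
  case False
  have no: "\<not> (\<gamma> > 0 \<and> j = 2 * p - 1)" if "p \<in> {1..j}" for p
  proof
   assume a: "\<gamma> > 0 \<and> j = 2 * p - 1"
   hence "odd j" using that by simp
   thus False using a False by simp
  qed
  have "(\<Sum>p=1..j. if \<gamma> > 0 \<and> j = 2 * p - 1 then h p else 0) = 0" for h :: "nat => complex"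
  proof (rule sum.neutral, rule ballI)
   fix p assume "p \<in> {1..j}"
   from no[OF this] show "(if \<gamma> > 0 \<and> j = 2 * p - 1 then h p else 0) = 0" by (simp only: if_False)
  qed
  moreover have "residue_family 0 0 x = 0" unfolding residue_term_eq[symmetric] residue_term_def using False by (simp only: if_False)
  ultimately show ?thesis by simp
 next
  case True
  define p where "p = (j + 1) div 2"
  have jp: "j = 2 * p - 1" "p \<in> {1..j}" using True unfolding p_def by (auto elim!: oddE)
  have sel: "(\<Sum>p=1..j. if \<gamma> > 0 \<and> j = 2 * p - 1 then h p else 0) = h p" for h :: "nat => complex"
  proof -
   have "(\<Sum>p=1..j. if \<gamma> > 0 \<and> j = 2 * p - 1 then h p else 0) = (\<Sum>p'=1..j. if p' = p then h p' else 0)"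
    by (rule sum.cong[OF refl]) (use True jp in auto)
   thus ?thesis using jp(2) by (simp only: sum.delta finite_atLeastAtMost if_True)
  qed
  have wd: "?w ^ od j = - \<i> * of_real \<gamma> ^ od j"
  proof -
   have "\<i> ^ od j = (\<i>\<^sup>2) ^ j * \<i>" by (simp only: power_add power_mult power_one_right)
   also have "\<dots> = - \<i>" using True by simp
   finally show ?thesis unfolding power_mult_distrib by simp
  qed
  have dat: "datum p n ?w = half_line_ft u0 (?w * alpha j p n) + Fterm j f T (?w * alpha j p n)" for n
   unfolding datum_eq by (simp only: mult.commute)
  have e: "?e = of_real (exp (- \<gamma> * x + \<gamma> ^ od j * 0))" by (simp flip: exp_of_real)
  have Dp: "1 / (2 * of_real pi) * ?D p = - (of_real \<gamma> * poly (Qpoly j p) 1 * ?e *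
    (\<Sum>n=1..j+1. (half_line_ft u0 (?w * alpha j p n) + Fterm j f T (?w * alpha j p n)) / poly (pderiv (Qpoly j p)) (alpha j p n)))"
   unfolding sum_distrib_left sum_negf[symmetric] dat[symmetric]
  proof (rule sum.cong[OF refl])
   fix n
   have "1 / (2 * of_real pi) * (a / b * (2 * of_real pi * \<i> * (\<i> * g) * dd * ee)) = - (g * a * ee * (dd / b))" for a b g dd ee :: complex
   proof -
    have "1 / (2 * of_real pi) * (a / b * (2 * of_real pi * \<i> * (\<i> * g) * dd * ee)) = (\<i> * \<i>) * (g * a * ee * (dd / b))" by simp
    thus ?thesis by simp
   qed
   thus "1 / (2 * of_real pi) * (?q p n * (2 * of_real pi * \<i> * ?w * datum p n ?w * ?e)) =
    - (of_real \<gamma> * poly (Qpoly j p) 1 * ?e * (datum p n ?w / poly (pderiv (Qpoly j p)) (alpha j p n)))" .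
  qed
  have Pp: "1 / (2 * of_real pi) * ?P p = \<i> * ?e * (\<Sum>l=1..j. ccoef j p l * ?w ^ (od j - l) * time_transform (\<phi> l) T (- \<i> * of_real \<gamma> ^ od j))"
   unfolding sum_distrib_left wd
  proof (rule sum.cong[OF refl])
   fix l assume "l \<in> {1..j}"
   hence "od j - l = Suc (2 * j - l)" by auto
   hence pw: "?w ^ (od j - l) = ?w * ?w ^ (2 * j - l)" by (simp only: power_Suc)
   have "1 / (2 * of_real pi) * (c * (2 * of_real pi * \<i> * w * (wp * tt) * ee)) = \<i> * ee * (c * (w * wp) * tt)" for c w wp tt ee :: complex
    by simp
   thus "1 / (2 * of_real pi) * (ccoef j p l * (2 * of_real pi * \<i> * ?w * (?w ^ (2 * j - l) * time_transform (\<phi> l) T (- \<i> * of_real \<gamma> ^ od j)) * ?e)) =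
    \<i> * ?e * (ccoef j p l * ?w ^ (od j - l) * time_transform (\<phi> l) T (- \<i> * of_real \<gamma> ^ od j))"
    unfolding pw .
  qed
  have "residue_family 0 0 x = of_real \<gamma> * poly (Qpoly j p) 1 * ?e *
    (\<Sum>n=1..j+1. (half_line_ft u0 (?w * alpha j p n) + Fterm j f T (?w * alpha j p n)) / poly (pderiv (Qpoly j p)) (alpha j p n))
    - \<i> * ?e * (\<Sum>l=1..j. ccoef j p l * ?w ^ (od j - l) * time_transform (\<phi> l) T (- \<i> * of_real \<gamma> ^ od j))"
   unfolding residue_term_eq[symmetric] residue_term_def Let_def p_def[symmetric] e[symmetric] using True by (simp only: if_True simp_thms)
  thus ?thesis unfolding sel distrib_left Dp Pp by simp
 qed
 have "solution 0 0 x = 1 / (2 * of_real pi) * (2 * of_real pi * u0 x) + (1 / (2 * of_real pi) * ((\<Sum>p=1..j. if \<gamma> > 0 \<and> j = 2 * p - 1 then ?D p else 0) + (\<Sum>p=1..j. if \<gamma> > 0 \<and> j = 2 * p - 1 then ?P p else 0)) + residue_family 0 0 x)"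
  unfolding solution_def contours_def A B line by (simp only: distrib_left diff_minus_eq_add add.assoc)
 thus ?thesis unfolding pole by simp
qed

lemma initial_condition:
 assumes x: "x > 0"
 shows "u_formula j \<gamma> T u0 \<phi> f 0 x = u0 x" "((%t. u_formula j \<gamma> T u0 \<phi> f t x) \<longlongrightarrow> u0 x) (at_right 0)"
proof -
 have T0: "0 \<in> {0..T}" using T_pos by simp
 show "u_formula j \<gamma> T u0 \<phi> f 0 x = u0 x" unfolding u_formula_eq[OF T0 x] by (rule initial_value[OF x])
 have "continuous (at 0 within {0..T}) (%t. solution 0 t x)"
  using solution_solution_family T0 x has_vector_derivative_continuous unfolding solution_family_def by meson
 hence lim: "((%t. solution 0 t x) \<longlongrightarrow> u0 x) (at_right 0)"
  unfolding continuous_within initial_value[OF x] at_within_Icc_at_right[OF T_pos] .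
 have "eventually (%t. solution 0 t x = u_formula j \<gamma> T u0 \<phi> f t x) (at_right 0)"
  unfolding eventually_at_right_field by (intro exI[of _ T]) (use T_pos u_formula_eq x in auto)
 thus "((%t. u_formula j \<gamma> T u0 \<phi> f t x) \<longlongrightarrow> u0 x) (at_right 0)"
  by (rule Lim_transform_eventually[OF lim])
qed

lemma solves: "solves_ibvp j \<gamma> T u0 \<phi> f (u_formula j \<gamma> T u0 \<phi> f)"
 unfolding solves_ibvp_def
 by (intro conjI allI impI equation iter_deriv_differentiable initial_condition boundary_condition) auto

end

lemma weight_bound:
 fixes x C y :: real
 assumes "(1 + x) ^ N * y \<le> C" "3 \<le> N" "0 \<le> x" "0 \<le> y"
 shows "y \<le> C / (1 + x) ^ 3"
proof -
 have "(1 + x) ^ 3 * y \<le> (1 + x) ^ N * y" using assms by (intro mult_right_mono power_increasing) auto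
 thus ?thesis using assms by (simp add: pos_le_divide_eq mult.commute)
qed

theorem proposition3p6:
  fixes j :: nat
  assumes "1 \<le> j"
  shows "\<exists>N::nat. \<forall>(\<gamma>::real) (T::real) (u0 :: real \<Rightarrow> complex)
      (\<phi> :: nat \<Rightarrow> real \<Rightarrow> complex) (f :: real \<Rightarrow> real \<Rightarrow> complex).
      0 < T \<longrightarrow> initial_class N u0 \<longrightarrow> (\<forall>l\<in>{1..j}. boundary_class N T (\<phi> l)) \<longrightarrow> source_class N T f \<longrightarrow>
        (\<forall>t\<in>{0..T}. \<forall>x>0. formula_converges j \<gamma> T u0 \<phi> f t x) \<and>
        solves_ibvp j \<gamma> T u0 \<phi> f (u_formula j \<gamma> T u0 \<phi> f)"
proof (rule exI[of _ "2 * j + 4"], intro allI impI)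
 (* Order 2 j + 4 leaves a remainder that is integrable, with room, after 2 j + 1 derivatives. *)
 let ?N = "2 * j + 4"
 fix \<gamma> T :: real and u0 :: "real => complex" and \<phi> :: "nat => real => complex" and f :: "real => real => complex"
 assume T: "0 < T" and u0: "initial_class ?N u0" and \<phi>: "\<forall>l\<in>{1..j}. boundary_class ?N T (\<phi> l)" and f: "source_class ?N T f"
 obtain U CU where U: "\<And>x. x \<ge> 0 ==> U 0 x = u0 x"
  "\<And>m x. m < ?N ==> x \<ge> 0 ==> (U m has_vector_derivative U (Suc m) x) (at x within {0..})"
  "\<And>m. m \<le> ?N ==> continuous_on {0..} (U m)"
  "\<And>m x. m \<le> ?N ==> x \<ge> 0 ==> (1 + x) ^ ?N * norm (U m x) \<le> CU"
  using u0 unfolding initial_class_def by blast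
 obtain D CF where D': "\<forall>t\<in>{0..T}. \<forall>x\<ge>0. D 0 0 t x = f t x"
  "\<forall>a b. a + b < ?N \<longrightarrow> (\<forall>t\<in>{0..T}. \<forall>x\<ge>0.
    ((%s. D a b s x) has_vector_derivative D (Suc a) b t x) (at t within {0..T}) \<and>
    ((%y. D a b t y) has_vector_derivative D a (Suc b) t x) (at x within {0..}))"
  "\<forall>a b. a + b \<le> ?N \<longrightarrow> continuous_on ({0..T} \<times> {0..}) (%(t, x). D a b t x)"
  "\<forall>a b. a + b \<le> ?N \<longrightarrow> (\<forall>t\<in>{0..T}. \<forall>x\<ge>0. (1 + x) ^ ?N * norm (D a b t x) \<le> CF)"
  using f unfolding source_class_def by (elim exE conjE) (rule that)
 have D: "D 0 0 t x = f t x" "b < ?N ==> ((%y. D 0 b t y) has_vector_derivative D 0 (Suc b) t x) (at x within {0..})"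
  "b \<le> ?N ==> (1 + x) ^ ?N * norm (D 0 b t x) \<le> CF" if "t \<in> {0..T}" "x \<ge> 0" for b t x
  using D'(1) D'(2)[rule_format, of 0 b t x] D'(4)[rule_format, of 0 b t x] that by simp_all
 have Dc: "continuous_on ({0..T} \<times> {0..}) (%(t, x). D 0 b t x)" if "b \<le> ?N" for b
  by (rule D'(3)[rule_format]) (use that in simp)
 define twice where "twice l B1 B2 \<longleftrightarrow> (\<forall>ta\<in>{0..T}. (\<phi> l has_vector_derivative B1 ta) (at ta within {0..T})) \<and>
   (\<forall>ta\<in>{0..T}. (B1 has_vector_derivative B2 ta) (at ta within {0..T})) \<and> continuous_on {0..T} B2" for l B1 B2
 have "\<exists>B1 B2. twice l B1 B2" if "l \<in> {1..j}" for l
 proof -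
  have "boundary_class ?N T (\<phi> l)" using \<phi> that by blast
  then obtain B where B: "\<And>t. t \<in> {0..T} ==> B 0 t = \<phi> l t"
   "\<And>m t. m < ?N ==> t \<in> {0..T} ==> (B m has_vector_derivative B (Suc m) t) (at t within {0..T})"
   "\<And>m. m \<le> ?N ==> continuous_on {0..T} (B m)"
   unfolding boundary_class_def by blast
  have "(\<phi> l has_vector_derivative B 1 ta) (at ta within {0..T})" if "ta \<in> {0..T}" for ta
  proof (rule has_vector_derivative_transform[OF that])
   show "(B 0 has_vector_derivative B 1 ta) (at ta within {0..T})" unfolding One_nat_def by (rule B(2)) (use that in auto)
  qed (use B(1) in simp)
  moreover have "(B 1 has_vector_derivative B (Suc 1) ta) (at ta within {0..T})" if "ta \<in> {0..T}" for ta
   by (rule B(2)) (use that in auto)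
  moreover have "continuous_on {0..T} (B (Suc 1))" by (rule B(3)) simp
  ultimately show ?thesis unfolding twice_def by blast
 qed
 then obtain B1 B2 where "\<And>l. l \<in> {1..j} ==> twice l (B1 l) (B2 l)" by metis
 hence B: "\<And>l ta. l \<in> {1..j} ==> ta \<in> {0..T} ==> (\<phi> l has_vector_derivative B1 l ta) (at ta within {0..T})"
  "\<And>l ta. l \<in> {1..j} ==> ta \<in> {0..T} ==> (B1 l has_vector_derivative B2 l ta) (at ta within {0..T})"
  "\<And>l. l \<in> {1..j} ==> continuous_on {0..T} (B2 l)"
  unfolding twice_def by blast+
 interpret ibvp_data j T CU CF U "%b t x. D 0 b t x" \<gamma> u0 \<phi> f B1 B2
 proof unfold_locales
  show "continuous_on ({0..T} \<times> {0..}) (%(t, x). U b x)" if "b \<le> ?N" for b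
   unfolding case_prod_beta by (rule continuous_on_compose2[OF U(3)[OF that]]) (auto intro!: continuous_intros)
  show "norm (U b x) \<le> CU / (1 + x) ^ 3" if "b \<le> ?N" "x \<ge> 0" for b x
   by (rule weight_bound[OF U(4)[OF that]]) (use that in auto)
  show "norm (D 0 b t x) \<le> CF / (1 + x) ^ 3" if "b \<le> ?N" "t \<in> {0..T}" "x \<ge> 0" for b t x
   by (rule weight_bound[OF D(3)]) (use that in auto)
 qed (rule T U(2) D(2) Dc U(1) D(1) B assms; assumption?)+
 show "(\<forall>t\<in>{0..T}. \<forall>x>0. formula_converges j \<gamma> T u0 \<phi> f t x) \<and> solves_ibvp j \<gamma> T u0 \<phi> f (u_formula j \<gamma> T u0 \<phi> f)"
  using converges solves by blast
qed

end
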